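(* Let $\mathbf K$ be a 2-category with finite 2-products which admits the construction of differential objects. There is a 2-functor $$\mathsf{DO}:\mathsf{cTng}(\mathbf K)_{\cong}\to\mathsf{cTng}(\mathbf K)_{\cong}$$ which sends a Cartesian tangentad $(\mathbb X,\mathbb T)$ of $\mathbf K$ to the tangentad $\mathsf{DO}(\mathbb X,\mathbb T)$ of differential objects of $(\mathbb X,\mathbb T)$. In particular, for each strong tangent morphism $(F,\alpha):(\mathbb X,\mathbb T)\to(\mathbb X',\mathbb T')$ in $\mathsf{cTng}(\mathbf K)_{\cong}$, the tangent morphism $\mathsf{DO}(F,\alpha):\mathsf{DO}(\mathbb X,\mathbb T)\to\mathsf{DO}(\mathbb X',\mathbb T')$ is also strong.
   Context: Composition $\circ$ is in the usual order; $F\varphi$, $\varphi_F$ denote whiskering. A limit in a hom-category $\mathbf K[\mathbb X',\mathbb X]$ is pointwise if it is preserved by precomposition with every 1-morphism $F:\mathbb X''\to\mathbb X'$. A tangentad $(\mathbb X,\mathbb T)$ in $\mathbf K$ is an object $\mathbb X$ with a 1-morphism $T:\mathbb X\to\mathbb X$ and 2-morphisms $p:T\Rightarrow\mathrm{id}$, $z:\mathrm{id}\Rightarrow T$, $s:T_2\Rightarrow T$, $l:T\Rightarrow T^2$, $c:T^2\Rightarrow T^2$, where $T_n$ is the pointwise $n$-fold pullback of $p$ along itself (required to exist and be preserved by postcomposition with all $T^m$), such that: $(p,z,s)$ is a commutative monoid in the slice $\mathbf K[\mathbb X,\mathbb X]/\mathrm{id}_{\mathbb X}$; $Tp\circ l=z\circ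 p$, $l\circ z=Tz\circ z$, $l\circ s=Ts\circ\langle l\pi_1,l\pi_2\rangle$; $p_T\circ c=Tp$, $c\circ Tz=z_T$, $c\circ Ts=s_T\circ\langle c\,T\pi_1,c\,T\pi_2\rangle$; $Tl\circ l=l_T\circ l$, $c\circ l=l$, $c_T\circ Tc\circ l_T=Tl\circ c$; $c\circ c=\mathrm{id}$, $Tc\circ c_T\circ Tc=c_T\circ Tc\circ c_T$; and the square with top $Ts\circ\langle z_T\pi_1,l\pi_2\rangle:T_2\Rightarrow T^2$, left $p\pi_1$, right $Tp:T^2\Rightarrow T$, bottom $z$ is a pointwise pullback. Tangentads in $\mathsf{Cat}$ are tangent categories. A lax tangent morphism $(F,\alpha):(\mathbb X',\mathbb T')\to(\mathbb X,\mathbb T)$ is a 1-morphism $F$ with a 2-morphism $\alpha:FT'\Rightarrow TF$ such that $p_F\circ\alpha=Fp'$, $\alpha\circ Fz'=z_F$, $\alpha\circ Fs'=s_F\circ\langle\alpha F\pi_1,\alpha F\pi_2\rangle$, $l_F\circ\alpha=T\alpha\circ\alpha_{T'}\circ Fl'$, $c_F\circ T\alpha\circ\alpha_{T'}=T\alpha\circ\alpha_{T'}\circ Fc'$; strong if $\alpha$ is invertible, strict if $\alpha$ is an identity; $(G,\beta)\circ(F,\alpha)=(GF,\beta_F\circ G\alpha)$. A tangent 2-morphism $\varphi:(F,\alpha)\Rightarrow(G,\beta)$ is a 2-morphism with $T\varphi\circ\alpha=\beta\circ\varphi_{T'}$. These form the 2-category $\mathsf{Tng}(\mathbf K)$. The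 hom-category $[\mathbb X',\mathbb T'\mid\mathbb X,\mathbb T]$ of lax tangent morphisms is a tangent category with $\bar T(F,\alpha)=(TF,c_F\circ T\alpha)$, $\bar T\varphi=T\varphi$, $\bar p_{(F,\alpha)}=p_F$, etc. Let $\mathbf K$ have finite 2-products with terminal object $\mathbb 1$. A Cartesian object is an object $\mathbb X$ with right adjoints $*:\mathbb 1\to\mathbb X$ of $!:\mathbb X\to\mathbb 1$ and $\times:\mathbb X\times\mathbb X\to\mathbb X$ of the diagonal. A Cartesian tangentad is a Cartesian object in $\mathsf{Tng}(\mathbf K)$; equivalently a tangentad on a Cartesian object whose $T$ (and structure) preserves $*$ and $\times$ via the canonical 2-morphisms, which are invertible. A strong tangent morphism preserves finite products if its canonical comparison 2-morphisms with $*$ and $\times$ are invertible. $\mathsf{cTng}(\mathbf K)_{\cong}$ is the 2-category of Cartesian tangentads of $\mathbf K$, strong tangent morphisms preserving finite products, and tangent 2-morphisms compatible with the comparison 2-morphisms. If $(\mathbb X,\mathbb T)$ is Cartesian, $[\mathbb X',\mathbb T'\mid\mathbb X,\mathbb T]$ is a Cartesian tangent category with terminal object $\top=*\circ{!}$ and product $A\Box B=\times\circ\langle A,B\rangle$. A differential object of a Cartesian tangent category is $(A,\zeta,\sigma,\hat p)$ with $(A,\zeta:*\to A,\sigma:A\times A\to A)$ a commutative monoid and $\hat p:TA\to A$ such that $\hat p\circ T\zeta=\zeta$, $\hat p\circ T\sigma=\sigma\circ(\hat p\times\hat p)$, $\hat p\circ z_A=\zeta\circ{!}$, $\hat p\circ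 s_A=\sigma\circ\langle\hat p\pi_1,\hat p\pi_2\rangle$, $\hat p\circ T\hat p\circ l_A=\hat p$, and $A\xleftarrow{p_A}TA\xrightarrow{\hat p}A$ is a product diagram. Morphisms are linear: $f\circ\hat p_A=\hat p_B\circ Tf$. The tangent bundle functor sends $(A,\zeta,\sigma,\hat p)$ to $(TA,T\zeta,T\sigma,T\hat p\circ c_A)$. A pointwise differential object in $[\mathbb X',\mathbb T'\mid\mathbb X,\mathbb T]$ is a differential object there whose product diagram is pointwise; these form the tangent category $\mathsf{DO}[\mathbb X',\mathbb T'\mid\mathbb X,\mathbb T]$. A Cartesian tangentad $(\mathbb X,\mathbb T)$ admits the construction of differential objects if there are a Cartesian tangentad $\mathsf{DO}(\mathbb X,\mathbb T)$, a strict tangent morphism $U:\mathsf{DO}(\mathbb X,\mathbb T)\to(\mathbb X,\mathbb T)$ and a pointwise differential object $(U;\mathcal Z,\mathcal S,\hat{\mathcal P})$ in $[\mathsf{DO}(\mathbb X,\mathbb T)\mid\mathbb X,\mathbb T]$ such that, for every tangentad $(\mathbb X',\mathbb T')$, the functor $[\mathbb X',\mathbb T'\mid\mathsf{DO}(\mathbb X,\mathbb T)]\to\mathsf{DO}[\mathbb X',\mathbb T'\mid\mathbb X,\mathbb T]$, $(H,\gamma)\mapsto(U\circ(H,\gamma);\mathcal Z_H,\mathcal S_H,\hat{\mathcal P}_H)$, is an isomorphism of tangent categories. $\mathsf{DO}(\mathbb X,\mathbb T)$ is called the tangentad of differential objects. $\mathbf K$ admits the construction of differential objects if every Cartesian tangentad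 of $\mathbf K$ does. *)

theory Defs
  imports Main
begin

section \<open>Categories and limits\<close>

text \<open>
  Arrows are elements of hom-sets \<open>Arr C A B\<close>. Different hom-sets may overlap: the same 2-morphism
  of a 2-category may underlie several tangent 2-morphisms. Hence every axiom is guarded by
  explicit membership, and functors are indexed by the endpoints wherever the image of an arrow may
  depend on them.
\<close>

record ('a, 'f) cat =
  Ob :: "'a set"
  Arr :: "'a \<Rightarrow> 'a \<Rightarrow> 'f set"
  idn :: "'a \<Rightarrow> 'f"
  cmp :: "'f \<Rightarrow> 'f \<Rightarrow> 'f" (infixr "\<cdot>\<index>" 70)

locale category =
  fixes C :: "('a, 'f, 'z) cat_scheme" (structure)
  assumes idn_closed: "A \<in> Ob C \<Longrightarrow> idn C A \<in> Arr C A A"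
    and cmp_closed: "\<lbrakk>A \<in> Ob C; B \<in> Ob C; D \<in> Ob C; f \<in> Arr C A B; g \<in> Arr C B D\<rbrakk>
      \<Longrightarrow> g \<cdot> f \<in> Arr C A D"
    and cmp_idn: "\<lbrakk>A \<in> Ob C; B \<in> Ob C; f \<in> Arr C A B\<rbrakk> \<Longrightarrow> f \<cdot> idn C A = f"
    and idn_cmp: "\<lbrakk>A \<in> Ob C; B \<in> Ob C; f \<in> Arr C A B\<rbrakk> \<Longrightarrow> idn C B \<cdot> f = f"
    and cmp_assoc: "\<lbrakk>A \<in> Ob C; B \<in> Ob C; D \<in> Ob C; E \<in> Ob C;
        f \<in> Arr C A B; g \<in> Arr C B D; h \<in> Arr C D E\<rbrakk>
      \<Longrightarrow> (h \<cdot> g) \<cdot> f = h \<cdot> (g \<cdot> f)"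

definition is_inverse :: "('a, 'f, 'z) cat_scheme \<Rightarrow> 'a \<Rightarrow> 'a \<Rightarrow> 'f \<Rightarrow> 'f \<Rightarrow> bool" where
  "is_inverse C A B f g \<longleftrightarrow> f \<in> Arr C A B \<and> g \<in> Arr C B A \<and>
     g \<cdot>\<^bsub>C\<^esub> f = idn C A \<and> f \<cdot>\<^bsub>C\<^esub> g = idn C B"

definition inverse_arr :: "('a, 'f, 'z) cat_scheme \<Rightarrow> 'a \<Rightarrow> 'a \<Rightarrow> 'f \<Rightarrow> 'f" where
  "inverse_arr C A B f = (THE g. is_inverse C A B f g)"

definition is_terminal :: "('a, 'f, 'z) cat_scheme \<Rightarrow> 'a \<Rightarrow> bool" where
  "is_terminal C t \<longleftrightarrow> t \<in> Ob C \<and> (\<forall>W\<in>Ob C. \<exists>!f. f \<in> Arr C W t)"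

definition to_terminal :: "('a, 'f, 'z) cat_scheme \<Rightarrow> 'a \<Rightarrow> 'a \<Rightarrow> 'f" where
  "to_terminal C t W = (THE f. f \<in> Arr C W t)"

definition is_product ::
    "('a, 'f, 'z) cat_scheme \<Rightarrow> 'a \<Rightarrow> 'f \<Rightarrow> 'f \<Rightarrow> 'a \<Rightarrow> 'a \<Rightarrow> bool" where
  "is_product C P q1 q2 A B \<longleftrightarrow>
     P \<in> Ob C \<and> A \<in> Ob C \<and> B \<in> Ob C \<and> q1 \<in> Arr C P A \<and> q2 \<in> Arr C P B \<and>
     (\<forall>W\<in>Ob C. \<forall>f\<in>Arr C W A. \<forall>g\<in>Arr C W B.
        \<exists>!u. u \<in> Arr C W P \<and> q1 \<cdot>\<^bsub>C\<^esub> u = f \<and> q2 \<cdot>\<^bsub>C\<^esub> u = g)"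

text \<open>The square with legs \<open>q1 : P \<rightarrow> A\<close>, \<open>q2 : P \<rightarrow> B\<close> over the cospan
  \<open>f : A \<rightarrow> D\<close>, \<open>g : B \<rightarrow> D\<close>.\<close>

definition is_pullback :: "('a, 'f, 'z) cat_scheme \<Rightarrow>
    'a \<Rightarrow> 'f \<Rightarrow> 'f \<Rightarrow> 'a \<Rightarrow> 'a \<Rightarrow> 'a \<Rightarrow> 'f \<Rightarrow> 'f \<Rightarrow> bool" where
  "is_pullback C P q1 q2 A B D f g \<longleftrightarrow>
     P \<in> Ob C \<and> A \<in> Ob C \<and> B \<in> Ob C \<and> D \<in> Ob C \<and>
     q1 \<in> Arr C P A \<and> q2 \<in> Arr C P B \<and> f \<in> Arr C A D \<and> g \<in> Arr C B D \<and>
     f \<cdot>\<^bsub>C\<^esub> q1 = g \<cdot>\<^bsub>C\<^esub> q2 \<and>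
     (\<forall>W\<in>Ob C. \<forall>a\<in>Arr C W A. \<forall>b\<in>Arr C W B. f \<cdot>\<^bsub>C\<^esub> a = g \<cdot>\<^bsub>C\<^esub> b \<longrightarrow>
        (\<exists>!u. u \<in> Arr C W P \<and> q1 \<cdot>\<^bsub>C\<^esub> u = a \<and> q2 \<cdot>\<^bsub>C\<^esub> u = b))"

text \<open>The \<open>n\<close>-fold pullback of \<open>f : A \<rightarrow> D\<close> along itself, with projections
  \<open>q 0, \<dots>, q (n - 1)\<close>; only used for \<open>n \<ge> 1\<close>.\<close>

definition is_fibre_power :: "('a, 'f, 'z) cat_scheme \<Rightarrow>
    nat \<Rightarrow> 'a \<Rightarrow> (nat \<Rightarrow> 'f) \<Rightarrow> 'a \<Rightarrow> 'a \<Rightarrow> 'f \<Rightarrow> bool" where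
  "is_fibre_power C n P q A D f \<longleftrightarrow>
     P \<in> Ob C \<and> A \<in> Ob C \<and> D \<in> Ob C \<and> f \<in> Arr C A D \<and>
     (\<forall>i<n. q i \<in> Arr C P A) \<and> (\<forall>i<n. \<forall>j<n. f \<cdot>\<^bsub>C\<^esub> q i = f \<cdot>\<^bsub>C\<^esub> q j) \<and>
     (\<forall>W\<in>Ob C. \<forall>a. (\<forall>i<n. a i \<in> Arr C W A) \<and> (\<forall>i<n. \<forall>j<n. f \<cdot>\<^bsub>C\<^esub> a i = f \<cdot>\<^bsub>C\<^esub> a j) \<longrightarrow>
        (\<exists>!u. u \<in> Arr C W P \<and> (\<forall>i<n. q i \<cdot>\<^bsub>C\<^esub> u = a i)))"

text \<open>The arrow \<open>\<langle>a, b\<rangle> : W \<rightarrow> P\<close> induced by a product or pullback \<open>P\<close> with projections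
  \<open>q1\<close>, \<open>q2\<close>.\<close>

definition pairing ::
    "('a, 'f, 'z) cat_scheme \<Rightarrow> 'a \<Rightarrow> 'f \<Rightarrow> 'f \<Rightarrow> 'a \<Rightarrow> 'f \<Rightarrow> 'f \<Rightarrow> 'f" where
  "pairing C P q1 q2 W a b =
     (THE u. u \<in> Arr C W P \<and> q1 \<cdot>\<^bsub>C\<^esub> u = a \<and> q2 \<cdot>\<^bsub>C\<^esub> u = b)"

definition slice :: "('a, 'f, 'z) cat_scheme \<Rightarrow> 'a \<Rightarrow> ('a \<times> 'f, 'f) cat" where
  "slice C I = \<lparr>
     Ob = {(A, a). A \<in> Ob C \<and> a \<in> Arr C A I},
     Arr = (\<lambda>(A, a) (B, b). {f \<in> Arr C A B. b \<cdot>\<^bsub>C\<^esub> f = a}),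
     idn = (\<lambda>(A, a). idn C A),
     cmp = cmp C \<rparr>"

text \<open>Commutative monoids \<open>(A, e : t \<rightarrow> A, m : P \<rightarrow> A)\<close>, where \<open>t\<close> is terminal and
  \<open>(P, q1, q2)\<close> is a product of \<open>A\<close> with itself. Associativity is expressed on generalized
  elements, so that no triple product has to be chosen.\<close>

definition commutative_monoid ::
    "('a, 'f, 'z) cat_scheme \<Rightarrow> 'a \<Rightarrow> 'a \<Rightarrow> 'f \<Rightarrow> 'f \<Rightarrow> 'a \<Rightarrow> 'f \<Rightarrow> 'f \<Rightarrow> bool" where
  "commutative_monoid C t P q1 q2 A e m \<longleftrightarrow>
     is_terminal C t \<and> is_product C P q1 q2 A A \<and> e \<in> Arr C t A \<and> m \<in> Arr C P A \<and>
     (\<forall>W\<in>Ob C. \<forall>a\<in>Arr C W A. \<forall>b\<in>Arr C W A. \<forall>d\<in>Arr C W A.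
        m \<cdot>\<^bsub>C\<^esub> pairing C P q1 q2 W (m \<cdot>\<^bsub>C\<^esub> pairing C P q1 q2 W a b) d =
        m \<cdot>\<^bsub>C\<^esub> pairing C P q1 q2 W a (m \<cdot>\<^bsub>C\<^esub> pairing C P q1 q2 W b d)) \<and>
     m \<cdot>\<^bsub>C\<^esub> pairing C P q1 q2 A (e \<cdot>\<^bsub>C\<^esub> to_terminal C t A) (idn C A) = idn C A \<and>
     m \<cdot>\<^bsub>C\<^esub> pairing C P q1 q2 A (idn C A) (e \<cdot>\<^bsub>C\<^esub> to_terminal C t A) = idn C A \<and>
     m \<cdot>\<^bsub>C\<^esub> pairing C P q1 q2 P q2 q1 = m"


section \<open>2-categories\<close>

record ('o, 'm, 'c) cat2 =
  obj :: "'o set"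
  hom1 :: "'o \<Rightarrow> 'o \<Rightarrow> 'm set"
  hom2 :: "'o \<Rightarrow> 'o \<Rightarrow> 'm \<Rightarrow> 'm \<Rightarrow> 'c set"
  id1 :: "'o \<Rightarrow> 'm"
  comp1 :: "'m \<Rightarrow> 'm \<Rightarrow> 'm" (infixr "\<odot>\<index>" 75)
  id2 :: "'m \<Rightarrow> 'c"
  vcomp :: "'c \<Rightarrow> 'c \<Rightarrow> 'c" (infixr "\<bullet>\<index>" 65)
  hcomp :: "'c \<Rightarrow> 'c \<Rightarrow> 'c" (infixr "\<star>\<index>" 72)

definition lwhisker :: "('o, 'm, 'c, 'z) cat2_scheme \<Rightarrow> 'm \<Rightarrow> 'c \<Rightarrow> 'c" (infixr "\<rhd>\<index>" 73) where
  "F \<rhd>\<^bsub>K\<^esub> \<phi> = id2 K F \<star>\<^bsub>K\<^esub> \<phi>"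

definition rwhisker :: "('o, 'm, 'c, 'z) cat2_scheme \<Rightarrow> 'c \<Rightarrow> 'm \<Rightarrow> 'c" (infixl "\<lhd>\<index>" 74) where
  "\<phi> \<lhd>\<^bsub>K\<^esub> F = \<phi> \<star>\<^bsub>K\<^esub> id2 K F"

definition homcat :: "('o, 'm, 'c, 'z) cat2_scheme \<Rightarrow> 'o \<Rightarrow> 'o \<Rightarrow> ('m, 'c) cat" where
  "homcat K X Y = \<lparr> Ob = hom1 K X Y, Arr = hom2 K X Y, idn = id2 K, cmp = vcomp K \<rparr>"

locale two_category =
  fixes K :: "('o, 'm, 'c, 'z) cat2_scheme" (structure)
  assumes id1_closed: "X \<in> obj K \<Longrightarrow> id1 K X \<in> hom1 K X X"
    and comp1_closed: "\<lbrakk>X \<in> obj K; Y \<in> obj K; Z \<in> obj K; F \<in> hom1 K X Y; G \<in> hom1 K Y Z\<rbrakk>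
      \<Longrightarrow> G \<odot> F \<in> hom1 K X Z"
    and comp1_id1: "\<lbrakk>X \<in> obj K; Y \<in> obj K; F \<in> hom1 K X Y\<rbrakk> \<Longrightarrow> F \<odot> id1 K X = F"
    and id1_comp1: "\<lbrakk>X \<in> obj K; Y \<in> obj K; F \<in> hom1 K X Y\<rbrakk> \<Longrightarrow> id1 K Y \<odot> F = F"
    and comp1_assoc: "\<lbrakk>W \<in> obj K; X \<in> obj K; Y \<in> obj K; Z \<in> obj K;
        F \<in> hom1 K W X; G \<in> hom1 K X Y; H \<in> hom1 K Y Z\<rbrakk>
      \<Longrightarrow> (H \<odot> G) \<odot> F = H \<odot> (G \<odot> F)"
    and category_homcat: "\<lbrakk>X \<in> obj K; Y \<in> obj K\<rbrakk> \<Longrightarrow> category (homcat K X Y)"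
    and hcomp_closed: "\<lbrakk>X \<in> obj K; Y \<in> obj K; Z \<in> obj K;
        F \<in> hom1 K X Y; F' \<in> hom1 K X Y; G \<in> hom1 K Y Z; G' \<in> hom1 K Y Z;
        \<phi> \<in> hom2 K X Y F F'; \<psi> \<in> hom2 K Y Z G G'\<rbrakk>
      \<Longrightarrow> \<psi> \<star> \<phi> \<in> hom2 K X Z (G \<odot> F) (G' \<odot> F')"
    and hcomp_id2: "\<lbrakk>X \<in> obj K; Y \<in> obj K; Z \<in> obj K; F \<in> hom1 K X Y; G \<in> hom1 K Y Z\<rbrakk>
      \<Longrightarrow> id2 K G \<star> id2 K F = id2 K (G \<odot> F)"
    and interchange: "\<lbrakk>X \<in> obj K; Y \<in> obj K; Z \<in> obj K;
        F \<in> hom1 K X Y; F' \<in> hom1 K X Y; F'' \<in> hom1 K X Y;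
        G \<in> hom1 K Y Z; G' \<in> hom1 K Y Z; G'' \<in> hom1 K Y Z;
        \<phi> \<in> hom2 K X Y F F'; \<phi>' \<in> hom2 K X Y F' F'';
        \<psi> \<in> hom2 K Y Z G G'; \<psi>' \<in> hom2 K Y Z G' G''\<rbrakk>
      \<Longrightarrow> (\<psi>' \<bullet> \<psi>) \<star> (\<phi>' \<bullet> \<phi>) = (\<psi>' \<star> \<phi>') \<bullet> (\<psi> \<star> \<phi>)"
    and hcomp_unit_right: "\<lbrakk>X \<in> obj K; Y \<in> obj K; F \<in> hom1 K X Y; F' \<in> hom1 K X Y;
        \<phi> \<in> hom2 K X Y F F'\<rbrakk> \<Longrightarrow> \<phi> \<star> id2 K (id1 K X) = \<phi>"
    and hcomp_unit_left: "\<lbrakk>X \<in> obj K; Y \<in> obj K; F \<in> hom1 K X Y; F' \<in> hom1 K X Y;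
        \<phi> \<in> hom2 K X Y F F'\<rbrakk> \<Longrightarrow> id2 K (id1 K Y) \<star> \<phi> = \<phi>"
    and hcomp_assoc: "\<lbrakk>W \<in> obj K; X \<in> obj K; Y \<in> obj K; Z \<in> obj K;
        F \<in> hom1 K W X; F' \<in> hom1 K W X; G \<in> hom1 K X Y; G' \<in> hom1 K X Y;
        H \<in> hom1 K Y Z; H' \<in> hom1 K Y Z;
        \<phi> \<in> hom2 K W X F F'; \<psi> \<in> hom2 K X Y G G'; \<chi> \<in> hom2 K Y Z H H'\<rbrakk>
      \<Longrightarrow> (\<chi> \<star> \<psi>) \<star> \<phi> = \<chi> \<star> (\<psi> \<star> \<phi>)"

definition invertible_cell ::
    "('o, 'm, 'c, 'z) cat2_scheme \<Rightarrow> 'o \<Rightarrow> 'o \<Rightarrow> 'm \<Rightarrow> 'm \<Rightarrow> 'c \<Rightarrow> bool" where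
  "invertible_cell K X Y F G \<theta> \<longleftrightarrow> (\<exists>\<theta>'. is_inverse (homcat K X Y) F G \<theta> \<theta>')"

definition adjunction ::
    "('o, 'm, 'c, 'z) cat2_scheme \<Rightarrow> 'o \<Rightarrow> 'o \<Rightarrow> 'm \<Rightarrow> 'm \<Rightarrow> 'c \<Rightarrow> 'c \<Rightarrow> bool" where
  "adjunction K X Y L R \<eta> \<epsilon> \<longleftrightarrow>
     L \<in> hom1 K X Y \<and> R \<in> hom1 K Y X \<and>
     \<eta> \<in> hom2 K X X (id1 K X) (R \<odot>\<^bsub>K\<^esub> L) \<and> \<epsilon> \<in> hom2 K Y Y (L \<odot>\<^bsub>K\<^esub> R) (id1 K Y) \<and>
     (\<epsilon> \<lhd>\<^bsub>K\<^esub> L) \<bullet>\<^bsub>K\<^esub> (L \<rhd>\<^bsub>K\<^esub> \<eta>) = id2 K L \<and>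
     (R \<rhd>\<^bsub>K\<^esub> \<epsilon>) \<bullet>\<^bsub>K\<^esub> (\<eta> \<lhd>\<^bsub>K\<^esub> R) = id2 K R"

definition pointwise_product :: "('o, 'm, 'c, 'z) cat2_scheme \<Rightarrow> 'o \<Rightarrow> 'o \<Rightarrow>
    'm \<Rightarrow> 'c \<Rightarrow> 'c \<Rightarrow> 'm \<Rightarrow> 'm \<Rightarrow> bool" where
  "pointwise_product K X Y P q1 q2 A B \<longleftrightarrow>
     is_product (homcat K X Y) P q1 q2 A B \<and>
     (\<forall>W\<in>obj K. \<forall>H\<in>hom1 K W X. is_product (homcat K W Y)
        (P \<odot>\<^bsub>K\<^esub> H) (q1 \<lhd>\<^bsub>K\<^esub> H) (q2 \<lhd>\<^bsub>K\<^esub> H) (A \<odot>\<^bsub>K\<^esub> H) (B \<odot>\<^bsub>K\<^esub> H))"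

definition pointwise_pullback :: "('o, 'm, 'c, 'z) cat2_scheme \<Rightarrow> 'o \<Rightarrow> 'o \<Rightarrow>
    'm \<Rightarrow> 'c \<Rightarrow> 'c \<Rightarrow> 'm \<Rightarrow> 'm \<Rightarrow> 'm \<Rightarrow> 'c \<Rightarrow> 'c \<Rightarrow> bool" where
  "pointwise_pullback K X Y P q1 q2 A B D f g \<longleftrightarrow>
     is_pullback (homcat K X Y) P q1 q2 A B D f g \<and>
     (\<forall>W\<in>obj K. \<forall>H\<in>hom1 K W X. is_pullback (homcat K W Y)
        (P \<odot>\<^bsub>K\<^esub> H) (q1 \<lhd>\<^bsub>K\<^esub> H) (q2 \<lhd>\<^bsub>K\<^esub> H)
        (A \<odot>\<^bsub>K\<^esub> H) (B \<odot>\<^bsub>K\<^esub> H) (D \<odot>\<^bsub>K\<^esub> H) (f \<lhd>\<^bsub>K\<^esub> H) (g \<lhd>\<^bsub>K\<^esub> H))"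

definition pointwise_fibre_power :: "('o, 'm, 'c, 'z) cat2_scheme \<Rightarrow> 'o \<Rightarrow> 'o \<Rightarrow>
    nat \<Rightarrow> 'm \<Rightarrow> (nat \<Rightarrow> 'c) \<Rightarrow> 'm \<Rightarrow> 'm \<Rightarrow> 'c \<Rightarrow> bool" where
  "pointwise_fibre_power K X Y n P q A D f \<longleftrightarrow>
     is_fibre_power (homcat K X Y) n P q A D f \<and>
     (\<forall>W\<in>obj K. \<forall>H\<in>hom1 K W X. is_fibre_power (homcat K W Y) n
        (P \<odot>\<^bsub>K\<^esub> H) (\<lambda>i. q i \<lhd>\<^bsub>K\<^esub> H) (A \<odot>\<^bsub>K\<^esub> H) (D \<odot>\<^bsub>K\<^esub> H) (f \<lhd>\<^bsub>K\<^esub> H))"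

record ('x, 'm, 'c, 'y, 'n, 'd) functor2 =
  fobj :: "'x \<Rightarrow> 'y"
  fmor :: "'x \<Rightarrow> 'x \<Rightarrow> 'm \<Rightarrow> 'n"
  fcell :: "'x \<Rightarrow> 'x \<Rightarrow> 'm \<Rightarrow> 'm \<Rightarrow> 'c \<Rightarrow> 'd"

locale two_functor =
  fixes M :: "('x, 'm, 'c, 'z) cat2_scheme"
    and N :: "('y, 'n, 'd, 'w) cat2_scheme"
    and \<Phi> :: "('x, 'm, 'c, 'y, 'n, 'd) functor2"
  assumes fobj_closed: "X \<in> obj M \<Longrightarrow> fobj \<Phi> X \<in> obj N"
    and fmor_closed: "\<lbrakk>X \<in> obj M; Y \<in> obj M; F \<in> hom1 M X Y\<rbrakk>
      \<Longrightarrow> fmor \<Phi> X Y F \<in> hom1 N (fobj \<Phi> X) (fobj \<Phi> Y)"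
    and fcell_closed: "\<lbrakk>X \<in> obj M; Y \<in> obj M; F \<in> hom1 M X Y; G \<in> hom1 M X Y;
        \<theta> \<in> hom2 M X Y F G\<rbrakk>
      \<Longrightarrow> fcell \<Phi> X Y F G \<theta> \<in>
        hom2 N (fobj \<Phi> X) (fobj \<Phi> Y) (fmor \<Phi> X Y F) (fmor \<Phi> X Y G)"
    and fmor_id1: "X \<in> obj M \<Longrightarrow> fmor \<Phi> X X (id1 M X) = id1 N (fobj \<Phi> X)"
    and fmor_comp1: "\<lbrakk>X \<in> obj M; Y \<in> obj M; Z \<in> obj M; F \<in> hom1 M X Y; G \<in> hom1 M Y Z\<rbrakk>
      \<Longrightarrow> fmor \<Phi> X Z (G \<odot>\<^bsub>M\<^esub> F) = fmor \<Phi> Y Z G \<odot>\<^bsub>N\<^esub> fmor \<Phi> X Y F"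
    and fcell_id2: "\<lbrakk>X \<in> obj M; Y \<in> obj M; F \<in> hom1 M X Y\<rbrakk>
      \<Longrightarrow> fcell \<Phi> X Y F F (id2 M F) = id2 N (fmor \<Phi> X Y F)"
    and fcell_vcomp: "\<lbrakk>X \<in> obj M; Y \<in> obj M;
        F \<in> hom1 M X Y; G \<in> hom1 M X Y; H \<in> hom1 M X Y;
        \<theta> \<in> hom2 M X Y F G; \<theta>' \<in> hom2 M X Y G H\<rbrakk>
      \<Longrightarrow> fcell \<Phi> X Y F H (\<theta>' \<bullet>\<^bsub>M\<^esub> \<theta>) = fcell \<Phi> X Y G H \<theta>' \<bullet>\<^bsub>N\<^esub> fcell \<Phi> X Y F G \<theta>"
    and fcell_hcomp: "\<lbrakk>X \<in> obj M; Y \<in> obj M; Z \<in> obj M;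
        F \<in> hom1 M X Y; F' \<in> hom1 M X Y; G \<in> hom1 M Y Z; G' \<in> hom1 M Y Z;
        \<theta> \<in> hom2 M X Y F F'; \<psi> \<in> hom2 M Y Z G G'\<rbrakk>
      \<Longrightarrow> fcell \<Phi> X Z (G \<odot>\<^bsub>M\<^esub> F) (G' \<odot>\<^bsub>M\<^esub> F') (\<psi> \<star>\<^bsub>M\<^esub> \<theta>) =
          fcell \<Phi> Y Z G G' \<psi> \<star>\<^bsub>N\<^esub> fcell \<Phi> X Y F F' \<theta>"


section \<open>Finite 2-products and Cartesian objects\<close>

record ('o, 'm, 'c) cat2p = "('o, 'm, 'c) cat2" +
  tobj :: 'o
  pobj :: "'o \<Rightarrow> 'o \<Rightarrow> 'o"
  pfst :: "'o \<Rightarrow> 'o \<Rightarrow> 'm"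
  psnd :: "'o \<Rightarrow> 'o \<Rightarrow> 'm"

locale finite_2_products =
  fixes K :: "('o, 'm, 'c, 'z) cat2p_scheme" (structure)
  assumes tobj_closed: "tobj K \<in> obj K"
    and tobj_ex1_mor: "X \<in> obj K \<Longrightarrow> \<exists>!F. F \<in> hom1 K X (tobj K)"
    and tobj_ex1_cell: "\<lbrakk>X \<in> obj K; F \<in> hom1 K X (tobj K); G \<in> hom1 K X (tobj K)\<rbrakk>
      \<Longrightarrow> \<exists>!\<theta>. \<theta> \<in> hom2 K X (tobj K) F G"
    and pobj_closed: "\<lbrakk>A \<in> obj K; B \<in> obj K\<rbrakk> \<Longrightarrow> pobj K A B \<in> obj K"
    and pfst_closed: "\<lbrakk>A \<in> obj K; B \<in> obj K\<rbrakk> \<Longrightarrow> pfst K A B \<in> hom1 K (pobj K A B) A"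
    and psnd_closed: "\<lbrakk>A \<in> obj K; B \<in> obj K\<rbrakk> \<Longrightarrow> psnd K A B \<in> hom1 K (pobj K A B) B"
    and pobj_ex1_mor: "\<lbrakk>A \<in> obj K; B \<in> obj K; W \<in> obj K; F \<in> hom1 K W A; G \<in> hom1 K W B\<rbrakk>
      \<Longrightarrow> \<exists>!H. H \<in> hom1 K W (pobj K A B) \<and> pfst K A B \<odot> H = F \<and> psnd K A B \<odot> H = G"
    and pobj_ex1_cell: "\<lbrakk>A \<in> obj K; B \<in> obj K; W \<in> obj K;
        H \<in> hom1 K W (pobj K A B); H' \<in> hom1 K W (pobj K A B);
        \<theta> \<in> hom2 K W A (pfst K A B \<odot> H) (pfst K A B \<odot> H');
        \<psi> \<in> hom2 K W B (psnd K A B \<odot> H) (psnd K A B \<odot> H')\<rbrakk>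
      \<Longrightarrow> \<exists>!\<omega>. \<omega> \<in> hom2 K W (pobj K A B) H H' \<and>
            pfst K A B \<rhd> \<omega> = \<theta> \<and> psnd K A B \<rhd> \<omega> = \<psi>"

definition bang1 :: "('o, 'm, 'c, 'z) cat2p_scheme \<Rightarrow> 'o \<Rightarrow> 'm" where
  "bang1 K X = (THE F. F \<in> hom1 K X (tobj K))"

definition pair1 :: "('o, 'm, 'c, 'z) cat2p_scheme \<Rightarrow> 'o \<Rightarrow> 'o \<Rightarrow> 'o \<Rightarrow> 'm \<Rightarrow> 'm \<Rightarrow> 'm" where
  "pair1 K W A B F G =
     (THE H. H \<in> hom1 K W (pobj K A B) \<and> pfst K A B \<odot>\<^bsub>K\<^esub> H = F \<and> psnd K A B \<odot>\<^bsub>K\<^esub> H = G)"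

definition diag1 :: "('o, 'm, 'c, 'z) cat2p_scheme \<Rightarrow> 'o \<Rightarrow> 'm" where
  "diag1 K X = pair1 K X X X (id1 K X) (id1 K X)"

text \<open>\<open>F \<times> G : A \<times> B \<rightarrow> A' \<times> B'\<close>, and \<open>\<theta> \<times> \<psi> : F \<times> G \<Rightarrow> F' \<times> G'\<close> for
  \<open>\<theta> : F \<Rightarrow> F'\<close>, \<open>\<psi> : G \<Rightarrow> G'\<close>.\<close>

definition prod1 ::
    "('o, 'm, 'c, 'z) cat2p_scheme \<Rightarrow> 'o \<Rightarrow> 'o \<Rightarrow> 'o \<Rightarrow> 'o \<Rightarrow> 'm \<Rightarrow> 'm \<Rightarrow> 'm" where
  "prod1 K A B A' B' F G =
     pair1 K (pobj K A B) A' B' (F \<odot>\<^bsub>K\<^esub> pfst K A B) (G \<odot>\<^bsub>K\<^esub> psnd K A B)"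

definition prod2 :: "('o, 'm, 'c, 'z) cat2p_scheme \<Rightarrow> 'o \<Rightarrow> 'o \<Rightarrow> 'o \<Rightarrow> 'o \<Rightarrow>
    'm \<Rightarrow> 'm \<Rightarrow> 'm \<Rightarrow> 'm \<Rightarrow> 'c \<Rightarrow> 'c \<Rightarrow> 'c" where
  "prod2 K A B A' B' F G F' G' \<theta> \<psi> =
     (THE \<omega>. \<omega> \<in> hom2 K (pobj K A B) (pobj K A' B') (prod1 K A B A' B' F G) (prod1 K A B A' B' F' G')
        \<and> pfst K A' B' \<rhd>\<^bsub>K\<^esub> \<omega> = \<theta> \<lhd>\<^bsub>K\<^esub> pfst K A B
        \<and> psnd K A' B' \<rhd>\<^bsub>K\<^esub> \<omega> = \<psi> \<lhd>\<^bsub>K\<^esub> psnd K A B)"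

text \<open>The right adjoints \<open>* : \<one> \<rightarrow> X\<close> and \<open>\<times> : X \<times> X \<rightarrow> X\<close>, with units and counits.\<close>

record ('m, 'c) cart =
  star :: 'm
  star_unit :: 'c
  star_counit :: 'c
  times1 :: 'm
  times_unit :: 'c
  times_counit :: 'c

definition cartesian_object ::
    "('o, 'm, 'c, 'z) cat2p_scheme \<Rightarrow> 'o \<Rightarrow> ('m, 'c) cart \<Rightarrow> bool" where
  "cartesian_object K X k \<longleftrightarrow> X \<in> obj K \<and>
     adjunction K X (tobj K) (bang1 K X) (star k) (star_unit k) (star_counit k) \<and>
     adjunction K X (pobj K X X) (diag1 K X) (times1 k) (times_unit k) (times_counit k)"

text \<open>The canonical comparisons \<open>F \<circ> * \<Rightarrow> *'\<close> and \<open>F \<circ> \<times> \<Rightarrow> \<times>' \<circ> (F \<times> F)\<close> of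
  \<open>F : (X, k) \<rightarrow> (Y, k')\<close>. The former is the unit of \<open>k'\<close> at \<open>F \<circ> *\<close>, using \<open>! \<circ> F \<circ> * = id\<close>;
  the latter is the mate of \<open>\<Delta> \<circ> F = (F \<times> F) \<circ> \<Delta>\<close>.\<close>

definition star_comparison ::
    "('o, 'm, 'c, 'z) cat2p_scheme \<Rightarrow> ('m, 'c) cart \<Rightarrow> ('m, 'c) cart \<Rightarrow> 'm \<Rightarrow> 'c" where
  "star_comparison K k k' F = star_unit k' \<lhd>\<^bsub>K\<^esub> (F \<odot>\<^bsub>K\<^esub> star k)"

definition times_comparison ::
    "('o, 'm, 'c, 'z) cat2p_scheme \<Rightarrow> 'o \<Rightarrow> ('m, 'c) cart \<Rightarrow> 'o \<Rightarrow> ('m, 'c) cart \<Rightarrow> 'm \<Rightarrow> 'c" where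
  "times_comparison K X k Y k' F =
     ((times1 k' \<odot>\<^bsub>K\<^esub> prod1 K X X Y Y F F) \<rhd>\<^bsub>K\<^esub> times_counit k)
       \<bullet>\<^bsub>K\<^esub> (times_unit k' \<lhd>\<^bsub>K\<^esub> (F \<odot>\<^bsub>K\<^esub> times1 k))"

definition preserves_products ::
    "('o, 'm, 'c, 'z) cat2p_scheme \<Rightarrow> 'o \<Rightarrow> ('m, 'c) cart \<Rightarrow> 'o \<Rightarrow> ('m, 'c) cart \<Rightarrow> 'm \<Rightarrow> bool" where
  "preserves_products K X k Y k' F \<longleftrightarrow>
     invertible_cell K (tobj K) Y (F \<odot>\<^bsub>K\<^esub> star k) (star k') (star_comparison K k k' F) \<and>
     invertible_cell K (pobj K X X) Y (F \<odot>\<^bsub>K\<^esub> times1 k)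
       (times1 k' \<odot>\<^bsub>K\<^esub> prod1 K X X Y Y F F) (times_comparison K X k Y k' F)"

definition compatible_cell :: "('o, 'm, 'c, 'z) cat2p_scheme \<Rightarrow>
    'o \<Rightarrow> ('m, 'c) cart \<Rightarrow> 'o \<Rightarrow> ('m, 'c) cart \<Rightarrow> 'm \<Rightarrow> 'm \<Rightarrow> 'c \<Rightarrow> bool" where
  "compatible_cell K X k Y k' F G \<phi> \<longleftrightarrow>
     star_comparison K k k' G \<bullet>\<^bsub>K\<^esub> (\<phi> \<lhd>\<^bsub>K\<^esub> star k) = star_comparison K k k' F \<and>
     times_comparison K X k Y k' G \<bullet>\<^bsub>K\<^esub> (\<phi> \<lhd>\<^bsub>K\<^esub> times1 k) =
     (times1 k' \<rhd>\<^bsub>K\<^esub> prod2 K X X Y Y F F G G \<phi> \<phi>) \<bullet>\<^bsub>K\<^esub> times_comparison K X k Y k' F"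


section \<open>Tangentads\<close>

primrec iter1 :: "('o, 'm, 'c, 'z) cat2_scheme \<Rightarrow> 'o \<Rightarrow> 'm \<Rightarrow> nat \<Rightarrow> 'm" where
  "iter1 K X T 0 = id1 K X"
| "iter1 K X T (Suc m) = T \<odot>\<^bsub>K\<^esub> iter1 K X T m"

text \<open>The pullback \<open>T2\<close> with projections \<open>q1\<close>, \<open>q2\<close> is part of the data, because \<open>T2\<close> is the
  source of \<open>s\<close>; the higher \<open>n\<close>-fold pullbacks are only required to exist.\<close>

locale tangent_structure =
  fixes K :: "('o, 'm, 'c, 'z) cat2_scheme" (structure)
    and X :: 'o and T :: 'm and T2 :: 'm and q1 :: 'c and q2 :: 'c
    and p :: 'c and z :: 'c and s :: 'c and l :: 'c and c :: 'c
  assumes X_obj: "X \<in> obj K"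
    and T_hom: "T \<in> hom1 K X X"
    and T2_hom: "T2 \<in> hom1 K X X"
    and q1_hom: "q1 \<in> hom2 K X X T2 T"
    and q2_hom: "q2 \<in> hom2 K X X T2 T"
    and p_hom: "p \<in> hom2 K X X T (id1 K X)"
    and z_hom: "z \<in> hom2 K X X (id1 K X) T"
    and s_hom: "s \<in> hom2 K X X T2 T"
    and l_hom: "l \<in> hom2 K X X T (T \<odot> T)"
    and c_hom: "c \<in> hom2 K X X (T \<odot> T) (T \<odot> T)"
    and T2_pullback: "\<And>m. let Tm = iter1 K X T m in
      pointwise_pullback K X X (Tm \<odot> T2) (Tm \<rhd> q1) (Tm \<rhd> q2)
        (Tm \<odot> T) (Tm \<odot> T) (Tm \<odot> id1 K X) (Tm \<rhd> p) (Tm \<rhd> p)"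
    and Tn_pullback: "\<And>n. 1 \<le> n \<Longrightarrow> \<exists>Tn q. Tn \<in> hom1 K X X \<and> (\<forall>i<n. q i \<in> hom2 K X X Tn T) \<and>
      (\<forall>m. let Tm = iter1 K X T m in
        pointwise_fibre_power K X X n (Tm \<odot> Tn) (\<lambda>i. Tm \<rhd> q i)
          (Tm \<odot> T) (Tm \<odot> id1 K X) (Tm \<rhd> p))"
    and additive_bundle: "commutative_monoid (slice (homcat K X X) (id1 K X))
      (id1 K X, id2 K (id1 K X)) (T2, p \<bullet> q1) q1 q2 (T, p) z s"
    and lift_proj: "(T \<rhd> p) \<bullet> l = z \<bullet> p"
    and lift_zero: "l \<bullet> z = (T \<rhd> z) \<bullet> z"
    and lift_add: "l \<bullet> s = (T \<rhd> s) \<bullet>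
      pairing (homcat K X X) (T \<odot> T2) (T \<rhd> q1) (T \<rhd> q2) T2 (l \<bullet> q1) (l \<bullet> q2)"
    and flip_proj: "(p \<lhd> T) \<bullet> c = T \<rhd> p"
    and flip_zero: "c \<bullet> (T \<rhd> z) = z \<lhd> T"
    and flip_add: "c \<bullet> (T \<rhd> s) = (s \<lhd> T) \<bullet>
      pairing (homcat K X X) (T2 \<odot> T) (q1 \<lhd> T) (q2 \<lhd> T) (T \<odot> T2) (c \<bullet> (T \<rhd> q1)) (c \<bullet> (T \<rhd> q2))"
    and lift_coassoc: "(T \<rhd> l) \<bullet> l = (l \<lhd> T) \<bullet> l"
    and flip_lift: "c \<bullet> l = l"
    and flip_flip_lift: "(c \<lhd> T) \<bullet> (T \<rhd> c) \<bullet> (l \<lhd> T) = (T \<rhd> l) \<bullet> c"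
    and flip_involutive: "c \<bullet> c = id2 K (T \<odot> T)"
    and flip_braid: "(T \<rhd> c) \<bullet> (c \<lhd> T) \<bullet> (T \<rhd> c) = (c \<lhd> T) \<bullet> (T \<rhd> c) \<bullet> (c \<lhd> T)"
    and lift_universal: "pointwise_pullback K X X T2
      (p \<bullet> q1)
      ((T \<rhd> s) \<bullet> pairing (homcat K X X) (T \<odot> T2) (T \<rhd> q1) (T \<rhd> q2) T2 ((z \<lhd> T) \<bullet> q1) (l \<bullet> q2))
      (id1 K X) (T \<odot> T) T z (T \<rhd> p)"

record ('o, 'm, 'c) tangentad =
  base :: 'o
  tanT :: 'm
  tanT2 :: 'm
  tan_q1 :: 'c
  tan_q2 :: 'c
  tan_p :: 'c
  tan_z :: 'c
  tan_s :: 'c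
  tan_l :: 'c
  tan_c :: 'c

definition is_tangentad :: "('o, 'm, 'c, 'z) cat2_scheme \<Rightarrow> ('o, 'm, 'c) tangentad \<Rightarrow> bool" where
  "is_tangentad K X \<longleftrightarrow> tangent_structure K (base X) (tanT X) (tanT2 X) (tan_q1 X) (tan_q2 X)
     (tan_p X) (tan_z X) (tan_s X) (tan_l X) (tan_c X)"

locale lax_tangent_morphism =
  fixes K :: "('o, 'm, 'c, 'z) cat2_scheme" (structure)
    and X' :: "('o, 'm, 'c) tangentad" and X :: "('o, 'm, 'c) tangentad"
    and F :: 'm and \<alpha> :: 'c
  assumes F_hom: "F \<in> hom1 K (base X') (base X)"
    and \<alpha>_hom: "\<alpha> \<in> hom2 K (base X') (base X) (F \<odot> tanT X') (tanT X \<odot> F)"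
    and comp_p: "(tan_p X \<lhd> F) \<bullet> \<alpha> = F \<rhd> tan_p X'"
    and comp_z: "\<alpha> \<bullet> (F \<rhd> tan_z X') = tan_z X \<lhd> F"
    and comp_s: "\<alpha> \<bullet> (F \<rhd> tan_s X') = (tan_s X \<lhd> F) \<bullet>
      pairing (homcat K (base X') (base X))
        (tanT2 X \<odot> F) (tan_q1 X \<lhd> F) (tan_q2 X \<lhd> F) (F \<odot> tanT2 X')
        (\<alpha> \<bullet> (F \<rhd> tan_q1 X')) (\<alpha> \<bullet> (F \<rhd> tan_q2 X'))"
    and comp_l: "(tan_l X \<lhd> F) \<bullet> \<alpha> = (tanT X \<rhd> \<alpha>) \<bullet> (\<alpha> \<lhd> tanT X') \<bullet> (F \<rhd> tan_l X')"
    and comp_c: "(tan_c X \<lhd> F) \<bullet> (tanT X \<rhd> \<alpha>) \<bullet> (\<alpha> \<lhd> tanT X') =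
      (tanT X \<rhd> \<alpha>) \<bullet> (\<alpha> \<lhd> tanT X') \<bullet> (F \<rhd> tan_c X')"

definition strong_tangent_morphism :: "('o, 'm, 'c, 'z) cat2_scheme \<Rightarrow>
    ('o, 'm, 'c) tangentad \<Rightarrow> ('o, 'm, 'c) tangentad \<Rightarrow> 'm \<times> 'c \<Rightarrow> bool" where
  "strong_tangent_morphism K X' X = (\<lambda>(F, \<alpha>). lax_tangent_morphism K X' X F \<alpha> \<and>
     invertible_cell K (base X') (base X) (F \<odot>\<^bsub>K\<^esub> tanT X') (tanT X \<odot>\<^bsub>K\<^esub> F) \<alpha>)"

definition strict_tangent_morphism :: "('o, 'm, 'c, 'z) cat2_scheme \<Rightarrow>
    ('o, 'm, 'c) tangentad \<Rightarrow> ('o, 'm, 'c) tangentad \<Rightarrow> 'm \<times> 'c \<Rightarrow> bool" where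
  "strict_tangent_morphism K X' X = (\<lambda>(F, \<alpha>). lax_tangent_morphism K X' X F \<alpha> \<and>
     F \<odot>\<^bsub>K\<^esub> tanT X' = tanT X \<odot>\<^bsub>K\<^esub> F \<and> \<alpha> = id2 K (F \<odot>\<^bsub>K\<^esub> tanT X'))"

definition tangent_2_morphism :: "('o, 'm, 'c, 'z) cat2_scheme \<Rightarrow>
    ('o, 'm, 'c) tangentad \<Rightarrow> ('o, 'm, 'c) tangentad \<Rightarrow> 'm \<times> 'c \<Rightarrow> 'm \<times> 'c \<Rightarrow> 'c \<Rightarrow> bool" where
  "tangent_2_morphism K X' X = (\<lambda>(F, \<alpha>) (G, \<beta>) \<phi>. \<phi> \<in> hom2 K (base X') (base X) F G \<and>
     (tanT X \<rhd>\<^bsub>K\<^esub> \<phi>) \<bullet>\<^bsub>K\<^esub> \<alpha> = \<beta> \<bullet>\<^bsub>K\<^esub> (\<phi> \<lhd>\<^bsub>K\<^esub> tanT X'))"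

definition terminal_tangentad :: "('o, 'm, 'c, 'z) cat2p_scheme \<Rightarrow> ('o, 'm, 'c) tangentad" where
  "terminal_tangentad K = (let I = id1 K (tobj K); i = id2 K I in
     \<lparr> base = tobj K, tanT = I, tanT2 = I, tan_q1 = i, tan_q2 = i,
       tan_p = i, tan_z = i, tan_s = i, tan_l = i, tan_c = i \<rparr>)"

definition product_tangentad :: "('o, 'm, 'c, 'z) cat2p_scheme \<Rightarrow>
    ('o, 'm, 'c) tangentad \<Rightarrow> ('o, 'm, 'c) tangentad \<Rightarrow> ('o, 'm, 'c) tangentad" where
  "product_tangentad K X Y =
     (let A = base X; B = base Y; I = id1 K A; J = id1 K B;
          T = tanT X; S = tanT Y; T2 = tanT2 X; S2 = tanT2 Y;
          TT = T \<odot>\<^bsub>K\<^esub> T; SS = S \<odot>\<^bsub>K\<^esub> S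
      in \<lparr> base = pobj K A B,
           tanT = prod1 K A B A B T S,
           tanT2 = prod1 K A B A B T2 S2,
           tan_q1 = prod2 K A B A B T2 S2 T S (tan_q1 X) (tan_q1 Y),
           tan_q2 = prod2 K A B A B T2 S2 T S (tan_q2 X) (tan_q2 Y),
           tan_p = prod2 K A B A B T S I J (tan_p X) (tan_p Y),
           tan_z = prod2 K A B A B I J T S (tan_z X) (tan_z Y),
           tan_s = prod2 K A B A B T2 S2 T S (tan_s X) (tan_s Y),
           tan_l = prod2 K A B A B T S TT SS (tan_l X) (tan_l Y),
           tan_c = prod2 K A B A B TT SS TT SS (tan_c X) (tan_c Y) \<rparr>)"

text \<open>\<open>Tng(K)\<close> with the finite 2-products inherited from \<open>K\<close>; the product projections are
  strict tangent morphisms.\<close>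

definition Tng ::
    "('o, 'm, 'c, 'z) cat2p_scheme \<Rightarrow> (('o, 'm, 'c) tangentad, 'm \<times> 'c, 'c) cat2p" where
  "Tng K = \<lparr>
     obj = {X. is_tangentad K X},
     hom1 = (\<lambda>X' X. {(F, \<alpha>). lax_tangent_morphism K X' X F \<alpha>}),
     hom2 = (\<lambda>X' X A B. {\<phi>. tangent_2_morphism K X' X A B \<phi>}),
     id1 = (\<lambda>X. (id1 K (base X), id2 K (tanT X))),
     comp1 = (\<lambda>(G, \<beta>) (F, \<alpha>). (G \<odot>\<^bsub>K\<^esub> F, (\<beta> \<lhd>\<^bsub>K\<^esub> F) \<bullet>\<^bsub>K\<^esub> (G \<rhd>\<^bsub>K\<^esub> \<alpha>))),
     id2 = (\<lambda>(F, \<alpha>). id2 K F),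
     vcomp = vcomp K,
     hcomp = hcomp K,
     tobj = terminal_tangentad K,
     pobj = product_tangentad K,
     pfst = (\<lambda>X Y. (pfst K (base X) (base Y), id2 K (tanT X \<odot>\<^bsub>K\<^esub> pfst K (base X) (base Y)))),
     psnd = (\<lambda>X Y. (psnd K (base X) (base Y), id2 K (tanT Y \<odot>\<^bsub>K\<^esub> psnd K (base X) (base Y)))) \<rparr>"

text \<open>A Cartesian tangentad is a Cartesian object of \<open>Tng(K)\<close>.\<close>

type_synonym ('o, 'm, 'c) cart_tangentad = "('o, 'm, 'c) tangentad \<times> ('m \<times> 'c, 'c) cart"

definition cTng_strong ::
    "('o, 'm, 'c, 'z) cat2p_scheme \<Rightarrow> (('o, 'm, 'c) cart_tangentad, 'm \<times> 'c, 'c) cat2" where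
  "cTng_strong K = \<lparr>
     obj = {(X, k). cartesian_object (Tng K) X k},
     hom1 = (\<lambda>(X, k) (Y, k').
       {F. strong_tangent_morphism K X Y F \<and> preserves_products (Tng K) X k Y k' F}),
     hom2 = (\<lambda>(X, k) (Y, k') F G.
       {\<phi>. tangent_2_morphism K X Y F G \<phi> \<and> compatible_cell (Tng K) X k Y k' F G \<phi>}),
     id1 = (\<lambda>(X, k). id1 (Tng K) X),
     comp1 = comp1 (Tng K),
     id2 = id2 (Tng K),
     vcomp = vcomp (Tng K),
     hcomp = hcomp (Tng K) \<rparr>"


section \<open>Tangent categories and differential objects\<close>

record ('a, 'f) tangent_cat = "('a, 'f) cat" +
  cT :: "'a \<Rightarrow> 'a"
  cTa :: "'f \<Rightarrow> 'f"
  cT2 :: "'a \<Rightarrow> 'a"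
  cq1 :: "'a \<Rightarrow> 'f"
  cq2 :: "'a \<Rightarrow> 'f"
  cp :: "'a \<Rightarrow> 'f"
  cz :: "'a \<Rightarrow> 'f"
  cs :: "'a \<Rightarrow> 'f"
  cl :: "'a \<Rightarrow> 'f"
  cc :: "'a \<Rightarrow> 'f"

record ('a, 'f) cart_tangent_cat = "('a, 'f) tangent_cat" +
  ctop :: 'a
  bx :: "'a \<Rightarrow> 'a \<Rightarrow> 'a"
  bx1 :: "'a \<Rightarrow> 'a \<Rightarrow> 'f"
  bx2 :: "'a \<Rightarrow> 'a \<Rightarrow> 'f"

definition T2_pair ::
    "('a, 'f, 'z) tangent_cat_scheme \<Rightarrow> 'a \<Rightarrow> 'a \<Rightarrow> 'f \<Rightarrow> 'f \<Rightarrow> 'f" where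
  "T2_pair C A W a b = pairing C (cT2 C A) (cq1 C A) (cq2 C A) W a b"

definition bx_pair ::
    "('a, 'f, 'z) cart_tangent_cat_scheme \<Rightarrow> 'a \<Rightarrow> 'a \<Rightarrow> 'a \<Rightarrow> 'f \<Rightarrow> 'f \<Rightarrow> 'f" where
  "bx_pair C A B W a b = pairing C (bx C A B) (bx1 C A B) (bx2 C A B) W a b"

text \<open>The canonical comparison \<open>T(A \<times> A) \<rightarrow> TA \<times> TA\<close>.\<close>

definition T_bx_comparison :: "('a, 'f, 'z) cart_tangent_cat_scheme \<Rightarrow> 'a \<Rightarrow> 'f" where
  "T_bx_comparison C A =
     bx_pair C (cT C A) (cT C A) (cT C (bx C A A)) (cTa C (bx1 C A A)) (cTa C (bx2 C A A))"

text \<open>Isomorphisms of tangent categories: strict tangent functors that are bijective on objects and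
  on hom-sets. \<open>T2\<close> is a chosen pullback, so it is preserved up to the induced arrow only.\<close>

locale tangent_cat_iso =
  fixes C :: "('a, 'f, 'z) tangent_cat_scheme" and D :: "('b, 'g, 'w) tangent_cat_scheme"
    and fo :: "'a \<Rightarrow> 'b" and fa :: "'f \<Rightarrow> 'g"
  assumes bij_ob: "bij_betw fo (Ob C) (Ob D)"
    and bij_arr: "\<lbrakk>A \<in> Ob C; B \<in> Ob C\<rbrakk> \<Longrightarrow> bij_betw fa (Arr C A B) (Arr D (fo A) (fo B))"
    and fa_idn: "A \<in> Ob C \<Longrightarrow> fa (idn C A) = idn D (fo A)"
    and fa_cmp: "\<lbrakk>A \<in> Ob C; B \<in> Ob C; E \<in> Ob C; f \<in> Arr C A B; g \<in> Arr C B E\<rbrakk>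
      \<Longrightarrow> fa (g \<cdot>\<^bsub>C\<^esub> f) = fa g \<cdot>\<^bsub>D\<^esub> fa f"
    and fo_T: "A \<in> Ob C \<Longrightarrow> fo (cT C A) = cT D (fo A)"
    and fa_T: "\<lbrakk>A \<in> Ob C; B \<in> Ob C; f \<in> Arr C A B\<rbrakk> \<Longrightarrow> fa (cTa C f) = cTa D (fa f)"
    and fa_p: "A \<in> Ob C \<Longrightarrow> fa (cp C A) = cp D (fo A)"
    and fa_z: "A \<in> Ob C \<Longrightarrow> fa (cz C A) = cz D (fo A)"
    and fa_s: "A \<in> Ob C \<Longrightarrow>
      fa (cs C A) = cs D (fo A) \<cdot>\<^bsub>D\<^esub> T2_pair D (fo A) (fo (cT2 C A)) (fa (cq1 C A)) (fa (cq2 C A))"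
    and fa_l: "A \<in> Ob C \<Longrightarrow> fa (cl C A) = cl D (fo A)"
    and fa_c: "A \<in> Ob C \<Longrightarrow> fa (cc C A) = cc D (fo A)"

record ('a, 'f) dobj =
  d_ob :: 'a
  d_zero :: 'f
  d_add :: 'f
  d_proj :: 'f

text \<open>Where the literature identifies \<open>T*\<close> with \<open>*\<close> and \<open>T(A \<times> A)\<close> with \<open>TA \<times> TA\<close>, the
  comparison arrows are written out.\<close>

definition differential_object ::
    "('a, 'f, 'z) cart_tangent_cat_scheme \<Rightarrow> ('a, 'f) dobj \<Rightarrow> bool" where
  "differential_object C D \<longleftrightarrow>
     (let A = d_ob D; \<zeta> = d_zero D; \<sigma> = d_add D; ph = d_proj D; TA = cT C A in
        A \<in> Ob C \<and>
        commutative_monoid C (ctop C) (bx C A A) (bx1 C A A) (bx2 C A A) A \<zeta> \<sigma> \<and>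
        ph \<in> Arr C TA A \<and>
        ph \<cdot>\<^bsub>C\<^esub> cTa C \<zeta> = \<zeta> \<cdot>\<^bsub>C\<^esub> to_terminal C (ctop C) (cT C (ctop C)) \<and>
        ph \<cdot>\<^bsub>C\<^esub> cTa C \<sigma> =
          \<sigma> \<cdot>\<^bsub>C\<^esub> bx_pair C A A (bx C TA TA) (ph \<cdot>\<^bsub>C\<^esub> bx1 C TA TA) (ph \<cdot>\<^bsub>C\<^esub> bx2 C TA TA)
            \<cdot>\<^bsub>C\<^esub> T_bx_comparison C A \<and>
        ph \<cdot>\<^bsub>C\<^esub> cz C A = \<zeta> \<cdot>\<^bsub>C\<^esub> to_terminal C (ctop C) A \<and>
        ph \<cdot>\<^bsub>C\<^esub> cs C A =
          \<sigma> \<cdot>\<^bsub>C\<^esub> bx_pair C A A (cT2 C A) (ph \<cdot>\<^bsub>C\<^esub> cq1 C A) (ph \<cdot>\<^bsub>C\<^esub> cq2 C A) \<and>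
        ph \<cdot>\<^bsub>C\<^esub> cTa C ph \<cdot>\<^bsub>C\<^esub> cl C A = ph \<and>
        is_product C TA (cp C A) ph A A)"

definition linear_arrow ::
    "('a, 'f, 'z) cart_tangent_cat_scheme \<Rightarrow> ('a, 'f) dobj \<Rightarrow> ('a, 'f) dobj \<Rightarrow> 'f \<Rightarrow> bool" where
  "linear_arrow C D E f \<longleftrightarrow>
     f \<in> Arr C (d_ob D) (d_ob E) \<and> f \<cdot>\<^bsub>C\<^esub> d_proj D = d_proj E \<cdot>\<^bsub>C\<^esub> cTa C f"

definition dobj_T :: "('a, 'f, 'z) cart_tangent_cat_scheme \<Rightarrow> ('a, 'f) dobj \<Rightarrow> ('a, 'f) dobj" where
  "dobj_T C D = (let A = d_ob D; TA = cT C A in \<lparr>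
     d_ob = TA,
     d_zero = cTa C (d_zero D) \<cdot>\<^bsub>C\<^esub>
       inverse_arr C (cT C (ctop C)) (ctop C) (to_terminal C (ctop C) (cT C (ctop C))),
     d_add = cTa C (d_add D) \<cdot>\<^bsub>C\<^esub>
       inverse_arr C (cT C (bx C A A)) (bx C TA TA) (T_bx_comparison C A),
     d_proj = cTa C (d_proj D) \<cdot>\<^bsub>C\<^esub> cc C A \<rparr>)"

text \<open>The pullback of \<open>p : TD \<rightarrow> D\<close> along itself in differential objects: \<open>T2 A\<close> with the
  componentwise structure.\<close>

definition dobj_T2 :: "('a, 'f, 'z) cart_tangent_cat_scheme \<Rightarrow> ('a, 'f) dobj \<Rightarrow> ('a, 'f) dobj" where
  "dobj_T2 C D = (let A = d_ob D; E = dobj_T C D; TA = cT C A; B = cT2 C A;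
       comp = (\<lambda>q. d_add E \<cdot>\<^bsub>C\<^esub>
         bx_pair C TA TA (bx C B B) (q \<cdot>\<^bsub>C\<^esub> bx1 C B B) (q \<cdot>\<^bsub>C\<^esub> bx2 C B B))
     in \<lparr>
     d_ob = B,
     d_zero = T2_pair C A (ctop C) (d_zero E) (d_zero E),
     d_add = T2_pair C A (bx C B B) (comp (cq1 C A)) (comp (cq2 C A)),
     d_proj = T2_pair C A (cT C B)
       (d_proj E \<cdot>\<^bsub>C\<^esub> cTa C (cq1 C A)) (d_proj E \<cdot>\<^bsub>C\<^esub> cTa C (cq2 C A)) \<rparr>)"

text \<open>The tangent category of those differential objects of \<open>C\<close> that lie in \<open>S\<close>, with linear
  morphisms.\<close>

definition DO_cat :: "('a, 'f, 'z) cart_tangent_cat_scheme \<Rightarrow> ('a, 'f) dobj set \<Rightarrow>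
    (('a, 'f) dobj, 'f) tangent_cat" where
  "DO_cat C S = \<lparr>
     Ob = {D \<in> S. differential_object C D},
     Arr = (\<lambda>D E. {f. linear_arrow C D E f}),
     idn = (\<lambda>D. idn C (d_ob D)),
     cmp = cmp C,
     cT = dobj_T C,
     cTa = cTa C,
     cT2 = dobj_T2 C,
     cq1 = (\<lambda>D. cq1 C (d_ob D)),
     cq2 = (\<lambda>D. cq2 C (d_ob D)),
     cp = (\<lambda>D. cp C (d_ob D)),
     cz = (\<lambda>D. cz C (d_ob D)),
     cs = (\<lambda>D. cs C (d_ob D)),
     cl = (\<lambda>D. cl C (d_ob D)),
     cc = (\<lambda>D. cc C (d_ob D)) \<rparr>"


section \<open>The hom tangent categories and the construction of differential objects\<close>

text \<open>The lax distributive law \<open>T2 \<circ> T \<Rightarrow> T \<circ> T2\<close> induced componentwise by \<open>c\<close>; it makes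
  \<open>T2\<close> a lax tangent endomorphism.\<close>

definition flip2 :: "('o, 'm, 'c, 'z) cat2_scheme \<Rightarrow> ('o, 'm, 'c) tangentad \<Rightarrow> 'c" where
  "flip2 K X = (let T = tanT X; T2 = tanT2 X in
     pairing (homcat K (base X) (base X)) (T \<odot>\<^bsub>K\<^esub> T2) (T \<rhd>\<^bsub>K\<^esub> tan_q1 X) (T \<rhd>\<^bsub>K\<^esub> tan_q2 X) (T2 \<odot>\<^bsub>K\<^esub> T)
       (tan_c X \<bullet>\<^bsub>K\<^esub> (tan_q1 X \<lhd>\<^bsub>K\<^esub> T)) (tan_c X \<bullet>\<^bsub>K\<^esub> (tan_q2 X \<lhd>\<^bsub>K\<^esub> T)))"

definition hom_tangent_cat :: "('o, 'm, 'c, 'z) cat2p_scheme \<Rightarrow>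
    ('o, 'm, 'c) tangentad \<Rightarrow> ('o, 'm, 'c) tangentad \<Rightarrow> ('m \<times> 'c, 'c) tangent_cat" where
  "hom_tangent_cat K X' X = \<lparr>
     Ob = hom1 (Tng K) X' X,
     Arr = hom2 (Tng K) X' X,
     idn = id2 (Tng K),
     cmp = vcomp (Tng K),
     cT = (\<lambda>(F, \<alpha>). (tanT X \<odot>\<^bsub>K\<^esub> F, (tan_c X \<lhd>\<^bsub>K\<^esub> F) \<bullet>\<^bsub>K\<^esub> (tanT X \<rhd>\<^bsub>K\<^esub> \<alpha>))),
     cTa = (\<lambda>\<phi>. tanT X \<rhd>\<^bsub>K\<^esub> \<phi>),
     cT2 = (\<lambda>(F, \<alpha>). (tanT2 X \<odot>\<^bsub>K\<^esub> F, (flip2 K X \<lhd>\<^bsub>K\<^esub> F) \<bullet>\<^bsub>K\<^esub> (tanT2 X \<rhd>\<^bsub>K\<^esub> \<alpha>))),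
     cq1 = (\<lambda>(F, \<alpha>). tan_q1 X \<lhd>\<^bsub>K\<^esub> F),
     cq2 = (\<lambda>(F, \<alpha>). tan_q2 X \<lhd>\<^bsub>K\<^esub> F),
     cp = (\<lambda>(F, \<alpha>). tan_p X \<lhd>\<^bsub>K\<^esub> F),
     cz = (\<lambda>(F, \<alpha>). tan_z X \<lhd>\<^bsub>K\<^esub> F),
     cs = (\<lambda>(F, \<alpha>). tan_s X \<lhd>\<^bsub>K\<^esub> F),
     cl = (\<lambda>(F, \<alpha>). tan_l X \<lhd>\<^bsub>K\<^esub> F),
     cc = (\<lambda>(F, \<alpha>). tan_c X \<lhd>\<^bsub>K\<^esub> F) \<rparr>"

text \<open>For a Cartesian tangentad \<open>(X, k)\<close>: the terminal object is \<open>* \<circ> !\<close> and the product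
  \<open>\<times> \<circ> \<langle>A, B\<rangle>\<close>, with projections given by the counit of \<open>\<Delta> \<stileturn> \<times>\<close> at \<open>\<langle>A, B\<rangle>\<close>.\<close>

definition hom_cart_tangent_cat :: "('o, 'm, 'c, 'z) cat2p_scheme \<Rightarrow>
    ('o, 'm, 'c) tangentad \<Rightarrow> ('o, 'm, 'c) cart_tangentad \<Rightarrow> ('m \<times> 'c, 'c) cart_tangent_cat" where
  "hom_cart_tangent_cat K X' = (\<lambda>(X, k). let M = Tng K in
     tangent_cat.extend (hom_tangent_cat K X' X) \<lparr>
       ctop = star k \<odot>\<^bsub>M\<^esub> bang1 M X',
       bx = (\<lambda>A B. times1 k \<odot>\<^bsub>M\<^esub> pair1 M X' X X A B),
       bx1 = (\<lambda>A B. pfst M X X \<rhd>\<^bsub>M\<^esub> (times_counit k \<lhd>\<^bsub>M\<^esub> pair1 M X' X X A B)),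
       bx2 = (\<lambda>A B. psnd M X X \<rhd>\<^bsub>M\<^esub> (times_counit k \<lhd>\<^bsub>M\<^esub> pair1 M X' X X A B)) \<rparr>)"

text \<open>\<open>DO[X' | X]\<close>: the pointwise differential objects, i.e. those whose product diagram
  \<open>A \<leftarrow> TA \<rightarrow> A\<close> is a pointwise product in the hom-category of \<open>Tng(K)\<close>.\<close>

definition pointwise_DO :: "('o, 'm, 'c, 'z) cat2p_scheme \<Rightarrow>
    ('o, 'm, 'c) tangentad \<Rightarrow> ('o, 'm, 'c) cart_tangentad \<Rightarrow>
    (('m \<times> 'c, 'c) dobj, 'c) tangent_cat" where
  "pointwise_DO K X' X = (let C = hom_cart_tangent_cat K X' X in
     DO_cat C {D. pointwise_product (Tng K) X' (fst X)
       (cT C (d_ob D)) (cp C (d_ob D)) (d_proj D) (d_ob D) (d_ob D)})"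

definition whisker_dobj :: "('o, 'm, 'c, 'z) cat2_scheme \<Rightarrow> ('m, 'c) dobj \<Rightarrow> 'm \<Rightarrow> ('m, 'c) dobj" where
  "whisker_dobj M D H = \<lparr> d_ob = d_ob D \<odot>\<^bsub>M\<^esub> H, d_zero = d_zero D \<lhd>\<^bsub>M\<^esub> H,
     d_add = d_add D \<lhd>\<^bsub>M\<^esub> H, d_proj = d_proj D \<lhd>\<^bsub>M\<^esub> H \<rparr>"

text \<open>\<open>Y = DO(X)\<close>, where \<open>V = (U; Z, S, P)\<close> is the universal pointwise differential object.\<close>

definition differential_objects_construction :: "('o, 'm, 'c, 'z) cat2p_scheme \<Rightarrow>
    ('o, 'm, 'c) cart_tangentad \<Rightarrow> ('o, 'm, 'c) cart_tangentad \<Rightarrow> ('m \<times> 'c, 'c) dobj \<Rightarrow> bool" where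
  "differential_objects_construction K X Y V \<longleftrightarrow>
     cartesian_object (Tng K) (fst Y) (snd Y) \<and>
     strict_tangent_morphism K (fst Y) (fst X) (d_ob V) \<and>
     V \<in> Ob (pointwise_DO K (fst Y) X) \<and>
     (\<forall>X'\<in>obj (Tng K). tangent_cat_iso (hom_tangent_cat K X' (fst Y)) (pointwise_DO K X' X)
        (whisker_dobj (Tng K) V) (\<lambda>\<phi>. d_ob V \<rhd>\<^bsub>Tng K\<^esub> \<phi>))"

definition is_tangentad_of_differential_objects :: "('o, 'm, 'c, 'z) cat2p_scheme \<Rightarrow>
    ('o, 'm, 'c) cart_tangentad \<Rightarrow> ('o, 'm, 'c) cart_tangentad \<Rightarrow> bool" where
  "is_tangentad_of_differential_objects K X Y \<longleftrightarrow>
     (\<exists>V. differential_objects_construction K X Y V)"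

definition admits_differential_objects :: "('o, 'm, 'c, 'z) cat2p_scheme \<Rightarrow> bool" where
  "admits_differential_objects K \<longleftrightarrow>
     (\<forall>X k. cartesian_object (Tng K) X k \<longrightarrow>
        (\<exists>Y. is_tangentad_of_differential_objects K (X, k) Y))"

end

theory Submission
  imports Defs
begin

text \<open>The universal property of \<open>DO(X)\<close> translates 1-cells into \<open>DO(X)\<close> into pointwise differential objects over \<open>X\<close>, and
2-cells between them into linear arrows. So everything is reduced to differential objects.

A strong tangent morphism \<open>(F, \<alpha>) : X \<rightarrow> X'\<close> that preserves finite products carries a differential object on \<open>A\<close> to one on
\<open>F A\<close>: its structure is transported along \<open>F * \<cong> *\<close>, \<open>F (A \<times> A) \<cong> F A \<times> F A\<close> and \<open>\<alpha> : F T A \<cong> T F A\<close> (\<open>dob_push\<close>). The one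
delicate axiom is the additivity of the projection, which speaks of \<open>T2 A\<close>, a pullback that \<open>F\<close> need not preserve. It is
enough that \<open>F T2 A \<rightarrow> T2 F A\<close> has a section, and it has one because a differential object makes \<open>T2 A\<close> a retract of
\<open>A \<times> (A \<times> A)\<close>.

For the universal differential object \<open>U : DO(X) \<rightarrow> X\<close> this gives a differential object on \<open>F U\<close>, hence a unique
\<open>H = DO(F, \<alpha>)\<close> with \<open>U' H = F U\<close> and compatible structure (\<open>udob_mor\<close>). For a tangent 2-morphism \<open>\<theta> : F \<Rightarrow> G\<close> the cell
\<open>\<theta> U\<close> is linear, hence of the form \<open>U' \<omega>\<close> for a unique \<open>\<omega> = DO(\<theta>)\<close> (\<open>lift_cell\<close>). The laws of a 2-functor follow from
uniqueness, because transport along \<open>G F\<close> is transport along \<open>F\<close> followed by transport along \<open>G\<close> (\<open>lift_comp\<close>).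

\<open>U'\<close> reflects invertibility, since the inverse of a linear arrow is linear. As \<open>U'\<close> sends the distributive law of \<open>H\<close> to
\<open>\<alpha> U\<close>, the morphism \<open>H\<close> is strong (\<open>lift_strong\<close>). The product of two differential objects is a differential object with
linear projections (\<open>dob_box\<close>), so \<open>U\<close> and \<open>U'\<close> preserve finite products; as \<open>F U = U' H\<close> preserves them and \<open>U'\<close>
reflects invertibility of the comparisons, \<open>H\<close> preserves them too (\<open>lift_fpres\<close>).

This argument takes place in \<open>Tng(K)\<close> and uses little of it; what it uses is collected in the locale
\<open>tangent_2_category\<close>. The first half of the text shows that \<open>Tng(K)\<close> is an instance: it is a 2-category with finite
2-products, in which \<open>(T, c)\<close> and \<open>(T2, flip2)\<close> are 1-cells and \<open>T2\<close> is still a pullback.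

Hom-sets may overlap, so a cell does not determine its endpoints. Calculations are therefore made with cells that carry
their endpoints: for these, composability is decided by computation, and whiskered composites have a normal form that
the simplifier finds.\<close>

section \<open>Cells that carry their endpoints\<close>

datatype ('a, 'f) tarr = Tarr (tdom: 'a) (tcod: 'a) (tval: 'f)

datatype ('o, 'm) tmor = Tmor (msrc: 'o) (mtrg: 'o) (mval: 'm)

context two_category
begin

definition mor :: "('o, 'm) tmor => bool" where
 "mor f \<longleftrightarrow> msrc f \<in> obj K & mtrg f \<in> obj K & mval f \<in> hom1 K (msrc f) (mtrg f)"

definition mid :: "'o => ('o, 'm) tmor" where
 "mid X = Tmor X X (id1 K X)"

definition mcomp :: "('o, 'm) tmor => ('o, 'm) tmor => ('o, 'm) tmor" (infixr "oo" 75) where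
 "g oo f = Tmor (msrc f) (mtrg g) (mval g \<odot> mval f)"

definition cel :: "(('o, 'm) tmor, 'c) tarr => bool" where
 "cel t \<longleftrightarrow> mor (tdom t) & mor (tcod t) & msrc (tcod t) = msrc (tdom t) & mtrg (tcod t) = mtrg (tdom t) &
   tval t \<in> hom2 K (msrc (tdom t)) (mtrg (tdom t)) (mval (tdom t)) (mval (tcod t))"

definition cid :: "('o, 'm) tmor => (('o, 'm) tmor, 'c) tarr" where
 "cid f = Tarr f f (id2 K (mval f))"

definition vc :: "(('o, 'm) tmor, 'c) tarr => (('o, 'm) tmor, 'c) tarr => (('o, 'm) tmor, 'c) tarr"
  (infixr "**" 65) where
 "s**t = Tarr (tdom t) (tcod s) (tval s \<bullet> tval t)"

definition lw :: "('o, 'm) tmor => (('o, 'm) tmor, 'c) tarr => (('o, 'm) tmor, 'c) tarr"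
  (infixr "|>" 73) where
 "f|>t = Tarr (f oo tdom t) (f oo tcod t) (mval f \<rhd> tval t)"

definition rw :: "(('o, 'm) tmor, 'c) tarr => ('o, 'm) tmor => (('o, 'm) tmor, 'c) tarr"
  (infixl "<|" 74) where
 "t<|f = Tarr (tdom t oo f) (tcod t oo f) (tval t \<lhd> mval f)"

lemma hc_id2:
 "[|X \<in> obj K; Y \<in> obj K; F \<in> hom1 K X Y|] ==> id2 K F \<in> hom2 K X Y F F"
 using category.idn_closed[OF category_homcat] by (fastforce simp: homcat_def)

lemma hc_vcomp:
 "[|X \<in> obj K; Y \<in> obj K; F \<in> hom1 K X Y; G \<in> hom1 K X Y; H \<in> hom1 K X Y;
  \<theta> \<in> hom2 K X Y F G; \<theta>' \<in> hom2 K X Y G H|] ==> \<theta>' \<bullet> \<theta> \<in> hom2 K X Y F H"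
 using category.cmp_closed[OF category_homcat, of X Y F G H \<theta> \<theta>'] by (simp add: homcat_def)

lemma hc_units:
 assumes "X \<in> obj K" "Y \<in> obj K" "F \<in> hom1 K X Y" "G \<in> hom1 K X Y" "\<theta> \<in> hom2 K X Y F G"
 shows "\<theta> \<bullet> id2 K F = \<theta>" "id2 K G \<bullet> \<theta> = \<theta>"
 using category.cmp_idn[OF category_homcat, of X Y F G \<theta>]
  category.idn_cmp[OF category_homcat, of X Y F G \<theta>] assms by (simp_all add: homcat_def)

lemma hc_assoc:
 "[|X \<in> obj K; Y \<in> obj K; F \<in> hom1 K X Y; G \<in> hom1 K X Y; H \<in> hom1 K X Y; I \<in> hom1 K X Y;
  \<theta> \<in> hom2 K X Y F G; \<theta>' \<in> hom2 K X Y G H; \<theta>'' \<in> hom2 K X Y H I|]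
  ==> (\<theta>'' \<bullet> \<theta>') \<bullet> \<theta> = \<theta>'' \<bullet> (\<theta>' \<bullet> \<theta>)"
 using category.cmp_assoc[OF category_homcat, of X Y F G H I \<theta> \<theta>' \<theta>''] by (simp add: homcat_def)

subsubsection \<open>typed simp rules\<close>

lemma typed_sel [simp]:
 "msrc (mid X) = X" "mtrg (mid X) = X" "msrc (g oo f) = msrc f" "mtrg (g oo f) = mtrg g"
 "tdom (cid f) = f" "tcod (cid f) = f" "tdom (s**t) = tdom t" "tcod (s**t) = tcod s"
 "tdom (f|>t) = f oo tdom t" "tcod (f|>t) = f oo tcod t"
 "tdom (t<|f) = tdom t oo f" "tcod (t<|f) = tcod t oo f"
 by (simp_all add: mid_def mcomp_def cid_def vc_def lw_def rw_def)

lemma typed_val: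
 "mval (mid X) = id1 K X" "mval (g oo f) = mval g \<odot> mval f"
 "tval (cid f) = id2 K (mval f)" "tval (s**t) = tval s \<bullet> tval t"
 "tval (f|>t) = mval f \<rhd> tval t" "tval (t<|f) = tval t \<lhd> mval f"
 by (simp_all add: mid_def mcomp_def cid_def vc_def lw_def rw_def)

lemma mor_mid [simp]: "X \<in> obj K ==> mor (mid X)"
 by (simp add: mor_def mid_def id1_closed)

lemma mor_obj: "mor f ==> msrc f \<in> obj K" "mor f ==> mtrg f \<in> obj K"
 by (simp_all add: mor_def)

lemma mor_mcomp [simp]: "[|mor g; mor f; msrc g = mtrg f|] ==> mor (g oo f)"
 using comp1_closed[of "msrc f" "mtrg f" "mtrg g" "mval f" "mval g"] by (simp add: mor_def mcomp_def)

lemma mcomp_assoc [simp]: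
 "[|mor h; mor g; mor f; msrc h = mtrg g; msrc g = mtrg f|] ==> (h oo g) oo f = h oo (g oo f)"
 using comp1_assoc[of "msrc f" "mtrg f" "mtrg g" "mtrg h" "mval f" "mval g" "mval h"]
 by (simp add: mor_def mcomp_def)

lemma mcomp_mid [simp]:
 "[|mor f; msrc f = X|] ==> f oo mid X = f" "[|mor f; mtrg f = X|] ==> mid X oo f = f"
 by (auto simp: mor_def mcomp_def mid_def comp1_id1 id1_comp1 tmor.expand)

lemma cel_mor:
 assumes "cel t"
 shows "mor (tdom t)" "mor (tcod t)" "msrc (tcod t) = msrc (tdom t)" "mtrg (tcod t) = mtrg (tdom t)"
 using assms by (simp_all add: cel_def)

lemma cel_cid [simp]: "mor f ==> cel (cid f)"
 by (simp add: cel_def cid_def hc_id2 mor_def)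

lemma cel_vc [simp]: "[|cel s; cel t; tdom s = tcod t|] ==> cel (s**t)"
 using hc_vcomp[of "msrc (tdom t)" "mtrg (tdom t)" "mval (tdom t)" "mval (tcod t)" "mval (tcod s)" "tval t" "tval s"]
 by (auto simp add: cel_def vc_def mor_def)

lemma cel_lw [simp]: "[|mor f; cel t; msrc f = mtrg (tdom t)|] ==> cel (f|>t)"
 using hcomp_closed[of "msrc (tdom t)" "mtrg (tdom t)" "mtrg f" "mval (tdom t)" "mval (tcod t)" "mval f" "mval f"
   "tval t" "id2 K (mval f)"]
 by (auto simp: cel_def lwhisker_def hc_id2 typed_val) (auto simp: mor_def hc_id2)

lemma cel_rw [simp]: "[|cel t; mor f; mtrg f = msrc (tdom t)|] ==> cel (t<|f)"
 using hcomp_closed[of "msrc f" "msrc (tdom t)" "mtrg (tdom t)" "mval f" "mval f" "mval (tdom t)" "mval (tcod t)"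
   "id2 K (mval f)" "tval t"]
 by (auto simp: cel_def rwhisker_def hc_id2 typed_val) (auto simp: mor_def hc_id2)

lemma vc_assoc [simp]:
 "[|cel r; cel s; cel t; tdom r = tcod s; tdom s = tcod t|] ==> (r**s)**t = r**(s**t)"
 using hc_assoc[of "msrc (tdom t)" "mtrg (tdom t)" "mval (tdom t)" "mval (tcod t)" "mval (tcod s)" "mval (tcod r)"
   "tval t" "tval s" "tval r"]
 by (auto simp add: cel_def vc_def mor_def)

lemma vc_cid [simp]:
 "[|cel t; tdom t = f|] ==> t**cid f = t" "[|cel t; tcod t = f|] ==> cid f**t = t"
 by (auto simp: cel_def vc_def cid_def mor_def tarr.expand hc_units)

lemma lw_vc [simp]:
 "[|mor f; cel s; cel t; tdom s = tcod t; msrc f = mtrg (tdom t)|] ==> f|>(s**t) = (f|>s)**(f|>t)"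
 using interchange[of "msrc (tdom t)" "msrc f" "mtrg f" "mval (tdom t)" "mval (tcod t)" "mval (tcod s)"
   "mval f" "mval f" "mval f" "tval t" "tval s" "id2 K (mval f)" "id2 K (mval f)"]
 by (auto simp: cel_def vc_def lw_def mor_def lwhisker_def hc_id2 hc_units)

lemma rw_vc [simp]:
 "[|mor f; cel s; cel t; tdom s = tcod t; mtrg f = msrc (tdom t)|] ==> (s**t)<|f = (s<|f)**(t<|f)"
 using interchange[of "msrc f" "msrc (tdom t)" "mtrg (tdom t)" "mval f" "mval f" "mval f"
   "mval (tdom t)" "mval (tcod t)" "mval (tcod s)" "id2 K (mval f)" "id2 K (mval f)" "tval t" "tval s"]
 by (auto simp: cel_def vc_def rw_def mor_def rwhisker_def hc_id2 hc_units)

lemma lw_cid [simp]: "[|mor f; mor g; msrc f = mtrg g|] ==> f|>cid g = cid (f oo g)"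
 by (auto simp: mor_def cid_def lw_def mcomp_def lwhisker_def hcomp_id2)

lemma rw_cid [simp]: "[|mor f; mor g; msrc f = mtrg g|] ==> cid f<|g = cid (f oo g)"
 by (auto simp: mor_def cid_def rw_def mcomp_def rwhisker_def hcomp_id2)

lemma lw_mcomp [simp]:
 "[|mor g; mor f; cel t; msrc g = mtrg f; msrc f = mtrg (tdom t)|] ==> (g oo f)|>t = g|>(f|>t)"
 using hcomp_assoc[of "msrc (tdom t)" "mtrg (tdom t)" "mtrg f" "mtrg g" "mval (tdom t)" "mval (tcod t)"
   "mval f" "mval f" "mval g" "mval g" "tval t" "id2 K (mval f)" "id2 K (mval g)"]
 by (auto simp: mor_def lw_def mcomp_def lwhisker_def hcomp_id2 hc_id2 cel_def comp1_assoc)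

lemma rw_mcomp [simp]:
 "[|mor g; mor f; cel t; msrc (tdom t) = mtrg g; msrc g = mtrg f|] ==> t<|(g oo f) = (t<|g)<|f"
 using hcomp_assoc[of "msrc f" "msrc g" "msrc (tdom t)" "mtrg (tdom t)" "mval f" "mval f"
   "mval g" "mval g" "mval (tdom t)" "mval (tcod t)" "id2 K (mval f)" "id2 K (mval g)" "tval t"]
 by (auto simp: mor_def rw_def mcomp_def rwhisker_def hcomp_id2 hc_id2 cel_def comp1_assoc)

lemma rw_lw [simp]:
 "[|mor g; mor f; cel t; msrc g = mtrg (tdom t); msrc (tdom t) = mtrg f|]
  ==> (g|>t)<|f = g|>(t<|f)"
 using hcomp_assoc[of "msrc f" "msrc (tdom t)" "mtrg (tdom t)" "mtrg g" "mval f" "mval f"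
  "mval (tdom t)" "mval (tcod t)" "mval g" "mval g" "id2 K (mval f)" "tval t" "id2 K (mval g)"]
 by (auto simp: mor_def rw_def lw_def mcomp_def rwhisker_def lwhisker_def hc_id2 cel_def comp1_assoc)

lemma lw_mid [simp]: "[|cel t; mtrg (tdom t) = X|] ==> mid X|>t = t"
 by (rule tarr.expand) (auto simp: cel_def lw_def lwhisker_def hcomp_unit_left mor_def typed_val)

lemma rw_mid [simp]: "[|cel t; msrc (tdom t) = X|] ==> t<|mid X = t"
 by (rule tarr.expand) (auto simp: cel_def rw_def rwhisker_def hcomp_unit_right mor_def typed_val)

text \<open>Naturality: two 2-cells side by side can be composed in either order.\<close>

lemma whisker_exchange:
 "[|cel s; cel t; msrc (tdom s) = mtrg (tdom t)|]
  ==> (s<|tcod t)**(tdom s|>t) = (tcod s|>t)**(s<|tdom t)"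
 using interchange[of "msrc (tdom t)" "mtrg (tdom t)" "mtrg (tdom s)" "mval (tdom t)" "mval (tcod t)" "mval (tcod t)"
   "mval (tdom s)" "mval (tdom s)" "mval (tcod s)" "tval t" "id2 K (mval (tcod t))" "id2 K (mval (tdom s))" "tval s"]
  interchange[of "msrc (tdom t)" "mtrg (tdom t)" "mtrg (tdom s)" "mval (tdom t)" "mval (tdom t)" "mval (tcod t)"
   "mval (tdom s)" "mval (tcod s)" "mval (tcod s)" "id2 K (mval (tdom t))" "tval t" "tval s" "id2 K (mval (tcod s))"]
 by (auto simp: cel_def mor_def lw_def rw_def vc_def mcomp_def lwhisker_def rwhisker_def hc_id2 hc_units)

declare mor_obj [simp] cel_mor [simp]

text \<open>The square \<open>f a = g b\<close> is a pullback in the hom-category to which the four cells belong.\<close>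

definition tpb :: "(('o, 'm) tmor, 'c) tarr => (('o, 'm) tmor, 'c) tarr => (('o, 'm) tmor, 'c) tarr =>
  (('o, 'm) tmor, 'c) tarr => bool" where
 "tpb a b f g \<longleftrightarrow> cel a & cel b & cel f & cel g & tdom a = tdom b & tcod a = tdom f & tcod b = tdom g &
   tcod f = tcod g & f**a = g**b &
   (\<forall>x y. cel x & cel y & tdom x = tdom y & tcod x = tdom f & tcod y = tdom g & f**x = g**y -->
    (\<exists>!u. cel u & tdom u = tdom x & tcod u = tdom a & a**u = x & b**u = y))"

lemma ex1_tarr:
 assumes "X \<in> obj K" "Y \<in> obj K" "W \<in> hom1 K X Y" "P \<in> hom1 K X Y"
  and "!!v. v \<in> hom2 K X Y W P ==> Q (Tarr (Tmor X Y W) (Tmor X Y P) v) \<longleftrightarrow> R v"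
 shows "(\<exists>!u. cel u & tdom u = Tmor X Y W & tcod u = Tmor X Y P & Q u) \<longleftrightarrow> (\<exists>!v. v \<in> hom2 K X Y W P & R v)"
  (is "?L = ?R")
proof
 assume ?L
 then obtain u where u: "cel u" "tdom u = Tmor X Y W" "tcod u = Tmor X Y P" "Q u"
  and un: "!!u'. cel u' ==> tdom u' = Tmor X Y W ==> tcod u' = Tmor X Y P ==> Q u' ==> u' = u" by blast
 have ue: "u = Tarr (Tmor X Y W) (Tmor X Y P) (tval u)" using u by (cases u) simp
 show ?R
 proof (rule ex1I[of _ "tval u"])
  have "tval u \<in> hom2 K X Y W P" using u by (simp add: cel_def del: cel_mor)
  then show "tval u \<in> hom2 K X Y W P & R (tval u)" using assms(5)[of "tval u"] ue u(4) by simp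
 next
  fix v assume v: "v \<in> hom2 K X Y W P & R v"
  then have "Tarr (Tmor X Y W) (Tmor X Y P) v = u"
   using assms by (intro un) (simp_all add: cel_def mor_def del: cel_mor mor_obj)
  then show "v = tval u" by (metis tarr.sel(3))
 qed
next
 assume ?R
 then obtain v where v: "v \<in> hom2 K X Y W P" "R v" and un: "!!v'. v' \<in> hom2 K X Y W P ==> R v' ==> v' = v" by blast
 show ?L
 proof (rule ex1I[of _ "Tarr (Tmor X Y W) (Tmor X Y P) v"])
  show "cel (Tarr (Tmor X Y W) (Tmor X Y P) v) & tdom (Tarr (Tmor X Y W) (Tmor X Y P) v) = Tmor X Y W &
   tcod (Tarr (Tmor X Y W) (Tmor X Y P) v) = Tmor X Y P & Q (Tarr (Tmor X Y W) (Tmor X Y P) v)"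
   using v assms by (simp add: cel_def mor_def del: cel_mor mor_obj)
 next
  fix u assume u: "cel u & tdom u = Tmor X Y W & tcod u = Tmor X Y P & Q u"
  then have h: "tval u \<in> hom2 K X Y W P" by (auto simp add: cel_def simp del: cel_mor)
  have ue: "u = Tarr (Tmor X Y W) (Tmor X Y P) (tval u)" using u by (cases u) simp
  have "R (tval u)" using assms(5)[OF h] ue u by simp
  then show "u = Tarr (Tmor X Y W) (Tmor X Y P) v" using un[OF h] ue by simp
 qed
qed

lemma is_pullback_iff_tpb:
 assumes "X \<in> obj K" "Y \<in> obj K" "P \<in> hom1 K X Y" "A \<in> hom1 K X Y" "B \<in> hom1 K X Y" "D \<in> hom1 K X Y"
 shows "is_pullback (homcat K X Y) P q1 q2 A B D f g \<longleftrightarrow>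
  tpb (Tarr (Tmor X Y P) (Tmor X Y A) q1) (Tarr (Tmor X Y P) (Tmor X Y B) q2)
   (Tarr (Tmor X Y A) (Tmor X Y D) f) (Tarr (Tmor X Y B) (Tmor X Y D) g)" (is "_ \<longleftrightarrow> tpb ?q1 ?q2 ?f ?g")
proof -
 let ?U = "%x y. (\<exists>!u. cel u & tdom u = tdom x & tcod u = Tmor X Y P & ?q1**u = x & ?q2**u = y)"
 have U: "?U (Tarr (Tmor X Y W) (Tmor X Y A) a) (Tarr (Tmor X Y W) (Tmor X Y B) b) \<longleftrightarrow>
   (\<exists>!u. u \<in> hom2 K X Y W P & q1 \<bullet> u = a & q2 \<bullet> u = b)"
  if "W \<in> hom1 K X Y" "a \<in> hom2 K X Y W A" "b \<in> hom2 K X Y W B" for W a b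
  by (simp, rule ex1_tarr) (use assms that in \<open>auto simp: vc_def\<close>)
 have main: "(\<forall>x y. cel x & cel y & tdom x = tdom y & tcod x = Tmor X Y A & tcod y = Tmor X Y B & ?f**x = ?g**y --> ?U x y)
  \<longleftrightarrow> (\<forall>W\<in>hom1 K X Y. \<forall>a\<in>hom2 K X Y W A. \<forall>b\<in>hom2 K X Y W B. f \<bullet> a = g \<bullet> b -->
    (\<exists>!u. u \<in> hom2 K X Y W P & q1 \<bullet> u = a & q2 \<bullet> u = b))" (is "?L \<longleftrightarrow> ?R")
 proof
  assume L: ?L
  show ?R
  proof (intro ballI impI)
   fix W a b assume h: "W \<in> hom1 K X Y" "a \<in> hom2 K X Y W A" "b \<in> hom2 K X Y W B" "f \<bullet> a = g \<bullet> b"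
   have "?U (Tarr (Tmor X Y W) (Tmor X Y A) a) (Tarr (Tmor X Y W) (Tmor X Y B) b)"
    using L[rule_format, of "Tarr (Tmor X Y W) (Tmor X Y A) a" "Tarr (Tmor X Y W) (Tmor X Y B) b"] h assms
    by (simp add: cel_def mor_def vc_def del: cel_mor mor_obj)
   then show "\<exists>!u. u \<in> hom2 K X Y W P & q1 \<bullet> u = a & q2 \<bullet> u = b" by (rule U[OF h(1-3), THEN iffD1])
  qed
 next
  assume R: ?R
  show ?L
  proof (intro allI impI)
   fix x y assume h: "cel x & cel y & tdom x = tdom y & tcod x = Tmor X Y A & tcod y = Tmor X Y B & ?f**x = ?g**y"
   have "msrc (tdom x) = X" "mtrg (tdom x) = Y" using h cel_mor(3,4)[of x] by auto
   then obtain W where W: "tdom x = Tmor X Y W" by (cases "tdom x") auto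
   obtain a where a: "x = Tarr (Tmor X Y W) (Tmor X Y A) a" using h W by (cases x) auto
   obtain b where b: "y = Tarr (Tmor X Y W) (Tmor X Y B) b" using h W by (cases y) auto
   have ab: "W \<in> hom1 K X Y" "a \<in> hom2 K X Y W A" "b \<in> hom2 K X Y W B" "f \<bullet> a = g \<bullet> b"
    using h unfolding a b by (auto simp: cel_def mor_def vc_def simp del: cel_mor mor_obj)
   show "?U x y" unfolding a b by (rule U[OF ab(1-3), THEN iffD2]) (use R ab in blast)
  qed
 qed
 show ?thesis
  unfolding is_pullback_def tpb_def
  using main assms by (auto simp: homcat_def cel_def mor_def vc_def simp del: cel_mor mor_obj)
qed

lemma tpbD:
 assumes "tpb a b f g"
 shows "cel a" "cel b" "cel f" "cel g" "tdom b = tdom a" "tcod a = tdom f" "tcod b = tdom g" "tcod g = tcod f"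
  "f**a = g**b"
 using assms unfolding tpb_def by auto

lemma tpb_ex:
 assumes "tpb a b f g" "cel x" "cel y" "tdom x = tdom y" "tcod x = tdom f" "tcod y = tdom g" "f**x = g**y"
 obtains u where "cel u" "tdom u = tdom x" "tcod u = tdom a" "a**u = x" "b**u = y"
 using assms unfolding tpb_def by metis

lemma tpb_eqI:
 assumes "tpb a b f g" "cel u" "cel v" "tdom u = tdom v" "tcod u = tdom a" "tcod v = tdom a"
  "a**u = a**v" "b**u = b**v"
 shows "u = v"
proof -
 note D = tpbD[OF assms(1)]
 have "f**a**v = g**b**v"
  using arg_cong[OF D(9), of "%w. w**v"] D(1-8) assms(2-6) by simp
 then have "\<exists>!w. cel w & tdom w = tdom (a**v) & tcod w = tdom a & a**w = a**v & b**w = b**v"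
 proof -
  have "\<forall>x y. cel x & cel y & tdom x = tdom y & tcod x = tdom f & tcod y = tdom g & f**x = g**y -->
    (\<exists>!u. cel u & tdom u = tdom x & tcod u = tdom a & a**u = x & b**u = y)"
   using assms(1) unfolding tpb_def by blast
  from this[rule_format, of "a**v" "b**v"] show ?thesis
   using \<open>f**a**v = g**b**v\<close> D(1-8) assms(2-6) by simp
 qed
 then show ?thesis using assms by (metis typed_sel(7))
qed

lemma pairing_tpb:
 assumes pb: "tpb a b f g" and u: "cel u" "tcod u = tdom a"
  and types: "tdom u = Tmor X Y W" "tdom a = Tmor X Y P"
  and eq: "tval x = tval (a**u)" "tval y = tval (b**u)"
 shows "pairing (homcat K X Y) P (tval a) (tval b) W (tval x) (tval y) = tval u"
proof -
 have X: "X \<in> obj K" "Y \<in> obj K" "W \<in> hom1 K X Y" "P \<in> hom1 K X Y" "tval u \<in> hom2 K X Y W P"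
  using u types by (auto simp: cel_def mor_def simp del: cel_mor mor_obj)
 have "\<exists>!v. v \<in> hom2 K X Y W P & tval a \<bullet> v = tval x & tval b \<bullet> v = tval y"
 proof (rule ex1I[of _ "tval u"])
  show "tval u \<in> hom2 K X Y W P & tval a \<bullet> tval u = tval x & tval b \<bullet> tval u = tval y"
   using X eq by (simp add: typed_val)
 next
  fix v assume v: "v \<in> hom2 K X Y W P & tval a \<bullet> v = tval x & tval b \<bullet> v = tval y"
  let ?v = "Tarr (Tmor X Y W) (Tmor X Y P) v"
  have "?v = u"
  proof (rule tpb_eqI[OF pb])
   show "cel ?v" using v X by (simp add: cel_def mor_def del: cel_mor mor_obj)
  qed (use u types eq v in \<open>auto simp: vc_def\<close>)
  then show "v = tval u" by (metis tarr.sel(3))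
 qed
 then show ?thesis using X eq unfolding pairing_def
  by (intro the1_equality) (simp_all add: homcat_def typed_val)
qed

definition tT :: "('o, 'm, 'c) tangentad => ('o, 'm) tmor" where
 "tT X = Tmor (base X) (base X) (tanT X)"
definition tT2 :: "('o, 'm, 'c) tangentad => ('o, 'm) tmor" where
 "tT2 X = Tmor (base X) (base X) (tanT2 X)"
definition tq1 where "tq1 X = Tarr (tT2 X) (tT X) (tan_q1 X)"
definition tq2 where "tq2 X = Tarr (tT2 X) (tT X) (tan_q2 X)"
definition tp where "tp X = Tarr (tT X) (mid (base X)) (tan_p X)"
definition tz where "tz X = Tarr (mid (base X)) (tT X) (tan_z X)"
definition ts where "ts X = Tarr (tT2 X) (tT X) (tan_s X)"
definition tl where "tl X = Tarr (tT X) (tT X oo tT X) (tan_l X)"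
definition tc where "tc X = Tarr (tT X oo tT X) (tT X oo tT X) (tan_c X)"
definition tTm where "tTm X m = Tmor (base X) (base X) (iter1 K (base X) (tanT X) m)"

lemma tan_sel [simp]:
 "msrc (tT X) = base X" "mtrg (tT X) = base X" "msrc (tT2 X) = base X" "mtrg (tT2 X) = base X"
 "tdom (tq1 X) = tT2 X" "tdom (tq2 X) = tT2 X" "tdom (tp X) = tT X" "tdom (tz X) = mid (base X)"
 "tdom (ts X) = tT2 X" "tdom (tl X) = tT X" "tdom (tc X) = tT X oo tT X"
 "tcod (tq1 X) = tT X" "tcod (tq2 X) = tT X" "tcod (tp X) = mid (base X)" "tcod (tz X) = tT X"
 "tcod (ts X) = tT X" "tcod (tl X) = tT X oo tT X" "tcod (tc X) = tT X oo tT X"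
 "msrc (tTm X m) = base X" "mtrg (tTm X m) = base X"
 by (simp_all add: tT_def tT2_def tq1_def tq2_def tp_def tz_def ts_def tl_def tc_def tTm_def)

lemma tan_val:
 "mval (tT X) = tanT X" "mval (tT2 X) = tanT2 X" "tval (tq1 X) = tan_q1 X" "tval (tq2 X) = tan_q2 X"
 "tval (tp X) = tan_p X" "tval (tz X) = tan_z X" "tval (ts X) = tan_s X" "tval (tl X) = tan_l X"
 "tval (tc X) = tan_c X" "mval (tTm X m) = iter1 K (base X) (tanT X) m"
 by (simp_all add: tT_def tT2_def tq1_def tq2_def tp_def tz_def ts_def tl_def tc_def tTm_def)

lemma celI:
 assumes "mor f" "mor g" "msrc g = msrc f" "mtrg g = mtrg f" "v \<in> hom2 K (msrc f) (mtrg f) (mval f) (mval g)"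
 shows "cel (Tarr f g v)"
 using assms by (simp add: cel_def del: cel_mor)

lemma tmor_eta: "msrc f = X ==> mtrg f = Y ==> f = Tmor X Y (mval f)"
 by (cases f) simp

lemma is_pullback_tpb:
 assumes "is_pullback (homcat K X Y) P q1 q2 A B D f g" "X \<in> obj K" "Y \<in> obj K"
  and "tval a = q1" "tval b = q2" "tval u = f" "tval v = g"
  and "tdom a = Tmor X Y P" "tcod a = Tmor X Y A" "tdom b = Tmor X Y P" "tcod b = Tmor X Y B"
   "tdom u = Tmor X Y A" "tcod u = Tmor X Y D" "tdom v = Tmor X Y B" "tcod v = Tmor X Y D"
 shows "tpb a b u v"
proof -
 have "a = Tarr (Tmor X Y P) (Tmor X Y A) q1" "b = Tarr (Tmor X Y P) (Tmor X Y B) q2"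
  "u = Tarr (Tmor X Y A) (Tmor X Y D) f" "v = Tarr (Tmor X Y B) (Tmor X Y D) g"
  using assms by (auto intro: tarr.expand)
 moreover have "P \<in> hom1 K X Y" "A \<in> hom1 K X Y" "B \<in> hom1 K X Y" "D \<in> hom1 K X Y"
  using assms(1) by (auto simp: is_pullback_def homcat_def)
 ultimately show ?thesis using assms(1-3) is_pullback_iff_tpb by metis
qed

lemma tangentad_types:
 assumes "is_tangentad K X"
 shows "base X \<in> obj K" "mor (tT X)" "mor (tT2 X)" "cel (tq1 X)" "cel (tq2 X)" "cel (tp X)" "cel (tz X)"
  "cel (ts X)" "cel (tl X)" "cel (tc X)" "mor (tTm X m)"
proof -
 interpret tangent_structure K "base X" "tanT X" "tanT2 X" "tan_q1 X" "tan_q2 X"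
   "tan_p X" "tan_z X" "tan_s X" "tan_l X" "tan_c X" using assms by (simp add: is_tangentad_def)
 show T: "base X \<in> obj K" "mor (tT X)" "mor (tT2 X)"
  by (simp_all add: X_obj mor_def tan_val T_hom T2_hom del: mor_obj)
 have TT: "mor (tT X oo tT X)" using T by simp
 show "cel (tq1 X)" "cel (tq2 X)" "cel (tp X)" "cel (tz X)" "cel (ts X)" "cel (tl X)" "cel (tc X)"
  unfolding tq1_def tq2_def tp_def tz_def ts_def tl_def tc_def
  using T q1_hom q2_hom p_hom z_hom s_hom l_hom c_hom
  by (auto intro!: celI simp: tan_val typed_val)
 show "mor (tTm X m)"
  by (induction m) (auto simp: mor_def tTm_def X_obj id1_closed T_hom
    intro: comp1_closed[of "base X" "base X" "base X"] simp del: mor_obj)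
qed

lemma tTm_simps:
 assumes "is_tangentad K X"
 shows "tTm X 0 = mid (base X)" "tTm X (Suc m) = tT X oo tTm X m"
 by (auto simp: tTm_def mid_def mcomp_def tT_def)

lemma tT2_tpb_iter:
 assumes X: "is_tangentad K X" and h: "mor h" "mtrg h = base X"
 shows "tpb (tTm X m|>tq1 X<|h) (tTm X m|>tq2 X<|h) (tTm X m|>tp X<|h) (tTm X m|>tp X<|h)"
proof -
 interpret tangent_structure K "base X" "tanT X" "tanT2 X" "tan_q1 X" "tan_q2 X"
   "tan_p X" "tan_z X" "tan_s X" "tan_l X" "tan_c X" using X by (simp add: is_tangentad_def)
 note [simp] = tangentad_types[OF X]
 have h': "msrc h \<in> obj K" "mval h \<in> hom1 K (msrc h) (base X)" using h by (auto simp: mor_def simp del: mor_obj)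
 have "tpb ((tTm X m|>tq1 X)<|h) ((tTm X m|>tq2 X)<|h) ((tTm X m|>tp X)<|h) ((tTm X m|>tp X)<|h)"
  by (rule is_pullback_tpb[OF T2_pullback[of m, unfolded Let_def pointwise_pullback_def, THEN conjunct2, rule_format, OF h']])
   (use h in \<open>auto simp: tan_val typed_val intro!: tmor.expand simp del: mcomp_assoc mcomp_mid rw_lw\<close>)
 then show ?thesis using h by simp
qed

lemmas tT2_tpb = tT2_tpb_iter[where m = 0]

lemma tarr_eqI: "[|tdom a = tdom b; tcod a = tcod b; tval a = tval b|] ==> a = b"
 by (simp add: tarr.expand)

lemma tangentad_eqs:
 assumes X: "is_tangentad K X"
 shows "(tT X|>tp X)**tl X = tz X**tp X"
  "tl X**tz X = (tT X|>tz X)**tz X"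
  "(tp X<|tT X)**tc X = tT X|>tp X"
  "tc X**(tT X|>tz X) = tz X<|tT X"
  "(tT X|>tl X)**tl X = (tl X<|tT X)**tl X"
  "tc X**tl X = tl X"
  "(tc X<|tT X)**(tT X|>tc X)**(tl X<|tT X) = (tT X|>tl X)**tc X"
  "tc X**tc X = cid (tT X oo tT X)"
  "(tT X|>tc X)**(tc X<|tT X)**(tT X|>tc X) =
   (tc X<|tT X)**(tT X|>tc X)**(tc X<|tT X)"
  "tp X**tq1 X = tp X**tq2 X"
proof -
 interpret tangent_structure K "base X" "tanT X" "tanT2 X" "tan_q1 X" "tan_q2 X"
   "tan_p X" "tan_z X" "tan_s X" "tan_l X" "tan_c X" using X by (simp add: is_tangentad_def)
 note [simp] = tangentad_types[OF X]
 note rules = lift_proj lift_zero flip_proj flip_zero lift_coassoc flip_lift flip_flip_lift flip_involutive flip_braid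
 show "(tT X|>tp X)**tl X = tz X**tp X"
  "tl X**tz X = (tT X|>tz X)**tz X"
  "(tp X<|tT X)**tc X = tT X|>tp X"
  "tc X**(tT X|>tz X) = tz X<|tT X"
  "(tT X|>tl X)**tl X = (tl X<|tT X)**tl X"
  "tc X**tl X = tl X"
  "(tc X<|tT X)**(tT X|>tc X)**(tl X<|tT X) = (tT X|>tl X)**tc X"
  "tc X**tc X = cid (tT X oo tT X)"
  "(tT X|>tc X)**(tc X<|tT X)**(tT X|>tc X) =
   (tc X<|tT X)**(tT X|>tc X)**(tc X<|tT X)"
  by (rule tarr_eqI; simp add: rules typed_val tan_val)+
 show "tp X**tq1 X = tp X**tq2 X"
  using tpbD(9)[OF tT2_tpb[OF X, of "mid (base X)"]] by (simp add: tTm_simps[OF X])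
qed

lemma T2_tpb:
 assumes X: "is_tangentad K X" and h: "mor h" "mtrg h = base X"
 shows "tpb (tq1 X<|h) (tq2 X<|h) (tp X<|h) (tp X<|h)"
  "tpb (tT X|>tq1 X<|h) (tT X|>tq2 X<|h) (tT X|>tp X<|h) (tT X|>tp X<|h)"
  "tpb (tT X|>tT X|>tq1 X<|h) (tT X|>tT X|>tq2 X<|h)
   (tT X|>tT X|>tp X<|h) (tT X|>tT X|>tp X<|h)"
 using tT2_tpb_iter[OF assms, of 0] tT2_tpb_iter[OF assms, of "Suc 0"] tT2_tpb_iter[OF assms, of "Suc (Suc 0)"]
 by (simp_all add: tTm_simps[OF X] tangentad_types[OF X] h)

text \<open>The additivity of the lift and of the flip, with the induced arrow given by its projections.\<close>

lemma tangentad_lift_add: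
 assumes X: "is_tangentad K X"
  and r: "cel r" "tdom r = tT2 X" "tcod r = tT X oo tT2 X"
   "(tT X|>tq1 X)**r = tl X**tq1 X" "(tT X|>tq2 X)**r = tl X**tq2 X"
 shows "tl X**ts X = (tT X|>ts X)**r"
proof -
 interpret tangent_structure K "base X" "tanT X" "tanT2 X" "tan_q1 X" "tan_q2 X"
   "tan_p X" "tan_z X" "tan_s X" "tan_l X" "tan_c X" using X by (simp add: is_tangentad_def)
 note [simp] = tangentad_types[OF X]
 note pb = T2_tpb(2)[OF X, of "mid (base X)", simplified]
 have "pairing (homcat K (base X) (base X)) (tanT X \<odot> tanT2 X) (tval (tT X|>tq1 X)) (tval (tT X|>tq2 X))
   (tanT2 X) (tval (tl X**tq1 X)) (tval (tl X**tq2 X)) = tval r"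
  by (rule pairing_tpb[OF pb]) (use r in \<open>auto simp: tT_def tT2_def mcomp_def\<close>)
 then show ?thesis using lift_add r by (intro tarr_eqI) (simp_all add: typed_val tan_val)
qed

lemma tangentad_flip_add:
 assumes X: "is_tangentad K X"
  and r: "cel r" "tdom r = tT X oo tT2 X" "tcod r = tT2 X oo tT X"
   "(tq1 X<|tT X)**r = tc X**(tT X|>tq1 X)" "(tq2 X<|tT X)**r = tc X**(tT X|>tq2 X)"
 shows "tc X**(tT X|>ts X) = (ts X<|tT X)**r"
proof -
 interpret tangent_structure K "base X" "tanT X" "tanT2 X" "tan_q1 X" "tan_q2 X"
   "tan_p X" "tan_z X" "tan_s X" "tan_l X" "tan_c X" using X by (simp add: is_tangentad_def)
 note [simp] = tangentad_types[OF X]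
 note pb = T2_tpb(1)[OF X, of "tT X", simplified]
 have "pairing (homcat K (base X) (base X)) (tanT2 X \<odot> tanT X) (tval (tq1 X<|tT X)) (tval (tq2 X<|tT X))
   (tanT X \<odot> tanT2 X) (tval (tc X**tT X|>tq1 X)) (tval (tc X**tT X|>tq2 X)) = tval r"
  by (rule pairing_tpb[OF pb]) (use r in \<open>auto simp: tT_def tT2_def mcomp_def\<close>)
 then show ?thesis using flip_add r by (intro tarr_eqI) (simp_all add: typed_val tan_val)
qed

section \<open>Lax tangent morphisms\<close>

text \<open>Compatibility with \<open>s\<close> mentions some cell \<open>r\<close> with the projections of the induced arrow. These projections determine
 \<open>r\<close>, and in this form the condition can be composed without computing pairings.\<close>

definition laxm :: "('o, 'm, 'c) tangentad => ('o, 'm, 'c) tangentad => ('o, 'm) tmor => (('o, 'm) tmor, 'c) tarr => bool" where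
 "laxm X' X f a \<longleftrightarrow> mor f & msrc f = base X' & mtrg f = base X &
   cel a & tdom a = f oo tT X' & tcod a = tT X oo f &
   (tp X<|f)**a = f|>tp X' &
   a**(f|>tz X') = tz X<|f &
   (\<exists>r. cel r & tdom r = f oo tT2 X' & tcod r = tT2 X oo f &
    (tq1 X<|f)**r = a**(f|>tq1 X') & (tq2 X<|f)**r = a**(f|>tq2 X') &
    a**(f|>ts X') = (ts X<|f)**r) &
   (tl X<|f)**a = (tT X|>a)**(a<|tT X')**(f|>tl X') &
   (tc X<|f)**(tT X|>a)**(a<|tT X') = (tT X|>a)**(a<|tT X')**(f|>tc X')"

definition mkf :: "('o, 'm, 'c) tangentad => ('o, 'm, 'c) tangentad => 'm => ('o, 'm) tmor" where
 "mkf X' X F = Tmor (base X') (base X) F"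

definition mka :: "('o, 'm, 'c) tangentad => ('o, 'm, 'c) tangentad => 'm => 'c => (('o, 'm) tmor, 'c) tarr" where
 "mka X' X F \<alpha> = Tarr (mkf X' X F oo tT X') (tT X oo mkf X' X F) \<alpha>"

lemma mk_sel [simp]: "msrc (mkf X' X F) = base X'" "mtrg (mkf X' X F) = base X"
 "tdom (mka X' X F \<alpha>) = mkf X' X F oo tT X'" "tcod (mka X' X F \<alpha>) = tT X oo mkf X' X F"
 by (simp_all add: mkf_def mka_def)

lemma mk_val: "mval (mkf X' X F) = F" "tval (mka X' X F \<alpha>) = \<alpha>"
 by (simp_all add: mkf_def mka_def)

lemma laxm_if_lax:
 assumes X': "is_tangentad K X'" and X: "is_tangentad K X"
  and lax: "lax_tangent_morphism K X' X F \<alpha>"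
 shows "laxm X' X (mkf X' X F) (mka X' X F \<alpha>)"
proof -
 interpret lax_tangent_morphism K X' X F \<alpha> by (rule lax)
 note [simp] = tangentad_types[OF X] tangentad_types[OF X']
 let ?f = "mkf X' X F" and ?a = "mka X' X F \<alpha>"
 have f [simp]: "mor ?f" by (simp add: mor_def mk_val F_hom del: mor_obj)
 have a [simp]: "cel ?a" unfolding mka_def by (rule celI) (simp_all add: mk_val tan_val typed_val \<alpha>_hom)
 have p: "(tp X<|?f)**?a = ?f|>tp X'"
  by (rule tarr_eqI) (simp_all add: typed_val tan_val mk_val comp_p)
 have e: "(tp X<|?f)**?a**?f|>tq1 X' = (tp X<|?f)**?a**?f|>tq2 X'"
  using arg_cong[OF p, of "%x. x**?f|>tq1 X'"] arg_cong[OF p, of "%x. x**?f|>tq2 X'"]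
   arg_cong[OF tangentad_eqs(10)[OF X'], of "%x. ?f|>x"] by simp
 obtain r where r: "cel r" "tdom r = ?f oo tT2 X'" "tcod r = tT2 X oo ?f"
   "(tq1 X<|?f)**r = ?a**(?f|>tq1 X')" "(tq2 X<|?f)**r = ?a**(?f|>tq2 X')"
  by (rule tpb_ex[OF T2_tpb(1)[OF X, of ?f], of "?a**(?f|>tq1 X')" "?a**(?f|>tq2 X')"]) (use e in auto)
 have "pairing (homcat K (base X') (base X)) (tanT2 X \<odot> F) (tval (tq1 X<|?f)) (tval (tq2 X<|?f))
   (F \<odot> tanT2 X') (tval (?a**(?f|>tq1 X'))) (tval (?a**(?f|>tq2 X'))) = tval r"
  by (rule pairing_tpb[OF T2_tpb(1)[OF X, of ?f]]) (use r in \<open>auto intro!: tmor.expand simp: typed_val tan_val mk_val\<close>)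
 then have s: "?a**(?f|>ts X') = (ts X<|?f)**r"
  using comp_s r by (intro tarr_eqI) (simp_all add: typed_val tan_val mk_val)
 show ?thesis unfolding laxm_def using p r s
  by (auto intro!: tarr_eqI simp: typed_val tan_val mk_val comp_z comp_l comp_c)
qed

lemma lax_if_laxm:
 assumes X': "is_tangentad K X'" and X: "is_tangentad K X" and lax: "laxm X' X f a"
 shows "lax_tangent_morphism K X' X (mval f) (tval a)"
proof -
 note [simp] = tangentad_types[OF X] tangentad_types[OF X']
 obtain r where r: "cel r" "tdom r = f oo tT2 X'" "tcod r = tT2 X oo f"
  "(tq1 X<|f)**r = a**(f|>tq1 X')" "(tq2 X<|f)**r = a**(f|>tq2 X')"
  "a**(f|>ts X') = (ts X<|f)**r"
  using lax unfolding laxm_def by blast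
 have f [simp]: "mor f" "msrc f = base X'" "mtrg f = base X" "cel a" "tdom a = f oo tT X'" "tcod a = tT X oo f"
  and eqs: "(tp X<|f)**a = f|>tp X'" "a**(f|>tz X') = tz X<|f"
   "(tl X<|f)**a = (tT X|>a)**(a<|tT X')**(f|>tl X')"
   "(tc X<|f)**(tT X|>a)**(a<|tT X') = (tT X|>a)**(a<|tT X')**(f|>tc X')"
  using lax unfolding laxm_def by auto
 have "pairing (homcat K (base X') (base X)) (mval (tT2 X oo f)) (tval (tq1 X<|f)) (tval (tq2 X<|f))
   (mval (f oo tT2 X')) (tval (a**(f|>tq1 X'))) (tval (a**(f|>tq2 X'))) = tval r"
  by (rule pairing_tpb[OF T2_tpb(1)[OF X, of f]]) (use r in \<open>auto intro!: tmor.expand simp: typed_val tan_val mk_val\<close>)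
 then have s: "tval a \<bullet> (mval f \<rhd> tan_s X') = (tan_s X \<lhd> mval f) \<bullet>
   pairing (homcat K (base X') (base X))
    (tanT2 X \<odot> mval f) (tan_q1 X \<lhd> mval f) (tan_q2 X \<lhd> mval f) (mval f \<odot> tanT2 X')
    (tval a \<bullet> (mval f \<rhd> tan_q1 X')) (tval a \<bullet> (mval f \<rhd> tan_q2 X'))"
  using arg_cong[OF r(6), of tval] by (simp add: typed_val tan_val)
 show ?thesis
 proof
  show "mval f \<in> hom1 K (base X') (base X)" using f(1-3) by (simp add: mor_def del: f mor_obj)
  show "tval a \<in> hom2 K (base X') (base X) (mval f \<odot> tanT X') (tanT X \<odot> mval f)"
   using f(4) by (simp add: cel_def typed_val tan_val del: f(4) cel_mor)
 qed (use s arg_cong[OF eqs(1), of tval] arg_cong[OF eqs(2), of tval] arg_cong[OF eqs(3), of tval]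
   arg_cong[OF eqs(4), of tval] in \<open>simp_all add: typed_val tan_val\<close>)
qed

lemma vc_pre:
 "[|a**b = c; cel a; cel b; cel x; tdom a = tcod b; tdom b = tcod x|] ==> a**b**x = c**x"
 by (metis vc_assoc)

lemma vc_lw_eq:
 "[|a**b = c; cel a; cel b; mor g; tdom a = tcod b; msrc g = mtrg (tdom b)|] ==> (g|>a)**(g|>b) = g|>c"
 by (metis lw_vc)

lemma vc_rw_eq:
 "[|a**b = c; cel a; cel b; mor g; tdom a = tcod b; mtrg g = msrc (tdom b)|] ==> (a<|g)**(b<|g) = c<|g"
 by (metis rw_vc)

lemma laxmD:
 assumes "laxm X' X f a"
 shows "mor f" "msrc f = base X'" "mtrg f = base X" "cel a" "tdom a = f oo tT X'" "tcod a = tT X oo f"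
  "(tp X<|f)**a = f|>tp X'"
  "a**(f|>tz X') = tz X<|f"
  "(tl X<|f)**a = (tT X|>a)**(a<|tT X')**(f|>tl X')"
  "(tc X<|f)**(tT X|>a)**(a<|tT X') = (tT X|>a)**(a<|tT X')**(f|>tc X')"
 using assms unfolding laxm_def by auto

lemma laxm_s:
 assumes "laxm X' X f a"
 obtains r where "cel r" "tdom r = f oo tT2 X'" "tcod r = tT2 X oo f"
  "(tq1 X<|f)**r = a**(f|>tq1 X')" "(tq2 X<|f)**r = a**(f|>tq2 X')"
  "a**(f|>ts X') = (ts X<|f)**r"
 using assms unfolding laxm_def by blast

text \<open>The witnesses \<open>r\<close> for \<open>s\<close> compose, because the projections of a composite of witnesses are the required ones.\<close>

lemma laxm_comp:
 assumes T: "is_tangentad K X''" "is_tangentad K X'" "is_tangentad K X"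
  and A: "laxm X'' X' f a" and B: "laxm X' X g b"
 shows "laxm X'' X (g oo f) ((b<|f)**(g|>a))"
proof -
 note [simp] = tangentad_types[OF T(1)] tangentad_types[OF T(2)] tangentad_types[OF T(3)] laxmD(1-6)[OF A] laxmD(1-6)[OF B]
 note a = laxmD(7-10)[OF A] and b = laxmD(7-10)[OF B]
 obtain r where r [simp]: "cel r" "tdom r = f oo tT2 X''" "tcod r = tT2 X' oo f"
  and r': "(tq1 X'<|f)**r = a**(f|>tq1 X'')" "(tq2 X'<|f)**r = a**(f|>tq2 X'')"
  "a**(f|>ts X'') = (ts X'<|f)**r"
  by (rule laxm_s[OF A])
 obtain q where q [simp]: "cel q" "tdom q = g oo tT2 X'" "tcod q = tT2 X oo g"
  and q': "(tq1 X<|g)**q = b**(g|>tq1 X')" "(tq2 X<|g)**q = b**(g|>tq2 X')"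
  "b**(g|>ts X') = (ts X<|g)**q"
  by (rule laxm_s[OF B])
 have ex: "b<|tT X'<|f**g|>tT X'|>a = tT X|>g|>a**b<|f<|tT X''"
  using whisker_exchange[of b a] by simp
 have c2: "(tc X<|g<|f)**(tT X|>b<|f)**(b<|tT X'<|f)**y =
   (tT X|>b<|f)**(b<|tT X'<|f)**(g|>tc X'<|f)**y"
  if "cel y" "tcod y = g oo tT X' oo tT X' oo f" for y
  using arg_cong[OF b(4), of "%x. x<|f**y"] that by simp
 have c1: "(g|>tc X'<|f)**(g|>tT X'|>a)**(g|>a<|tT X'') =
   (g|>tT X'|>a)**(g|>a<|tT X'')**(g|>f|>tc X'')"
  using arg_cong[OF a(4), of "%x. g|>x"] by simp
 have cc: "(tc X<|g<|f)**(tT X|>b<|f)**(tT X|>g|>a)**(b<|f<|tT X'')**(g|>a<|tT X'') =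
   (tT X|>b<|f)**(tT X|>g|>a)**(b<|f<|tT X'')**(g|>a<|tT X'')**(g|>f|>tc X'')"
  using c2[of "(g|>tT X'|>a)**(g|>a<|tT X'')"] by (simp add: c1 ex[symmetric] vc_pre[OF ex[symmetric]])
 have l: "(tl X<|g<|f)**(b<|f)**(g|>a) =
   (tT X|>b<|f)**(tT X|>g|>a)**(b<|f<|tT X'')**(g|>a<|tT X'')**(g|>f|>tl X'')"
  by (simp add: vc_pre[OF vc_rw_eq[OF b(3)]] vc_lw_eq[OF a(3)] vc_pre[OF ex])
 show ?thesis
  unfolding laxm_def
 proof (intro conjI exI)
  show "cel ((q<|f)**(g|>r))" by simp
 qed (use l cc in \<open>simp_all add: vc_pre[OF vc_rw_eq[OF b(1)]] vc_lw_eq[OF a(1)]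
   vc_lw_eq[OF a(2)] vc_rw_eq[OF b(2), of f, simplified] vc_pre[OF vc_rw_eq[OF q'(1)]] vc_pre[OF vc_rw_eq[OF q'(2)]]
   vc_lw_eq[OF r'(1)] vc_lw_eq[OF r'(2)] vc_lw_eq[OF r'(3)] vc_pre[OF vc_rw_eq[OF q'(3), of f, simplified]]\<close>)
qed

lemma laxm_id:
 assumes "is_tangentad K X"
 shows "laxm X X (mid (base X)) (cid (tT X))"
proof -
 note [simp] = tangentad_types[OF assms]
 show ?thesis unfolding laxm_def
  by (intro conjI exI[of _ "cid (tT2 X)"]) simp_all
qed

end

section \<open>The 2-category of tangentads\<close>

locale cartesian_2_category = two_category K + finite_2_products K
 for K :: "('o, 'm, 'c, 'z) cat2p_scheme" (structure)
begin

lemma hom2_Tng_iff: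
 "\<phi> \<in> hom2 (Tng K) X' X A B \<longleftrightarrow> \<phi> \<in> hom2 K (base X') (base X) (fst A) (fst B) &
   (tanT X \<rhd> \<phi>) \<bullet> snd A = snd B \<bullet> (\<phi> \<lhd> tanT X')"
 by (cases A; cases B) (simp add: Tng_def tangent_2_morphism_def)

lemma lax_cases:
 assumes "is_tangentad K X'" "is_tangentad K X" "A \<in> hom1 (Tng K) X' X"
 shows "laxm X' X (mkf X' X (fst A)) (mka X' X (fst A) (snd A))"
 using assms laxm_if_lax by (auto simp: Tng_def)

lemma hom1_Tng_I:
 assumes "is_tangentad K X'" "is_tangentad K X" "laxm X' X f a" "fst A = mval f" "snd A = tval a"
 shows "A \<in> hom1 (Tng K) X' X"
 using lax_if_laxm[OF assms(1-3)] assms(4,5) by (cases A) (simp add: Tng_def)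

definition mkt :: "('o, 'm, 'c) tangentad => ('o, 'm, 'c) tangentad => 'm \<times> 'c => 'm \<times> 'c => 'c => (('o, 'm) tmor, 'c) tarr" where
 "mkt X' X A B \<phi> = Tarr (mkf X' X (fst A)) (mkf X' X (fst B)) \<phi>"

lemma mkt_sel [simp]: "tdom (mkt X' X A B \<phi>) = mkf X' X (fst A)" "tcod (mkt X' X A B \<phi>) = mkf X' X (fst B)"
 by (simp_all add: mkt_def)

lemma mkt_val: "tval (mkt X' X A B \<phi>) = \<phi>"
 by (simp add: mkt_def)

text \<open>A tangent 2-morphism is a 2-cell of \<open>K\<close> that commutes with the distributive laws.\<close>

lemma cell_cases:
 assumes "is_tangentad K X'" "is_tangentad K X" "A \<in> hom1 (Tng K) X' X" "B \<in> hom1 (Tng K) X' X"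
  "\<phi> \<in> hom2 (Tng K) X' X A B"
 shows "cel (mkt X' X A B \<phi>)"
  "(tT X|>mkt X' X A B \<phi>)**mka X' X (fst A) (snd A) = mka X' X (fst B) (snd B)**(mkt X' X A B \<phi><|tT X')"
proof -
 note f [simp] = laxmD(1)[OF lax_cases[OF assms(1-3)]] laxmD(1)[OF lax_cases[OF assms(1,2,4)]]
 show "cel (mkt X' X A B \<phi>)" unfolding mkt_def
  by (rule celI) (use assms(5) in \<open>auto simp: mk_val hom2_Tng_iff\<close>)
 show "(tT X|>mkt X' X A B \<phi>)**mka X' X (fst A) (snd A) = mka X' X (fst B) (snd B)**(mkt X' X A B \<phi><|tT X')"
  using assms(5) by (intro tarr_eqI) (auto simp: mk_val mkt_val tan_val typed_val hom2_Tng_iff)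
qed

lemma hom2_Tng_I:
 assumes "cel t" "msrc (tdom t) = base X'" "mtrg (tdom t) = base X"
  and "tval a = snd A" "tval b = snd B" "mval (tdom t) = fst A" "mval (tcod t) = fst B" "\<phi> = tval t"
  and "(tT X|>t)**a = b**(t<|tT X')"
 shows "\<phi> \<in> hom2 (Tng K) X' X A B"
 using assms(1-8) arg_cong[OF assms(9), of tval]
 by (auto simp: hom2_Tng_iff cel_def typed_val tan_val simp del: cel_mor)

lemma Tng_sel [simp]:
 "obj (Tng K) = {X. is_tangentad K X}"
 "id1 (Tng K) X = (id1 K (base X), id2 K (tanT X))"
 "comp1 (Tng K) B A = (fst B \<odot> fst A, (snd B \<lhd> fst A) \<bullet> (fst B \<rhd> snd A))"
 "id2 (Tng K) A = id2 K (fst A)" "vcomp (Tng K) = vcomp K" "hcomp (Tng K) = hcomp K"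
 by (simp_all add: Tng_def split_beta)

lemma Tng_whisker [simp]:
 "lwhisker (Tng K) A \<phi> = lwhisker K (fst A) \<phi>" "rwhisker (Tng K) \<phi> A = rwhisker K \<phi> (fst A)"
 by (simp_all add: lwhisker_def rwhisker_def)

lemma mkt_hom2:
 assumes "is_tangentad K X'" "is_tangentad K X" "A \<in> hom1 (Tng K) X' X" "B \<in> hom1 (Tng K) X' X"
  "cel t" "tdom t = mkf X' X (fst A)" "tcod t = mkf X' X (fst B)"
  "(tT X|>t)**mka X' X (fst A) (snd A) = mka X' X (fst B) (snd B)**(t<|tT X')"
 shows "tval t \<in> hom2 (Tng K) X' X A B"
 by (rule hom2_Tng_I[OF assms(5) _ _ _ _ _ _ _ assms(8)]) (simp_all add: assms(6,7) mk_val)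

lemma Tng_id1_closed: "is_tangentad K X ==> id1 (Tng K) X \<in> hom1 (Tng K) X X"
 by (rule hom1_Tng_I[OF _ _ laxm_id]) (simp_all add: typed_val tan_val)

lemma Tng_comp1_closed:
 assumes "is_tangentad K X" "is_tangentad K Y" "is_tangentad K Z" "A \<in> hom1 (Tng K) X Y" "B \<in> hom1 (Tng K) Y Z"
 shows "comp1 (Tng K) B A \<in> hom1 (Tng K) X Z"
 using assms
 by (intro hom1_Tng_I[OF _ _ laxm_comp[OF _ _ _ lax_cases[of X Y A] lax_cases[of Y Z B]]])
  (simp_all add: typed_val tan_val mk_val)

lemma Tng_base_hom1:
 assumes "A \<in> hom1 (Tng K) X Y"
 shows "fst A \<in> hom1 K (base X) (base Y)"
 using assms by (auto simp: Tng_def lax_tangent_morphism_def)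

lemma Tng_base_hom2: "\<phi> \<in> hom2 (Tng K) X Y A B ==> \<phi> \<in> hom2 K (base X) (base Y) (fst A) (fst B)"
 by (simp add: hom2_Tng_iff)

lemma Tng_base_obj: "is_tangentad K X ==> base X \<in> obj K"
 by (rule tangentad_types)

lemma Tng_category_homcat:
 assumes X: "is_tangentad K X" and Y: "is_tangentad K Y"
 shows "category (homcat (Tng K) X Y)"
proof -
 note XY [simp] = tangentad_types[OF X] tangentad_types[OF Y]
 interpret KXY: category "homcat K (base X) (base Y)" by (rule category_homcat) simp_all
 note b = Tng_base_hom1 Tng_base_hom2
 show ?thesis
 proof
  fix A assume "A \<in> Ob (homcat (Tng K) X Y)"
  then have A: "A \<in> hom1 (Tng K) X Y" by (simp add: homcat_def)
  note [simp] = laxmD(1-6)[OF lax_cases[OF X Y A]]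
  have "tval (cid (mkf X Y (fst A))) \<in> hom2 (Tng K) X Y A A"
   by (rule mkt_hom2[OF X Y A A]) simp_all
  then show "idn (homcat (Tng K) X Y) A \<in> Arr (homcat (Tng K) X Y) A A"
   by (simp add: homcat_def typed_val mk_val)
 next
  fix A B D f g
  assume *: "A \<in> Ob (homcat (Tng K) X Y)" "B \<in> Ob (homcat (Tng K) X Y)" "D \<in> Ob (homcat (Tng K) X Y)"
   "f \<in> Arr (homcat (Tng K) X Y) A B" "g \<in> Arr (homcat (Tng K) X Y) B D"
  then have A: "A \<in> hom1 (Tng K) X Y" and B: "B \<in> hom1 (Tng K) X Y" and D: "D \<in> hom1 (Tng K) X Y"
   and f: "f \<in> hom2 (Tng K) X Y A B" and g: "g \<in> hom2 (Tng K) X Y B D" by (simp_all add: homcat_def)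
  note [simp] = laxmD(1-6)[OF lax_cases[OF X Y A]] laxmD(1-6)[OF lax_cases[OF X Y B]]
   laxmD(1-6)[OF lax_cases[OF X Y D]] cell_cases(1)[OF X Y A B f] cell_cases(1)[OF X Y B D g]
  note e = cell_cases(2)[OF X Y A B f] cell_cases(2)[OF X Y B D g]
  have "tval (mkt X Y B D g**mkt X Y A B f) \<in> hom2 (Tng K) X Y A D"
   by (rule mkt_hom2[OF X Y A D]) (simp_all add: e vc_pre[OF e(2)])
  then show "g \<cdot>\<^bsub>homcat (Tng K) X Y\<^esub> f \<in> Arr (homcat (Tng K) X Y) A D"
   by (simp add: homcat_def typed_val mkt_val)
 next
  fix A B f assume "A \<in> Ob (homcat (Tng K) X Y)" "B \<in> Ob (homcat (Tng K) X Y)" "f \<in> Arr (homcat (Tng K) X Y) A B"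
  then have h: "fst A \<in> Ob (homcat K (base X) (base Y))" "fst B \<in> Ob (homcat K (base X) (base Y))"
   "f \<in> Arr (homcat K (base X) (base Y)) (fst A) (fst B)" using b by (simp_all add: homcat_def)
  show "f \<cdot>\<^bsub>homcat (Tng K) X Y\<^esub> idn (homcat (Tng K) X Y) A = f" "idn (homcat (Tng K) X Y) B \<cdot>\<^bsub>homcat (Tng K) X Y\<^esub> f = f"
   using KXY.cmp_idn[OF h] KXY.idn_cmp[OF h] by (simp_all add: homcat_def)
 next
  fix A B D E f g h
  assume "A \<in> Ob (homcat (Tng K) X Y)" "B \<in> Ob (homcat (Tng K) X Y)" "D \<in> Ob (homcat (Tng K) X Y)" "E \<in> Ob (homcat (Tng K) X Y)"
   "f \<in> Arr (homcat (Tng K) X Y) A B" "g \<in> Arr (homcat (Tng K) X Y) B D" "h \<in> Arr (homcat (Tng K) X Y) D E"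
  then show "(h \<cdot>\<^bsub>homcat (Tng K) X Y\<^esub> g) \<cdot>\<^bsub>homcat (Tng K) X Y\<^esub> f = h \<cdot>\<^bsub>homcat (Tng K) X Y\<^esub> g \<cdot>\<^bsub>homcat (Tng K) X Y\<^esub> f"
   using KXY.cmp_assoc[of "fst A" "fst B" "fst D" "fst E" f g h] b by (simp add: homcat_def)
 qed
qed

definition hc :: "(('o, 'm) tmor, 'c) tarr => (('o, 'm) tmor, 'c) tarr => (('o, 'm) tmor, 'c) tarr" where
 "hc s t = (s<|tcod t)**(tdom s|>t)"

lemma tval_hc:
 assumes "cel s" "cel t" "msrc (tdom s) = mtrg (tdom t)"
 shows "tval (hc s t) = tval s \<star> tval t"
 using interchange[of "msrc (tdom t)" "mtrg (tdom t)" "mtrg (tdom s)" "mval (tdom t)" "mval (tcod t)" "mval (tcod t)"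
   "mval (tdom s)" "mval (tdom s)" "mval (tcod s)" "tval t" "id2 K (mval (tcod t))" "id2 K (mval (tdom s))" "tval s"] assms
 by (auto simp: hc_def typed_val cel_def mor_def lwhisker_def rwhisker_def hc_id2 hc_units simp del: cel_mor mor_obj)

lemma Tng_hcomp_closed:
 assumes X: "is_tangentad K X" and Y: "is_tangentad K Y" and Z: "is_tangentad K Z"
  and F: "F \<in> hom1 (Tng K) X Y" and F': "F' \<in> hom1 (Tng K) X Y"
  and G: "G \<in> hom1 (Tng K) Y Z" and G': "G' \<in> hom1 (Tng K) Y Z"
  and \<phi>: "\<phi> \<in> hom2 (Tng K) X Y F F'" and \<psi>: "\<psi> \<in> hom2 (Tng K) Y Z G G'"
 shows "\<psi> \<star> \<phi> \<in> hom2 (Tng K) X Z (G \<odot>\<^bsub>Tng K\<^esub> F) (G' \<odot>\<^bsub>Tng K\<^esub> F')"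
proof -
 note [simp] = tangentad_types[OF X] tangentad_types[OF Y] tangentad_types[OF Z]
  laxmD(1-6)[OF lax_cases[OF X Y F]] laxmD(1-6)[OF lax_cases[OF X Y F']]
  laxmD(1-6)[OF lax_cases[OF Y Z G]] laxmD(1-6)[OF lax_cases[OF Y Z G']]
  cell_cases(1)[OF X Y F F' \<phi>] cell_cases(1)[OF Y Z G G' \<psi>]
 let ?p = "mkt X Y F F' \<phi>" and ?q = "mkt Y Z G G' \<psi>"
 let ?f = "mkf X Y (fst F)" and ?f' = "mkf X Y (fst F')" and ?g = "mkf Y Z (fst G)" and ?g' = "mkf Y Z (fst G')"
 let ?a = "mka X Y (fst F) (snd F)" and ?a' = "mka X Y (fst F') (snd F')"
  and ?b = "mka Y Z (fst G) (snd G)" and ?b' = "mka Y Z (fst G') (snd G')"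
 note e = cell_cases(2)[OF X Y F F' \<phi>] cell_cases(2)[OF Y Z G G' \<psi>]
 have ex1: "?q<|tT Y<|?f'**?g|>?a' = ?g'|>?a'**?q<|?f'<|tT X"
  using whisker_exchange[of ?q ?a'] by simp
 have ex2: "?b<|?f'**?g|>tT Y|>?p = tT Z|>?g|>?p**?b<|?f"
  using whisker_exchange[of ?b ?p] by simp
 have c: "cel (hc ?q ?p)" unfolding hc_def by simp
 show ?thesis
  by (rule hom2_Tng_I[OF c, where a = "(?b<|?f)**(?g|>?a)" and b = "(?b'<|?f')**(?g'|>?a')"])
   (simp_all add: tval_hc mkt_val, simp_all add: hc_def typed_val mk_val vc_lw_eq[OF e(1), symmetric]
    ex1[symmetric] vc_pre[OF ex1[symmetric]] ex2[symmetric] vc_pre[OF ex2[symmetric]]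
    vc_rw_eq[OF e(2), of ?f', simplified] vc_pre[OF vc_rw_eq[OF e(2), of ?f', simplified]]
     vc_lw_eq[OF e(1), of ?g, simplified])
qed

lemma two_category_Tng: "two_category (Tng K)"
proof (rule two_category.intro)
 fix X assume "X \<in> obj (Tng K)"
 then show "id1 (Tng K) X \<in> hom1 (Tng K) X X" using Tng_id1_closed[of X] by simp
next
 fix X Y assume "X \<in> obj (Tng K)" "Y \<in> obj (Tng K)"
 then show "category (homcat (Tng K) X Y)" using Tng_category_homcat[of X Y] by simp
next
 note b = Tng_base_hom1 Tng_base_hom2 Tng_base_obj
 fix X Y assume "X \<in> obj (Tng K)" "Y \<in> obj (Tng K)"
 then have X: "is_tangentad K X" and Y: "is_tangentad K Y" by simp_all
 note [simp] = tangentad_types[OF X] tangentad_types[OF Y]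
 fix F assume F: "F \<in> hom1 (Tng K) X Y"
 note [simp] = laxmD(1-6)[OF lax_cases[OF X Y F]]
 let ?f = "mkf X Y (fst F)" and ?a = "mka X Y (fst F) (snd F)"
 have "mval (?f oo mid (base X)) = mval ?f" "tval ((?a<|mid (base X))**(?f|>cid (tT X))) = tval ?a"
  "mval (mid (base Y) oo ?f) = mval ?f" "tval ((cid (tT Y)<|?f)**(mid (base Y)|>?a)) = tval ?a"
  by simp_all
 then show "F \<odot>\<^bsub>Tng K\<^esub> id1 (Tng K) X = F" "id1 (Tng K) Y \<odot>\<^bsub>Tng K\<^esub> F = F"
  by (cases F; simp add: typed_val mk_val tan_val)+
 fix F' \<phi> assume F': "F' \<in> hom1 (Tng K) X Y" and \<phi>: "\<phi> \<in> hom2 (Tng K) X Y F F'"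
 show "\<phi> \<star>\<^bsub>Tng K\<^esub> id2 (Tng K) (id1 (Tng K) X) = \<phi>" "id2 (Tng K) (id1 (Tng K) Y) \<star>\<^bsub>Tng K\<^esub> \<phi> = \<phi>"
  using hcomp_unit_right[OF b(3)[OF X] b(3)[OF Y] b(1)[OF F] b(1)[OF F'] b(2)[OF \<phi>]]
   hcomp_unit_left[OF b(3)[OF X] b(3)[OF Y] b(1)[OF F] b(1)[OF F'] b(2)[OF \<phi>]] by simp_all
next
 fix X Y Z F G assume "X \<in> obj (Tng K)" "Y \<in> obj (Tng K)" "Z \<in> obj (Tng K)" "F \<in> hom1 (Tng K) X Y" "G \<in> hom1 (Tng K) Y Z"
 then show "G \<odot>\<^bsub>Tng K\<^esub> F \<in> hom1 (Tng K) X Z" "id2 (Tng K) G \<star>\<^bsub>Tng K\<^esub> id2 (Tng K) F = id2 (Tng K) (G \<odot>\<^bsub>Tng K\<^esub> F)"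
  using Tng_comp1_closed[of X Y Z F G] hcomp_id2[OF Tng_base_obj Tng_base_obj Tng_base_obj Tng_base_hom1 Tng_base_hom1, of X Y Z F G]
  by auto
next
 fix W X Y Z F G H assume "W \<in> obj (Tng K)" "X \<in> obj (Tng K)" "Y \<in> obj (Tng K)" "Z \<in> obj (Tng K)"
  and F: "F \<in> hom1 (Tng K) W X" and G: "G \<in> hom1 (Tng K) X Y" and H: "H \<in> hom1 (Tng K) Y Z"
 then have W: "is_tangentad K W" and X: "is_tangentad K X" and Y: "is_tangentad K Y" and Z: "is_tangentad K Z" by simp_all
 note [simp] = tangentad_types[OF X] tangentad_types[OF Y] tangentad_types[OF Z] tangentad_types[OF W]
  laxmD(1-6)[OF lax_cases[OF W X F]] laxmD(1-6)[OF lax_cases[OF X Y G]] laxmD(1-6)[OF lax_cases[OF Y Z H]]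
 let ?f = "mkf W X (fst F)" and ?a = "mka W X (fst F) (snd F)"
 let ?g = "mkf X Y (fst G)" and ?b = "mka X Y (fst G) (snd G)"
 let ?h = "mkf Y Z (fst H)" and ?d = "mka Y Z (fst H) (snd H)"
 have "mval ((?h oo ?g) oo ?f) = mval (?h oo (?g oo ?f))"
  "tval ((((?d<|?g)**(?h|>?b))<|?f)**((?h oo ?g)|>?a)) =
   tval ((?d<|(?g oo ?f))**(?h|>((?b<|?f)**(?g|>?a))))" by simp_all
 then show "(H \<odot>\<^bsub>Tng K\<^esub> G) \<odot>\<^bsub>Tng K\<^esub> F = H \<odot>\<^bsub>Tng K\<^esub> G \<odot>\<^bsub>Tng K\<^esub> F"
  by (simp add: typed_val mk_val del: mcomp_assoc lw_mcomp rw_mcomp)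
next
 fix X Y Z F F' G G' \<phi> \<psi>
 assume "X \<in> obj (Tng K)" "Y \<in> obj (Tng K)" "Z \<in> obj (Tng K)"
  "F \<in> hom1 (Tng K) X Y" "F' \<in> hom1 (Tng K) X Y" "G \<in> hom1 (Tng K) Y Z" "G' \<in> hom1 (Tng K) Y Z"
  "\<phi> \<in> hom2 (Tng K) X Y F F'" "\<psi> \<in> hom2 (Tng K) Y Z G G'"
 then show "\<psi> \<star>\<^bsub>Tng K\<^esub> \<phi> \<in> hom2 (Tng K) X Z (G \<odot>\<^bsub>Tng K\<^esub> F) (G' \<odot>\<^bsub>Tng K\<^esub> F')"
  using Tng_hcomp_closed[of X Y Z F F' G G' \<phi> \<psi>] by simp
next
 fix X Y Z F F' F'' G G' G'' \<phi> \<phi>' \<psi> \<psi>'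
 assume "X \<in> obj (Tng K)" "Y \<in> obj (Tng K)" "Z \<in> obj (Tng K)"
  "F \<in> hom1 (Tng K) X Y" "F' \<in> hom1 (Tng K) X Y" "F'' \<in> hom1 (Tng K) X Y"
  "G \<in> hom1 (Tng K) Y Z" "G' \<in> hom1 (Tng K) Y Z" "G'' \<in> hom1 (Tng K) Y Z"
  "\<phi> \<in> hom2 (Tng K) X Y F F'" "\<phi>' \<in> hom2 (Tng K) X Y F' F''"
  "\<psi> \<in> hom2 (Tng K) Y Z G G'" "\<psi>' \<in> hom2 (Tng K) Y Z G' G''"
 then show "(\<psi>' \<bullet>\<^bsub>Tng K\<^esub> \<psi>) \<star>\<^bsub>Tng K\<^esub> (\<phi>' \<bullet>\<^bsub>Tng K\<^esub> \<phi>) = (\<psi>' \<star>\<^bsub>Tng K\<^esub> \<phi>') \<bullet>\<^bsub>Tng K\<^esub> (\<psi> \<star>\<^bsub>Tng K\<^esub> \<phi>)"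
  using interchange[OF Tng_base_obj Tng_base_obj Tng_base_obj Tng_base_hom1 Tng_base_hom1 Tng_base_hom1
   Tng_base_hom1 Tng_base_hom1 Tng_base_hom1 Tng_base_hom2 Tng_base_hom2 Tng_base_hom2 Tng_base_hom2,
   of X Y Z F F' F'' G G' G'' \<phi> \<phi>' \<psi> \<psi>'] by simp
next
 fix W X Y Z F F' G G' H H' \<phi> \<psi> \<chi>
 assume "W \<in> obj (Tng K)" "X \<in> obj (Tng K)" "Y \<in> obj (Tng K)" "Z \<in> obj (Tng K)"
  "F \<in> hom1 (Tng K) W X" "F' \<in> hom1 (Tng K) W X" "G \<in> hom1 (Tng K) X Y" "G' \<in> hom1 (Tng K) X Y"
  "H \<in> hom1 (Tng K) Y Z" "H' \<in> hom1 (Tng K) Y Z"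
  "\<phi> \<in> hom2 (Tng K) W X F F'" "\<psi> \<in> hom2 (Tng K) X Y G G'" "\<chi> \<in> hom2 (Tng K) Y Z H H'"
 then show "(\<chi> \<star>\<^bsub>Tng K\<^esub> \<psi>) \<star>\<^bsub>Tng K\<^esub> \<phi> = \<chi> \<star>\<^bsub>Tng K\<^esub> \<psi> \<star>\<^bsub>Tng K\<^esub> \<phi>"
  using hcomp_assoc[OF Tng_base_obj Tng_base_obj Tng_base_obj Tng_base_obj Tng_base_hom1 Tng_base_hom1 Tng_base_hom1
   Tng_base_hom1 Tng_base_hom1 Tng_base_hom1 Tng_base_hom2 Tng_base_hom2 Tng_base_hom2,
   of W X Y Z F F' G G' H H' \<phi> \<psi> \<chi>] by simp
qed

section \<open>Pairing of 1-cells and 2-cells\<close>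

definition pr1 :: "'o => 'o => ('o, 'm) tmor" where "pr1 A B = Tmor (pobj K A B) A (pfst K A B)"
definition pr2 :: "'o => 'o => ('o, 'm) tmor" where "pr2 A B = Tmor (pobj K A B) B (psnd K A B)"

lemma pr_sel [simp]: "msrc (pr1 A B) = pobj K A B" "mtrg (pr1 A B) = A" "msrc (pr2 A B) = pobj K A B" "mtrg (pr2 A B) = B"
 by (simp_all add: pr1_def pr2_def)

lemma pr_val: "mval (pr1 A B) = pfst K A B" "mval (pr2 A B) = psnd K A B"
 by (simp_all add: pr1_def pr2_def)

lemma mor_pr [simp]: "[|A \<in> obj K; B \<in> obj K|] ==> mor (pr1 A B)" "[|A \<in> obj K; B \<in> obj K|] ==> mor (pr2 A B)"
 by (simp_all add: mor_def pr_val pobj_closed pfst_closed psnd_closed del: mor_obj)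

definition tpair :: "('o, 'm) tmor => ('o, 'm) tmor => ('o, 'm) tmor" where
 "tpair f g = Tmor (msrc f) (pobj K (mtrg f) (mtrg g)) (pair1 K (msrc f) (mtrg f) (mtrg g) (mval f) (mval g))"

lemma tpair_sel [simp]: "msrc (tpair f g) = msrc f" "mtrg (tpair f g) = pobj K (mtrg f) (mtrg g)"
 by (simp_all add: tpair_def)

lemma tpair_props:
 assumes "mor f" "mor g" "msrc g = msrc f" "A = mtrg f" "B = mtrg g"
 shows "mor (tpair f g)" "pr1 A B oo tpair f g = f" "pr2 A B oo tpair f g = g"
proof -
 have "\<exists>!H. H \<in> hom1 K (msrc f) (pobj K (mtrg f) (mtrg g)) & pfst K (mtrg f) (mtrg g) \<odot> H = mval f &
   psnd K (mtrg f) (mtrg g) \<odot> H = mval g"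
  by (rule pobj_ex1_mor) (use assms in \<open>auto simp: mor_def simp del: mor_obj\<close>)
 from theI'[OF this] have *: "mval (tpair f g) \<in> hom1 K (msrc f) (pobj K A B) &
   pfst K A B \<odot> mval (tpair f g) = mval f & psnd K A B \<odot> mval (tpair f g) = mval g"
  using assms by (simp add: tpair_def pair1_def)
 show "mor (tpair f g)" using assms * unfolding mor_def by (auto simp: pobj_closed)
 show "pr1 A B oo tpair f g = f" "pr2 A B oo tpair f g = g"
  using assms * by (auto intro!: tmor.expand simp: typed_val pr_val)
qed

lemmas mor_tpair [simp] = tpair_props(1)[OF _ _ _ refl refl]
lemmas pr_tpair [simp] = tpair_props(2,3)

lemma pr_tpair' [simp]:
 assumes "mor f" "mor g" "msrc g = msrc f" "A = mtrg f" "B = mtrg g" "mor h" "mtrg h = msrc f"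
 shows "pr1 A B oo tpair f g oo h = f oo h" "pr2 A B oo tpair f g oo h = g oo h"
 using mcomp_assoc[of "pr1 A B" "tpair f g" h] mcomp_assoc[of "pr2 A B" "tpair f g" h] assms by simp_all

lemma mor_prod_eqI:
 assumes "mor f" "mor g" "msrc f = msrc g" "mtrg f = pobj K A B" "mtrg g = pobj K A B" "A \<in> obj K" "B \<in> obj K"
  "pr1 A B oo f = pr1 A B oo g" "pr2 A B oo f = pr2 A B oo g"
 shows "f = g"
proof -
 have "\<exists>!H. H \<in> hom1 K (msrc g) (pobj K A B) & pfst K A B \<odot> H = pfst K A B \<odot> mval g &
   psnd K A B \<odot> H = psnd K A B \<odot> mval g"
  using assms(2,5,6,7) by (intro pobj_ex1_mor)
   (auto simp: mor_def pfst_closed psnd_closed intro!: comp1_closed[where Y = "pobj K A B"] simp del: mor_obj)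
 moreover have "pfst K A B \<odot> mval f = pfst K A B \<odot> mval g" "psnd K A B \<odot> mval f = psnd K A B \<odot> mval g"
  using arg_cong[OF assms(8), of mval] arg_cong[OF assms(9), of mval] by (simp_all add: typed_val pr_val)
 ultimately have "mval f = mval g" using assms(1-5) by (auto simp: mor_def simp del: mor_obj)
 then show ?thesis using assms by (auto intro: tmor.expand)
qed

lemma tpair_comp:
 assumes "mor f" "mor g" "msrc g = msrc f" "mor h" "mtrg h = msrc f"
 shows "tpair f g oo h = tpair (f oo h) (g oo h)"
 by (rule mor_prod_eqI[of _ _ "mtrg f" "mtrg g"]) (use assms in simp_all)

lemma tpair_pr [simp]:
 assumes "A \<in> obj K" "B \<in> obj K"
 shows "tpair (pr1 A B) (pr2 A B) = mid (pobj K A B)"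
 by (rule mor_prod_eqI[of _ _ A B]) (use assms in \<open>simp_all add: pobj_closed\<close>)

lemma cel_prod_ex1:
 assumes "mor h" "mor h'" "msrc h' = msrc h" "mtrg h = pobj K A B" "mtrg h' = pobj K A B" "A \<in> obj K" "B \<in> obj K"
  and "cel t" "tdom t = pr1 A B oo h" "tcod t = pr1 A B oo h'"
  and "cel s" "tdom s = pr2 A B oo h" "tcod s = pr2 A B oo h'"
 shows "\<exists>!u. cel u & tdom u = h & tcod u = h' & pr1 A B|>u = t & pr2 A B|>u = s"
proof -
 let ?X = "msrc h" and ?Y = "pobj K A B"
 have h: "h = Tmor ?X ?Y (mval h)" "h' = Tmor ?X ?Y (mval h')" using assms(3-5) by (auto intro: tmor.expand)
 have hh: "mval h \<in> hom1 K ?X ?Y" "mval h' \<in> hom1 K ?X ?Y" "?X \<in> obj K" "?Y \<in> obj K"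
  using assms(1-5) by (auto simp: mor_def simp del: mor_obj)
 have ts: "tval t \<in> hom2 K ?X A (pfst K A B \<odot> mval h) (pfst K A B \<odot> mval h')"
  "tval s \<in> hom2 K ?X B (psnd K A B \<odot> mval h) (psnd K A B \<odot> mval h')"
  using assms by (auto simp: cel_def typed_val pr_val simp del: cel_mor)
 have "\<exists>!v. v \<in> hom2 K ?X ?Y (mval h) (mval h') & pfst K A B \<rhd> v = tval t & psnd K A B \<rhd> v = tval s"
  using pobj_ex1_cell[OF assms(6,7) hh(3,1,2) ts] .
 then have "\<exists>!u. cel u & tdom u = Tmor ?X ?Y (mval h) & tcod u = Tmor ?X ?Y (mval h') &
   (pr1 A B|>u = t & pr2 A B|>u = s)"
 proof (subst ex1_tarr[OF hh(3,4,1,2), where R = "%v. pfst K A B \<rhd> v = tval t & psnd K A B \<rhd> v = tval s"])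
  fix v
  show "(pr1 A B|>Tarr (Tmor ?X ?Y (mval h)) (Tmor ?X ?Y (mval h')) v = t & pr2 A B|>Tarr (Tmor ?X ?Y (mval h)) (Tmor ?X ?Y (mval h')) v = s) =
     (pfst K A B \<rhd> v = tval t & psnd K A B \<rhd> v = tval s)"
   using assms(9,10,12,13) unfolding h[symmetric] by (auto intro!: tarr_eqI simp: typed_val pr_val)
 qed
 then show ?thesis unfolding h[symmetric] .
qed

lemma cel_prod_eqI:
 assumes "cel u" "cel v" "tdom u = tdom v" "tcod u = tcod v" "mtrg (tdom v) = pobj K A B" "A \<in> obj K" "B \<in> obj K"
  "pr1 A B|>u = pr1 A B|>v" "pr2 A B|>u = pr2 A B|>v"
 shows "u = v"
 using cel_prod_ex1[of "tdom v" "tcod v" A B "pr1 A B|>v" "pr2 A B|>v"] assms by auto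

definition cpair :: "(('o, 'm) tmor, 'c) tarr => (('o, 'm) tmor, 'c) tarr => (('o, 'm) tmor, 'c) tarr" where
 "cpair t s = (THE u. cel u & tdom u = tpair (tdom t) (tdom s) & tcod u = tpair (tcod t) (tcod s) &
   pr1 (mtrg (tdom t)) (mtrg (tdom s))|>u = t & pr2 (mtrg (tdom t)) (mtrg (tdom s))|>u = s)"

lemma cpair_props:
 assumes "cel t" "cel s" "msrc (tdom s) = msrc (tdom t)" "A = mtrg (tdom t)" "B = mtrg (tdom s)"
 shows "cel (cpair t s)" "tdom (cpair t s) = tpair (tdom t) (tdom s)" "tcod (cpair t s) = tpair (tcod t) (tcod s)"
  "pr1 A B|>cpair t s = t" "pr2 A B|>cpair t s = s"
proof -
 have "\<exists>!u. cel u & tdom u = tpair (tdom t) (tdom s) & tcod u = tpair (tcod t) (tcod s) &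
   pr1 A B|>u = t & pr2 A B|>u = s"
  by (rule cel_prod_ex1) (use assms in simp_all)
 from theI'[OF this] show "cel (cpair t s)" "tdom (cpair t s) = tpair (tdom t) (tdom s)" "tcod (cpair t s) = tpair (tcod t) (tcod s)"
  "pr1 A B|>cpair t s = t" "pr2 A B|>cpair t s = s"
  using assms by (simp_all add: cpair_def)
qed

lemmas cel_cpair [simp] = cpair_props(1-3)[OF _ _ _ refl refl]
lemmas pr_cpair [simp] = cpair_props(4,5)

lemma pr_cpair_rw [simp]:
 assumes "cel t" "cel s" "msrc (tdom s) = msrc (tdom t)" "A = mtrg (tdom t)" "B = mtrg (tdom s)" "mor h" "mtrg h = msrc (tdom t)"
 shows "pr1 A B|>cpair t s<|h = t<|h" "pr2 A B|>cpair t s<|h = s<|h"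
 using rw_lw[of "pr1 A B" h "cpair t s"] rw_lw[of "pr2 A B" h "cpair t s"] assms by simp_all

text \<open>Existence and uniqueness of the induced cell are checked after the two projections, by the universal property of the
 product for 2-cells.\<close>

lemma tpb_prod:
 assumes AB: "A \<in> obj K" "B \<in> obj K"
  and c: "cel a" "cel b" "cel f" "cel g" "tdom b = tdom a" "tcod a = tdom f" "tcod b = tdom g" "tcod g = tcod f"
   "mtrg (tdom a) = pobj K A B"
  and 1: "tpb (pr1 A B|>a) (pr1 A B|>b) (pr1 A B|>f) (pr1 A B|>g)"
  and 2: "tpb (pr2 A B|>a) (pr2 A B|>b) (pr2 A B|>f) (pr2 A B|>g)"
 shows "tpb a b f g"
proof -
 have t [simp]: "mtrg (tdom f) = pobj K A B" "mtrg (tdom g) = pobj K A B" "mtrg (tdom b) = pobj K A B"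
  "msrc (tdom f) = msrc (tdom a)" "msrc (tdom g) = msrc (tdom a)"
  using c cel_mor(3,4)[of a] cel_mor(3,4)[of b] by auto
 note [simp] = c AB
 have e: "f**a = g**b"
  by (rule cel_prod_eqI[of _ _ A B]) (use tpbD(9)[OF 1] tpbD(9)[OF 2] in simp_all)
 show ?thesis
  unfolding tpb_def
 proof (intro conjI allI impI, simp_all add: e, elim conjE)
  fix x y assume x [simp]: "cel x" "cel y" "tdom x = tdom y" "tcod x = tdom f" "tcod y = tdom g" and xy: "f**x = g**y"
  have x' [simp]: "mtrg (tdom y) = pobj K A B" "msrc (tdom y) = msrc (tdom a)"
   using cel_mor(3,4)[of x] cel_mor(3,4)[of a] by auto
  have xy1: "(pr1 A B|>f)**(pr1 A B|>x) = (pr1 A B|>g)**(pr1 A B|>y)"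
   using arg_cong[OF xy, of "%x. pr1 A B|>x"] by simp
  obtain u where u: "cel u" "tdom u = pr1 A B oo tdom y" "tcod u = pr1 A B oo tdom a"
   "(pr1 A B|>a)**u = pr1 A B|>x" "(pr1 A B|>b)**u = pr1 A B|>y"
   by (rule tpb_ex[OF 1 _ _ _ _ _ xy1]) (simp_all)
  have xy2: "(pr2 A B|>f)**(pr2 A B|>x) = (pr2 A B|>g)**(pr2 A B|>y)"
   using arg_cong[OF xy, of "%x. pr2 A B|>x"] by simp
  obtain v where v: "cel v" "tdom v = pr2 A B oo tdom y" "tcod v = pr2 A B oo tdom a"
   "(pr2 A B|>a)**v = pr2 A B|>x" "(pr2 A B|>b)**v = pr2 A B|>y"
   by (rule tpb_ex[OF 2 _ _ _ _ _ xy2]) (simp_all)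
  obtain w where w [simp]: "cel w" "tdom w = tdom y" "tcod w = tdom a" "pr1 A B|>w = u" "pr2 A B|>w = v"
   using cel_prod_ex1[of "tdom y" "tdom a" A B u v] u v by auto
  show "\<exists>!u. cel u & tdom u = tdom y & tcod u = tdom a & a**u = x & b**u = y"
  proof (rule ex1I[of _ w])
   have "a**w = x" by (rule cel_prod_eqI[of _ _ A B]) (simp_all add: u v)
   moreover have "b**w = y" by (rule cel_prod_eqI[of _ _ A B]) (simp_all add: u v)
   ultimately show "cel w & tdom w = tdom y & tcod w = tdom a & a**w = x & b**w = y" by simp
  next
   fix w' assume w': "cel w' & tdom w' = tdom y & tcod w' = tdom a & a**w' = x & b**w' = y"
   then have w2 [simp]: "cel w'" "tdom w' = tdom y" "tcod w' = tdom a" by blast+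
   have xy': "a**w' = x" "b**w' = y" using w' by blast+
   have "pr1 A B|>w' = u"
    by (rule tpb_eqI[OF 1]) (simp_all add: u(1-3), simp_all add: u(4,5) vc_lw_eq[OF xy'(1)] vc_lw_eq[OF xy'(2)])
   moreover have "pr2 A B|>w' = v"
    by (rule tpb_eqI[OF 2]) (simp_all add: v(1-3), simp_all add: v(4,5) vc_lw_eq[OF xy'(1)] vc_lw_eq[OF xy'(2)])
   ultimately show "w' = w" using cel_prod_eqI[of w' w A B] by simp
  qed
 qed
qed

end

context two_category
begin

section \<open>Tangentads in terms of induced cells\<close>

text \<open>The \<open>n\<close>-fold pullback of \<open>f\<close> along itself, with projections \<open>q i\<close> for \<open>i < n\<close>.\<close>

definition tfp :: "nat => ('o, 'm) tmor => (nat => (('o, 'm) tmor, 'c) tarr) => (('o, 'm) tmor, 'c) tarr => bool" where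
 "tfp n P q f \<longleftrightarrow> mor P & cel f & msrc P = msrc (tdom f) & mtrg P = mtrg (tdom f) &
  (\<forall>i<n. cel (q i) & tdom (q i) = P & tcod (q i) = tdom f) & (\<forall>i<n. \<forall>j<n. f**q i = f**q j) &
  (\<forall>W x. mor W & msrc W = msrc P & mtrg W = mtrg P & (\<forall>i<n. cel (x i) & tdom (x i) = W & tcod (x i) = tdom f) &
    (\<forall>i<n. \<forall>j<n. f**x i = f**x j) -->
    (\<exists>!u. cel u & tdom u = W & tcod u = P & (\<forall>i<n. q i**u = x i)))"

lemma is_fibre_power_iff_tfp:
 assumes "X \<in> obj K" "Y \<in> obj K" "P \<in> hom1 K X Y" "A \<in> hom1 K X Y" "D \<in> hom1 K X Y"
 shows "is_fibre_power (homcat K X Y) n P q A D f \<longleftrightarrow>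
  tfp n (Tmor X Y P) (%i. Tarr (Tmor X Y P) (Tmor X Y A) (q i)) (Tarr (Tmor X Y A) (Tmor X Y D) f)"
  (is "_ \<longleftrightarrow> tfp n ?P ?q ?f")
proof -
 let ?U = "%W x. (\<exists>!u. cel u & tdom u = W & tcod u = Tmor X Y P & (\<forall>i<n. ?q i**u = x i))"
 have U: "?U (Tmor X Y W) x \<longleftrightarrow> (\<exists>!u. u \<in> hom2 K X Y W P & (\<forall>i<n. q i \<bullet> u = a i))"
  if "W \<in> hom1 K X Y" "\<forall>i<n. x i = Tarr (Tmor X Y W) (Tmor X Y A) (a i)" for W a x
  by (rule ex1_tarr[OF assms(1,2) that(1) assms(3), where R = "%v. \<forall>i<n. q i \<bullet> v = a i"])
   (simp add: vc_def that(2))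
 have main: "(\<forall>W x. mor W & msrc W = X & mtrg W = Y & (\<forall>i<n. cel (x i) & tdom (x i) = W & tcod (x i) = Tmor X Y A) &
    (\<forall>i<n. \<forall>j<n. ?f**x i = ?f**x j) --> ?U W x)
  \<longleftrightarrow> (\<forall>W\<in>hom1 K X Y. \<forall>a. (\<forall>i<n. a i \<in> hom2 K X Y W A) & (\<forall>i<n. \<forall>j<n. f \<bullet> a i = f \<bullet> a j) -->
    (\<exists>!u. u \<in> hom2 K X Y W P & (\<forall>i<n. q i \<bullet> u = a i)))" (is "?L \<longleftrightarrow> ?R")
 proof
  assume L: ?L
  show ?R
  proof (intro ballI allI impI)
   fix W a assume W: "W \<in> hom1 K X Y" and h: "(\<forall>i<n. a i \<in> hom2 K X Y W A) & (\<forall>i<n. \<forall>j<n. f \<bullet> a i = f \<bullet> a j)"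
   have "?U (Tmor X Y W) (%i. Tarr (Tmor X Y W) (Tmor X Y A) (a i))"
   proof (rule L[THEN spec, THEN spec, THEN mp], intro conjI allI impI)
    fix i j assume "i < n" "j < n"
    then have "f \<bullet> a i = f \<bullet> a j" using h by blast
    then show "?f**Tarr (Tmor X Y W) (Tmor X Y A) (a i) = ?f**Tarr (Tmor X Y W) (Tmor X Y A) (a j)"
     by (simp add: vc_def)
   qed (use W h[THEN conjunct1] assms in \<open>simp_all add: cel_def mor_def del: cel_mor mor_obj\<close>)
   then show "\<exists>!u. u \<in> hom2 K X Y W P & (\<forall>i<n. q i \<bullet> u = a i)"
    by (rule U[OF W, THEN iffD1, rotated]) simp
  qed
 next
  assume R: ?R
  show ?L
  proof (intro allI impI)
   fix W x assume h: "mor W & msrc W = X & mtrg W = Y & (\<forall>i<n. cel (x i) & tdom (x i) = W & tcod (x i) = Tmor X Y A) &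
    (\<forall>i<n. \<forall>j<n. ?f**x i = ?f**x j)"
   from h have "mor W" "msrc W = X" "mtrg W = Y" by blast+
   then have W: "W = Tmor X Y (mval W)" "mval W \<in> hom1 K X Y" by (auto intro: tmor.expand simp: mor_def simp del: mor_obj)
   have c: "cel (x i)" "tdom (x i) = W" "tcod (x i) = Tmor X Y A" if "i < n" for i using h that by blast+
   have x: "x i = Tarr (Tmor X Y (mval W)) (Tmor X Y A) (tval (x i))" if "i < n" for i
    using c[OF that] W(1) by (intro tarr_eqI) simp_all
   have a: "tval (x i) \<in> hom2 K X Y (mval W) A" if "i < n" for i
    using c[OF that] W(1) by (metis cel_def tmor.sel)
   have e: "f \<bullet> tval (x i) = f \<bullet> tval (x j)" if "i < n" "j < n" for i j
   proof -
    have "?f**x i = ?f**x j" using h that by blast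
    then show ?thesis by (simp add: vc_def)
   qed
   have r: "\<exists>!u. u \<in> hom2 K X Y (mval W) P & (\<forall>i<n. q i \<bullet> u = tval (x i))"
    by (rule R[THEN bspec, OF W(2), THEN spec, THEN mp]) (intro conjI allI impI; rule a e; assumption)
   have "?U (Tmor X Y (mval W)) x"
    by (rule U[OF W(2), THEN iffD2, OF _ r]) (intro allI impI, rule x)
   then show "?U W x" using W(1) by simp
  qed
 qed
 have "(\<forall>i<n. \<forall>j<n. f \<bullet> q i = f \<bullet> q j) \<longleftrightarrow> (\<forall>i<n. \<forall>j<n. ?f**?q i = ?f**?q j)"
  by (simp add: vc_def)
 moreover have "cel ?f \<longleftrightarrow> f \<in> hom2 K X Y A D" "cel (?q i) \<longleftrightarrow> q i \<in> hom2 K X Y P A" "mor ?P" for i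
  using assms by (simp_all add: cel_def mor_def del: cel_mor mor_obj)
 ultimately show ?thesis
  unfolding is_fibre_power_def tfp_def homcat_def
  by (simp only: main[symmetric] cat.simps tarr.sel tmor.sel assms) (simp only: simp_thms)
qed

lemma tfp_cong:
 assumes "!!i. i < n ==> q i = q' i"
 shows "tfp n P q f \<longleftrightarrow> tfp n P q' f"
proof -
 have "(\<forall>i<n. cel (q i) & tdom (q i) = P & tcod (q i) = tdom f) = (\<forall>i<n. cel (q' i) & tdom (q' i) = P & tcod (q' i) = tdom f)"
  "(\<forall>i<n. \<forall>j<n. f**q i = f**q j) = (\<forall>i<n. \<forall>j<n. f**q' i = f**q' j)"
  "!!u x. (\<forall>i<n. q i**u = x i) = (\<forall>i<n. q' i**u = x i)" by (simp_all add: assms)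
 then show ?thesis by (simp only: tfp_def)
qed

lemma is_fibre_power_cong:
 assumes "!!i. i < n ==> q i = q' i"
 shows "is_fibre_power C n P q A D f \<longleftrightarrow> is_fibre_power C n P q' A D f"
proof -
 have "(\<forall>i<n. q i \<in> Arr C P A) = (\<forall>i<n. q' i \<in> Arr C P A)"
  "(\<forall>i<n. \<forall>j<n. f \<cdot>\<^bsub>C\<^esub> q i = f \<cdot>\<^bsub>C\<^esub> q j) = (\<forall>i<n. \<forall>j<n. f \<cdot>\<^bsub>C\<^esub> q' i = f \<cdot>\<^bsub>C\<^esub> q' j)"
  "!!u x. (\<forall>i<n. q i \<cdot>\<^bsub>C\<^esub> u = x i) = (\<forall>i<n. q' i \<cdot>\<^bsub>C\<^esub> u = x i)" by (simp_all add: assms)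
 then show ?thesis by (simp only: is_fibre_power_def)
qed

lemma tfpD:
 assumes "tfp n P q f"
 shows "mor P" "cel f" "msrc P = msrc (tdom f)" "mtrg P = mtrg (tdom f)"
  "!!i. i < n ==> cel (q i)" "!!i. i < n ==> tdom (q i) = P" "!!i. i < n ==> tcod (q i) = tdom f"
  "!!i j. i < n ==> j < n ==> f**q i = f**q j"
proof -
 note * = assms[unfolded tfp_def]
 show "mor P" "cel f" "msrc P = msrc (tdom f)" "mtrg P = mtrg (tdom f)" using * by simp_all
 show "cel (q i)" "tdom (q i) = P" "tcod (q i) = tdom f" if "i < n" for i using * that by simp_all
 show "f**q i = f**q j" if "i < n" "j < n" for i j
  using *[THEN conjunct2, THEN conjunct2, THEN conjunct2, THEN conjunct2, THEN conjunct2, THEN conjunct1] that by blast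
qed

lemma tfp_univ:
 assumes "tfp n P q f" "mor W" "msrc W = msrc P" "mtrg W = mtrg P"
  "!!i. i < n ==> cel (x i)" "!!i. i < n ==> tdom (x i) = W" "!!i. i < n ==> tcod (x i) = tdom f"
  "!!i j. i < n ==> j < n ==> f**x i = f**x j"
 shows "\<exists>!u. cel u & tdom u = W & tcod u = P & (\<forall>i<n. q i**u = x i)"
 by (rule assms(1)[unfolded tfp_def, THEN conjunct2, THEN conjunct2, THEN conjunct2, THEN conjunct2, THEN conjunct2,
    THEN conjunct2, THEN spec, THEN spec, THEN mp]) (intro conjI allI impI; fact assms(2-8) | (rule assms(5-8); assumption))

lemma tfp_ex:
 assumes "tfp n P q f" "mor W" "msrc W = msrc P" "mtrg W = mtrg P"
  "!!i. i < n ==> cel (x i)" "!!i. i < n ==> tdom (x i) = W" "!!i. i < n ==> tcod (x i) = tdom f"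
  "!!i j. i < n ==> j < n ==> f**x i = f**x j"
 obtains u where "cel u" "tdom u = W" "tcod u = P" "!!i. i < n ==> q i**u = x i"
proof -
 have "\<exists>!u. cel u & tdom u = W & tcod u = P & (\<forall>i<n. q i**u = x i)"
  by (rule tfp_univ[OF assms(1-4)]) (simp_all add: assms(5-7), rule assms(8))
 then show thesis using that by blast
qed

lemma tfp_eqI:
 assumes "tfp n P q f" "cel u" "cel v" "tdom u = tdom v" "tcod u = P" "tcod v = P" "1 \<le> n"
  "!!i. i < n ==> q i**u = q i**v"
 shows "u = v"
proof -
 note D = tfpD[OF assms(1)]
 let ?W = "tdom v" and ?x = "%i. q i**v"
 have e: "f**q i**v = f**q j**v" if "i < n" "j < n" for i j
  using arg_cong[OF D(8)[OF that], of "%w. w**v"] D(1-7) assms(2-6) that by simp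
 have W: "msrc ?W = msrc P" "mtrg ?W = mtrg P" using cel_mor[OF assms(3)] assms(6) by auto
 have "\<exists>!u. cel u & tdom u = ?W & tcod u = P & (\<forall>i<n. q i**u = ?x i)"
 proof (rule tfp_univ[OF assms(1) _ W])
  fix i j assume "i < n" "j < n"
  then show "f**?x i = f**?x j" by (rule e)
 qed (simp_all add: assms(2-6) D(1-7))
 then have *: "!!a b. cel a & tdom a = ?W & tcod a = P & (\<forall>i<n. q i**a = ?x i) ==>
   cel b & tdom b = ?W & tcod b = P & (\<forall>i<n. q i**b = ?x i) ==> a = b" by blast
 show ?thesis by (rule *) (simp_all add: assms)
qed

text \<open>The commutative monoid \<open>p : T \<rightarrow> id\<close> in the slice, with the induced arrows given by their projections.\<close>

definition addb :: "('o, 'm, 'c) tangentad => bool" where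
 "addb X \<longleftrightarrow> tp X**tz X = cid (mid (base X)) & tp X**ts X = tp X**tq1 X &
  (\<forall>W u v u' v'. mor W & msrc W = base X & mtrg W = base X &
    cel u & cel v & cel u' & cel v' & tdom u = W & tdom v = W & tdom u' = W & tdom v' = W &
    tcod u = tT2 X & tcod v = tT2 X & tcod u' = tT2 X & tcod v' = tT2 X &
    tq1 X**v = ts X**u & tq2 X**v = tq2 X**u' & tq1 X**u' = tq2 X**u &
    tq1 X**v' = tq1 X**u & tq2 X**v' = ts X**u' --> ts X**v = ts X**v') &
  (\<forall>u. cel u & tdom u = tT X & tcod u = tT2 X & tq1 X**u = tz X**tp X & tq2 X**u = cid (tT X)
    --> ts X**u = cid (tT X)) &
  (\<forall>u. cel u & tdom u = tT X & tcod u = tT2 X & tq2 X**u = tz X**tp X & tq1 X**u = cid (tT X)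
    --> ts X**u = cid (tT X)) &
  (\<forall>u. cel u & tdom u = tT2 X & tcod u = tT2 X & tq1 X**u = tq2 X & tq2 X**u = tq1 X
    --> ts X**u = ts X)"

text \<open>The data of a tangentad with the right types; only the limit conditions and the equations are left open.\<close>

definition pretan :: "('o, 'm, 'c) tangentad => bool" where
 "pretan X \<longleftrightarrow> base X \<in> obj K & mor (tT X) & mor (tT2 X) & cel (tq1 X) & cel (tq2 X) & cel (tp X) & cel (tz X) &
  cel (ts X) & cel (tl X) & cel (tc X)"

abbreviation add_monoid :: "('o, 'm, 'c) tangentad => bool" where
 "add_monoid X \<equiv> commutative_monoid (slice (homcat K (base X) (base X)) (id1 K (base X)))
   (id1 K (base X), id2 K (id1 K (base X))) (tanT2 X, tan_p X \<bullet> tan_q1 X) (tan_q1 X) (tan_q2 X) (tanT X, tan_p X)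
    (tan_z X) (tan_s X)"

lemma slice_pairing:
 assumes X: "pretan X" and pb: "tpb (tq1 X) (tq2 X) (tp X) (tp X)"
  and u: "cel u" "tdom u = Tmor (base X) (base X) W" "tcod u = tT2 X"
  and eq: "w = tval (tp X**tq1 X**u)" "a = tval (tq1 X**u)" "b = tval (tq2 X**u)"
 shows "pairing (slice (homcat K (base X) (base X)) (id1 K (base X)))
   (tanT2 X, tan_p X \<bullet> tan_q1 X) (tan_q1 X) (tan_q2 X) (W, w) a b = tval u"
proof -
 note [simp] = X[unfolded pretan_def, THEN conjunct1]
 have t [simp]: "mor (tT X)" "mor (tT2 X)" "cel (tq1 X)" "cel (tq2 X)" "cel (tp X)" "cel (tz X)" "cel (ts X)"
  using X by (auto simp: pretan_def)
 let ?S = "slice (homcat K (base X) (base X)) (id1 K (base X))"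
 have A: "Arr ?S (W, w) (tanT2 X, tan_p X \<bullet> tan_q1 X) = {v \<in> hom2 K (base X) (base X) W (tanT2 X). (tan_p X \<bullet> tan_q1 X) \<bullet> v = w}"
  by (simp add: slice_def homcat_def)
 have as: "(tp X**tq1 X)**u = tp X**tq1 X**u" using u by simp
 have u': "tval u \<in> hom2 K (base X) (base X) W (tanT2 X)" "W \<in> hom1 K (base X) (base X)"
  using u by (auto simp: cel_def mor_def tan_val simp del: cel_mor mor_obj)
 have eqs: "(tan_p X \<bullet> tan_q1 X) \<bullet> tval u = w" "tan_q1 X \<bullet> tval u = a" "tan_q2 X \<bullet> tval u = b"
  using arg_cong[OF as, of tval] eq by (simp_all add: typed_val tan_val)
 have un: "v = tval u" if v: "v \<in> hom2 K (base X) (base X) W (tanT2 X)" "tan_q1 X \<bullet> v = a" "tan_q2 X \<bullet> v = b" for v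
 proof -
  let ?v = "Tarr (Tmor (base X) (base X) W) (tT2 X) v"
  have "?v = u"
  proof (rule tpb_eqI[OF pb])
   have "mor (Tmor (base X) (base X) W)" using cel_mor(1)[OF u(1)] u(2) by simp
   then show "cel ?v" using v u' by (intro celI) (simp_all add: tan_val)
  qed (use u v eqs in \<open>auto intro!: tarr_eqI simp: typed_val tan_val\<close>)
  then show ?thesis by (metis tarr.sel(3))
 qed
 show ?thesis unfolding pairing_def A
 proof (rule the_equality)
  show "tval u \<in> {v \<in> hom2 K (base X) (base X) W (tanT2 X). (tan_p X \<bullet> tan_q1 X) \<bullet> v = w} &
   tan_q1 X \<cdot>\<^bsub>?S\<^esub> tval u = a & tan_q2 X \<cdot>\<^bsub>?S\<^esub> tval u = b"
   using u'(1) eqs by (simp add: slice_def homcat_def)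
 next
  fix v assume "v \<in> {v \<in> hom2 K (base X) (base X) W (tanT2 X). (tan_p X \<bullet> tan_q1 X) \<bullet> v = w} &
   tan_q1 X \<cdot>\<^bsub>?S\<^esub> v = a & tan_q2 X \<cdot>\<^bsub>?S\<^esub> v = b"
  then show "v = tval u" by (intro un) (simp_all add: slice_def homcat_def)
 qed
qed

lemma tpb_is_pullback:
 assumes "tpb a b u v"
  and "tdom a = Tmor X Y P" "tdom u = Tmor X Y A" "tdom v = Tmor X Y B" "tcod u = Tmor X Y D"
 shows "is_pullback (homcat K X Y) P (tval a) (tval b) A B D (tval u) (tval v)"
proof -
 note D = tpbD[OF assms(1)]
 have "a = Tarr (Tmor X Y P) (Tmor X Y A) (tval a)" "b = Tarr (Tmor X Y P) (Tmor X Y B) (tval b)"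
  "u = Tarr (Tmor X Y A) (Tmor X Y D) (tval u)" "v = Tarr (Tmor X Y B) (Tmor X Y D) (tval v)"
  using assms D by (auto intro: tarr.expand)
 moreover have "mor (tdom a)" "mor (tdom u)" "mor (tdom v)" "mor (tcod u)" using D by auto
 then have "X \<in> obj K" "Y \<in> obj K" "P \<in> hom1 K X Y" "A \<in> hom1 K X Y" "B \<in> hom1 K X Y" "D \<in> hom1 K X Y"
  using assms by (auto simp: mor_def simp del: mor_obj)
 ultimately show ?thesis using assms(1) is_pullback_iff_tpb by metis
qed

lemma pretan_simps:
 assumes "pretan X"
 shows "base X \<in> obj K" "mor (tT X)" "mor (tT2 X)" "cel (tq1 X)" "cel (tq2 X)" "cel (tp X)" "cel (tz X)"
  "cel (ts X)" "cel (tl X)" "cel (tc X)" "mor (tTm X m)"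
proof -
 show *: "base X \<in> obj K" "mor (tT X)" "mor (tT2 X)" "cel (tq1 X)" "cel (tq2 X)" "cel (tp X)" "cel (tz X)"
  "cel (ts X)" "cel (tl X)" "cel (tc X)" using assms by (simp_all add: pretan_def)
 show "mor (tTm X m)"
 proof (induction m)
  case 0
  have "tTm X 0 = mid (base X)" by (simp add: tTm_def mid_def)
  then show ?case using * by simp
 next
  case (Suc m)
  have "tTm X (Suc m) = tT X oo tTm X m" by (simp add: tTm_def mcomp_def tT_def)
  then show ?case using * Suc by simp
 qed
qed

lemma tTm_rec: "tTm X 0 = mid (base X)" "tTm X (Suc m) = tT X oo tTm X m"
 by (auto simp: tTm_def mid_def mcomp_def tT_def)

text \<open>A product in the slice over the identity is a pullback of \<open>p\<close> along itself. So a generalized element of the monoid in the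
 slice is a cell into \<open>T\<close>, and each pairing is a cell into \<open>T2\<close> known by its projections.\<close>

lemma addb_if_add_monoid:
 assumes X: "pretan X" and pb: "tpb (tq1 X) (tq2 X) (tp X) (tp X)" and mon: "add_monoid X"
 shows "addb X"
proof -
 note t [simp] = pretan_simps[OF X]
 note pq = tpbD(9)[OF pb]
 let ?H = "homcat K (base X) (base X)"
 let ?S = "slice ?H (id1 K (base X))"
 let ?I = "(id1 K (base X), id2 K (id1 K (base X)))"
 let ?P = "(tanT2 X, tan_p X \<bullet> tan_q1 X)" and ?A = "(tanT X, tan_p X)"
 let ?pr = "pairing ?S ?P (tan_q1 X) (tan_q2 X)"
 note m = mon[unfolded commutative_monoid_def]
 have "tan_z X \<in> Arr ?S ?I ?A" "tan_s X \<in> Arr ?S ?P ?A" using m by blast+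
 then have pz: "tp X**tz X = cid (mid (base X))" and ps: "tp X**ts X = tp X**tq1 X"
  by (auto intro!: tarr_eqI simp: slice_def homcat_def typed_val tan_val)
 have unit: "to_terminal ?S ?I ?A = tan_p X"
  unfolding to_terminal_def slice_def homcat_def
 proof (rule the_equality, goal_cases)
  case 1
  have p: "tan_p X \<in> hom2 K (base X) (base X) (tanT X) (id1 K (base X))"
   using t(6) by (simp add: cel_def tan_val typed_val del: cel_mor t)
  have "tval (cid (mid (base X))**tp X) = tval (tp X)" by simp
  then have "id2 K (id1 K (base X)) \<bullet> tan_p X = tan_p X" by (simp only: typed_val tan_val)
  then show ?case using p by simp
 next
  case (2 f)
  then have f: "f \<in> hom2 K (base X) (base X) (tanT X) (id1 K (base X))" and e: "id2 K (id1 K (base X)) \<bullet> f = tan_p X" by auto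
  let ?f = "Tarr (tT X) (mid (base X)) f"
  have "cel ?f" by (rule celI) (use f in \<open>simp_all add: typed_val tan_val\<close>)
  then have "tval (cid (mid (base X))**?f) = tval ?f" by simp
  then have "id2 K (id1 K (base X)) \<bullet> f = f" by (simp only: typed_val tarr.sel)
  then show ?case using e by simp
 qed
 have assoc: "ts X**v = ts X**v'"
  if W: "mor W" "msrc W = base X" "mtrg W = base X"
   and [simp]: "cel u" "cel v" "cel u'" "cel v'" "tdom u = W" "tdom v = W" "tdom u' = W" "tdom v' = W"
    "tcod u = tT2 X" "tcod v = tT2 X" "tcod u' = tT2 X" "tcod v' = tT2 X"
   and h: "tq1 X**v = ts X**u" "tq2 X**v = tq2 X**u'" "tq1 X**u' = tq2 X**u"
    "tq1 X**v' = tq1 X**u" "tq2 X**v' = ts X**u'" for W u v u' v'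
 proof -
  let ?w = "tp X**tq1 X**u"
  have Wm: "W = Tmor (base X) (base X) (mval W)" using W by (intro tmor_eta)
  have Wm': "tdom u = Tmor (base X) (base X) (mval W)" "tdom u' = Tmor (base X) (base X) (mval W)"
   "tdom v = Tmor (base X) (base X) (mval W)" "tdom v' = Tmor (base X) (base X) (mval W)" using Wm by simp_all
  have Wob: "(mval W, tval ?w) \<in> Ob ?S"
  proof -
   have "cel ?w" by simp
   then have "tval ?w \<in> hom2 K (base X) (base X) (mval W) (id1 K (base X))"
    using W by (simp add: cel_def typed_val del: cel_mor)
   moreover have "mval W \<in> hom1 K (base X) (base X)" using W by (simp add: mor_def del: mor_obj)
   ultimately show ?thesis by (simp add: slice_def homcat_def)
  qed
  have mem: "tval x \<in> Arr ?S (mval W, tval ?w) ?A" if "cel x" "tdom x = W" "tcod x = tT X" "tp X**x = ?w" for x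
   using that(1) that(2-3) arg_cong[OF that(4), of tval] W
   by (simp add: slice_def homcat_def cel_def typed_val tan_val del: cel_mor)
  have w1: "tp X**tq1 X**u' = ?w" "tp X**tq1 X**v = ?w" "tp X**tq1 X**v' = ?w"
    "tp X**tq2 X**u = ?w" "tp X**tq2 X**u' = ?w"
   by (simp_all add: h vc_pre[OF pq[symmetric]] vc_pre[OF ps])
  have pu: "?pr (mval W, tval ?w) (tval (tq1 X**u)) (tval (tq2 X**u)) = tval u"
   by (rule slice_pairing[OF X pb _ Wm'(1)]) simp_all
  have pu': "?pr (mval W, tval ?w) (tval (tq1 X**u')) (tval (tq2 X**u')) = tval u'"
   by (rule slice_pairing[OF X pb _ Wm'(2)]) (simp_all add: w1)
  have pv: "?pr (mval W, tval ?w) (tval (tq1 X**v)) (tval (tq2 X**v)) = tval v"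
   by (rule slice_pairing[OF X pb _ Wm'(3)]) (simp_all add: w1)
  have pv': "?pr (mval W, tval ?w) (tval (tq1 X**v')) (tval (tq2 X**v')) = tval v'"
   by (rule slice_pairing[OF X pb _ Wm'(4)]) (simp_all add: w1)
  have "tan_s X \<cdot>\<^bsub>?S\<^esub> ?pr (mval W, tval ?w) (tan_s X \<cdot>\<^bsub>?S\<^esub> ?pr (mval W, tval ?w) (tval (tq1 X**u)) (tval (tq2 X**u))) (tval (tq2 X**u')) =
    tan_s X \<cdot>\<^bsub>?S\<^esub> ?pr (mval W, tval ?w) (tval (tq1 X**u)) (tan_s X \<cdot>\<^bsub>?S\<^esub> ?pr (mval W, tval ?w) (tval (tq2 X**u)) (tval (tq2 X**u')))"
   using m Wob mem[of "tq1 X**u"] mem[of "tq2 X**u"] mem[of "tq2 X**u'"] w1 by simp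
  moreover have "tan_s X \<cdot>\<^bsub>?S\<^esub> tval u = tval (tq1 X**v)" "tan_s X \<cdot>\<^bsub>?S\<^esub> tval u' = tval (tq2 X**v')"
   unfolding h by (simp_all add: slice_def homcat_def typed_val tan_val)
  ultimately have "tan_s X \<cdot>\<^bsub>?S\<^esub> tval v = tan_s X \<cdot>\<^bsub>?S\<^esub> tval v'"
   using pu pu' pv pv' h by simp
  then show ?thesis by (intro tarr_eqI) (simp_all add: slice_def homcat_def typed_val tan_val)
 qed
 have T: "tT X = Tmor (base X) (base X) (tanT X)" "tT2 X = Tmor (base X) (base X) (tanT2 X)" by (simp_all add: tT_def tT2_def)
 have l: "ts X**u = cid (tT X)"
  if [simp]: "cel u" "tdom u = tT X" "tcod u = tT2 X" and h: "tq1 X**u = tz X**tp X" "tq2 X**u = cid (tT X)" for u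
 proof -
  have "?pr ?A (tval (tq1 X**u)) (tval (tq2 X**u)) = tval u"
   by (rule slice_pairing[OF X pb]) (simp_all add: T h vc_pre[OF pz], simp add: tan_val)
  then have "?pr ?A (tan_z X \<bullet> tan_p X) (id2 K (tanT X)) = tval u" using h by (simp add: typed_val tan_val)
  then have "tan_s X \<bullet> tval u = id2 K (tanT X)" using m unit by (simp add: slice_def homcat_def)
  then show ?thesis by (intro tarr_eqI) (simp_all add: typed_val tan_val)
 qed
 have r: "ts X**u = cid (tT X)"
  if [simp]: "cel u" "tdom u = tT X" "tcod u = tT2 X" and h: "tq2 X**u = tz X**tp X" "tq1 X**u = cid (tT X)" for u
 proof -
  have "?pr ?A (tval (tq1 X**u)) (tval (tq2 X**u)) = tval u"
   by (rule slice_pairing[OF X pb]) (simp_all add: T h, simp add: tan_val)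
  then have "?pr ?A (id2 K (tanT X)) (tan_z X \<bullet> tan_p X) = tval u" using h by (simp add: typed_val tan_val)
  then have "tan_s X \<bullet> tval u = id2 K (tanT X)" using m unit by (simp add: slice_def homcat_def)
  then show ?thesis by (intro tarr_eqI) (simp_all add: typed_val tan_val)
 qed
 have c: "ts X**u = ts X"
  if [simp]: "cel u" "tdom u = tT2 X" "tcod u = tT2 X" and h: "tq1 X**u = tq2 X" "tq2 X**u = tq1 X" for u
 proof -
  have "?pr ?P (tval (tq1 X**u)) (tval (tq2 X**u)) = tval u"
   by (rule slice_pairing[OF X pb]) (simp_all add: T h pq[symmetric], simp add: tan_val typed_val)
  then have "tan_s X \<bullet> tval u = tan_s X" using m h by (simp add: slice_def homcat_def tan_val)
  then show ?thesis by (intro tarr_eqI) (simp_all add: typed_val tan_val)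
 qed
 show ?thesis unfolding addb_def
  by (intro conjI allI impI pz ps; (elim conjE)?; (rule assoc l r c; assumption)?)
qed

lemma add_monoid_if_addb:
 assumes X: "pretan X" and pb: "tpb (tq1 X) (tq2 X) (tp X) (tp X)" and ad: "addb X"
 shows "add_monoid X"
proof -
 note t [simp] = pretan_simps[OF X]
 note pq = tpbD(9)[OF pb]
 let ?b = "base X"
 let ?H = "homcat K ?b ?b"
 let ?S = "slice ?H (id1 K ?b)"
 let ?I = "(id1 K ?b, id2 K (id1 K ?b))"
 let ?P = "(tanT2 X, tan_p X \<bullet> tan_q1 X)" and ?A = "(tanT X, tan_p X)"
 let ?pr = "pairing ?S ?P (tan_q1 X) (tan_q2 X)"
 have pz: "tp X**tz X = cid (mid ?b)" and ps: "tp X**ts X = tp X**tq1 X"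
  using ad unfolding addb_def by blast+
 have T: "tT X = Tmor ?b ?b (tanT X)" "tT2 X = Tmor ?b ?b (tanT2 X)" by (simp_all add: tT_def tT2_def)
 have hom: "tanT X \<in> hom1 K ?b ?b" "tanT2 X \<in> hom1 K ?b ?b" "id1 K ?b \<in> hom1 K ?b ?b"
  using t(2,3) id1_closed[of ?b] by (simp_all add: mor_def tan_val del: t(2,3) mor_obj)
 have cells: "tan_p X \<in> hom2 K ?b ?b (tanT X) (id1 K ?b)" "tan_z X \<in> hom2 K ?b ?b (id1 K ?b) (tanT X)"
  "tan_s X \<in> hom2 K ?b ?b (tanT2 X) (tanT X)" "tan_q1 X \<in> hom2 K ?b ?b (tanT2 X) (tanT X)"
  "tan_q2 X \<in> hom2 K ?b ?b (tanT2 X) (tanT X)"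
  using t(4-8) by (simp_all add: cel_def tan_val typed_val del: t cel_mor)
 have pq1: "tan_p X \<bullet> tan_q1 X \<in> hom2 K ?b ?b (tanT2 X) (id1 K ?b)" "tan_p X \<bullet> tan_q2 X = tan_p X \<bullet> tan_q1 X"
  using hc_vcomp[OF t(1) t(1) hom(2,1,3) cells(4,1)] arg_cong[OF pq, of tval] by (simp_all add: typed_val tan_val)
 have ob: "?I \<in> Ob ?S" "?P \<in> Ob ?S" "?A \<in> Ob ?S"
  using hom cells pq1 hc_id2[OF t(1) t(1) hom(3)] by (simp_all add: slice_def homcat_def)
 have typed: "cel (Tarr (Tmor ?b ?b W) (tT X) a)" "tp X**Tarr (Tmor ?b ?b W) (tT X) a = Tarr (Tmor ?b ?b W) (mid ?b) w"
  if "(W, w) \<in> Ob ?S" "a \<in> Arr ?S (W, w) ?A" for W w a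
  using that hom by (auto intro!: celI tarr_eqI simp: slice_def homcat_def mor_def tan_val typed_val simp del: mor_obj)
 have arr: "tval u \<in> Arr ?S (W, w) ?P"
  if "(W, w) \<in> Ob ?S" "cel u" "tdom u = Tmor ?b ?b W" "tcod u = tT2 X" "tp X**tq1 X**u = Tarr (Tmor ?b ?b W) (mid ?b) w" for u W w
 proof -
  have "(tp X**tq1 X)**u = Tarr (Tmor ?b ?b W) (mid ?b) w" using that by simp
  from arg_cong[OF this, of tval] have "(tan_p X \<bullet> tan_q1 X) \<bullet> tval u = w" by (simp add: typed_val tan_val)
  then show ?thesis using that(2-4) by (auto simp: slice_def homcat_def cel_def tan_val simp del: cel_mor)
 qed
 have ex: "\<exists>u. cel u & tdom u = Tmor ?b ?b W & tcod u = tT2 X & tq1 X**u = Tarr (Tmor ?b ?b W) (tT X) a &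
   tq2 X**u = Tarr (Tmor ?b ?b W) (tT X) c & ?pr (W, w) a c = tval u"
  if W: "(W, w) \<in> Ob ?S" and a: "a \<in> Arr ?S (W, w) ?A" and c: "c \<in> Arr ?S (W, w) ?A" for W w a c
 proof -
  obtain u where u: "cel u" "tdom u = Tmor ?b ?b W" "tcod u = tT2 X" "tq1 X**u = Tarr (Tmor ?b ?b W) (tT X) a"
    "tq2 X**u = Tarr (Tmor ?b ?b W) (tT X) c"
   by (rule tpb_ex[OF pb typed(1)[OF W a] typed(1)[OF W c]]) (simp_all add: typed(2)[OF W a] typed(2)[OF W c])
  moreover have "?pr (W, w) a c = tval u"
   by (rule slice_pairing[OF X pb u(1-3)]) (simp_all add: u typed(2)[OF W a])
  ultimately show ?thesis by blast
 qed
 have prod: "is_product ?S ?P (tan_q1 X) (tan_q2 X) ?A ?A"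
  unfolding is_product_def
 proof (intro conjI ballI ob)
  show "tan_q1 X \<in> Arr ?S ?P ?A" "tan_q2 X \<in> Arr ?S ?P ?A"
   using cells pq1 by (simp_all add: slice_def homcat_def)
 next
  fix V a c assume "V \<in> Ob ?S" "a \<in> Arr ?S V ?A" "c \<in> Arr ?S V ?A"
  moreover obtain W w where "V = (W, w)" by (cases V)
  ultimately have W: "(W, w) \<in> Ob ?S" and a: "a \<in> Arr ?S (W, w) ?A" and c: "c \<in> Arr ?S (W, w) ?A" and V: "V = (W, w)" by simp_all
  obtain u where u: "cel u" "tdom u = Tmor ?b ?b W" "tcod u = tT2 X" "tq1 X**u = Tarr (Tmor ?b ?b W) (tT X) a"
    "tq2 X**u = Tarr (Tmor ?b ?b W) (tT X) c" using ex[OF W a c] by blast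
  show "\<exists>!u. u \<in> Arr ?S V ?P & tan_q1 X \<cdot>\<^bsub>?S\<^esub> u = a & tan_q2 X \<cdot>\<^bsub>?S\<^esub> u = c"
  proof (rule ex1I[of _ "tval u"], intro conjI)
   show "tval u \<in> Arr ?S V ?P" unfolding V by (rule arr[OF W u(1-3)]) (simp add: u typed(2)[OF W a])
   show "tan_q1 X \<cdot>\<^bsub>?S\<^esub> tval u = a" "tan_q2 X \<cdot>\<^bsub>?S\<^esub> tval u = c"
    using arg_cong[OF u(4), of tval] arg_cong[OF u(5), of tval] by (simp_all add: slice_def homcat_def typed_val tan_val)
  next
   fix v assume v: "v \<in> Arr ?S V ?P & tan_q1 X \<cdot>\<^bsub>?S\<^esub> v = a & tan_q2 X \<cdot>\<^bsub>?S\<^esub> v = c"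
   let ?v = "Tarr (Tmor ?b ?b W) (tT2 X) v"
   have "?v = u"
   proof (rule tpb_eqI[OF pb])
    have "mor (Tmor ?b ?b W)" using cel_mor(1)[OF u(1)] u(2) by simp
    then show "cel ?v" by (rule celI) (use v V W in \<open>auto simp: slice_def homcat_def tan_val\<close>)
   qed (use u v in \<open>auto simp: slice_def homcat_def typed_val tan_val intro!: tarr_eqI\<close>)
   then show "v = tval u" by (metis tarr.sel(3))
  qed
 qed
 have idf: "id2 K (id1 K ?b) \<bullet> f = f" if "f \<in> hom2 K ?b ?b W (id1 K ?b)" "W \<in> hom1 K ?b ?b" for f W
  by (rule hc_units(2)[OF t(1) t(1) that(2) hom(3) that(1)])
 have trm: "is_terminal ?S ?I"
  unfolding is_terminal_def
 proof (intro conjI ballI ob)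
  fix V assume V: "V \<in> Ob ?S"
  obtain W w where "V = (W, w)" by (cases V)
  with V show "\<exists>!f. f \<in> Arr ?S V ?I"
   by (intro ex1I[of _ w]) (auto simp: slice_def homcat_def idf)
 qed
 have unit: "to_terminal ?S ?I ?A = tan_p X"
  unfolding to_terminal_def
  by (rule the_equality) (use cells hom in \<open>auto simp: slice_def homcat_def idf\<close>)
 have ida: "id2 K (tanT X) \<in> Arr ?S ?A ?A" "tan_z X \<bullet> tan_p X \<in> Arr ?S ?A ?A"
 proof -
  have "tp X**cid (tT X) = tp X" "tp X**tz X**tp X = tp X" by (simp_all add: vc_pre[OF pz])
  from arg_cong[OF this(1), of tval] arg_cong[OF this(2), of tval]
  show "id2 K (tanT X) \<in> Arr ?S ?A ?A" "tan_z X \<bullet> tan_p X \<in> Arr ?S ?A ?A"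
   using hom cells hc_units(1)[OF t(1) t(1) hom(1,3) cells(1)] hc_id2[OF t(1) t(1) hom(1)] hc_vcomp[OF t(1) t(1) hom(1,3,1) cells(1,2)]
   by (simp_all add: slice_def homcat_def typed_val tan_val)
 qed
 show ?thesis
  unfolding commutative_monoid_def
 proof (intro conjI ballI trm prod)
  show "tan_z X \<in> Arr ?S ?I ?A" "tan_s X \<in> Arr ?S ?P ?A"
   using arg_cong[OF pz, of tval] arg_cong[OF ps, of tval] cells by (simp_all add: slice_def homcat_def typed_val tan_val)
 next
  fix V a c d assume "V \<in> Ob ?S" "a \<in> Arr ?S V ?A" "c \<in> Arr ?S V ?A" "d \<in> Arr ?S V ?A"
  moreover obtain W w where "V = (W, w)" by (cases V)
  ultimately have W: "(W, w) \<in> Ob ?S" and a: "a \<in> Arr ?S (W, w) ?A" and c: "c \<in> Arr ?S (W, w) ?A"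
   and d: "d \<in> Arr ?S (W, w) ?A" and V: "V = (W, w)" by simp_all
  have sarr: "tan_s X \<bullet> tval u \<in> Arr ?S (W, w) ?A"
   if "cel u" "tdom u = Tmor ?b ?b W" "tcod u = tT2 X" "tq1 X**u = Tarr (Tmor ?b ?b W) (tT X) a" "a \<in> Arr ?S (W, w) ?A" for u a
  proof -
   have "cel (ts X**u)" "tp X**ts X**u = Tarr (Tmor ?b ?b W) (mid ?b) w"
    using that by (simp_all add: vc_pre[OF ps] typed(2)[OF W])
   from this(1) arg_cong[OF this(2), of tval] show ?thesis using that
    by (simp add: slice_def homcat_def cel_def typed_val tan_val del: cel_mor)
  qed
  obtain u where u: "cel u" "tdom u = Tmor ?b ?b W" "tcod u = tT2 X" "tq1 X**u = Tarr (Tmor ?b ?b W) (tT X) a"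
    "tq2 X**u = Tarr (Tmor ?b ?b W) (tT X) c" "?pr (W, w) a c = tval u" using ex[OF W a c] by blast
  obtain u' where u': "cel u'" "tdom u' = Tmor ?b ?b W" "tcod u' = tT2 X" "tq1 X**u' = Tarr (Tmor ?b ?b W) (tT X) c"
    "tq2 X**u' = Tarr (Tmor ?b ?b W) (tT X) d" "?pr (W, w) c d = tval u'" using ex[OF W c d] by blast
  obtain v where v: "cel v" "tdom v = Tmor ?b ?b W" "tcod v = tT2 X" "tq1 X**v = Tarr (Tmor ?b ?b W) (tT X) (tan_s X \<bullet> tval u)"
    "tq2 X**v = Tarr (Tmor ?b ?b W) (tT X) d" "?pr (W, w) (tan_s X \<bullet> tval u) d = tval v"
   using ex[OF W sarr[OF u(1-4) a] d] by blast
  obtain v' where v': "cel v'" "tdom v' = Tmor ?b ?b W" "tcod v' = tT2 X"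
    "tq1 X**v' = Tarr (Tmor ?b ?b W) (tT X) a"
    "tq2 X**v' = Tarr (Tmor ?b ?b W) (tT X) (tan_s X \<bullet> tval u')" "?pr (W, w) a (tan_s X \<bullet> tval u') = tval v'"
   using ex[OF W a sarr[OF u'(1-4) c]] by blast
  have "ts X**u = Tarr (Tmor ?b ?b W) (tT X) (tan_s X \<bullet> tval u)" "ts X**u' = Tarr (Tmor ?b ?b W) (tT X) (tan_s X \<bullet> tval u')"
   using u u' by (auto intro!: tarr_eqI simp: typed_val tan_val)
  moreover have "mor (Tmor ?b ?b W)" using cel_mor(1)[OF u(1)] u(2) by simp
  ultimately have "ts X**v = ts X**v'"
   using ad[unfolded addb_def, THEN conjunct2, THEN conjunct2, THEN conjunct1, rule_format, of "Tmor ?b ?b W" u v u' v']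
    u(1-5) v(1-5) u'(1-5) v'(1-5) by simp
  from arg_cong[OF this, of tval] have "tan_s X \<bullet> tval v = tan_s X \<bullet> tval v'" by (simp add: typed_val tan_val)
  then show "tan_s X \<cdot>\<^bsub>?S\<^esub> ?pr V (tan_s X \<cdot>\<^bsub>?S\<^esub> ?pr V a c) d = tan_s X \<cdot>\<^bsub>?S\<^esub> ?pr V a (tan_s X \<cdot>\<^bsub>?S\<^esub> ?pr V c d)"
   using u(6) v(6) u'(6) v'(6) V by (simp add: slice_def homcat_def)
 next
  obtain u where u: "cel u" "tdom u = tT X" "tcod u = tT2 X" "tq1 X**u = Tarr (tT X) (tT X) (tan_z X \<bullet> tan_p X)"
    "tq2 X**u = Tarr (tT X) (tT X) (id2 K (tanT X))" "?pr ?A (tan_z X \<bullet> tan_p X) (id2 K (tanT X)) = tval u"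
   using ex[OF ob(3) ida(2,1)] unfolding T(1) by blast
  have "tq1 X**u = tz X**tp X" "tq2 X**u = cid (tT X)"
   unfolding u(4,5) by (auto intro!: tarr_eqI simp: typed_val tan_val)
  then have "ts X**u = cid (tT X)" using ad u(1-3) unfolding addb_def by blast
  from arg_cong[OF this, of tval]
  show "tan_s X \<cdot>\<^bsub>?S\<^esub> ?pr ?A (tan_z X \<cdot>\<^bsub>?S\<^esub> to_terminal ?S ?I ?A) (idn ?S ?A) = idn ?S ?A"
   using u(6) unit by (simp add: slice_def homcat_def typed_val tan_val)
 next
  obtain u where u: "cel u" "tdom u = tT X" "tcod u = tT2 X" "tq2 X**u = Tarr (tT X) (tT X) (tan_z X \<bullet> tan_p X)"
    "tq1 X**u = Tarr (tT X) (tT X) (id2 K (tanT X))" "?pr ?A (id2 K (tanT X)) (tan_z X \<bullet> tan_p X) = tval u"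
   using ex[OF ob(3) ida] unfolding T(1) by blast
  have "tq2 X**u = tz X**tp X" "tq1 X**u = cid (tT X)"
   unfolding u(4,5) by (auto intro!: tarr_eqI simp: typed_val tan_val)
  then have "ts X**u = cid (tT X)" using ad u(1-3) unfolding addb_def by blast
  from arg_cong[OF this, of tval]
  show "tan_s X \<cdot>\<^bsub>?S\<^esub> ?pr ?A (idn ?S ?A) (tan_z X \<cdot>\<^bsub>?S\<^esub> to_terminal ?S ?I ?A) = idn ?S ?A"
   using u(6) unit by (simp add: slice_def homcat_def typed_val tan_val)
 next
  have q: "tan_q1 X \<in> Arr ?S ?P ?A" "tan_q2 X \<in> Arr ?S ?P ?A"
   using prod unfolding is_product_def by blast+
  obtain u where u: "cel u" "tdom u = tT2 X" "tcod u = tT2 X" "tq1 X**u = Tarr (tT2 X) (tT X) (tan_q2 X)"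
    "tq2 X**u = Tarr (tT2 X) (tT X) (tan_q1 X)" "?pr ?P (tan_q2 X) (tan_q1 X) = tval u"
   using ex[OF ob(2) q(2,1)] unfolding T(2) by blast
  have "tq1 X**u = tq2 X" "tq2 X**u = tq1 X"
   unfolding u(4,5) by (auto intro!: tarr_eqI simp: typed_val tan_val)
  then have "ts X**u = ts X" using ad u(1-3) unfolding addb_def by blast
  from arg_cong[OF this, of tval]
  show "tan_s X \<cdot>\<^bsub>?S\<^esub> ?pr ?P (tan_q2 X) (tan_q1 X) = tan_s X"
   using u(6) by (simp add: slice_def homcat_def typed_val tan_val)
 qed
qed

definition fibre_powers :: "('o, 'm, 'c) tangentad => bool" where
 "fibre_powers X \<longleftrightarrow> (\<forall>n\<ge>1. \<exists>P q. mor P & msrc P = base X & mtrg P = base X &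
   (\<forall>i<n. cel (q i) & tdom (q i) = P & tcod (q i) = tT X) &
   (\<forall>m h. mor h & mtrg h = base X -->
     tfp n (tTm X m oo P oo h) (%i. tTm X m|>q i<|h) (tTm X m|>tp X<|h)))"

text \<open>The universality of the vertical lift. The cell \<open>r\<close> is the induced arrow \<open>\<langle>z T q1, l q2\<rangle> : T2 \<Rightarrow> T T2\<close>, given by its
 projections.\<close>

definition lift_univ :: "('o, 'm, 'c) tangentad => bool" where
 "lift_univ X \<longleftrightarrow> (\<exists>r. cel r & tdom r = tT2 X & tcod r = tT X oo tT2 X &
   (tT X|>tq1 X)**r = (tz X<|tT X)**tq1 X & (tT X|>tq2 X)**r = tl X**tq2 X &
   (\<forall>h. mor h & mtrg h = base X --> tpb ((tp X**tq1 X)<|h) (((tT X|>ts X)**r)<|h) (tz X<|h) (tT X|>tp X<|h)))"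

lemma pairing_rw:
 assumes pb: "tpb a b f g" and u: "cel u" "tcod u = tdom a"
  and types: "tdom u = Tmor X Y W" "tdom a = Tmor X Y P"
  and eq: "a**u = x" "b**u = y"
 shows "pairing (homcat K X Y) P (tval a) (tval b) W (tval x) (tval y) = tval u"
 by (rule pairing_tpb[OF pb u types]) (simp_all add: eq)

lemma fibre_power_bridge:
 assumes X: "pretan X" and P: "mor P" "msrc P = base X" "mtrg P = base X"
  and q: "!!i. i < n ==> cel (q i) & tdom (q i) = P & tcod (q i) = tT X"
  and h: "mor h" "mtrg h = base X"
 shows "is_fibre_power (homcat K (msrc h) (base X)) n ((iter1 K (base X) (tanT X) m \<odot> mval P) \<odot> mval h)
   (%i. (iter1 K (base X) (tanT X) m \<rhd> tval (q i)) \<lhd> mval h)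
   ((iter1 K (base X) (tanT X) m \<odot> tanT X) \<odot> mval h) ((iter1 K (base X) (tanT X) m \<odot> id1 K (base X)) \<odot> mval h)
   ((iter1 K (base X) (tanT X) m \<rhd> tan_p X) \<lhd> mval h) \<longleftrightarrow>
  tfp n (tTm X m oo P oo h) (%i. tTm X m|>q i<|h) (tTm X m|>tp X<|h)"
proof -
 note t [simp] = pretan_simps[OF X]
 let ?b = "base X" and ?Tm = "iter1 K (base X) (tanT X) m" and ?H = "mval h" and ?W = "msrc h"
 have hh: "h = Tmor ?W ?b ?H" using h by (intro tmor_eta) simp_all
 have m: "mor ((tTm X m oo P) oo h)" "mor ((tTm X m oo tT X) oo h)" "mor ((tTm X m oo mid ?b) oo h)"
  using P h by simp_all
 have hm: "(?Tm \<odot> mval P) \<odot> ?H \<in> hom1 K ?W ?b" "(?Tm \<odot> tanT X) \<odot> ?H \<in> hom1 K ?W ?b" "(?Tm \<odot> id1 K ?b) \<odot> ?H \<in> hom1 K ?W ?b"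
  using m P h by (simp_all add: mor_def typed_val tan_val del: mor_obj mor_mcomp mcomp_assoc mcomp_mid)
 have g1: "Tmor ?W ?b ((?Tm \<odot> mval P) \<odot> ?H) = tTm X m oo P oo h"
 proof -
  have "(tTm X m oo P) oo h = tTm X m oo P oo h" using P h by simp
  then show ?thesis using P h by (simp add: mcomp_def tTm_def)
 qed
 have g2: "Tarr (Tmor ?W ?b ((?Tm \<odot> tanT X) \<odot> ?H)) (Tmor ?W ?b ((?Tm \<odot> id1 K ?b) \<odot> ?H)) ((?Tm \<rhd> tan_p X) \<lhd> ?H) = tTm X m|>tp X<|h"
 proof -
  have "(tTm X m|>tp X)<|h = tTm X m|>tp X<|h" using h by simp
  then show ?thesis using h by (simp add: mcomp_def tTm_def lw_def rw_def tp_def tT_def mid_def)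
 qed
 have g3: "Tarr (Tmor ?W ?b ((?Tm \<odot> mval P) \<odot> ?H)) (Tmor ?W ?b ((?Tm \<odot> tanT X) \<odot> ?H)) ((?Tm \<rhd> tval (q i)) \<lhd> ?H) = tTm X m|>q i<|h"
  if "i < n" for i
 proof -
  have qi: "cel (q i)" "tdom (q i) = P" "tcod (q i) = tT X" using q[OF that] by auto
  have "(tTm X m|>q i)<|h = tTm X m|>q i<|h" using qi P h by simp
  moreover have "(tTm X m|>q i)<|h = Tarr (Tmor ?W ?b ((?Tm \<odot> mval P) \<odot> ?H)) (Tmor ?W ?b ((?Tm \<odot> tanT X) \<odot> ?H)) ((?Tm \<rhd> tval (q i)) \<lhd> ?H)"
   using qi P h by (simp add: lw_def rw_def mcomp_def tTm_def tT_def)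
  ultimately show ?thesis by simp
 qed
 have "tfp n (Tmor ?W ?b ((?Tm \<odot> mval P) \<odot> ?H))
   (%i. Tarr (Tmor ?W ?b ((?Tm \<odot> mval P) \<odot> ?H)) (Tmor ?W ?b ((?Tm \<odot> tanT X) \<odot> ?H)) ((?Tm \<rhd> tval (q i)) \<lhd> ?H))
   (Tarr (Tmor ?W ?b ((?Tm \<odot> tanT X) \<odot> ?H)) (Tmor ?W ?b ((?Tm \<odot> id1 K ?b) \<odot> ?H)) ((?Tm \<rhd> tan_p X) \<lhd> ?H)) \<longleftrightarrow>
  tfp n (tTm X m oo P oo h) (%i. tTm X m|>q i<|h) (tTm X m|>tp X<|h)"
  by (subst tfp_cong[OF g3], assumption) (simp only: g1 g2)
 then show ?thesis using is_fibre_power_iff_tfp[OF _ t(1) hm] h by simp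
qed

text \<open>Every axiom with an induced arrow is assumed for an arbitrary cell with the projections of that arrow.\<close>

lemma is_tangentad_I:
 assumes X: "pretan X"
  and eqs: "(tT X|>tp X)**tl X = tz X**tp X"
  "tl X**tz X = (tT X|>tz X)**tz X"
  "(tp X<|tT X)**tc X = tT X|>tp X"
  "tc X**(tT X|>tz X) = tz X<|tT X"
  "(tT X|>tl X)**tl X = (tl X<|tT X)**tl X"
  "tc X**tl X = tl X"
  "(tc X<|tT X)**(tT X|>tc X)**(tl X<|tT X) = (tT X|>tl X)**tc X"
  "tc X**tc X = cid (tT X oo tT X)"
  "(tT X|>tc X)**(tc X<|tT X)**(tT X|>tc X) =
   (tc X<|tT X)**(tT X|>tc X)**(tc X<|tT X)"
  and la: "cel r" "tdom r = tT2 X" "tcod r = tT X oo tT2 X"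
   "(tT X|>tq1 X)**r = tl X**tq1 X" "(tT X|>tq2 X)**r = tl X**tq2 X"
   "tl X**ts X = (tT X|>ts X)**r"
  and fa: "cel r'" "tdom r' = tT X oo tT2 X" "tcod r' = tT2 X oo tT X"
   "(tq1 X<|tT X)**r' = tc X**(tT X|>tq1 X)" "(tq2 X<|tT X)**r' = tc X**(tT X|>tq2 X)"
   "tc X**(tT X|>ts X) = (ts X<|tT X)**r'"
  and pb: "!!m h. mor h ==> mtrg h = base X ==>
   tpb (tTm X m|>tq1 X<|h) (tTm X m|>tq2 X<|h) (tTm X m|>tp X<|h) (tTm X m|>tp X<|h)"
  and ad: "addb X" and fp: "fibre_powers X" and lu: "lift_univ X"
 shows "is_tangentad K X"
proof -
 note t [simp] = pretan_simps[OF X]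
 let ?b = "base X"
 have Th: "tT X = Tmor ?b ?b (tanT X)" "tT2 X = Tmor ?b ?b (tanT2 X)" by (simp_all add: tT_def tT2_def)
 have pbh: "tpb (tTm X m|>tq1 X) (tTm X m|>tq2 X) (tTm X m|>tp X) (tTm X m|>tp X)" for m
  using pb[of "mid ?b" m] by simp
 have pb0: "tpb (tq1 X) (tq2 X) (tp X) (tp X)" using pbh[of 0] by (simp add: tTm_rec)
 have pb1: "tpb (tT X|>tq1 X) (tT X|>tq2 X) (tT X|>tp X) (tT X|>tp X)"
  using pbh[of "Suc 0"] by (simp add: tTm_rec)
 have pbT: "tpb (tq1 X<|tT X) (tq2 X<|tT X) (tp X<|tT X) (tp X<|tT X)"
  using pb[of "tT X" 0] by (simp add: tTm_rec)
 have unt: "tval (a**b) = tval a \<bullet> tval b" "tval (f|>a) = mval f \<rhd> tval a" "tval (a<|f) = tval a \<lhd> mval f" for a b f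
  by (simp_all add: typed_val)
 show ?thesis
  unfolding is_tangentad_def
 proof (rule tangent_structure.intro)
  show "?b \<in> obj K" by simp
  show "tanT X \<in> hom1 K ?b ?b" "tanT2 X \<in> hom1 K ?b ?b"
   using t(2,3) by (simp_all add: mor_def tan_val del: t(2,3) mor_obj)
  show "tan_q1 X \<in> hom2 K ?b ?b (tanT2 X) (tanT X)" "tan_q2 X \<in> hom2 K ?b ?b (tanT2 X) (tanT X)"
   "tan_p X \<in> hom2 K ?b ?b (tanT X) (id1 K ?b)" "tan_z X \<in> hom2 K ?b ?b (id1 K ?b) (tanT X)"
   "tan_s X \<in> hom2 K ?b ?b (tanT2 X) (tanT X)" "tan_l X \<in> hom2 K ?b ?b (tanT X) (tanT X \<odot> tanT X)"
   "tan_c X \<in> hom2 K ?b ?b (tanT X \<odot> tanT X) (tanT X \<odot> tanT X)"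
   using t(4-10) by (simp_all add: cel_def tan_val typed_val del: t cel_mor)
 next
  fix m
  have e: "(tTm X m|>x)<|h = tTm X m|>x<|h"
   if "cel x" "msrc (tdom x) = ?b" "mtrg (tdom x) = ?b" "mor h" "mtrg h = ?b" for x h using that by simp
  show "let Tm = iter1 K ?b (tanT X) m in pointwise_pullback K ?b ?b (Tm \<odot> tanT2 X) (Tm \<rhd> tan_q1 X) (Tm \<rhd> tan_q2 X)
    (Tm \<odot> tanT X) (Tm \<odot> tanT X) (Tm \<odot> id1 K ?b) (Tm \<rhd> tan_p X) (Tm \<rhd> tan_p X)"
   unfolding Let_def pointwise_pullback_def
  proof (intro conjI ballI)
   show "is_pullback (homcat K ?b ?b) (iter1 K ?b (tanT X) m \<odot> tanT2 X) (iter1 K ?b (tanT X) m \<rhd> tan_q1 X) (iter1 K ?b (tanT X) m \<rhd> tan_q2 X)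
    (iter1 K ?b (tanT X) m \<odot> tanT X) (iter1 K ?b (tanT X) m \<odot> tanT X) (iter1 K ?b (tanT X) m \<odot> id1 K ?b)
    (iter1 K ?b (tanT X) m \<rhd> tan_p X) (iter1 K ?b (tanT X) m \<rhd> tan_p X)"
    using tpb_is_pullback[OF pbh[of m], of ?b ?b "iter1 K ?b (tanT X) m \<odot> tanT2 X" "iter1 K ?b (tanT X) m \<odot> tanT X"
      "iter1 K ?b (tanT X) m \<odot> tanT X" "iter1 K ?b (tanT X) m \<odot> id1 K ?b"]
    by (simp add: typed_val tan_val del: mcomp_mid) (simp add: mcomp_def tTm_def tT_def tT2_def mid_def del: mcomp_mid)
  next
   fix W H assume "W \<in> obj K" "H \<in> hom1 K W ?b"
   then have h: "mor (Tmor W ?b H)" by (simp add: mor_def)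
   have "tpb ((tTm X m|>tq1 X)<|Tmor W ?b H) ((tTm X m|>tq2 X)<|Tmor W ?b H)
     ((tTm X m|>tp X)<|Tmor W ?b H) ((tTm X m|>tp X)<|Tmor W ?b H)"
    using pb[OF h, of m] h by simp
   from tpb_is_pullback[OF this, of W ?b "(iter1 K ?b (tanT X) m \<odot> tanT2 X) \<odot> H" "(iter1 K ?b (tanT X) m \<odot> tanT X) \<odot> H"
     "(iter1 K ?b (tanT X) m \<odot> tanT X) \<odot> H" "(iter1 K ?b (tanT X) m \<odot> id1 K ?b) \<odot> H"]
   show "is_pullback (homcat K W ?b) ((iter1 K ?b (tanT X) m \<odot> tanT2 X) \<odot> H) ((iter1 K ?b (tanT X) m \<rhd> tan_q1 X) \<lhd> H)
     ((iter1 K ?b (tanT X) m \<rhd> tan_q2 X) \<lhd> H)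
    ((iter1 K ?b (tanT X) m \<odot> tanT X) \<odot> H) ((iter1 K ?b (tanT X) m \<odot> tanT X) \<odot> H) ((iter1 K ?b (tanT X) m \<odot> id1 K ?b) \<odot> H)
    ((iter1 K ?b (tanT X) m \<rhd> tan_p X) \<lhd> H) ((iter1 K ?b (tanT X) m \<rhd> tan_p X) \<lhd> H)"
    by (simp add: typed_val tan_val del: rw_lw mcomp_assoc mcomp_mid) (simp add: mcomp_def tTm_def tT_def tT2_def mid_def del: mcomp_mid)
  qed
 next
  fix n :: nat assume n: "1 \<le> n"
  obtain P q where P: "mor P" "msrc P = ?b" "mtrg P = ?b" and q: "!!i. i < n ==> cel (q i) & tdom (q i) = P & tcod (q i) = tT X"
   and f: "!!m h. mor h ==> mtrg h = ?b ==> tfp n (tTm X m oo P oo h) (%i. tTm X m|>q i<|h) (tTm X m|>tp X<|h)"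
   using fp n unfolding fibre_powers_def by metis
  have Pm: "P = Tmor ?b ?b (mval P)" using P by (intro tmor_eta)
  show "\<exists>Tn q. Tn \<in> hom1 K ?b ?b & (\<forall>i<n. q i \<in> hom2 K ?b ?b Tn (tanT X)) &
   (\<forall>m. let Tm = iter1 K ?b (tanT X) m in
    pointwise_fibre_power K ?b ?b n (Tm \<odot> Tn) (%i. Tm \<rhd> q i) (Tm \<odot> tanT X) (Tm \<odot> id1 K ?b) (Tm \<rhd> tan_p X))"
  proof (intro exI[of _ "mval P"] exI[of _ "%i. tval (q i)"] conjI allI impI)
   show "mval P \<in> hom1 K ?b ?b" using P by (simp add: mor_def del: mor_obj)
   fix i assume "i < n"
   with q have "cel (q i)" "tdom (q i) = P" "tcod (q i) = tT X" by auto
   then show "tval (q i) \<in> hom2 K ?b ?b (mval P) (tanT X)"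
    using P by (simp add: cel_def tan_val del: cel_mor)
  next
   fix m
   let ?Tm = "iter1 K ?b (tanT X) m"
   have main: "is_fibre_power (homcat K W ?b) n ((?Tm \<odot> mval P) \<odot> H) (%i. (?Tm \<rhd> tval (q i)) \<lhd> H)
     ((?Tm \<odot> tanT X) \<odot> H) ((?Tm \<odot> id1 K ?b) \<odot> H) ((?Tm \<rhd> tan_p X) \<lhd> H)"
    if "W \<in> obj K" "H \<in> hom1 K W ?b" for W H
   proof -
    have h: "mor (Tmor W ?b H)" using that by (simp add: mor_def)
    show ?thesis using fibre_power_bridge[where n = n and m = m and q = q, OF X P q h] f[OF h, of m] by simp
   qed
   have idr: "x \<odot> id1 K ?b = x" if "x \<in> hom1 K ?b ?b" for x using comp1_id1[OF t(1) t(1) that] .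
   have Tmh: "?Tm \<in> hom1 K ?b ?b" using t(11)[of m] by (simp add: mor_def tan_val del: mor_obj t)
   have Ph: "mval P \<in> hom1 K ?b ?b" "tanT X \<in> hom1 K ?b ?b" "id1 K ?b \<in> hom1 K ?b ?b"
    using P t(2) id1_closed[OF t(1)] by (simp_all add: mor_def tan_val del: mor_obj t)
   have c: "?Tm \<odot> mval P \<in> hom1 K ?b ?b" "?Tm \<odot> tanT X \<in> hom1 K ?b ?b" "?Tm \<odot> id1 K ?b \<in> hom1 K ?b ?b"
    using comp1_closed[OF t(1) t(1) t(1) _ Tmh] Ph by simp_all
   have e1: "(?Tm \<rhd> tval (q i)) \<lhd> id1 K ?b = ?Tm \<rhd> tval (q i)" if "i < n" for i
   proof -
    have qi: "cel (q i)" "tdom (q i) = P" "tcod (q i) = tT X" using q[OF that] by auto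
    have "tval ((tTm X m|>q i)<|mid ?b) = tval (tTm X m|>q i)" using qi P by simp
    then show ?thesis by (simp only: typed_val tan_val)
   qed
   have e2: "(?Tm \<rhd> tan_p X) \<lhd> id1 K ?b = ?Tm \<rhd> tan_p X"
   proof -
    have "tval ((tTm X m|>tp X)<|mid ?b) = tval (tTm X m|>tp X)" by simp
    then show ?thesis by (simp only: typed_val tan_val)
   qed
   have "is_fibre_power (homcat K ?b ?b) n (?Tm \<odot> mval P) (%i. ?Tm \<rhd> tval (q i)) (?Tm \<odot> tanT X) (?Tm \<odot> id1 K ?b) (?Tm \<rhd> tan_p X)"
    by (rule is_fibre_power_cong[OF e1, THEN iffD1])
     (use main[OF t(1) Ph(3)] in \<open>simp_all only: e2 idr[OF c(1)] idr[OF c(2)] idr[OF c(3)]\<close>)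
   then show "let Tm = ?Tm in
    pointwise_fibre_power K ?b ?b n (Tm \<odot> mval P) (%i. Tm \<rhd> tval (q i)) (Tm \<odot> tanT X) (Tm \<odot> id1 K ?b) (Tm \<rhd> tan_p X)"
    unfolding Let_def pointwise_fibre_power_def using main by blast
  qed
 next
  show "add_monoid X" by (rule add_monoid_if_addb[OF X pb0 ad])
 next
  have "pairing (homcat K ?b ?b) (tanT X \<odot> tanT2 X) (tval (tT X|>tq1 X)) (tval (tT X|>tq2 X)) (tanT2 X)
    (tval (tl X**tq1 X)) (tval (tl X**tq2 X)) = tval r"
   by (rule pairing_rw[OF pb1 la(1) _ _ _ la(4,5)]) (simp_all add: la, simp_all add: mcomp_def Th)
  then show "tan_l X \<bullet> tan_s X = (tanT X \<rhd> tan_s X) \<bullet> pairing (homcat K ?b ?b) (tanT X \<odot> tanT2 X)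
    (tanT X \<rhd> tan_q1 X) (tanT X \<rhd> tan_q2 X) (tanT2 X) (tan_l X \<bullet> tan_q1 X) (tan_l X \<bullet> tan_q2 X)"
   using arg_cong[OF la(6), of tval] by (simp add: typed_val tan_val)
  have "pairing (homcat K ?b ?b) (tanT2 X \<odot> tanT X) (tval (tq1 X<|tT X)) (tval (tq2 X<|tT X)) (tanT X \<odot> tanT2 X)
    (tval (tc X**(tT X|>tq1 X))) (tval (tc X**(tT X|>tq2 X))) = tval r'"
   by (rule pairing_rw[OF pbT fa(1) _ _ _ fa(4,5)]) (simp_all add: fa, simp_all add: mcomp_def Th)
  then show "tan_c X \<bullet> (tanT X \<rhd> tan_s X) = (tan_s X \<lhd> tanT X) \<bullet> pairing (homcat K ?b ?b) (tanT2 X \<odot> tanT X)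
    (tan_q1 X \<lhd> tanT X) (tan_q2 X \<lhd> tanT X) (tanT X \<odot> tanT2 X) (tan_c X \<bullet> (tanT X \<rhd> tan_q1 X)) (tan_c X \<bullet> (tanT X \<rhd> tan_q2 X))"
   using arg_cong[OF fa(6), of tval] by (simp add: typed_val tan_val)
 next
  obtain r where r: "cel r" "tdom r = tT2 X" "tcod r = tT X oo tT2 X"
   "(tT X|>tq1 X)**r = (tz X<|tT X)**tq1 X" "(tT X|>tq2 X)**r = tl X**tq2 X"
   and p: "!!h. mor h ==> mtrg h = base X ==> tpb ((tp X**tq1 X)<|h) (((tT X|>ts X)**r)<|h) (tz X<|h) (tT X|>tp X<|h)"
   using lu unfolding lift_univ_def by blast
  have "pairing (homcat K ?b ?b) (tanT X \<odot> tanT2 X) (tval (tT X|>tq1 X)) (tval (tT X|>tq2 X)) (tanT2 X)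
    (tval ((tz X<|tT X)**tq1 X)) (tval (tl X**tq2 X)) = tval r"
   by (rule pairing_rw[OF pb1 r(1) _ _ _ r(4,5)]) (simp_all add: r, simp_all add: mcomp_def Th)
  then have pr: "pairing (homcat K ?b ?b) (tanT X \<odot> tanT2 X) (tanT X \<rhd> tan_q1 X) (tanT X \<rhd> tan_q2 X) (tanT2 X)
    ((tan_z X \<lhd> tanT X) \<bullet> tan_q1 X) (tan_l X \<bullet> tan_q2 X) = tval r" by (simp add: typed_val tan_val)
  have p0: "tpb (tp X**tq1 X) ((tT X|>ts X)**r) (tz X) (tT X|>tp X)" using p[of "mid ?b"] r(1-3) by simp
  have "is_pullback (homcat K ?b ?b) (tanT2 X) (tval (tp X**tq1 X)) (tval ((tT X|>ts X)**r)) (id1 K ?b) (tanT X \<odot> tanT X) (tanT X)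
    (tval (tz X)) (tval (tT X|>tp X))"
   by (rule tpb_is_pullback[OF p0]) (simp_all add: mcomp_def tT_def tT2_def mid_def)
  moreover have "is_pullback (homcat K W ?b) (tanT2 X \<odot> H) ((tan_p X \<bullet> tan_q1 X) \<lhd> H) (((tanT X \<rhd> tan_s X) \<bullet> tval r) \<lhd> H)
    (id1 K ?b \<odot> H) ((tanT X \<odot> tanT X) \<odot> H) (tanT X \<odot> H) (tan_z X \<lhd> H) ((tanT X \<rhd> tan_p X) \<lhd> H)"
   if "W \<in> obj K" "H \<in> hom1 K W ?b" for W H
  proof -
   have h: "mor (Tmor W ?b H)" using that by (simp add: mor_def)
   have "tpb ((tp X**tq1 X)<|Tmor W ?b H) (((tT X|>ts X)**r)<|Tmor W ?b H) (tz X<|Tmor W ?b H) ((tT X|>tp X)<|Tmor W ?b H)"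
    using p[OF h] h r(1-3) by simp
   from tpb_is_pullback[OF this, of W ?b "tanT2 X \<odot> H" "id1 K ?b \<odot> H" "(tanT X \<odot> tanT X) \<odot> H" "tanT X \<odot> H"]
   show ?thesis
    by (simp add: typed_val tan_val del: rw_lw rw_vc mcomp_assoc mcomp_mid) (simp add: mcomp_def tT_def tT2_def mid_def del: mcomp_mid)
  qed
  ultimately show "pointwise_pullback K ?b ?b (tanT2 X) (tan_p X \<bullet> tan_q1 X)
   ((tanT X \<rhd> tan_s X) \<bullet> pairing (homcat K ?b ?b) (tanT X \<odot> tanT2 X) (tanT X \<rhd> tan_q1 X) (tanT X \<rhd> tan_q2 X) (tanT2 X) ((tan_z X \<lhd> tanT X) \<bullet> tan_q1 X) (tan_l X \<bullet> tan_q2 X))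
   (id1 K ?b) (tanT X \<odot> tanT X) (tanT X) (tan_z X) (tanT X \<rhd> tan_p X)"
   unfolding pointwise_pullback_def pr by (simp add: typed_val tan_val)
 qed (use eqs[THEN arg_cong[of _ _ tval]] in \<open>simp_all add: typed_val tan_val\<close>)
qed

lemma pretan_if_tangentad: "is_tangentad K X ==> pretan X"
 unfolding pretan_def by (simp add: tangentad_types)

lemma tangentad_addb:
 assumes X: "is_tangentad K X" shows "addb X"
proof (rule addb_if_add_monoid[OF pretan_if_tangentad[OF X]])
 interpret tangent_structure K "base X" "tanT X" "tanT2 X" "tan_q1 X" "tan_q2 X"
   "tan_p X" "tan_z X" "tan_s X" "tan_l X" "tan_c X" using X by (simp add: is_tangentad_def)
 show "add_monoid X" by (rule additive_bundle)
 show "tpb (tq1 X) (tq2 X) (tp X) (tp X)"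
  using T2_tpb(1)[OF X, of "mid (base X)"] tangentad_types[OF X] by simp
qed

lemma tangentad_fibre_powers:
 assumes X: "is_tangentad K X" shows "fibre_powers X"
 unfolding fibre_powers_def
proof (intro allI impI)
 interpret tangent_structure K "base X" "tanT X" "tanT2 X" "tan_q1 X" "tan_q2 X"
   "tan_p X" "tan_z X" "tan_s X" "tan_l X" "tan_c X" using X by (simp add: is_tangentad_def)
 note t = tangentad_types[OF X]
 fix n :: nat assume "1 \<le> n"
 then obtain Tn q where Tn: "Tn \<in> hom1 K (base X) (base X)" and q: "\<forall>i<n. q i \<in> hom2 K (base X) (base X) Tn (tanT X)"
   and f: "!!m. pointwise_fibre_power K (base X) (base X) n (iter1 K (base X) (tanT X) m \<odot> Tn) (%i. iter1 K (base X) (tanT X) m \<rhd> q i)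
     (iter1 K (base X) (tanT X) m \<odot> tanT X) (iter1 K (base X) (tanT X) m \<odot> id1 K (base X)) (iter1 K (base X) (tanT X) m \<rhd> tan_p X)"
  using Tn_pullback[of n] unfolding Let_def by blast
 let ?P = "Tmor (base X) (base X) Tn" and ?q = "%i. Tarr (Tmor (base X) (base X) Tn) (tT X) (q i)"
 have P: "mor ?P" using Tn t(1) by (simp add: mor_def)
 have q': "cel (?q i) & tdom (?q i) = ?P & tcod (?q i) = tT X" if "i < n" for i
  using q that P t(2) by (auto intro!: celI simp: tan_val)
 show "\<exists>P q. mor P & msrc P = base X & mtrg P = base X &
   (\<forall>i<n. cel (q i) & tdom (q i) = P & tcod (q i) = tT X) &
   (\<forall>m h. mor h & mtrg h = base X -->
     tfp n (tTm X m oo P oo h) (%i. tTm X m|>q i<|h) (tTm X m|>tp X<|h))"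
 proof (intro exI[of _ ?P] exI[of _ ?q] conjI allI impI)
  fix m h assume h: "mor h & mtrg h = base X"
  then have "mval h \<in> hom1 K (msrc h) (base X)" "msrc h \<in> obj K" by (auto simp: mor_def simp del: mor_obj)
  then show "tfp n (tTm X m oo ?P oo h) (%i. tTm X m|>?q i<|h) (tTm X m|>tp X<|h)"
   using fibre_power_bridge[where n = n and m = m and q = ?q and h = h, OF pretan_if_tangentad[OF X] P _ _ q'] h f[of m]
   unfolding pointwise_fibre_power_def by simp
 qed (use P q' in auto)
qed

lemma tangentad_lift_univ:
 assumes X: "is_tangentad K X" shows "lift_univ X"
proof -
 interpret tangent_structure K "base X" "tanT X" "tanT2 X" "tan_q1 X" "tan_q2 X"
   "tan_p X" "tan_z X" "tan_s X" "tan_l X" "tan_c X" using X by (simp add: is_tangentad_def)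
 note t [simp] = tangentad_types[OF X]
 note e = tangentad_eqs[OF X]
 let ?b = "base X"
 have pb1: "tpb (tT X|>tq1 X) (tT X|>tq2 X) (tT X|>tp X) (tT X|>tp X)"
  using T2_tpb(2)[OF X, of "mid ?b"] by simp
 have ex: "tT X|>tp X**tz X<|tT X = tz X**tp X"
  using whisker_exchange[of "tz X" "tp X"] by simp
 obtain r where r [simp]: "cel r" "tdom r = tT2 X" "tcod r = tT X oo tT2 X"
  and r': "(tT X|>tq1 X)**r = (tz X<|tT X)**tq1 X" "(tT X|>tq2 X)**r = tl X**tq2 X"
  by (rule tpb_ex[OF pb1, of "(tz X<|tT X)**tq1 X" "tl X**tq2 X"])
   (simp_all add: vc_pre[OF e(1)] vc_pre[OF ex] e(10))
 have "pairing (homcat K ?b ?b) (tanT X \<odot> tanT2 X) (tval (tT X|>tq1 X)) (tval (tT X|>tq2 X)) (tanT2 X)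
   (tval ((tz X<|tT X)**tq1 X)) (tval (tl X**tq2 X)) = tval r"
  by (rule pairing_rw[OF pb1 r(1) _ _ _ r']) (simp_all, simp_all add: mcomp_def tT_def tT2_def)
 then have pr: "pairing (homcat K ?b ?b) (tanT X \<odot> tanT2 X) (tanT X \<rhd> tan_q1 X) (tanT X \<rhd> tan_q2 X) (tanT2 X)
   ((tan_z X \<lhd> tanT X) \<bullet> tan_q1 X) (tan_l X \<bullet> tan_q2 X) = tval r" by (simp add: typed_val tan_val)
 note lu = lift_universal[unfolded pointwise_pullback_def pr, THEN conjunct2, rule_format]
 show ?thesis unfolding lift_univ_def
 proof (intro exI[of _ r] conjI allI impI r r')
  fix h assume h: "mor h & mtrg h = ?b"
  then have H: "msrc h \<in> obj K" "mval h \<in> hom1 K (msrc h) ?b" by (auto simp: mor_def simp del: mor_obj)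
  have TM: "tT X oo mid ?b = tT X" by simp
  have "tpb ((tp X**tq1 X)<|h) (((tT X|>ts X)**r)<|h) (tz X<|h) ((tT X|>tp X)<|h)"
   by (rule is_pullback_tpb[OF lu[OF H] H(1) t(1)])
    (use h in \<open>auto simp: TM tan_val typed_val intro!: tmor.expand simp del: mcomp_assoc mcomp_mid rw_lw rw_vc\<close>)
  then show "tpb ((tp X**tq1 X)<|h) (((tT X|>ts X)**r)<|h) (tz X<|h) (tT X|>tp X<|h)"
   using h by simp
 qed
qed

text \<open>\<open>Q : P \<rightarrow> X\<close> commutes strictly with all the tangent structure.\<close>

definition strictly :: "('o, 'm) tmor => ('o, 'm, 'c) tangentad => ('o, 'm, 'c) tangentad => bool" where
 "strictly Q P X \<longleftrightarrow> mor Q & msrc Q = base P & mtrg Q = base X &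
   Q oo tT P = tT X oo Q & Q oo tT2 P = tT2 X oo Q &
   Q|>tq1 P = tq1 X<|Q & Q|>tq2 P = tq2 X<|Q & Q|>tp P = tp X<|Q & Q|>tz P = tz X<|Q &
   Q|>ts P = ts X<|Q & Q|>tl P = tl X<|Q & Q|>tc P = tc X<|Q"

lemma strictly_simps:
 assumes Q: "strictly Q P X" and P: "pretan P" and X: "pretan X"
 shows "mor Q" "msrc Q = base P" "mtrg Q = base X"
  "Q oo tT P = tT X oo Q" "Q oo tT2 P = tT2 X oo Q"
  "Q|>tq1 P = tq1 X<|Q" "Q|>tq2 P = tq2 X<|Q" "Q|>tp P = tp X<|Q" "Q|>tz P = tz X<|Q"
   "Q|>ts P = ts X<|Q" "Q|>tl P = tl X<|Q" "Q|>tc P = tc X<|Q"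
   "Q oo tTm P m = tTm X m oo Q"
 and "!!f. mor f ==> mtrg f = base P ==> Q oo tT P oo f = tT X oo Q oo f"
  "!!f. mor f ==> mtrg f = base P ==> Q oo tT2 P oo f = tT2 X oo Q oo f"
  "!!f m. mor f ==> mtrg f = base P ==> Q oo tTm P m oo f = tTm X m oo Q oo f"
 and "!!f. mor f ==> mtrg f = base P ==> Q|>tq1 P<|f = tq1 X<|Q<|f"
  "!!f. mor f ==> mtrg f = base P ==> Q|>tq2 P<|f = tq2 X<|Q<|f"
  "!!f. mor f ==> mtrg f = base P ==> Q|>tp P<|f = tp X<|Q<|f"
  "!!f. mor f ==> mtrg f = base P ==> Q|>tz P<|f = tz X<|Q<|f"
  "!!f. mor f ==> mtrg f = base P ==> Q|>ts P<|f = ts X<|Q<|f"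
  "!!f. mor f ==> mtrg f = base P ==> Q|>tl P<|f = tl X<|Q<|f"
  "!!f. mor f ==> mtrg f = base P ==> Q|>tc P<|f = tc X<|Q<|f"
 and "!!t. cel t ==> mtrg (tdom t) = base P ==> Q|>tT P|>t = tT X|>Q|>t"
  "!!t m. cel t ==> mtrg (tdom t) = base P ==> Q|>tTm P m|>t = tTm X m|>Q|>t"
  "!!t. cel t ==> msrc (tdom t) = base X ==> t<|Q<|tT P = t<|tT X<|Q"
  "!!t. cel t ==> msrc (tdom t) = base X ==> t<|Q<|tT2 P = t<|tT2 X<|Q"
proof -
 note [simp] = pretan_simps[OF P] pretan_simps[OF X]
 show e [simp]: "mor Q" "msrc Q = base P" "mtrg Q = base X"
  and T: "Q oo tT P = tT X oo Q" and T2: "Q oo tT2 P = tT2 X oo Q"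
  and c: "Q|>tq1 P = tq1 X<|Q" "Q|>tq2 P = tq2 X<|Q" "Q|>tp P = tp X<|Q" "Q|>tz P = tz X<|Q"
   "Q|>ts P = ts X<|Q" "Q|>tl P = tl X<|Q" "Q|>tc P = tc X<|Q"
  using Q by (auto simp: strictly_def)
 have Tf: "Q oo tT P oo f = tT X oo Q oo f" if "mor f" "mtrg f = base P" for f
  using arg_cong[OF T, of "%x. x oo f"] that by simp
 show Tm: "Q oo tTm P m = tTm X m oo Q" for m
  by (induction m) (simp_all add: tTm_rec Tf)
 fix f assume f [simp]: "mor f" "mtrg f = base P"
 show "Q oo tT P oo f = tT X oo Q oo f" by (simp add: Tf)
 show "Q oo tT2 P oo f = tT2 X oo Q oo f" using arg_cong[OF T2, of "%x. x oo f"] by simp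
 show "Q oo tTm P m oo f = tTm X m oo Q oo f" for m using arg_cong[OF Tm, of "%x. x oo f"] by simp
 show "Q|>tq1 P<|f = tq1 X<|Q<|f" "Q|>tq2 P<|f = tq2 X<|Q<|f"
  "Q|>tp P<|f = tp X<|Q<|f" "Q|>tz P<|f = tz X<|Q<|f" "Q|>ts P<|f = ts X<|Q<|f"
  "Q|>tl P<|f = tl X<|Q<|f" "Q|>tc P<|f = tc X<|Q<|f"
  using c[THEN arg_cong[of _ _ "%x. x<|f"]] by simp_all
next
 note [simp] = pretan_simps[OF P] pretan_simps[OF X]
 have [simp]: "mor Q" "msrc Q = base P" "mtrg Q = base X"
  and T: "Q oo tT P = tT X oo Q" and T2: "Q oo tT2 P = tT2 X oo Q" using Q by (auto simp: strictly_def)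
 have Tf: "Q oo tT P oo f = tT X oo Q oo f" if "mor f" "mtrg f = base P" for f
  using arg_cong[OF T, of "%x. x oo f"] that by simp
 have Tm: "Q oo tTm P m = tTm X m oo Q" for m
  by (induction m) (simp_all add: tTm_rec Tf)
 show "Q|>tT P|>t = tT X|>Q|>t" "Q|>tTm P m|>t = tTm X m|>Q|>t" if "cel t" "mtrg (tdom t) = base P" for t m
  using arg_cong[OF T, of "%x. x|>t"] arg_cong[OF Tm, of "%x. x|>t"] that by simp_all
 show "t<|Q<|tT P = t<|tT X<|Q" "t<|Q<|tT2 P = t<|tT2 X<|Q" if "cel t" "msrc (tdom t) = base X" for t
  using arg_cong[OF T, of "%x. t<|x"] arg_cong[OF T2, of "%x. t<|x"] that by simp_all
qed

text \<open>The monoid axioms persist after whiskering, because they may be checked on the generic triple \<open>T3\<close>.\<close>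

lemma addb_assoc_whisker:
 assumes X: "is_tangentad K X" and h: "mor h" "mtrg h = base X"
  and W: "mor W" "msrc W = msrc h" "mtrg W = base X"
  and c: "cel u" "cel v" "cel u'" "cel v'" "tdom u = W" "tdom v = W" "tdom u' = W" "tdom v' = W"
    "tcod u = tT2 X oo h" "tcod v = tT2 X oo h" "tcod u' = tT2 X oo h" "tcod v' = tT2 X oo h"
  and e: "(tq1 X<|h)**v = (ts X<|h)**u" "(tq2 X<|h)**v = (tq2 X<|h)**u'"
   "(tq1 X<|h)**u' = (tq2 X<|h)**u"
   "(tq1 X<|h)**v' = (tq1 X<|h)**u" "(tq2 X<|h)**v' = (ts X<|h)**u'"
 shows "(ts X<|h)**v = (ts X<|h)**v'"
proof -
 note t [simp] = tangentad_types[OF X] and [simp] = h W c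
 note ad = tangentad_addb[OF X]
 have ps: "tp X**ts X = tp X**tq1 X" using ad unfolding addb_def by blast
 note pq = tangentad_eqs(10)[OF X]
 have pb: "tpb (tq1 X) (tq2 X) (tp X) (tp X)" using T2_tpb(1)[OF X, of "mid (base X)"] by simp
 note pbh = T2_tpb(1)[OF X h]
 have pqh: "(tp X<|h)**(tq1 X<|h) = (tp X<|h)**(tq2 X<|h)" using arg_cong[OF pq, of "%x. x<|h"] by simp
 obtain P q where P [simp]: "mor P" "msrc P = base X" "mtrg P = base X"
  and q: "\<forall>i<3. cel (q i) & tdom (q i) = P & tcod (q i) = tT X"
  and f: "!!m h. mor h ==> mtrg h = base X ==> tfp 3 (tTm X m oo P oo h) (%i. tTm X m|>q i<|h) (tTm X m|>tp X<|h)"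
  using tangentad_fibre_powers[OF X, unfolded fibre_powers_def, rule_format, of 3] by (auto simp: numeral_3_eq_3)
 have q' [simp]: "cel (q 0)" "cel (q (Suc 0))" "cel (q 2)" "tdom (q 0) = P" "tdom (q (Suc 0)) = P" "tdom (q 2) = P"
  "tcod (q 0) = tT X" "tcod (q (Suc 0)) = tT X" "tcod (q 2) = tT X" using q by simp_all
 have fh: "tfp 3 (P oo h) (%i. q i<|h) (tp X<|h)"
 proof -
  have "tfp 3 (P oo h) (%i. mid (base X)|>q i<|h) (tp X<|h)" using f[OF h, of 0] by (simp add: tTm_rec)
  then show ?thesis by (rule tfp_cong[THEN iffD1, rotated]) (use q in simp)
 qed
 have f0: "tfp 3 P q (tp X)"
 proof -
  have "tfp 3 P (%i. mid (base X)|>q i<|mid (base X)) (tp X)" using f[of "mid (base X)" 0] by (simp add: tTm_rec)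
  then show ?thesis by (rule tfp_cong[THEN iffD1, rotated]) (use q in simp)
 qed
 have pq0: "tp X**q 0 = tp X**q (Suc 0)" "tp X**q (Suc 0) = tp X**q 2"
  using tfpD(8)[OF f0, of 0 "Suc 0"] tfpD(8)[OF f0, of "Suc 0" 2] by simp_all
 obtain u0 where u0 [simp]: "cel u0" "tdom u0 = P" "tcod u0 = tT2 X" and u0q: "tq1 X**u0 = q 0" "tq2 X**u0 = q (Suc 0)"
  by (rule tpb_ex[OF pb, of "q 0" "q (Suc 0)"]) (simp_all add: pq0)
 obtain u1 where u1 [simp]: "cel u1" "tdom u1 = P" "tcod u1 = tT2 X" and u1q: "tq1 X**u1 = q (Suc 0)" "tq2 X**u1 = q 2"
  by (rule tpb_ex[OF pb, of "q (Suc 0)" "q 2"]) (simp_all add: pq0)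
 obtain v0 where v0 [simp]: "cel v0" "tdom v0 = P" "tcod v0 = tT2 X" and v0q: "tq1 X**v0 = ts X**u0" "tq2 X**v0 = q 2"
  by (rule tpb_ex[OF pb, of "ts X**u0" "q 2"]) (simp_all add: pq0 vc_pre[OF ps] u0q)
 obtain v1 where v1 [simp]: "cel v1" "tdom v1 = P" "tcod v1 = tT2 X" and v1q: "tq1 X**v1 = q 0" "tq2 X**v1 = ts X**u1"
  by (rule tpb_ex[OF pb, of "q 0" "ts X**u1"]) (simp_all add: pq0 vc_pre[OF ps] u1q)
 have s0: "ts X**v0 = ts X**v1"
  using ad[unfolded addb_def, THEN conjunct2, THEN conjunct2, THEN conjunct1, rule_format, of P u0 v0 u1 v1]
  by (simp add: u0q u1q v0q v1q)
 let ?x = "%i::nat. if i = 0 then (tq1 X<|h)**u else if i = 1 then (tq2 X<|h)**u else (tq2 X<|h)**u'"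
 have px: "(tp X<|h)**?x i = (tp X<|h)**?x 0" for i
  by (simp add: vc_pre[OF pqh[symmetric]] e(3))
 obtain w where w [simp]: "cel w" "tdom w = W" "tcod w = P oo h" and wq: "!!i. i < 3 ==> (q i<|h)**w = ?x i"
 proof (rule tfp_ex[OF fh, of W ?x])
  fix i j show "(tp X<|h)**?x i = (tp X<|h)**?x j" unfolding px[of i] px[of j] ..
 qed simp_all
 have wq': "(q 0<|h)**w = (tq1 X<|h)**u" "(q (Suc 0)<|h)**w = (tq2 X<|h)**u" "(q 2<|h)**w = (tq2 X<|h)**u'"
  using wq[of 0] wq[of "Suc 0"] wq[of 2] by simp_all
 have [simp]: "u = (u0<|h)**w"
  by (rule tpb_eqI[OF pbh]) (simp_all add: vc_pre[OF vc_rw_eq[OF u0q(1)]] vc_pre[OF vc_rw_eq[OF u0q(2)]] wq')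
 have u': "u' = (u1<|h)**w"
  by (rule tpb_eqI[OF pbh]) (simp_all add: vc_pre[OF vc_rw_eq[OF u1q(1)]] vc_pre[OF vc_rw_eq[OF u1q(2)]] wq' e del: \<open>u = _\<close>)
 have v: "v = (v0<|h)**w"
  by (rule tpb_eqI[OF pbh]) (simp_all add: vc_pre[OF vc_rw_eq[OF v0q(1), of h, simplified]] vc_pre[OF vc_rw_eq[OF v0q(2)]] wq' e)
 have v': "v' = (v1<|h)**w"
  by (rule tpb_eqI[OF pbh]) (simp_all add: vc_pre[OF vc_rw_eq[OF v1q(1)]] vc_pre[OF vc_rw_eq[OF v1q(2), of h, simplified]] wq' e u' del: \<open>u = _\<close>)
 show ?thesis unfolding v v' using arg_cong[OF s0, of "%x. (x<|h)**w"] by simp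
qed

lemma strictly_addb:
 assumes Q: "strictly Q P X" and P: "pretan P" and X: "is_tangentad K X"
 shows "Q|>(tp P**tz P) = Q|>cid (mid (base P))" "Q|>(tp P**ts P) = Q|>(tp P**tq1 P)"
  and "!!W u v u' v'. [|mor W; msrc W = base P; mtrg W = base P; cel u; cel v; cel u'; cel v'; tdom u = W; tdom v = W; tdom u' = W; tdom v' = W;
    tcod u = tT2 P; tcod v = tT2 P; tcod u' = tT2 P; tcod v' = tT2 P;
    tq1 P**v = ts P**u; tq2 P**v = tq2 P**u'; tq1 P**u' = tq2 P**u;
    tq1 P**v' = tq1 P**u; tq2 P**v' = ts P**u'|] ==> Q|>(ts P**v) = Q|>(ts P**v')"
  and "!!u. [|cel u; tdom u = tT P; tcod u = tT2 P; tq1 P**u = tz P**tp P; tq2 P**u = cid (tT P)|]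
    ==> Q|>(ts P**u) = Q|>cid (tT P)"
  and "!!u. [|cel u; tdom u = tT P; tcod u = tT2 P; tq2 P**u = tz P**tp P; tq1 P**u = cid (tT P)|]
    ==> Q|>(ts P**u) = Q|>cid (tT P)"
  and "!!u. [|cel u; tdom u = tT2 P; tcod u = tT2 P; tq1 P**u = tq2 P; tq2 P**u = tq1 P|]
    ==> Q|>(ts P**u) = Q|>ts P"
proof -
 note [simp] = pretan_simps[OF P] tangentad_types[OF X]
 note s [simp] = strictly_simps[OF Q P pretan_if_tangentad[OF X]]
 note ad = tangentad_addb[OF X]
 have pz: "tp X**tz X = cid (mid (base X))" and ps: "tp X**ts X = tp X**tq1 X" using ad unfolding addb_def by blast+
 note pbQ = T2_tpb(1)[OF X s(1,3)]
 have pb: "tpb (tq1 X) (tq2 X) (tp X) (tp X)" using T2_tpb(1)[OF X, of "mid (base X)"] by simp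
 show "Q|>(tp P**tz P) = Q|>cid (mid (base P))" "Q|>(tp P**ts P) = Q|>(tp P**tq1 P)"
  using arg_cong[OF pz, of "%x. x<|Q"] arg_cong[OF ps, of "%x. x<|Q"] by simp_all
 show "Q|>(ts P**v) = Q|>(ts P**v')"
  if [simp]: "mor W" "msrc W = base P" "mtrg W = base P" "cel u" "cel v" "cel u'" "cel v'" "tdom u = W" "tdom v = W" "tdom u' = W" "tdom v' = W"
    "tcod u = tT2 P" "tcod v = tT2 P" "tcod u' = tT2 P" "tcod v' = tT2 P"
   and e: "tq1 P**v = ts P**u" "tq2 P**v = tq2 P**u'" "tq1 P**u' = tq2 P**u"
    "tq1 P**v' = tq1 P**u" "tq2 P**v' = ts P**u'" for W u v u' v'
 proof -
  have "(ts X<|Q)**(Q|>v) = (ts X<|Q)**(Q|>v')"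
   by (rule addb_assoc_whisker[OF X s(1,3), of "Q oo W" "Q|>u" _ "Q|>u'"])
    (use e[THEN arg_cong[of _ _ "%x. Q|>x"]] in simp_all)
  then show ?thesis by simp
 qed
 show "Q|>(ts P**u) = Q|>cid (tT P)"
  if [simp]: "cel u" "tdom u = tT P" "tcod u = tT2 P" and e: "tq1 P**u = tz P**tp P" "tq2 P**u = cid (tT P)" for u
 proof -
  obtain w where w [simp]: "cel w" "tdom w = tT X" "tcod w = tT2 X" and wq: "tq1 X**w = tz X**tp X" "tq2 X**w = cid (tT X)"
   by (rule tpb_ex[OF pb, of "tz X**tp X" "cid (tT X)"]) (simp_all add: vc_pre[OF pz])
  have sw: "ts X**w = cid (tT X)" using ad w wq unfolding addb_def by blast
  have "Q|>u = w<|Q"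
   by (rule tpb_eqI[OF pbQ]) (use e[THEN arg_cong[of _ _ "%x. Q|>x"]] wq[THEN arg_cong[of _ _ "%x. x<|Q"]] in simp_all)
  then show ?thesis using arg_cong[OF sw, of "%x. x<|Q"] by simp
 qed
 show "Q|>(ts P**u) = Q|>cid (tT P)"
  if [simp]: "cel u" "tdom u = tT P" "tcod u = tT2 P" and e: "tq2 P**u = tz P**tp P" "tq1 P**u = cid (tT P)" for u
 proof -
  obtain w where w [simp]: "cel w" "tdom w = tT X" "tcod w = tT2 X" and wq: "tq1 X**w = cid (tT X)" "tq2 X**w = tz X**tp X"
   by (rule tpb_ex[OF pb, of "cid (tT X)" "tz X**tp X"]) (simp_all add: vc_pre[OF pz])
  have sw: "ts X**w = cid (tT X)" using ad w wq unfolding addb_def by blast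
  have "Q|>u = w<|Q"
   by (rule tpb_eqI[OF pbQ]) (use e[THEN arg_cong[of _ _ "%x. Q|>x"]] wq[THEN arg_cong[of _ _ "%x. x<|Q"]] in simp_all)
  then show ?thesis using arg_cong[OF sw, of "%x. x<|Q"] by simp
 qed
 show "Q|>(ts P**u) = Q|>ts P"
  if [simp]: "cel u" "tdom u = tT2 P" "tcod u = tT2 P" and e: "tq1 P**u = tq2 P" "tq2 P**u = tq1 P" for u
 proof -
  obtain w where w [simp]: "cel w" "tdom w = tT2 X" "tcod w = tT2 X" and wq: "tq1 X**w = tq2 X" "tq2 X**w = tq1 X"
   by (rule tpb_ex[OF pb, of "tq2 X" "tq1 X"]) (simp_all add: tangentad_eqs(10)[OF X])
  have sw: "ts X**w = ts X" using ad w wq unfolding addb_def by blast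
  have "Q|>u = w<|Q"
   by (rule tpb_eqI[OF pbQ]) (use e[THEN arg_cong[of _ _ "%x. Q|>x"]] wq[THEN arg_cong[of _ _ "%x. x<|Q"]] in simp_all)
  then show ?thesis using arg_cong[OF sw, of "%x. x<|Q"] by simp
 qed
qed

lemma strictly_eqs:
 assumes Q: "strictly Q P X" and P: "pretan P" and X: "is_tangentad K X"
 shows "Q|>((tT P|>tp P)**tl P) = Q|>(tz P**tp P)"
  "Q|>(tl P**tz P) = Q|>((tT P|>tz P)**tz P)"
  "Q|>((tp P<|tT P)**tc P) = Q|>tT P|>tp P"
  "Q|>(tc P**(tT P|>tz P)) = Q|>tz P<|tT P"
  "Q|>((tT P|>tl P)**tl P) = Q|>((tl P<|tT P)**tl P)"
  "Q|>(tc P**tl P) = Q|>tl P"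
  "Q|>((tc P<|tT P)**(tT P|>tc P)**(tl P<|tT P)) = Q|>((tT P|>tl P)**tc P)"
  "Q|>(tc P**tc P) = Q|>cid (tT P oo tT P)"
  "Q|>((tT P|>tc P)**(tc P<|tT P)**(tT P|>tc P)) =
   Q|>((tc P<|tT P)**(tT P|>tc P)**(tc P<|tT P))"
  "Q|>(tp P**tq1 P) = Q|>(tp P**tq2 P)"
proof -
 note [simp] = pretan_simps[OF P] tangentad_types[OF X]
 note s [simp] = strictly_simps[OF Q P pretan_if_tangentad[OF X]]
 note e = tangentad_eqs[OF X, THEN arg_cong[of _ _ "%x. x<|Q"]]
 show "Q|>((tT P|>tp P)**tl P) = Q|>(tz P**tp P)"
  "Q|>(tl P**tz P) = Q|>((tT P|>tz P)**tz P)"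
  "Q|>((tp P<|tT P)**tc P) = Q|>tT P|>tp P"
  "Q|>(tc P**(tT P|>tz P)) = Q|>tz P<|tT P"
  "Q|>((tT P|>tl P)**tl P) = Q|>((tl P<|tT P)**tl P)"
  "Q|>(tc P**tl P) = Q|>tl P"
  "Q|>((tc P<|tT P)**(tT P|>tc P)**(tl P<|tT P)) = Q|>((tT P|>tl P)**tc P)"
  "Q|>(tc P**tc P) = Q|>cid (tT P oo tT P)"
  "Q|>((tT P|>tc P)**(tc P<|tT P)**(tT P|>tc P)) =
   Q|>((tc P<|tT P)**(tT P|>tc P)**(tc P<|tT P))"
  "Q|>(tp P**tq1 P) = Q|>(tp P**tq2 P)"
  using e by simp_all
qed

end

context cartesian_2_category
begin

section \<open>Products of tangentads\<close>

lemma tfp_prod: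
 assumes AB [simp]: "A \<in> obj K" "B \<in> obj K"
  and c [simp]: "mor P" "cel f" "msrc P = msrc (tdom f)" "mtrg P = pobj K A B" "mtrg (tdom f) = pobj K A B"
  and q: "!!i. i < n ==> cel (q i)" "!!i. i < n ==> tdom (q i) = P" "!!i. i < n ==> tcod (q i) = tdom f" and n: "1 \<le> n"
  and 1: "tfp n (pr1 A B oo P) (%i. pr1 A B|>q i) (pr1 A B|>f)"
  and 2: "tfp n (pr2 A B oo P) (%i. pr2 A B|>q i) (pr2 A B|>f)"
 shows "tfp n P q f"
proof -
 have e: "f**q i = f**q j" if "i < n" "j < n" for i j
  by (rule cel_prod_eqI[of _ _ A B]) (use q[OF that(1)] q[OF that(2)] tfpD(8)[OF 1 that] tfpD(8)[OF 2 that] in simp_all)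
 show ?thesis
  unfolding tfp_def
 proof (intro conjI allI impI)
  fix W x
  assume h: "mor W & msrc W = msrc P & mtrg W = mtrg P & (\<forall>i<n. cel (x i) & tdom (x i) = W & tcod (x i) = tdom f) &
    (\<forall>i<n. \<forall>j<n. f**x i = f**x j)"
  have "mor W" "msrc W = msrc P" "mtrg W = mtrg P" using h by blast+
  then have W [simp]: "mor W" "msrc W = msrc (tdom f)" "mtrg W = pobj K A B" by simp_all
  have x: "cel (x i)" "tdom (x i) = W" "tcod (x i) = tdom f" if "i < n" for i using h that by blast+
  have xx: "f**x i = f**x j" if "i < n" "j < n" for i j using h that by blast
  have xx1: "(pr1 A B|>f)**(pr1 A B|>x i) = (pr1 A B|>f)**(pr1 A B|>x j)"
   "(pr2 A B|>f)**(pr2 A B|>x i) = (pr2 A B|>f)**(pr2 A B|>x j)" if "i < n" "j < n" for i j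
   using arg_cong[OF xx[OF that], of "%x. pr1 A B|>x"] arg_cong[OF xx[OF that], of "%x. pr2 A B|>x"] x[OF that(1)] x[OF that(2)]
   by simp_all
  obtain u where u: "cel u" "tdom u = pr1 A B oo W" "tcod u = pr1 A B oo P" "!!i. i < n ==> (pr1 A B|>q i)**u = pr1 A B|>x i"
   by (rule tfp_ex[OF 1, of "pr1 A B oo W" "%i. pr1 A B|>x i"]) (simp_all add: x, rule xx1)
  obtain v where v: "cel v" "tdom v = pr2 A B oo W" "tcod v = pr2 A B oo P" "!!i. i < n ==> (pr2 A B|>q i)**v = pr2 A B|>x i"
   by (rule tfp_ex[OF 2, of "pr2 A B oo W" "%i. pr2 A B|>x i"]) (simp_all add: x, rule xx1)
  have "\<exists>!w. cel w & tdom w = W & tcod w = P & pr1 A B|>w = u & pr2 A B|>w = v"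
   by (rule cel_prod_ex1) (simp_all add: u v)
  then obtain w where w [simp]: "cel w" "tdom w = W" "tcod w = P" and wu: "pr1 A B|>w = u" "pr2 A B|>w = v" by blast
  show "\<exists>!u. cel u & tdom u = W & tcod u = P & (\<forall>i<n. q i**u = x i)"
  proof (rule ex1I[of _ w], intro conjI allI impI w)
   fix i assume i: "i < n"
   show "q i**w = x i" by (rule cel_prod_eqI[of _ _ A B]) (simp_all add: q[OF i] x[OF i] u(4)[OF i] v(4)[OF i] wu)
  next
   fix w' assume w': "cel w' & tdom w' = W & tcod w' = P & (\<forall>i<n. q i**w' = x i)"
   then have w2 [simp]: "cel w'" "tdom w' = W" "tcod w' = P" by blast+
   have xw: "x i = q i**w'" if "i < n" for i using w' that by simp
   have a: "pr1 A B|>w' = u"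
   proof (rule tfp_eqI[OF 1])
    fix i assume i: "i < n"
    show "(pr1 A B|>q i)**(pr1 A B|>w') = (pr1 A B|>q i)**u"
     unfolding u(4)[OF i] xw[OF i] by (simp add: q[OF i])
   qed (use n in \<open>simp_all add: u\<close>)
   have b: "pr2 A B|>w' = v"
   proof (rule tfp_eqI[OF 2])
    fix i assume i: "i < n"
    show "(pr2 A B|>q i)**(pr2 A B|>w') = (pr2 A B|>q i)**v"
     unfolding v(4)[OF i] xw[OF i] by (simp add: q[OF i])
   qed (use n in \<open>simp_all add: v\<close>)
   show "w' = w" by (rule cel_prod_eqI[of _ _ A B]) (simp_all add: a b wu)
  qed
 next
  fix i j assume "i < n" "j < n"
  then show "f**q i = f**q j" by (rule e)
 qed (simp_all add: q)
qed

text \<open>Equations between cells into a product may be checked after each projection, and a square of such cells is a pullback if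
 both projected squares are. The projections commute strictly with the structure, so the projected statements are the axioms
 of the two factors, whiskered with the projections; this is where the limits have to be pointwise.\<close>

lemma product_is_tangentad:
 assumes P: "pretan P" and X: "is_tangentad K X" and Y: "is_tangentad K Y"
  and b: "base P = pobj K (base X) (base Y)"
  and Q1: "strictly (pr1 (base X) (base Y)) P X" and Q2: "strictly (pr2 (base X) (base Y)) P Y"
 shows "is_tangentad K P"
proof -
 let ?A = "base X" and ?B = "base Y" and ?p = "pr1 (base X) (base Y)" and ?q = "pr2 (base X) (base Y)"
 note [simp] = pretan_simps[OF P] tangentad_types[OF X] tangentad_types[OF Y]
 note s1 [simp] = strictly_simps[OF Q1 P pretan_if_tangentad[OF X]] and s2 [simp] = strictly_simps[OF Q2 P pretan_if_tangentad[OF Y]]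
 note [simp] = b
 note eqI = cel_prod_eqI[of _ _ ?A ?B]
 note e1 = strictly_eqs[OF Q1 P X] and e2 = strictly_eqs[OF Q2 P Y]
 have pb: "tpb (tTm P m|>tq1 P<|h) (tTm P m|>tq2 P<|h) (tTm P m|>tp P<|h) (tTm P m|>tp P<|h)"
  if h [simp]: "mor h" "mtrg h = base P" for m h
  by (rule tpb_prod[of ?A ?B]) (use tT2_tpb_iter[OF X, of "?p oo h" m] tT2_tpb_iter[OF Y, of "?q oo h" m] in simp_all)
 have m: "mor (mid (pobj K ?A ?B))" by (rule mor_mid) (use pretan_simps(1)[OF P] in simp)
 have pqP: "tp P**tq1 P = tp P**tq2 P"
  by (rule eqI) (use e1(10) e2(10) m in simp_all)
 have E: "(tT P|>tp P)**tl P = tz P**tp P"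
  "tl P**tz P = (tT P|>tz P)**tz P"
  "(tp P<|tT P)**tc P = tT P|>tp P"
  "tc P**(tT P|>tz P) = tz P<|tT P"
  "(tT P|>tl P)**tl P = (tl P<|tT P)**tl P"
  "tc P**tl P = tl P"
  "(tc P<|tT P)**(tT P|>tc P)**(tl P<|tT P) = (tT P|>tl P)**tc P"
  "tc P**tc P = cid (tT P oo tT P)"
  "(tT P|>tc P)**(tc P<|tT P)**(tT P|>tc P) =
   (tc P<|tT P)**(tT P|>tc P)**(tc P<|tT P)"
  by (rule eqI; (simp only: e1 e2)?; simp add: m)+
 note pbP = pb[OF m, of "Suc 0", simplified, simplified tTm_rec, simplified]
 have pb1: "tpb (tT P|>tq1 P) (tT P|>tq2 P) (tT P|>tp P) (tT P|>tp P)"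
  using pb[of "mid (pobj K ?A ?B)" "Suc 0"] m by (simp add: tTm_rec)
 have pbT: "tpb (tq1 P<|tT P) (tq2 P<|tT P) (tp P<|tT P) (tp P<|tT P)"
  using pb[of "tT P" 0] m by (simp add: tTm_rec)
 obtain r where r [simp]: "cel r" "tdom r = tT2 P" "tcod r = tT P oo tT2 P"
   and rq: "(tT P|>tq1 P)**r = tl P**tq1 P" "(tT P|>tq2 P)**r = tl P**tq2 P"
  by (rule tpb_ex[OF pb1, of "tl P**tq1 P" "tl P**tq2 P"]) (simp_all add: vc_pre[OF E(1)] pqP)
 have la: "Q|>(tl P**ts P) = Q|>((tT P|>ts P)**r)" if Q: "strictly Q P Z" and Z: "is_tangentad K Z" for Q Z
 proof -
  note t [simp] = tangentad_types[OF Z]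
  note s [simp] = strictly_simps[OF Q P pretan_if_tangentad[OF Z]]
  note eZ = tangentad_eqs[OF Z]
  have pbZ: "tpb (tT Z|>tq1 Z) (tT Z|>tq2 Z) (tT Z|>tp Z) (tT Z|>tp Z)" using T2_tpb(2)[OF Z, of "mid (base Z)"] by simp
  obtain w where w [simp]: "cel w" "tdom w = tT2 Z" "tcod w = tT Z oo tT2 Z"
    and wq: "(tT Z|>tq1 Z)**w = tl Z**tq1 Z" "(tT Z|>tq2 Z)**w = tl Z**tq2 Z"
   by (rule tpb_ex[OF pbZ, of "tl Z**tq1 Z" "tl Z**tq2 Z"]) (simp_all add: vc_pre[OF eZ(1)] eZ(10))
  have "Q|>r = w<|Q"
   by (rule tpb_eqI[OF T2_tpb(2)[OF Z s(1,3)]])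
    (use rq[THEN arg_cong[of _ _ "%x. Q|>x"]] wq[THEN arg_cong[of _ _ "%x. x<|Q"]] s(2) in \<open>simp_all del: b add: b[symmetric]\<close>)
  then show ?thesis using arg_cong[OF tangentad_lift_add[OF Z w wq], of "%x. x<|Q"] s(2) by (simp del: b add: b[symmetric])
 qed
 have lP: "tl P**ts P = (tT P|>ts P)**r"
  by (rule eqI) (use la[OF Q1 X] la[OF Q2 Y] m in simp_all)
 obtain r' where r' [simp]: "cel r'" "tdom r' = tT P oo tT2 P" "tcod r' = tT2 P oo tT P"
   and rq': "(tq1 P<|tT P)**r' = tc P**(tT P|>tq1 P)" "(tq2 P<|tT P)**r' = tc P**(tT P|>tq2 P)"
  by (rule tpb_ex[OF pbT, of "tc P**(tT P|>tq1 P)" "tc P**(tT P|>tq2 P)"])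
   (simp_all add: vc_pre[OF E(3)] vc_lw_eq[OF pqP])
 have fa: "Q|>(tc P**(tT P|>ts P)) = Q|>((ts P<|tT P)**r')" if Q: "strictly Q P Z" and Z: "is_tangentad K Z" for Q Z
 proof -
  note t [simp] = tangentad_types[OF Z]
  note s [simp] = strictly_simps[OF Q P pretan_if_tangentad[OF Z]]
  note eZ = tangentad_eqs[OF Z]
  note pbZ = T2_tpb(1)[OF Z, of "tT Z", simplified]
  obtain w where w [simp]: "cel w" "tdom w = tT Z oo tT2 Z" "tcod w = tT2 Z oo tT Z"
    and wq: "(tq1 Z<|tT Z)**w = tc Z**(tT Z|>tq1 Z)" "(tq2 Z<|tT Z)**w = tc Z**(tT Z|>tq2 Z)"
   by (rule tpb_ex[OF pbZ, of "tc Z**(tT Z|>tq1 Z)" "tc Z**(tT Z|>tq2 Z)"]) (simp_all add: vc_pre[OF eZ(3)] vc_lw_eq[OF eZ(10)])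
  have "Q|>r' = w<|Q"
   by (rule tpb_eqI[OF T2_tpb(1)[OF Z, of "tT Z oo Q"]])
    (use rq'[THEN arg_cong[of _ _ "%x. Q|>x"]] wq[THEN arg_cong[of _ _ "%x. x<|Q"]] s(2) in \<open>simp_all del: b add: b[symmetric]\<close>)
  then show ?thesis using arg_cong[OF tangentad_flip_add[OF Z w wq], of "%x. x<|Q"] s(2) by (simp del: b add: b[symmetric])
 qed
 have fP: "tc P**(tT P|>ts P) = (ts P<|tT P)**r'"
  by (rule eqI) (use fa[OF Q1 X] fa[OF Q2 Y] m in simp_all)
 have adP: "addb P"
  unfolding addb_def
 proof (intro conjI allI impI; (elim conjE)?)
  show "tp P**tz P = cid (mid (base P))"
   by (rule eqI; (simp only: strictly_addb(1)[OF Q1 P X] strictly_addb(1)[OF Q2 P Y])?; simp add: m)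
  show "tp P**ts P = tp P**tq1 P"
   by (rule eqI; (simp only: strictly_addb(2)[OF Q1 P X] strictly_addb(2)[OF Q2 P Y])?; simp add: m)
  show "ts P**v = ts P**v'"
   if h: "mor W" "msrc W = base P" "mtrg W = base P" "cel u" "cel v" "cel u'" "cel v'" "tdom u = W" "tdom v = W" "tdom u' = W" "tdom v' = W"
    "tcod u = tT2 P" "tcod v = tT2 P" "tcod u' = tT2 P" "tcod v' = tT2 P"
    "tq1 P**v = ts P**u" "tq2 P**v = tq2 P**u'" "tq1 P**u' = tq2 P**u"
    "tq1 P**v' = tq1 P**u" "tq2 P**v' = ts P**u'" for W u v u' v'
   by (rule eqI; (rule strictly_addb(3)[OF Q1 P X h] strictly_addb(3)[OF Q2 P Y h])?; simp add: h(1-15) m)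
  show "ts P**u = cid (tT P)" if h: "cel u" "tdom u = tT P" "tcod u = tT2 P" "tq1 P**u = tz P**tp P" "tq2 P**u = cid (tT P)" for u
   by (rule eqI; (rule strictly_addb(4)[OF Q1 P X h] strictly_addb(4)[OF Q2 P Y h])?; simp add: h(1-3) m)
  show "ts P**u = cid (tT P)" if h: "cel u" "tdom u = tT P" "tcod u = tT2 P" "tq2 P**u = tz P**tp P" "tq1 P**u = cid (tT P)" for u
   by (rule eqI; (rule strictly_addb(5)[OF Q1 P X h] strictly_addb(5)[OF Q2 P Y h])?; simp add: h(1-3) m)
  show "ts P**u = ts P" if h: "cel u" "tdom u = tT2 P" "tcod u = tT2 P" "tq1 P**u = tq2 P" "tq2 P**u = tq1 P" for u
   by (rule eqI; (rule strictly_addb(6)[OF Q1 P X h] strictly_addb(6)[OF Q2 P Y h])?; simp add: h(1-3) m)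
 qed
 have fp: "fibre_powers P"
  unfolding fibre_powers_def
 proof (intro allI impI)
  fix n :: nat assume n: "1 \<le> n"
  obtain S s where S [simp]: "mor S" "msrc S = ?A" "mtrg S = ?A"
   and s: "!!i. i < n ==> cel (s i)" "!!i. i < n ==> tdom (s i) = S" "!!i. i < n ==> tcod (s i) = tT X"
   and sf: "!!m h. mor h ==> mtrg h = ?A ==> tfp n (tTm X m oo S oo h) (%i. tTm X m|>s i<|h) (tTm X m|>tp X<|h)"
   using tangentad_fibre_powers[OF X] n unfolding fibre_powers_def by metis
  obtain R t where R [simp]: "mor R" "msrc R = ?B" "mtrg R = ?B"
   and t: "!!i. i < n ==> cel (t i)" "!!i. i < n ==> tdom (t i) = R" "!!i. i < n ==> tcod (t i) = tT Y"
   and tf: "!!m h. mor h ==> mtrg h = ?B ==> tfp n (tTm Y m oo R oo h) (%i. tTm Y m|>t i<|h) (tTm Y m|>tp Y<|h)"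
   using tangentad_fibre_powers[OF Y] n unfolding fibre_powers_def by metis
  let ?P = "tpair (S oo ?p) (R oo ?q)" and ?f = "%i. cpair (s i<|?p) (t i<|?q)"
  have TP: "tpair (tT X oo ?p) (tT Y oo ?q) = tT P"
   by (rule mor_prod_eqI[of _ _ ?A ?B]) simp_all
  have f: "cel (?f i)" "tdom (?f i) = ?P" "tcod (?f i) = tT P" if "i < n" for i
   using s[OF that] t[OF that] TP by simp_all
  have fpr: "?p|>?f i = s i<|?p" "?q|>?f i = t i<|?q" if "i < n" for i
   using s[OF that] t[OF that] by simp_all
  have fprh: "?p|>?f i<|h = s i<|?p<|h" "?q|>?f i<|h = t i<|?q<|h" if "i < n" "mor h" "mtrg h = base P" for i h
   using s[OF that(1)] t[OF that(1)] that by simp_all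
  show "\<exists>Pa q. mor Pa & msrc Pa = base P & mtrg Pa = base P &
    (\<forall>i<n. cel (q i) & tdom (q i) = Pa & tcod (q i) = tT P) &
    (\<forall>m h. mor h & mtrg h = base P --> tfp n (tTm P m oo Pa oo h) (%i. tTm P m|>q i<|h) (tTm P m|>tp P<|h))"
  proof (intro exI[of _ ?P] exI[of _ ?f] conjI allI impI; (elim conjE)?)
   fix m h assume h [simp]: "mor h" "mtrg h = base P"
   show "tfp n (tTm P m oo ?P oo h) (%i. tTm P m|>?f i<|h) (tTm P m|>tp P<|h)"
   proof (rule tfp_prod[of ?A ?B])
    have "tfp n (?p oo tTm P m oo ?P oo h) (%i. tTm X m|>s i<|?p<|h) (?p|>tTm P m|>tp P<|h)"
    proof -
     have "tfp n (tTm X m oo S oo ?p oo h) (%i. tTm X m|>s i<|(?p oo h)) (tTm X m|>tp X<|(?p oo h))"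
      by (rule sf) simp_all
     then have "tfp n (tTm X m oo S oo ?p oo h) (%i. tTm X m|>s i<|?p<|h) (tTm X m|>tp X<|(?p oo h))"
      by (rule tfp_cong[THEN iffD1, rotated]) (simp add: s)
     then show ?thesis by simp
    qed
    then show "tfp n (?p oo tTm P m oo ?P oo h) (%i. ?p|>tTm P m|>?f i<|h) (?p|>tTm P m|>tp P<|h)"
     by (rule tfp_cong[THEN iffD1, rotated]) (simp add: f fprh del: cel_cpair pr_cpair pr_cpair_rw)
    have "tfp n (?q oo tTm P m oo ?P oo h) (%i. tTm Y m|>t i<|?q<|h) (?q|>tTm P m|>tp P<|h)"
    proof -
     have "tfp n (tTm Y m oo R oo ?q oo h) (%i. tTm Y m|>t i<|(?q oo h)) (tTm Y m|>tp Y<|(?q oo h))"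
      by (rule tf) simp_all
     then have "tfp n (tTm Y m oo R oo ?q oo h) (%i. tTm Y m|>t i<|?q<|h) (tTm Y m|>tp Y<|(?q oo h))"
      by (rule tfp_cong[THEN iffD1, rotated]) (simp add: t)
     then show ?thesis by simp
    qed
    then show "tfp n (?q oo tTm P m oo ?P oo h) (%i. ?q|>tTm P m|>?f i<|h) (?q|>tTm P m|>tp P<|h)"
     by (rule tfp_cong[THEN iffD1, rotated]) (simp add: f fprh del: cel_cpair pr_cpair pr_cpair_rw)
   qed (use n in \<open>simp_all add: f del: cel_cpair pr_cpair pr_cpair_rw\<close>)
  qed (simp_all add: f del: cel_cpair pr_cpair pr_cpair_rw)
 qed
 have ex: "tT P|>tp P**tz P<|tT P = tz P**tp P"
  using whisker_exchange[of "tz P" "tp P"] m by simp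
 obtain w where w [simp]: "cel w" "tdom w = tT2 P" "tcod w = tT P oo tT2 P"
  and wq: "(tT P|>tq1 P)**w = (tz P<|tT P)**tq1 P" "(tT P|>tq2 P)**w = tl P**tq2 P"
  by (rule tpb_ex[OF pb1, of "(tz P<|tT P)**tq1 P" "tl P**tq2 P"])
   (simp_all add: vc_pre[OF E(1)] vc_pre[OF ex] pqP m)
 have lu: "tpb (Q|>(tp P**tq1 P)<|h) (Q|>((tT P|>ts P)**w)<|h) (Q|>tz P<|h) (Q|>tT P|>tp P<|h)"
  if Q: "strictly Q P Z" and Z: "is_tangentad K Z" and h: "mor h" "mtrg h = base P" for Q Z h
 proof -
  note t [simp] = tangentad_types[OF Z]
  note s [simp] = strictly_simps[OF Q P pretan_if_tangentad[OF Z]]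
  note eZ = tangentad_eqs[OF Z]
  have bb: "pobj K ?A ?B = base P" by simp
  obtain v where v [simp]: "cel v" "tdom v = tT2 Z" "tcod v = tT Z oo tT2 Z"
    and vq: "(tT Z|>tq1 Z)**v = (tz Z<|tT Z)**tq1 Z" "(tT Z|>tq2 Z)**v = tl Z**tq2 Z"
    and pv: "!!h. mor h ==> mtrg h = base Z ==> tpb ((tp Z**tq1 Z)<|h) (((tT Z|>ts Z)**v)<|h) (tz Z<|h) (tT Z|>tp Z<|h)"
   using tangentad_lift_univ[OF Z] unfolding lift_univ_def by blast
  have eq: "Q|>w = v<|Q"
   by (rule tpb_eqI[OF T2_tpb(2)[OF Z s(1,3)]])
    (use wq[THEN arg_cong[of _ _ "%x. Q|>x"]] vq[THEN arg_cong[of _ _ "%x. x<|Q"]] s(2) in \<open>simp_all del: b add: bb\<close>)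
  have eqh: "Q|>w<|h = v<|Q<|h" using arg_cong[OF eq, of "%x. x<|h"] h s(2) by (simp del: b)
  show ?thesis using pv[of "Q oo h"] h s(2) eqh by (simp del: b)
 qed
 have lP': "lift_univ P"
  unfolding lift_univ_def
 proof (intro exI[of _ w] conjI allI impI w wq; (elim conjE)?)
  fix h assume h [simp]: "mor h" "mtrg h = base P"
  show "tpb ((tp P**tq1 P)<|h) (((tT P|>ts P)**w)<|h) (tz P<|h) (tT P|>tp P<|h)"
   by (rule tpb_prod[of ?A ?B]; (rule lu[OF Q1 X h] lu[OF Q2 Y h])?)
    (use vc_rw_eq[OF E(1), of h] ex m whisker_exchange[of "tz P" "tp P"] in simp_all)
 qed
 show ?thesis
  by (rule is_tangentad_I[OF P E r rq lP r' rq' fP pb adP fp lP'])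
qed

lemma prod1_tpair:
 "prod1 K A B A' B' (mval f) (mval g) = mval (tpair (f oo pr1 A B) (g oo pr2 A B))"
 if "mtrg f = A'" "mtrg g = B'" "msrc f = A" "msrc g = B"
 using that by (simp add: prod1_def tpair_def mcomp_def pr1_def pr2_def)

lemma prod2_cpair:
 assumes AB: "A \<in> obj K" "B \<in> obj K"
  and ts: "cel t" "cel s" "msrc (tdom t) = A" "msrc (tdom s) = B" "mtrg (tdom t) = A'" "mtrg (tdom s) = B'"
  and F: "F = mval (tdom t)" "G = mval (tdom s)" "F' = mval (tcod t)" "G' = mval (tcod s)" "\<theta> = tval t" "\<psi> = tval s"
 shows "prod2 K A B A' B' F G F' G' \<theta> \<psi> = tval (cpair (t<|pr1 A B) (s<|pr2 A B))"
proof -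
 note [simp] = AB ts
 let ?u = "cpair (t<|pr1 A B) (s<|pr2 A B)"
 have AB' [simp]: "A' \<in> obj K" "B' \<in> obj K" using mor_obj[OF cel_mor(1)[OF ts(1)]] mor_obj[OF cel_mor(1)[OF ts(2)]] by simp_all
 have u: "cel ?u" "tdom ?u = tpair (tdom t oo pr1 A B) (tdom s oo pr2 A B)" "tcod ?u = tpair (tcod t oo pr1 A B) (tcod s oo pr2 A B)"
  by simp_all
 have p1: "prod1 K A B A' B' F G = mval (tdom ?u)" "prod1 K A B A' B' F' G' = mval (tcod ?u)"
  unfolding u(2,3) using F by (simp_all add: prod1_tpair)
 have mem: "tval ?u \<in> hom2 K (pobj K A B) (pobj K A' B') (mval (tdom ?u)) (mval (tcod ?u))"
  using u(1) unfolding cel_def by simp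
 have e: "pr1 A' B'|>?u = t<|pr1 A B" "pr2 A' B'|>?u = s<|pr2 A B" by simp_all
 show ?thesis
  unfolding prod2_def p1
 proof (rule the_equality, intro conjI mem)
  show "pfst K A' B' \<rhd> tval ?u = \<theta> \<lhd> pfst K A B" "psnd K A' B' \<rhd> tval ?u = \<psi> \<lhd> psnd K A B"
   using e[THEN arg_cong[of _ _ tval]] F by (simp_all add: typed_val pr_val del: cel_cpair pr_cpair)
 next
  fix w assume w: "w \<in> hom2 K (pobj K A B) (pobj K A' B') (mval (tdom ?u)) (mval (tcod ?u)) & pfst K A' B' \<rhd> w = \<theta> \<lhd> pfst K A B
   & psnd K A' B' \<rhd> w = \<psi> \<lhd> psnd K A B"
  let ?w = "Tarr (tdom ?u) (tcod ?u) w"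
  have cw: "cel ?w" by (rule celI) (use w in simp_all)
  have "?w = ?u"
  proof (rule cel_prod_eqI[of _ _ A' B'])
   show "pr1 A' B'|>?w = pr1 A' B'|>?u" "pr2 A' B'|>?w = pr2 A' B'|>?u"
    unfolding e using w F by (auto intro!: tarr_eqI simp: typed_val pr_val simp del: pr_cpair)
  qed (use cw in simp_all)
  then show "w = tval ?u" by (metis tarr.sel(3))
 qed
qed

lemma product_tangentad_strict:
 assumes X: "is_tangentad K X" and Y: "is_tangentad K Y"
 defines "P \<equiv> product_tangentad K X Y"
 shows "pretan P" "base P = pobj K (base X) (base Y)"
  "strictly (pr1 (base X) (base Y)) P X" "strictly (pr2 (base X) (base Y)) P Y"
proof -
 let ?A = "base X" and ?B = "base Y" and ?p = "pr1 (base X) (base Y)" and ?q = "pr2 (base X) (base Y)"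
 note [simp] = tangentad_types[OF X] tangentad_types[OF Y]
 let ?c = "%t s. cpair (t<|?p) (s<|?q)"
 show b: "base P = pobj K ?A ?B" by (simp add: P_def product_tangentad_def Let_def)
 have T: "tT P = tpair (tT X oo ?p) (tT Y oo ?q)" "tT2 P = tpair (tT2 X oo ?p) (tT2 Y oo ?q)"
  using prod1_tpair[of "tT X" ?A "tT Y" ?B ?A ?B] prod1_tpair[of "tT2 X" ?A "tT2 Y" ?B ?A ?B]
  by (auto intro!: tmor.expand simp: b tan_val) (simp_all add: P_def product_tangentad_def Let_def)
 have TT: "tT P oo tT P = tpair (tT X oo tT X oo ?p) (tT Y oo tT Y oo ?q)"
  by (rule mor_prod_eqI[of _ _ ?A ?B]) (simp_all add: T)
 have v: "tan_q1 P = tval (?c (tq1 X) (tq1 Y))" "tan_q2 P = tval (?c (tq2 X) (tq2 Y))" "tan_p P = tval (?c (tp X) (tp Y))"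
  "tan_z P = tval (?c (tz X) (tz Y))" "tan_s P = tval (?c (ts X) (ts Y))" "tan_l P = tval (?c (tl X) (tl Y))" "tan_c P = tval (?c (tc X) (tc Y))"
  unfolding P_def product_tangentad_def Let_def by (simp_all, (subst prod2_cpair; (rule refl)?; simp add: tan_val typed_val)+)
 have c: "tq1 P = ?c (tq1 X) (tq1 Y)" "tq2 P = ?c (tq2 X) (tq2 Y)" "tp P = ?c (tp X) (tp Y)"
  "tz P = ?c (tz X) (tz Y)" "ts P = ?c (ts X) (ts Y)" "tl P = ?c (tl X) (tl Y)" "tc P = ?c (tc X) (tc Y)"
  by (rule tarr_eqI; simp add: v tan_val b T TT[unfolded T])+
 show "pretan P" unfolding pretan_def c T b by (simp add: pobj_closed)
 show "strictly ?p P X" "strictly ?q P Y" unfolding strictly_def c T b by simp_all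
qed

lemma is_tangentad_product:
 "is_tangentad K X ==> is_tangentad K Y ==> is_tangentad K (product_tangentad K X Y)"
 by (rule product_is_tangentad[OF product_tangentad_strict(1) _ _ product_tangentad_strict(2,3,4)])

section \<open>The terminal tangentad\<close>

lemma mor_tobj_eq: "[|mor f; mor g; mtrg f = tobj K; mtrg g = tobj K; msrc f = msrc g|] ==> f = g"
 using tobj_ex1_mor[of "msrc f"] by (intro tmor.expand) (auto simp: mor_def simp del: mor_obj)

lemma cel_tobj_eq: "[|cel u; cel v; tdom u = tdom v; mtrg (tdom u) = tobj K|] ==> u = v"
proof -
 assume h: "cel u" "cel v" "tdom u = tdom v" "mtrg (tdom u) = tobj K"
 have t: "tcod u = tcod v" by (rule mor_tobj_eq) (use h in simp_all)
 have "\<exists>!\<theta>. \<theta> \<in> hom2 K (msrc (tdom u)) (tobj K) (mval (tdom u)) (mval (tcod u))"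
  using h by (intro tobj_ex1_cell) (auto simp: cel_def mor_def simp del: mor_obj cel_mor)
 then have "tval u = tval v" using h t by (auto simp: cel_def simp del: cel_mor)
 then show ?thesis using h t by (intro tarr_eqI)
qed

lemma tpb_tobj:
 assumes "cel a" "cel b" "cel f" "cel g" "tdom b = tdom a" "tcod a = tdom f" "tcod b = tdom g" "tcod g = tcod f" "mtrg (tdom a) = tobj K"
 shows "tpb a b f g"
proof -
 have m: "mtrg (tdom f) = tobj K" "mtrg (tdom g) = tobj K" "msrc (tdom f) = msrc (tdom a)" "msrc (tdom g) = msrc (tdom a)"
  using cel_mor[OF assms(1)] cel_mor[OF assms(2)] assms by auto
 show ?thesis unfolding tpb_def
 proof (intro conjI allI impI; (elim conjE)?)
  show "f**a = g**b" by (rule cel_tobj_eq) (use assms m in simp_all)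
 next
  fix x y assume [simp]: "cel x" "cel y" "tdom x = tdom y" "tcod x = tdom f" "tcod y = tdom g"
  have [simp]: "mtrg (tdom y) = tobj K" "msrc (tdom y) = msrc (tdom a)" using cel_mor(3,4)[of x] m by simp_all
  have d: "tdom y = tdom a" by (rule mor_tobj_eq) (use assms in simp_all)
  show "\<exists>!u. cel u & tdom u = tdom x & tcod u = tdom a & a**u = x & b**u = y"
  proof (rule ex1I[of _ "cid (tdom a)"], intro conjI)
   show "a**cid (tdom a) = x" by (rule cel_tobj_eq) (use assms d in simp_all)
   show "b**cid (tdom a) = y" by (rule cel_tobj_eq) (use assms d in simp_all)
   fix u assume "cel u & tdom u = tdom x & tcod u = tdom a & a**u = x & b**u = y"
   then show "u = cid (tdom a)" by (intro cel_tobj_eq) (use assms d in auto)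
  qed (use assms d in simp_all)
 qed (use assms in simp_all)
qed

lemma tfp_tobj:
 assumes "mor P" "cel f" "msrc P = msrc (tdom f)" "mtrg P = tobj K" "mtrg (tdom f) = tobj K"
  and q: "!!i. i < n ==> cel (q i)" "!!i. i < n ==> tdom (q i) = P" "!!i. i < n ==> tcod (q i) = tdom f"
 shows "tfp n P q f"
 unfolding tfp_def
proof (intro conjI allI impI; (elim conjE)?)
 show "f**q i = f**q j" if "i < n" "j < n" for i j
  by (rule cel_tobj_eq) (use assms(1-5) q[OF that(1)] q[OF that(2)] in simp_all)
next
 fix W x assume W [simp]: "mor W" "msrc W = msrc P" "mtrg W = mtrg P"
  and x: "\<forall>i<n. cel (x i) & tdom (x i) = W & tcod (x i) = tdom f"
 have WP: "W = P" by (rule mor_tobj_eq) (use assms in simp_all)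
 show "\<exists>!u. cel u & tdom u = W & tcod u = P & (\<forall>i<n. q i**u = x i)"
 proof (rule ex1I[of _ "cid P"], intro conjI allI impI)
  fix i assume i: "i < n"
  show "q i**cid P = x i" by (rule cel_tobj_eq) (use assms(1-5) q[OF i] x[rule_format, OF i] WP in simp_all)
 next
  fix u assume "cel u & tdom u = W & tcod u = P & (\<forall>i<n. q i**u = x i)"
  then show "u = cid P" by (intro cel_tobj_eq) (use assms(1-5) WP in auto)
 qed (use assms WP in simp_all)
qed (use assms in simp_all)

lemma is_tangentad_terminal: "is_tangentad K (terminal_tangentad K)"
proof -
 let ?P = "terminal_tangentad K" and ?m = "mid (tobj K)"
 note [simp] = tobj_closed
 have b [simp]: "base ?P = tobj K" by (simp add: terminal_tangentad_def Let_def)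
 have T [simp]: "tT ?P = ?m" "tT2 ?P = ?m"
  by (simp_all add: tT_def tT2_def mid_def) (simp_all add: terminal_tangentad_def Let_def)
 have c [simp]: "tq1 ?P = cid ?m" "tq2 ?P = cid ?m" "tp ?P = cid ?m" "tz ?P = cid ?m" "ts ?P = cid ?m" "tl ?P = cid ?m" "tc ?P = cid ?m"
  by (auto intro!: tarr_eqI simp: tan_val) (simp_all add: terminal_tangentad_def Let_def typed_val)
 have Tm [simp]: "tTm ?P m = ?m" for m by (induction m) (simp_all add: tTm_rec)
 have P: "pretan ?P" unfolding pretan_def by simp
 show ?thesis
 proof (rule is_tangentad_I[OF P, where r = "cid ?m" and r' = "cid ?m"])
  show "addb ?P" unfolding addb_def by (auto intro!: cel_tobj_eq)
  show "fibre_powers ?P" unfolding fibre_powers_def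
  proof (intro allI impI)
   fix n :: nat
   show "\<exists>Pa q. mor Pa & msrc Pa = base ?P & mtrg Pa = base ?P & (\<forall>i<n. cel (q i) & tdom (q i) = Pa & tcod (q i) = tT ?P) &
     (\<forall>m h. mor h & mtrg h = base ?P --> tfp n (tTm ?P m oo Pa oo h) (%i. tTm ?P m|>q i<|h) (tTm ?P m|>tp ?P<|h))"
    by (intro exI[of _ ?m] exI[of _ "%i. cid ?m"]) (auto intro!: tfp_tobj)
  qed
  show "lift_univ ?P" unfolding lift_univ_def
   by (intro exI[of _ "cid ?m"]) (auto intro!: tpb_tobj)
 qed (auto intro!: tpb_tobj)
qed

section \<open>Finite 2-products of tangentads\<close>

lemma laxm_strict:
 assumes Q: "strictly Q P X" and P: "is_tangentad K P" and X: "is_tangentad K X"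
 shows "laxm P X Q (cid (tT X oo Q))"
proof -
 note [simp] = tangentad_types[OF P] tangentad_types[OF X]
 note s [simp] = strictly_simps[OF Q pretan_if_tangentad[OF P] pretan_if_tangentad[OF X]]
 show ?thesis unfolding laxm_def
  by (intro conjI exI[of _ "cid (tT2 X oo Q)"]) simp_all
qed

text \<open>The conditions on a distributive law into a product are equations between cells into the product, so they may be checked
 after the two strict projections.\<close>

lemma laxm_prod:
 assumes P: "is_tangentad K P" and X: "is_tangentad K X" and Y: "is_tangentad K Y" and W: "is_tangentad K W"
  and b: "base P = pobj K (base X) (base Y)"
  and Q1: "strictly (pr1 (base X) (base Y)) P X" and Q2: "strictly (pr2 (base X) (base Y)) P Y"
  and k: "mor k" "msrc k = base W" "mtrg k = base P" and h: "cel h" "tdom h = k oo tT W" "tcod h = tT P oo k"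
  and 1: "laxm W X (pr1 (base X) (base Y) oo k) (pr1 (base X) (base Y)|>h)"
  and 2: "laxm W Y (pr2 (base X) (base Y) oo k) (pr2 (base X) (base Y)|>h)"
 shows "laxm W P k h"
proof -
 let ?A = "base X" and ?B = "base Y" and ?p = "pr1 (base X) (base Y)" and ?q = "pr2 (base X) (base Y)"
 note [simp] = tangentad_types[OF P] tangentad_types[OF X] tangentad_types[OF Y] tangentad_types[OF W]
 note s1 [simp] = strictly_simps[OF Q1 pretan_if_tangentad[OF P] pretan_if_tangentad[OF X]]
 note s2 [simp] = strictly_simps[OF Q2 pretan_if_tangentad[OF P] pretan_if_tangentad[OF Y]]
 have m: "mor (mid (pobj K ?A ?B))" using tangentad_types(1)[OF P] b by (intro mor_mid) simp
 note [simp] = b k h m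
 note e1 = laxmD(7-10)[OF 1] and e2 = laxmD(7-10)[OF 2]
 obtain r1 where r1 [simp]: "cel r1" "tdom r1 = (?p oo k) oo tT2 W" "tcod r1 = tT2 X oo ?p oo k"
  and r1e: "(tq1 X<|(?p oo k))**r1 = (?p|>h)**((?p oo k)|>tq1 W)"
   "(tq2 X<|(?p oo k))**r1 = (?p|>h)**((?p oo k)|>tq2 W)"
  "(?p|>h)**((?p oo k)|>ts W) = (ts X<|(?p oo k))**r1"
  by (rule laxm_s[OF 1])
 obtain r2 where r2 [simp]: "cel r2" "tdom r2 = (?q oo k) oo tT2 W" "tcod r2 = tT2 Y oo ?q oo k"
  and r2e: "(tq1 Y<|(?q oo k))**r2 = (?q|>h)**((?q oo k)|>tq1 W)"
   "(tq2 Y<|(?q oo k))**r2 = (?q|>h)**((?q oo k)|>tq2 W)"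
  "(?q|>h)**((?q oo k)|>ts W) = (ts Y<|(?q oo k))**r2"
  by (rule laxm_s[OF 2])
 have "\<exists>!u. cel u & tdom u = k oo tT2 W & tcod u = tT2 P oo k & ?p|>u = r1 & ?q|>u = r2"
  by (rule cel_prod_ex1) simp_all
 then obtain r where r [simp]: "cel r" "tdom r = k oo tT2 W" "tcod r = tT2 P oo k" "?p|>r = r1" "?q|>r = r2" by blast
 show ?thesis unfolding laxm_def
 proof (intro conjI exI[of _ r])
  show "(tp P<|k)**h = k|>tp W" by (rule cel_prod_eqI[of _ _ ?A ?B]) (use e1(1) e2(1) in simp_all)
  show "h**(k|>tz W) = tz P<|k" by (rule cel_prod_eqI[of _ _ ?A ?B]) (use e1(2) e2(2) in simp_all)
  show "(tl P<|k)**h = (tT P|>h)**(h<|tT W)**(k|>tl W)"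
   by (rule cel_prod_eqI[of _ _ ?A ?B]) (use e1(3) e2(3) in simp_all)
  show "(tc P<|k)**(tT P|>h)**(h<|tT W) = (tT P|>h)**(h<|tT W)**(k|>tc W)"
   by (rule cel_prod_eqI[of _ _ ?A ?B]) (use e1(4) e2(4) in simp_all)
  show "(tq1 P<|k)**r = h**(k|>tq1 W)" by (rule cel_prod_eqI[of _ _ ?A ?B]) (use r1e(1) r2e(1) in simp_all)
  show "(tq2 P<|k)**r = h**(k|>tq2 W)" by (rule cel_prod_eqI[of _ _ ?A ?B]) (use r1e(2) r2e(2) in simp_all)
  show "h**(k|>ts W) = (ts P<|k)**r" by (rule cel_prod_eqI[of _ _ ?A ?B]) (use r1e(3) r2e(3) in simp_all)
 qed simp_all
qed

lemma Tng_psel [simp]: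
 "tobj (Tng K) = terminal_tangentad K" "pobj (Tng K) = product_tangentad K"
 "pfst (Tng K) X Y = (pfst K (base X) (base Y), id2 K (tanT X \<odot> pfst K (base X) (base Y)))"
 "psnd (Tng K) X Y = (psnd K (base X) (base Y), id2 K (tanT Y \<odot> psnd K (base X) (base Y)))"
 by (simp_all add: Tng_def)

lemma mk_eq:
 assumes "is_tangentad K X'" "is_tangentad K X" "A \<in> hom1 (Tng K) X' X" "B \<in> hom1 (Tng K) X' X"
  "mkf X' X (fst A) = mkf X' X (fst B)" "mka X' X (fst A) (snd A) = mka X' X (fst B) (snd B)"
 shows "A = B"
 using assms(5,6) by (auto simp: mkf_def mka_def intro: prod_eqI)

lemma Tng_tobj_ex1_mor:
 assumes X: "is_tangentad K X"
 shows "\<exists>!F. F \<in> hom1 (Tng K) X (terminal_tangentad K)"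
proof -
 let ?P = "terminal_tangentad K"
 note P = is_tangentad_terminal
 note [simp] = tangentad_types[OF X] tangentad_types[OF P]
 have b [simp]: "base ?P = tobj K" by (simp add: terminal_tangentad_def Let_def)
 obtain F where F: "F \<in> hom1 K (base X) (tobj K)" using tobj_ex1_mor[of "base X"] by auto
 let ?f = "Tmor (base X) (tobj K) F"
 have f [simp]: "mor ?f" using F tobj_closed by (simp add: mor_def)
 have e [simp]: "?f oo tT X = ?f" "?f oo tT2 X = ?f" "tT ?P oo ?f = ?f" "tT2 ?P oo ?f = ?f" "?f oo tT X oo tT X = ?f"
  by (rule mor_tobj_eq; simp)+
 have "laxm X ?P ?f (cid ?f)"
  unfolding laxm_def by (intro conjI exI[of _ "cid ?f"]; (rule cel_tobj_eq)?; simp)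
 then have "(F, id2 K F) \<in> hom1 (Tng K) X ?P"
  by (rule hom1_Tng_I[OF X P]) (simp_all add: typed_val)
 moreover have "A = B" if A: "A \<in> hom1 (Tng K) X ?P" and B: "B \<in> hom1 (Tng K) X ?P" for A B
 proof (rule mk_eq[OF X P A B])
  note a = laxmD(1-6)[OF lax_cases[OF X P A]] and c = laxmD(1-6)[OF lax_cases[OF X P B]]
  show e: "mkf X ?P (fst A) = mkf X ?P (fst B)" by (rule mor_tobj_eq) (use a c in simp_all)
  show "mka X ?P (fst A) (snd A) = mka X ?P (fst B) (snd B)" by (rule cel_tobj_eq) (use a c e in simp_all)
 qed
 ultimately show ?thesis by blast
qed

lemma Tng_tobj_ex1_cell:
 assumes X: "is_tangentad K X" and F: "F \<in> hom1 (Tng K) X (terminal_tangentad K)" and G: "G \<in> hom1 (Tng K) X (terminal_tangentad K)"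
 shows "\<exists>!\<theta>. \<theta> \<in> hom2 (Tng K) X (terminal_tangentad K) F G"
proof -
 let ?P = "terminal_tangentad K"
 note P = is_tangentad_terminal
 have b [simp]: "base ?P = tobj K" by (simp add: terminal_tangentad_def Let_def)
 note [simp] = tangentad_types[OF X] tangentad_types[OF P] laxmD(1-6)[OF lax_cases[OF X P F]] laxmD(1-6)[OF lax_cases[OF X P G]]
 have e: "mkf X ?P (fst G) = mkf X ?P (fst F)" by (rule mor_tobj_eq) simp_all
 have "tval (cid (mkf X ?P (fst F))) \<in> hom2 (Tng K) X ?P F G"
  by (rule mkt_hom2[OF X P F G]) (simp_all add: e, rule cel_tobj_eq, simp_all add: e)
 moreover have "\<theta> = \<psi>" if t: "\<theta> \<in> hom2 (Tng K) X ?P F G" and s: "\<psi> \<in> hom2 (Tng K) X ?P F G" for \<theta> \<psi>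
 proof -
  have "mkt X ?P F G \<theta> = mkt X ?P F G \<psi>"
   by (rule cel_tobj_eq) (use cell_cases(1)[OF X P F G t] cell_cases(1)[OF X P F G s] in simp_all)
  then show ?thesis by (simp add: mkt_def)
 qed
 ultimately show ?thesis by blast
qed

lemma finite_2_products_Tng: "finite_2_products (Tng K)"
proof (rule finite_2_products.intro)
 show "tobj (Tng K) \<in> obj (Tng K)" by (simp add: is_tangentad_terminal)
next
 fix X assume "X \<in> obj (Tng K)"
 then show "\<exists>!F. F \<in> hom1 (Tng K) X (tobj (Tng K))" using Tng_tobj_ex1_mor by simp
next
 fix X F G assume "X \<in> obj (Tng K)" "F \<in> hom1 (Tng K) X (tobj (Tng K))" "G \<in> hom1 (Tng K) X (tobj (Tng K))"
 then show "\<exists>!\<theta>. \<theta> \<in> hom2 (Tng K) X (tobj (Tng K)) F G" using Tng_tobj_ex1_cell by simp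
next
 fix A B assume "A \<in> obj (Tng K)" "B \<in> obj (Tng K)"
 then have X: "is_tangentad K A" and Y: "is_tangentad K B" by simp_all
 note P = is_tangentad_product[OF X Y] and s = product_tangentad_strict[OF X Y]
 show "pobj (Tng K) A B \<in> obj (Tng K)" using P by simp
 show "pfst (Tng K) A B \<in> hom1 (Tng K) (pobj (Tng K) A B) A"
  using hom1_Tng_I[OF P X laxm_strict[OF s(3) P X]] by (simp add: typed_val pr_val tan_val)
 show "psnd (Tng K) A B \<in> hom1 (Tng K) (pobj (Tng K) A B) B"
  using hom1_Tng_I[OF P Y laxm_strict[OF s(4) P Y]] by (simp add: typed_val pr_val tan_val)
next
 fix A B W F G assume "A \<in> obj (Tng K)" "B \<in> obj (Tng K)" "W \<in> obj (Tng K)" and F: "F \<in> hom1 (Tng K) W A" and G: "G \<in> hom1 (Tng K) W B"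
 then have X: "is_tangentad K A" and Y: "is_tangentad K B" and W: "is_tangentad K W" by simp_all
 let ?P = "product_tangentad K A B"
 note P = is_tangentad_product[OF X Y] and s = product_tangentad_strict[OF X Y]
 note f = lax_cases[OF W X F] and g = lax_cases[OF W Y G]
 note [simp] = tangentad_types[OF P] tangentad_types[OF X] tangentad_types[OF Y] tangentad_types[OF W] s(2)
  laxmD(1-6)[OF f] laxmD(1-6)[OF g]
 note s1 [simp] = strictly_simps[OF s(3) s(1) pretan_if_tangentad[OF X]]
 note s2 [simp] = strictly_simps[OF s(4) s(1) pretan_if_tangentad[OF Y]]
 let ?p = "pr1 (base A) (base B)" and ?q = "pr2 (base A) (base B)"
 let ?f = "mkf W A (fst F)" and ?a = "mka W A (fst F) (snd F)" and ?g = "mkf W B (fst G)" and ?b = "mka W B (fst G) (snd G)"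
 let ?k = "tpair ?f ?g"
 have k [simp]: "mor ?k" "?p oo ?k = ?f" "?q oo ?k = ?g" by simp_all
 have "\<exists>!u. cel u & tdom u = ?k oo tT W & tcod u = tT ?P oo ?k & ?p|>u = ?a & ?q|>u = ?b"
  by (rule cel_prod_ex1) simp_all
 then obtain u where u [simp]: "cel u" "tdom u = ?k oo tT W" "tcod u = tT ?P oo ?k" "?p|>u = ?a" "?q|>u = ?b" by blast
 have "laxm W ?P ?k u" by (rule laxm_prod[OF P X Y W s(2,3,4)]) (use f g in simp_all)
 from hom1_Tng_I[OF W P this, of "(mval ?k, tval u)"] have H: "(mval ?k, tval u) \<in> hom1 (Tng K) W ?P" by simp
 have "mval (?p oo ?k) = fst F" "tval ((cid (tT A oo ?p)<|?k)**(?p|>u)) = snd F"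
  "mval (?q oo ?k) = fst G" "tval ((cid (tT B oo ?q)<|?k)**(?q|>u)) = snd G"
  by (simp_all add: mk_val)
 then have e: "pfst (Tng K) A B \<odot>\<^bsub>Tng K\<^esub> (mval ?k, tval u) = F" "psnd (Tng K) A B \<odot>\<^bsub>Tng K\<^esub> (mval ?k, tval u) = G"
  by (simp_all only: typed_val pr_val tan_val Tng_psel Tng_sel fst_conv snd_conv prod.collapse)
 have un: "H' = (mval ?k, tval u)" if H': "H' \<in> hom1 (Tng K) W ?P" and eq: "pfst (Tng K) A B \<odot>\<^bsub>Tng K\<^esub> H' = F" "psnd (Tng K) A B \<odot>\<^bsub>Tng K\<^esub> H' = G" for H'
 proof -
  note [simp] = laxmD(1-6)[OF lax_cases[OF W P H']]
  let ?h = "mkf W ?P (fst H')" and ?c = "mka W ?P (fst H') (snd H')"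
  have m: "mval (?p oo ?h) = mval ?f" "mval (?q oo ?h) = mval ?g"
   using eq by (auto simp: typed_val pr_val mk_val)
  have ph: "?p oo ?h = ?f" "?q oo ?h = ?g" using m by (auto intro: tmor.expand)
  have hk: "?h = ?k" by (rule mor_prod_eqI[of _ _ "base A" "base B"]) (simp_all add: ph)
  have v: "tval ((cid (tT A oo ?p)<|?h)**(?p|>?c)) = tval ?a" "tval ((cid (tT B oo ?q)<|?h)**(?q|>?c)) = tval ?b"
   using arg_cong[OF eq(1), of snd] arg_cong[OF eq(2), of snd]
   by (simp_all only: typed_val pr_val mk_val tan_val Tng_psel Tng_sel fst_conv snd_conv)
  then have v': "tval (?p|>?c) = tval ?a" "tval (?q|>?c) = tval ?b" by (simp_all add: ph)
  have pc: "?p|>?c = ?a" "?q|>?c = ?b" by (rule tarr_eqI; use v' hk in simp)+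
  have "?c = u" by (rule cel_prod_eqI[of _ _ "base A" "base B"]) (simp_all add: hk pc)
  then show ?thesis using arg_cong[OF hk, of mval] by (metis mk_val prod.collapse)
 qed
 show "\<exists>!H. H \<in> hom1 (Tng K) W (pobj (Tng K) A B) & pfst (Tng K) A B \<odot>\<^bsub>Tng K\<^esub> H = F & psnd (Tng K) A B \<odot>\<^bsub>Tng K\<^esub> H = G"
  unfolding Tng_psel(2)
 proof (rule ex1I[of _ "(mval ?k, tval u)"], intro conjI)
  fix H' assume "H' \<in> hom1 (Tng K) W ?P & pfst (Tng K) A B \<odot>\<^bsub>Tng K\<^esub> H' = F & psnd (Tng K) A B \<odot>\<^bsub>Tng K\<^esub> H' = G"
  then show "H' = (mval ?k, tval u)" by (elim conjE) (rule un)
 qed (rule H e)+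
next
 fix A B W H H' \<theta> \<psi>
 assume "A \<in> obj (Tng K)" "B \<in> obj (Tng K)" "W \<in> obj (Tng K)" and H0: "H \<in> hom1 (Tng K) W (pobj (Tng K) A B)" "H' \<in> hom1 (Tng K) W (pobj (Tng K) A B)"
  and t0: "\<theta> \<in> hom2 (Tng K) W A (pfst (Tng K) A B \<odot>\<^bsub>Tng K\<^esub> H) (pfst (Tng K) A B \<odot>\<^bsub>Tng K\<^esub> H')"
   "\<psi> \<in> hom2 (Tng K) W B (psnd (Tng K) A B \<odot>\<^bsub>Tng K\<^esub> H) (psnd (Tng K) A B \<odot>\<^bsub>Tng K\<^esub> H')"
 then have X: "is_tangentad K A" and Y: "is_tangentad K B" and W: "is_tangentad K W" by simp_all
 let ?P = "product_tangentad K A B"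
 note P = is_tangentad_product[OF X Y] and s = product_tangentad_strict[OF X Y]
 have H: "H \<in> hom1 (Tng K) W ?P" and H': "H' \<in> hom1 (Tng K) W ?P" using H0 by simp_all
 note h = lax_cases[OF W P H] and h' = lax_cases[OF W P H']
 note [simp] = tangentad_types[OF P] tangentad_types[OF X] tangentad_types[OF Y] tangentad_types[OF W] s(2)
  laxmD(1-6)[OF h] laxmD(1-6)[OF h']
 note s1 [simp] = strictly_simps[OF s(3) s(1) pretan_if_tangentad[OF X]]
 note s2 [simp] = strictly_simps[OF s(4) s(1) pretan_if_tangentad[OF Y]]
 let ?p = "pr1 (base A) (base B)" and ?q = "pr2 (base A) (base B)"
 let ?h = "mkf W ?P (fst H)" and ?a = "mka W ?P (fst H) (snd H)" and ?h' = "mkf W ?P (fst H')" and ?b = "mka W ?P (fst H') (snd H')"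
 have iid: "id2 K (tanT A \<odot> pfst K (base A) (base B)) \<lhd> fst Z \<bullet> (pfst K (base A) (base B) \<rhd> snd Z) = tval (?p|>mka W ?P (fst Z) (snd Z))"
  "id2 K (tanT B \<odot> psnd K (base A) (base B)) \<lhd> fst Z \<bullet> (psnd K (base A) (base B) \<rhd> snd Z) = tval (?q|>mka W ?P (fst Z) (snd Z))"
  if Z: "Z \<in> hom1 (Tng K) W ?P" for Z
 proof -
  note [simp] = laxmD(1-6)[OF lax_cases[OF W P Z]]
  let ?z = "mkf W ?P (fst Z)" and ?c = "mka W ?P (fst Z) (snd Z)"
  have "tval ((cid (tT A oo ?p)<|?z)**(?p|>?c)) = tval (?p|>?c)"
   "tval ((cid (tT B oo ?q)<|?z)**(?q|>?c)) = tval (?q|>?c)" by simp_all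
  then show "id2 K (tanT A \<odot> pfst K (base A) (base B)) \<lhd> fst Z \<bullet> (pfst K (base A) (base B) \<rhd> snd Z) = tval (?p|>?c)"
   "id2 K (tanT B \<odot> psnd K (base A) (base B)) \<lhd> fst Z \<bullet> (psnd K (base A) (base B) \<rhd> snd Z) = tval (?q|>?c)"
   by (simp_all only: typed_val pr_val mk_val tan_val)
 qed
 let ?t = "Tarr (?p oo ?h) (?p oo ?h') \<theta>" and ?s = "Tarr (?q oo ?h) (?q oo ?h') \<psi>"
 have t: "cel ?t" "cel ?s"
  using t0 by (auto intro!: celI simp: hom2_Tng_iff typed_val pr_val mk_val)
 have te: "(tT A|>?t)**(?p|>?a) = (?p|>?b)**(?t<|tT W)" "(tT B|>?s)**(?q|>?a) = (?q|>?b)**(?s<|tT W)"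
  by (rule tarr_eqI, use t t0 in \<open>simp_all add: hom2_Tng_iff iid[OF H] iid[OF H']\<close>, simp_all add: typed_val pr_val mk_val tan_val)+
 have "\<exists>!u. cel u & tdom u = ?h & tcod u = ?h' & ?p|>u = ?t & ?q|>u = ?s"
  by (rule cel_prod_ex1) (use t in simp_all)
 then obtain u where u [simp]: "cel u" "tdom u = ?h" "tcod u = ?h'" and pu: "?p|>u = ?t" "?q|>u = ?s" by blast
 have "(tT ?P|>u)**?a = ?b**(u<|tT W)"
 proof (rule cel_prod_eqI[of _ _ "base A" "base B"])
  have 1: "?p|>u<|tT W = ?t<|tT W" "?q|>u<|tT W = ?s<|tT W"
   using pu[THEN arg_cong[of _ _ "%x. x<|tT W"]] by simp_all
  show "?p|>((tT ?P|>u)**?a) = ?p|>(?b**(u<|tT W))" by (simp add: pu 1 te)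
  show "?q|>((tT ?P|>u)**?a) = ?q|>(?b**(u<|tT W))" by (simp add: pu 1 te)
 qed simp_all
 then have m: "tval u \<in> hom2 (Tng K) W ?P H H'" by (intro mkt_hom2[OF W P H H']) simp_all
 have e: "pfst (Tng K) A B \<rhd>\<^bsub>Tng K\<^esub> tval u = \<theta>" "psnd (Tng K) A B \<rhd>\<^bsub>Tng K\<^esub> tval u = \<psi>"
  using pu[THEN arg_cong[of _ _ tval]] by (simp_all add: typed_val pr_val)
 have un: "v = tval u" if v: "v \<in> hom2 (Tng K) W ?P H H'" and "pfst (Tng K) A B \<rhd>\<^bsub>Tng K\<^esub> v = \<theta>" "psnd (Tng K) A B \<rhd>\<^bsub>Tng K\<^esub> v = \<psi>" for v
 proof -
  note [simp] = cell_cases(1)[OF W P H H' v]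
  have "mkt W ?P H H' v = u"
  proof (rule cel_prod_eqI[of _ _ "base A" "base B"])
   show "?p|>mkt W ?P H H' v = ?p|>u" "?q|>mkt W ?P H H' v = ?q|>u"
    unfolding pu using that by (auto intro!: tarr_eqI simp: typed_val mkt_val pr_val)
  qed simp_all
  then show ?thesis by (metis mkt_val)
 qed
 show "\<exists>!\<omega>. \<omega> \<in> hom2 (Tng K) W (pobj (Tng K) A B) H H' & pfst (Tng K) A B \<rhd>\<^bsub>Tng K\<^esub> \<omega> = \<theta> & psnd (Tng K) A B \<rhd>\<^bsub>Tng K\<^esub> \<omega> = \<psi>"
  unfolding Tng_psel(2)
 proof (rule ex1I[of _ "tval u"], intro conjI)
  fix v assume "v \<in> hom2 (Tng K) W ?P H H' & pfst (Tng K) A B \<rhd>\<^bsub>Tng K\<^esub> v = \<theta> & psnd (Tng K) A B \<rhd>\<^bsub>Tng K\<^esub> v = \<psi>"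
  then show "v = tval u" by (elim conjE) (rule un)
 qed (rule m e)+
qed

lemma cartesian_2_category_Tng: "cartesian_2_category (Tng K)"
 by (rule cartesian_2_category.intro[OF two_category_Tng finite_2_products_Tng])

section \<open>The tangent bundle as a tangent morphism\<close>

text \<open>The flip makes \<open>T\<close> a tangent endomorphism. Its compatibility with \<open>l\<close> is the axiom on \<open>c T\<close>, \<open>T c\<close> and \<open>l T\<close>, solved
 for \<open>l T\<close> by means of \<open>c c = id\<close>.\<close>

lemma laxm_T:
 assumes X: "is_tangentad K X"
 shows "laxm X X (tT X) (tc X)"
proof -
 note [simp] = tangentad_types[OF X]
 note e = tangentad_eqs[OF X]
 obtain r where r: "cel r" "tdom r = tT X oo tT2 X" "tcod r = tT2 X oo tT X"
    "(tq1 X<|tT X)**r = tc X**(tT X|>tq1 X)" "(tq2 X<|tT X)**r = tc X**(tT X|>tq2 X)"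
  by (rule tpb_ex[OF T2_tpb(1)[OF X, of "tT X"], of "tc X**(tT X|>tq1 X)" "tc X**(tT X|>tq2 X)"])
   (simp_all add: vc_pre[OF e(3)] vc_lw_eq[OF e(10)])
 have cT: "(tc X<|tT X)**(tc X<|tT X) = cid (tT X oo tT X oo tT X)"
  "(tT X|>tc X)**(tT X|>tc X) = cid (tT X oo tT X oo tT X)"
  using arg_cong[OF e(8), of "%x. x<|tT X"] arg_cong[OF e(8), of "%x. tT X|>x"] by simp_all
 have l: "(tl X<|tT X)**tc X = (tT X|>tc X)**(tc X<|tT X)**(tT X|>tl X)"
 proof -
  have "(tT X|>tc X)**(tc X<|tT X)**(tT X|>tl X)**tc X**tc X
    = (tT X|>tc X)**(tc X<|tT X)**(tc X<|tT X)**(tT X|>tc X)**(tl X<|tT X)**tc X"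
   using arg_cong[OF e(7), of "%x. (tT X|>tc X)**(tc X<|tT X)**x**tc X"] by simp
  also have "\<dots> = (tl X<|tT X)**tc X"
   by (simp add: vc_pre[OF cT(1)] vc_pre[OF cT(2)])
  finally show ?thesis by (simp add: e(8))
 qed
 show ?thesis unfolding laxm_def
  using r tangentad_flip_add[OF X r] l e(3,4,9) by auto
qed

definition tflip :: "('o, 'm, 'c) tangentad => (('o, 'm) tmor, 'c) tarr" where
 "tflip X = Tarr (tT2 X oo tT X) (tT X oo tT2 X) (flip2 K X)"

lemma tflip_sel [simp]: "tdom (tflip X) = tT2 X oo tT X" "tcod (tflip X) = tT X oo tT2 X"
 by (simp_all add: tflip_def)

lemma tflip_props:
 assumes X: "is_tangentad K X"
 shows "cel (tflip X)" "(tT X|>tq1 X)**tflip X = tc X**(tq1 X<|tT X)"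
  "(tT X|>tq2 X)**tflip X = tc X**(tq2 X<|tT X)"
proof -
 note [simp] = tangentad_types[OF X]
 note e = tangentad_eqs[OF X]
 have pb: "tpb (tT X|>tq1 X) (tT X|>tq2 X) (tT X|>tp X) (tT X|>tp X)"
  using T2_tpb(2)[OF X, of "mid (base X)"] by simp
 have pc: "(tT X|>tp X)**tc X = tp X<|tT X"
  using arg_cong[OF e(3), of "%x. x**tc X"] by (simp add: e(8))
 obtain r where r: "cel r" "tdom r = tT2 X oo tT X" "tcod r = tT X oo tT2 X"
   "(tT X|>tq1 X)**r = tc X**(tq1 X<|tT X)" "(tT X|>tq2 X)**r = tc X**(tq2 X<|tT X)"
  by (rule tpb_ex[OF pb, of "tc X**(tq1 X<|tT X)" "tc X**(tq2 X<|tT X)"])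
   (simp_all add: vc_pre[OF pc] vc_rw_eq[OF e(10)])
 have "pairing (homcat K (base X) (base X)) (tanT X \<odot> tanT2 X) (tval (tT X|>tq1 X)) (tval (tT X|>tq2 X)) (tanT2 X \<odot> tanT X)
   (tval (tc X**(tq1 X<|tT X))) (tval (tc X**(tq2 X<|tT X))) = tval r"
  by (rule pairing_rw[OF pb r(1) _ _ _ r(4,5)]) (simp_all add: r, simp_all add: mcomp_def tT_def tT2_def)
 then have "flip2 K X = tval r" by (simp add: flip2_def Let_def typed_val tan_val)
 then have "tflip X = r" using r by (intro tarr_eqI) (simp_all add: tflip_def)
 then show "cel (tflip X)" "(tT X|>tq1 X)**tflip X = tc X**(tq1 X<|tT X)"
  "(tT X|>tq2 X)**tflip X = tc X**(tq2 X<|tT X)" using r by simp_all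
qed

text \<open>All conditions on the distributive law of \<open>T2\<close> may be checked after the projections of a pullback that is preserved by
 \<open>T\<close> and by \<open>T T\<close>, and after these projections they are the conditions on the flip.\<close>

lemma laxm_T2:
 assumes X: "is_tangentad K X"
 shows "laxm X X (tT2 X) (tflip X)"
proof -
 note [simp] = tangentad_types[OF X] tflip_props(1)[OF X]
 note e = tangentad_eqs[OF X] and f = tflip_props(2,3)[OF X]
 have pbT: "tpb (tT X|>tq1 X) (tT X|>tq2 X) (tT X|>tp X) (tT X|>tp X)"
  using T2_tpb(2)[OF X, of "mid (base X)"] by simp
 have pb: "tpb (tq1 X) (tq2 X) (tp X) (tp X)" using T2_tpb(1)[OF X, of "mid (base X)"] by simp
 have pbTT: "tpb (tT X|>tT X|>tq1 X) (tT X|>tT X|>tq2 X) (tT X|>tT X|>tp X) (tT X|>tT X|>tp X)"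
  using T2_tpb(3)[OF X, of "mid (base X)"] by simp
 note T = laxm_T[OF X]
 note t = laxmD(7-10)[OF T]
 obtain rT where rT [simp]: "cel rT" "tdom rT = tT X oo tT2 X" "tcod rT = tT2 X oo tT X"
  and rTe: "(tq1 X<|tT X)**rT = tc X**(tT X|>tq1 X)" "(tq2 X<|tT X)**rT = tc X**(tT X|>tq2 X)"
  "tc X**(tT X|>ts X) = (ts X<|tT X)**rT"
  by (rule laxm_s[OF T])
 have nat: "(t<|tT X)**(tdom t|>s) = (tcod t|>s)**(t<|tdom s)"
  if "cel t" "cel s" "tcod s = tT X" "msrc (tdom t) = base X" for t s
  using whisker_exchange[of t s] that cel_mor(4)[of s] by simp
 have p: "(tp X<|tT2 X)**tflip X = tT2 X|>tp X"
 proof (rule tpb_eqI[OF pb])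
  have "tq**tp X<|tT2 X**tflip X = tq**tT2 X|>tp X"
   if [simp]: "cel tq" "tdom tq = tT2 X" "tcod tq = tT X" and ft: "(tT X|>tq)**tflip X = tc X**(tq<|tT X)" for tq
  proof -
   have x: "tq**tp X<|tT2 X = tp X<|tT X**tT X|>tq" using whisker_exchange[of "tp X" tq] by simp
   have y: "tT X|>tp X**tq<|tT X = tq**tT2 X|>tp X" using whisker_exchange[of tq "tp X"] by simp
   show ?thesis by (simp add: vc_pre[OF x] ft vc_pre[OF e(3)] y)
  qed
  then show "tq1 X**tp X<|tT2 X**tflip X = tq1 X**tT2 X|>tp X"
   "tq2 X**tp X<|tT2 X**tflip X = tq2 X**tT2 X|>tp X" using f by simp_all
 qed simp_all
 have z: "tflip X**(tT2 X|>tz X) = tz X<|tT2 X"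
 proof (rule tpb_eqI[OF pbT])
  have "(tT X|>tq)**tflip X**(tT2 X|>tz X) = (tT X|>tq)**tz X<|tT2 X"
   if [simp]: "cel tq" "tdom tq = tT2 X" "tcod tq = tT X" and ft: "(tT X|>tq)**tflip X = tc X**(tq<|tT X)" for tq
  proof -
   have x: "tq<|tT X**tT2 X|>tz X = tT X|>tz X**tq" using whisker_exchange[of tq "tz X"] by simp
   have y: "(tT X|>tq)**tz X<|tT2 X = (tz X<|tT X)**tq" using whisker_exchange[of "tz X" tq] by simp
   show ?thesis by (simp add: vc_pre[OF ft] x y vc_pre[OF e(4)])
  qed
  then show "(tT X|>tq1 X)**tflip X**(tT2 X|>tz X) = (tT X|>tq1 X)**tz X<|tT2 X"
   "(tT X|>tq2 X)**tflip X**(tT2 X|>tz X) = (tT X|>tq2 X)**tz X<|tT2 X" using f by simp_all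
 qed simp_all
 have pt: "tp X<|tT2 X**tflip X**(tT2 X|>tq1 X) = tp X<|tT2 X**tflip X**(tT2 X|>tq2 X)"
  by (simp add: vc_pre[OF p] vc_lw_eq[OF e(10)])
 obtain r where r [simp]: "cel r" "tdom r = tT2 X oo tT2 X" "tcod r = tT2 X oo tT2 X"
  and re: "(tq1 X<|tT2 X)**r = tflip X**(tT2 X|>tq1 X)" "(tq2 X<|tT2 X)**r = tflip X**(tT2 X|>tq2 X)"
  by (rule tpb_ex[OF T2_tpb(1)[OF X, of "tT2 X"], of "tflip X**(tT2 X|>tq1 X)" "tflip X**(tT2 X|>tq2 X)"]) (simp_all add: pt)
 have s: "tflip X**(tT2 X|>ts X) = (ts X<|tT2 X)**r"
 proof (rule tpb_eqI[OF pbT])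
  have "(tT X|>tq)**tflip X**(tT2 X|>ts X) = (tT X|>tq)**(ts X<|tT2 X)**r"
   if [simp]: "cel tq" "tdom tq = tT2 X" "tcod tq = tT X" and ft: "(tT X|>tq)**tflip X = tc X**(tq<|tT X)" for tq
  proof -
   have x: "tq<|tT X**tT2 X|>ts X = tT X|>ts X**tq<|tT2 X" using whisker_exchange[of tq "ts X"] by simp
   have y: "(tT X|>tq)**ts X<|tT2 X = (ts X<|tT X)**tT2 X|>tq" using whisker_exchange[of "ts X" tq] by simp
   have "(tT2 X|>tq)**r = rT**tq<|tT2 X"
   proof (rule tpb_eqI[OF T2_tpb(1)[OF X, of "tT X"]])
    have "(q<|tT X)**(tT2 X|>tq)**r = (q<|tT X)**rT**tq<|tT2 X"
     if [simp]: "cel q" "tdom q = tT2 X" "tcod q = tT X"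
      and q: "(q<|tT2 X)**r = tflip X**(tT2 X|>q)" "(q<|tT X)**rT = tc X**(tT X|>q)" for q
    proof -
     have a: "(q<|tT X)**(tT2 X|>tq) = (tT X|>tq)**(q<|tT2 X)" using whisker_exchange[of q tq] by simp
     have b: "(tq<|tT X)**(tT2 X|>q) = (tT X|>q)**(tq<|tT2 X)" using whisker_exchange[of tq q] by simp
     show ?thesis by (simp add: vc_pre[OF a] q vc_pre[OF ft] b vc_pre[OF q(2)])
    qed
    then show "(tq1 X<|tT X)**(tT2 X|>tq)**r = (tq1 X<|tT X)**rT**tq<|tT2 X"
     "(tq2 X<|tT X)**(tT2 X|>tq)**r = (tq2 X<|tT X)**rT**tq<|tT2 X" using re rTe by simp_all
   qed simp_all
   then show ?thesis by (simp add: vc_pre[OF ft] x vc_pre[OF y] vc_pre[OF rTe(3)])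
  qed
  then show "(tT X|>tq1 X)**tflip X**(tT2 X|>ts X) = (tT X|>tq1 X)**(ts X<|tT2 X)**r"
   "(tT X|>tq2 X)**tflip X**(tT2 X|>ts X) = (tT X|>tq2 X)**(ts X<|tT2 X)**r" using f by simp_all
 qed simp_all
 have l: "(tl X<|tT2 X)**tflip X = (tT X|>tflip X)**(tflip X<|tT X)**(tT2 X|>tl X)"
  and c: "(tc X<|tT2 X)**(tT X|>tflip X)**(tflip X<|tT X) = (tT X|>tflip X)**(tflip X<|tT X)**(tT2 X|>tc X)"
 proof -
  have "(tT X|>tT X|>tq)**(tl X<|tT2 X)**tflip X = (tT X|>tT X|>tq)**(tT X|>tflip X)**(tflip X<|tT X)**(tT2 X|>tl X) &
   (tT X|>tT X|>tq)**(tc X<|tT2 X)**(tT X|>tflip X)**(tflip X<|tT X) =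
   (tT X|>tT X|>tq)**(tT X|>tflip X)**(tflip X<|tT X)**(tT2 X|>tc X)"
   if [simp]: "cel tq" "tdom tq = tT2 X" "tcod tq = tT X" and ft: "(tT X|>tq)**tflip X = tc X**(tq<|tT X)" for tq
  proof -
   have ftl: "(tT X|>tT X|>tq)**(tT X|>tflip X) = (tT X|>tc X)**(tT X|>tq<|tT X)"
    using arg_cong[OF ft, of "%x. tT X|>x"] by simp
   have ftr: "(tT X|>tq<|tT X)**(tflip X<|tT X) = (tc X<|tT X)**(tq<|tT X<|tT X)"
    using arg_cong[OF ft, of "%x. x<|tT X"] by simp
   have xl: "(tT X|>tT X|>tq)**(tl X<|tT2 X) = (tl X<|tT X)**(tT X|>tq)"
    using whisker_exchange[of "tl X" tq] by simp
   have xc: "(tT X|>tT X|>tq)**(tc X<|tT2 X) = (tc X<|tT X)**(tT X|>tT X|>tq)"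
    using whisker_exchange[of "tc X" tq] by simp
   have yl: "(tq<|tT X<|tT X)**(tT2 X|>tl X) = (tT X|>tl X)**(tq<|tT X)"
    using whisker_exchange[of tq "tl X"] by simp
   have yc: "(tq<|tT X<|tT X)**(tT2 X|>tc X) = (tT X|>tc X)**(tq<|tT X<|tT X)"
    using whisker_exchange[of tq "tc X"] by simp
   have 1: "(tT X|>tT X|>tq)**(tl X<|tT2 X)**tflip X = (tT X|>tc X)**(tc X<|tT X)**(tT X|>tl X)**tq<|tT X"
    by (simp add: vc_pre[OF xl] ft vc_pre[OF t(3)])
   have br: "(tT X|>tc X)**(tc X<|tT X)**(tT X|>tc X)**(tq<|tT X<|tT X) =
     (tc X<|tT X)**(tT X|>tc X)**(tc X<|tT X)**(tq<|tT X<|tT X)"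
    using arg_cong[OF e(9), of "%x. x**(tq<|tT X<|tT X)"] by simp
   show ?thesis by (simp add: 1 vc_pre[OF xc] ftl vc_pre[OF ftl] ftr vc_pre[OF ftr] yl yc br)
  qed
  note * = this[OF _ _ _ f(1), simplified] this[OF _ _ _ f(2), simplified]
  show "(tl X<|tT2 X)**tflip X = (tT X|>tflip X)**(tflip X<|tT X)**(tT2 X|>tl X)"
   by (rule tpb_eqI[OF pbTT]) (use * in simp_all)
  show "(tc X<|tT2 X)**(tT X|>tflip X)**(tflip X<|tT X) = (tT X|>tflip X)**(tflip X<|tT X)**(tT2 X|>tc X)"
   by (rule tpb_eqI[OF pbTT]) (use * in simp_all)
 qed
 show ?thesis unfolding laxm_def
  using p z l c r re s by (intro conjI exI[of _ r]) simp_all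
qed

section \<open>Cartesian objects\<close>

lemma tpair_comp_simp [simp]:
 "[|mor f; mor g; msrc g = msrc f; mor h; mtrg h = msrc f|] ==> tpair f g oo h = tpair (f oo h) (g oo h)"
 by (rule tpair_comp)

lemma lw_tpair [simp]:
 assumes "mor f" "mor g" "msrc g = msrc f" "cel t" "mtrg (tdom t) = msrc f"
 shows "tpair f g|>t = cpair (f|>t) (g|>t)"
proof (rule cel_prod_eqI[of _ _ "mtrg f" "mtrg g"])
 show "pr1 (mtrg f) (mtrg g)|>tpair f g|>t = pr1 (mtrg f) (mtrg g)|>cpair (f|>t) (g|>t)"
  using arg_cong[OF pr_tpair(1)[OF assms(1-3) refl refl], of "%x. x|>t"] assms lw_mcomp[of "pr1 (mtrg f) (mtrg g)" "tpair f g" t] by simp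
 show "pr2 (mtrg f) (mtrg g)|>tpair f g|>t = pr2 (mtrg f) (mtrg g)|>cpair (f|>t) (g|>t)"
  using arg_cong[OF pr_tpair(2)[OF assms(1-3) refl refl], of "%x. x|>t"] assms lw_mcomp[of "pr2 (mtrg f) (mtrg g)" "tpair f g" t] by simp
qed (use assms in simp_all)

lemma cpair_rw [simp]:
 assumes "cel t" "cel s" "msrc (tdom s) = msrc (tdom t)" "mor h" "mtrg h = msrc (tdom t)"
 shows "cpair t s<|h = cpair (t<|h) (s<|h)"
 by (rule cel_prod_eqI[of _ _ "mtrg (tdom t)" "mtrg (tdom s)"]) (use assms in simp_all)

lemma cpair_vc [simp]:
 assumes "cel t" "cel s" "msrc (tdom s) = msrc (tdom t)" "cel t'" "cel s'" "tcod t' = tdom t" "tcod s' = tdom s" "msrc (tdom s') = msrc (tdom t')"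
 shows "cpair t s**cpair t' s' = cpair (t**t') (s**s')"
proof (rule cel_prod_eqI[of _ _ "mtrg (tdom t)" "mtrg (tdom s)"])
 have [simp]: "mtrg (tdom t') = mtrg (tdom t)" "mtrg (tdom s') = mtrg (tdom s)" using cel_mor(4)[OF assms(4)] cel_mor(4)[OF assms(5)] assms by simp_all
 show "pr1 (mtrg (tdom t)) (mtrg (tdom s))|>(cpair t s**cpair t' s') = pr1 (mtrg (tdom t)) (mtrg (tdom s))|>cpair (t**t') (s**s')"
  "pr2 (mtrg (tdom t)) (mtrg (tdom s))|>(cpair t s**cpair t' s') = pr2 (mtrg (tdom t)) (mtrg (tdom s))|>cpair (t**t') (s**s')"
  using assms by simp_all
qed (use assms cel_mor(3,4)[OF assms(4)] cel_mor(3,4)[OF assms(5)] in simp_all)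

lemma cpair_cid [simp]:
 assumes "mor f" "mor g" "msrc g = msrc f" shows "cpair (cid f) (cid g) = cid (tpair f g)"
 by (rule cel_prod_eqI[of _ _ "mtrg f" "mtrg g"]) (use assms in simp_all)

lemma cpair_pr:
 assumes "cel t" "A \<in> obj K" "B \<in> obj K" "mtrg (tdom t) = pobj K A B"
 shows "cpair (pr1 A B|>t) (pr2 A B|>t) = t"
proof (rule cel_prod_eqI[of _ _ A B])
 show "tdom (cpair (pr1 A B|>t) (pr2 A B|>t)) = tdom t" using assms by simp (rule mor_prod_eqI[of _ _ A B], simp_all)
 show "tcod (cpair (pr1 A B|>t) (pr2 A B|>t)) = tcod t" using assms by simp (rule mor_prod_eqI[of _ _ A B], simp_all)
qed (use assms in simp_all)

definition tbang :: "'o => ('o, 'm) tmor" where "tbang W = Tmor W (tobj K) (bang1 K W)"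

lemma tbang_sel [simp]: "msrc (tbang W) = W" "mtrg (tbang W) = tobj K" "mval (tbang W) = bang1 K W"
 by (simp_all add: tbang_def)

lemma mor_tbang [simp]: "W \<in> obj K ==> mor (tbang W)"
 using theI'[OF tobj_ex1_mor[of W]] by (simp add: mor_def tobj_closed bang1_def)

lemma tbang_comp [simp]:
 assumes "mor w" "mtrg w = W" shows "tbang W oo w = tbang (msrc w)"
proof (rule mor_tobj_eq)
 have "W \<in> obj K" using assms mor_obj(2) by blast
 then show "mor (tbang W oo w)" using assms by simp
qed (use assms in simp_all)

lemma tbang_tobj: "tbang (tobj K) = mid (tobj K)"
 by (rule mor_tobj_eq) (simp_all add: tobj_closed)

lemma lw_tbang [simp]: "[|cel t; mtrg (tdom t) = W|] ==> tbang W|>t = cid (tbang (msrc (tdom t)))"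
 by (rule cel_tobj_eq) auto

text \<open>The structure of a Cartesian object \<open>(X, k)\<close>: the right adjoints, their units, and the two components of the counit
 of \<open>\<Delta> \<stileturn> \<times>\<close>. The counit of \<open>! \<stileturn> *\<close> is an identity.\<close>

definition tms :: "'o => ('m, 'c) cart => ('o, 'm) tmor" where "tms X k = Tmor (pobj K X X) X (times1 k)"
definition tst :: "'o => ('m, 'c) cart => ('o, 'm) tmor" where "tst X k = Tmor (tobj K) X (star k)"
definition teta where "teta X k = Tarr (mid X) (tms X k oo tpair (mid X) (mid X)) (times_unit k)"
definition teps where "teps X k = Tarr (tpair (tms X k) (tms X k)) (mid (pobj K X X)) (times_counit k)"
definition ep1 where "ep1 X k = pr1 X X|>teps X k"
definition ep2 where "ep2 X k = pr2 X X|>teps X k"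
definition tsu where "tsu X k = Tarr (mid X) (tst X k oo tbang X) (star_unit k)"

lemma cart_sel [simp]:
 "msrc (tms X k) = pobj K X X" "mtrg (tms X k) = X" "msrc (tst X k) = tobj K" "mtrg (tst X k) = X"
 "tdom (teta X k) = mid X" "tcod (teta X k) = tms X k oo tpair (mid X) (mid X)"
 "tdom (tsu X k) = mid X" "tcod (tsu X k) = tst X k oo tbang X"
 "tdom (teps X k) = tpair (tms X k) (tms X k)" "tcod (teps X k) = mid (pobj K X X)"
 by (simp_all add: tms_def tst_def teta_def tsu_def teps_def)

lemma cart_val: "mval (tms X k) = times1 k" "mval (tst X k) = star k" "tval (teta X k) = times_unit k" "tval (tsu X k) = star_unit k"
 "tval (teps X k) = times_counit k"
 by (simp_all add: tms_def tst_def teta_def tsu_def teps_def)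

lemma diag1_val: "X \<in> obj K ==> mval (tpair (mid X) (mid X)) = diag1 K X"
 by (simp add: tpair_def diag1_def mid_def)

lemma cart_types:
 assumes co: "cartesian_object K X k"
 shows "X \<in> obj K" "mor (tms X k)" "mor (tst X k)" "cel (teta X k)" "cel (teps X k)" "cel (tsu X k)" "cel (ep1 X k)" "cel (ep2 X k)"
  "tdom (ep1 X k) = tms X k" "tdom (ep2 X k) = tms X k" "tcod (ep1 X k) = pr1 X X" "tcod (ep2 X k) = pr2 X X"
  "tobj K \<in> obj K" "pobj K X X \<in> obj K"
proof -
 note ad = co[unfolded cartesian_object_def adjunction_def]
 show X [simp]: "X \<in> obj K" and o [simp]: "tobj K \<in> obj K" "pobj K X X \<in> obj K" using ad tobj_closed pobj_closed[of X X] by auto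
 show m [simp]: "mor (tms X k)" "mor (tst X k)" using ad by (auto simp: mor_def tms_def tst_def)
 have dt: "mval (tpair (tms X k) (tms X k)) = diag1 K X \<odot> times1 k"
 proof -
  have "tpair (tms X k) (tms X k) = tpair (mid X) (mid X) oo tms X k" by simp
  then show ?thesis by (simp only: typed_val diag1_val[OF X] cart_val)
 qed
 show "cel (teta X k)" unfolding teta_def by (rule celI) (use ad in \<open>simp_all add: typed_val cart_val diag1_val\<close>)
 show t [simp]: "cel (teps X k)" unfolding teps_def by (rule celI) (use ad dt in \<open>simp_all add: typed_val cart_val\<close>)
 show "cel (tsu X k)" unfolding tsu_def by (rule celI) (use ad in \<open>simp_all add: typed_val cart_val\<close>)
 show "cel (ep1 X k)" "cel (ep2 X k)" "tdom (ep1 X k) = tms X k" "tdom (ep2 X k) = tms X k" "tcod (ep1 X k) = pr1 X X" "tcod (ep2 X k) = pr2 X X"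
  unfolding ep1_def ep2_def by simp_all
qed

lemma cpair_ep:
 assumes co: "cartesian_object K X k" shows "cpair (ep1 X k) (ep2 X k) = teps X k"
 unfolding ep1_def ep2_def by (rule cpair_pr) (simp_all add: cart_types[OF co])

lemma cart_triangles:
 assumes co: "cartesian_object K X k"
 shows "(ep1 X k<|tpair (mid X) (mid X))**teta X k = cid (mid X)"
  "(ep2 X k<|tpair (mid X) (mid X))**teta X k = cid (mid X)"
  "(tms X k|>teps X k)**(teta X k<|tms X k) = cid (tms X k)"
  "tsu X k<|tst X k = cid (tst X k)"
proof -
 note [simp] = cart_types[OF co]
 note ad = co[unfolded cartesian_object_def adjunction_def]
 let ?d = "tpair (mid X) (mid X)"
 have dt: "mval (tpair (tms X k) (tms X k)) = diag1 K X \<odot> times1 k"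
 proof -
  have "tpair (tms X k) (tms X k) = tpair (mid X) (mid X) oo tms X k" by simp
  then show ?thesis by (simp only: typed_val diag1_val[OF cart_types(1)[OF co]] cart_val)
 qed
 have 1: "(teps X k<|?d)**(?d|>teta X k) = cid ?d"
 proof (rule tarr_eqI)
  show "tval (teps X k<|?d**?d|>teta X k) = tval (cid ?d)"
   using ad by (simp add: typed_val cart_val diag1_val del: lw_tpair)
 qed (simp_all del: lw_tpair)
 show "(ep1 X k<|?d)**teta X k = cid (mid X)"
  using arg_cong[OF 1, of "%x. pr1 X X|>x"] by (simp add: ep1_def)
 show "(ep2 X k<|?d)**teta X k = cid (mid X)"
  using arg_cong[OF 1, of "%x. pr2 X X|>x"] by (simp add: ep2_def)
 show "(tms X k|>teps X k)**(teta X k<|tms X k) = cid (tms X k)"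
  by (rule tarr_eqI) (use ad in \<open>simp_all add: typed_val cart_val\<close>)
 let ?e = "Tarr (tbang X oo tst X k) (mid (tobj K)) (star_counit k)"
 have e: "cel ?e" by (rule celI) (use ad in \<open>simp_all add: typed_val cart_val del: tbang_comp\<close>)
 have ee: "?e = cid (mid (tobj K))" by (rule cel_tobj_eq) (use e in \<open>simp_all add: tbang_tobj\<close>)
 have "(tst X k|>?e)**(tsu X k<|tst X k) = cid (tst X k)"
  by (rule tarr_eqI) (use ad in \<open>simp_all add: typed_val cart_val tbang_tobj\<close>)
 then show "tsu X k<|tst X k = cid (tst X k)" unfolding ee by (simp add: tbang_tobj)
qed

text \<open>The finite products of a hom-category into a Cartesian object.\<close>

definition tbx where "tbx k A B = tms (mtrg A) k oo tpair A B"
definition tbx1 where "tbx1 k A B = ep1 (mtrg A) k<|tpair A B"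
definition tbx2 where "tbx2 k A B = ep2 (mtrg A) k<|tpair A B"
definition bpr where "bpr k f g = (tms (mtrg (tdom f)) k|>cpair f g)**(teta (mtrg (tdom f)) k<|tdom f)"
definition topo where "topo X k W = tst X k oo tbang W"
definition bng where "bng k w = tsu (mtrg w) k<|w"

lemma box:
 assumes co: "cartesian_object K X k" and A: "mor A" "mtrg A = X" and B: "mor B" "mtrg B = X" "msrc B = msrc A"
 shows "mor (tbx k A B)" "msrc (tbx k A B) = msrc A" "mtrg (tbx k A B) = X" "cel (tbx1 k A B)" "cel (tbx2 k A B)"
  "tdom (tbx1 k A B) = tbx k A B" "tdom (tbx2 k A B) = tbx k A B" "tcod (tbx1 k A B) = A" "tcod (tbx2 k A B) = B"
 using assms by (simp_all add: tbx_def tbx1_def tbx2_def cart_types[OF co])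

lemma bpr:
 assumes co: "cartesian_object K X k" and f: "cel f" "mtrg (tdom f) = X" and g: "cel g" "tdom g = tdom f"
 shows "cel (bpr k f g)" "tdom (bpr k f g) = tdom f" "tcod (bpr k f g) = tbx k (tcod f) (tcod g)"
  "tbx1 k (tcod f) (tcod g)**bpr k f g = f" "tbx2 k (tcod f) (tcod g)**bpr k f g = g"
proof -
 note [simp] = cart_types[OF co] f g
 have [simp]: "mtrg (tcod f) = X" "msrc (tcod g) = msrc (tdom f)" "mtrg (tcod g) = X" using cel_mor(3,4)[OF f(1)] cel_mor(3,4)[OF g(1)] by simp_all
 show "cel (bpr k f g)" "tdom (bpr k f g) = tdom f" "tcod (bpr k f g) = tbx k (tcod f) (tcod g)"
  by (simp_all add: bpr_def tbx_def)
 note t = cart_triangles[OF co]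
 have d: "tpair (mid X) (mid X) oo tdom f = tpair (tdom f) (tdom f)" by simp
 have w: "e<|tpair (mid X) (mid X)<|tdom f = e<|tpair (tdom f) (tdom f)" if "cel e" "msrc (tdom e) = pobj K X X" for e
  using rw_mcomp[of "tpair (mid X) (mid X)" "tdom f" e] that by (simp add: d)
 have x: "(ep1 X k<|tpair (tcod f) (tcod g))**(tms X k|>cpair f g) = f**ep1 X k<|tpair (tdom f) (tdom f)"
  "(ep2 X k<|tpair (tcod f) (tcod g))**(tms X k|>cpair f g) = g**ep2 X k<|tpair (tdom f) (tdom f)"
  using whisker_exchange[of "ep1 X k" "cpair f g"] whisker_exchange[of "ep2 X k" "cpair f g"] by simp_all
 have y: "(ep1 X k<|tpair (tdom f) (tdom f))**(teta X k<|tdom f) = cid (tdom f)"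
  "(ep2 X k<|tpair (tdom f) (tdom f))**(teta X k<|tdom f) = cid (tdom f)"
  using arg_cong[OF t(1), of "%x. x<|tdom f"] arg_cong[OF t(2), of "%x. x<|tdom f"] by (simp_all add: w)
 show "tbx1 k (tcod f) (tcod g)**bpr k f g = f" "tbx2 k (tcod f) (tcod g)**bpr k f g = g"
  by (simp_all add: bpr_def tbx1_def tbx2_def vc_pre[OF x(1)] vc_pre[OF x(2)] y)
qed

lemma bpr_expand:
 assumes co: "cartesian_object K X k" and A: "mor A" "mtrg A = X" and B: "mor B" "mtrg B = X" "msrc B = msrc A"
  and u: "cel u" "tcod u = tbx k A B"
 shows "u = bpr k (tbx1 k A B**u) (tbx2 k A B**u)"
proof -
 note [simp] = cart_types[OF co] A B u box[OF co A B]
 have [simp]: "mtrg (tdom u) = X" "msrc (tdom u) = msrc A" using cel_mor(3,4)[OF u(1)] by simp_all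
 have d: "tpair (mid X) (mid X) oo tbx k A B = tpair (mid X) (mid X) oo tms X k oo tpair A B" by (simp add: tbx_def)
 have t: "(tms X k|>teps X k<|tpair A B)**(teta X k<|tms X k<|tpair A B) = cid (tms X k oo tpair A B)"
  using arg_cong[OF cart_triangles(3)[OF co], of "%x. x<|tpair A B"] by simp
 have eb: "cpair (tbx1 k A B) (tbx2 k A B) = teps X k<|tpair A B"
  by (simp add: tbx1_def tbx2_def cpair_ep[OF co, symmetric])
 have x: "(teta X k<|tbx k A B)**u = (tms X k|>cpair u u)**(teta X k<|tdom u)"
  using whisker_exchange[of "teta X k" u] by simp
 have e: "teta X k<|tbx k A B = teta X k<|tms X k<|tpair A B" by (simp add: tbx_def)
 have "bpr k (tbx1 k A B**u) (tbx2 k A B**u) = (tms X k|>(cpair (tbx1 k A B) (tbx2 k A B)**cpair u u))**(teta X k<|tdom u)"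
  by (simp add: bpr_def)
 also have "\<dots> = (tms X k|>cpair (tbx1 k A B) (tbx2 k A B))**(tms X k|>cpair u u)**(teta X k<|tdom u)"
  by (simp del: cpair_vc)
 also have "\<dots> = (tms X k|>cpair (tbx1 k A B) (tbx2 k A B))**(teta X k<|tbx k A B)**u" unfolding x ..
 also have "\<dots> = u" unfolding eb e by (simp add: vc_pre[OF t] tbx_def)
 finally show ?thesis ..
qed

text \<open>The arrow into a product is determined by its projections: this is the second triangle identity of the adjunction.\<close>

lemma bpr_eqI:
 assumes co: "cartesian_object K X k" and A: "mor A" "mtrg A = X" and B: "mor B" "mtrg B = X" "msrc B = msrc A"
  and u: "cel u" "tcod u = tbx k A B" and v: "cel v" "tcod v = tbx k A B" "tdom u = tdom v"
  and e: "tbx1 k A B**u = tbx1 k A B**v" "tbx2 k A B**u = tbx2 k A B**v"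
 shows "u = v"
 using bpr_expand[OF co A B u] bpr_expand[OF co A B v(1,2)] e by simp

lemma bx_bpr:
 assumes co: "cartesian_object K X k" and f: "cel f" "mtrg (tdom f) = X" and g: "cel g" "tdom g = tdom f" and AB: "A = tcod f" "B = tcod g"
 shows "tbx1 k A B**bpr k f g = f" "tbx2 k A B**bpr k f g = g"
 using bpr(4,5)[OF co f g] AB by simp_all

lemma bx_bpr_pre:
 assumes co: "cartesian_object K X k" and f: "cel f" "mtrg (tdom f) = X" and g: "cel g" "tdom g = tdom f" and AB: "A = tcod f" "B = tcod g"
  and h: "cel h" "tcod h = tdom f"
 shows "tbx1 k A B**bpr k f g**h = f**h" "tbx2 k A B**bpr k f g**h = g**h"
proof -
 have t: "mtrg (tcod f) = X" "msrc (tcod g) = msrc (tcod f)" "mtrg (tcod g) = X" using cel_mor(3,4)[OF f(1)] cel_mor(3,4)[OF g(1)] f g by simp_all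
 note [simp] = bpr(1-3)[OF co f g] box[OF co cel_mor(2)[OF f(1)] t(1) cel_mor(2)[OF g(1)] t(3,2)]
 show "tbx1 k A B**bpr k f g**h = f**h" "tbx2 k A B**bpr k f g**h = g**h"
  using h AB by (simp_all add: vc_pre[OF bpr(4)[OF co f g]] vc_pre[OF bpr(5)[OF co f g]])
qed

lemma bpr_comp:
 assumes co: "cartesian_object K X k" and f: "cel f" "mtrg (tdom f) = X" and g: "cel g" "tdom g = tdom f"
  and h: "cel h" "tcod h = tdom f"
 shows "bpr k f g**h = bpr k (f**h) (g**h)"
proof -
 have t: "mtrg (tcod f) = X" "msrc (tcod g) = msrc (tcod f)" "mtrg (tcod g) = X" using cel_mor(3,4)[OF f(1)] cel_mor(3,4)[OF g(1)] f g by simp_all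
 have t2: "mtrg (tdom h) = X" using cel_mor(4)[OF h(1)] h f by simp
 note b = bpr(1-3)[OF co f g] box[OF co cel_mor(2)[OF f(1)] t(1) cel_mor(2)[OF g(1)] t(3,2)]
 have fh: "cel (f**h)" "mtrg (tdom (f**h)) = X" "cel (g**h)" "tdom (g**h) = tdom (f**h)" using f g h t2 by simp_all
 have e: "tbx1 k (tcod f) (tcod g)**bpr k (f**h) (g**h) = f**h" "tbx2 k (tcod f) (tcod g)**bpr k (f**h) (g**h) = g**h"
  using bx_bpr[OF co fh] by simp_all
 show ?thesis
  by (rule bpr_eqI[OF co cel_mor(2)[OF f(1)] t(1) cel_mor(2)[OF g(1)] t(3,2)])
   (use b h bpr(1-3)[OF co fh] f g in \<open>simp_all add: bx_bpr_pre[OF co f g refl refl h] e\<close>)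
qed

lemma box_whisker:
 assumes co: "cartesian_object K X k" and A: "mor A" "mtrg A = X" and B: "mor B" "mtrg B = X" "msrc B = msrc A" and h: "mor h" "mtrg h = msrc A"
 shows "tbx k A B oo h = tbx k (A oo h) (B oo h)" "tbx1 k A B<|h = tbx1 k (A oo h) (B oo h)" "tbx2 k A B<|h = tbx2 k (A oo h) (B oo h)"
proof -
 note [simp] = cart_types[OF co] A B h
 have d: "tpair A B oo h = tpair (A oo h) (B oo h)" by simp
 show "tbx k A B oo h = tbx k (A oo h) (B oo h)" by (simp add: tbx_def)
 show "tbx1 k A B<|h = tbx1 k (A oo h) (B oo h)" "tbx2 k A B<|h = tbx2 k (A oo h) (B oo h)"
  using rw_mcomp[of "tpair A B" h "ep1 X k"] rw_mcomp[of "tpair A B" h "ep2 X k"] by (simp_all add: tbx1_def tbx2_def)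
qed

lemma top:
 assumes co: "cartesian_object K X k" and W: "W \<in> obj K"
 shows "mor (topo X k W)" "msrc (topo X k W) = W" "mtrg (topo X k W) = X"
 using W by (simp_all add: topo_def cart_types[OF co])

lemma bng:
 assumes co: "cartesian_object K X k" and w: "mor w" "mtrg w = X"
 shows "cel (bng k w)" "tdom (bng k w) = w" "tcod (bng k w) = topo X k (msrc w)"
 using w by (simp_all add: bng_def topo_def cart_types[OF co])

lemma bng_unique:
 assumes co: "cartesian_object K X k" and u: "cel u" "tcod u = topo X k W" and W: "W \<in> obj K"
 shows "u = bng k (tdom u)"
proof -
 note [simp] = cart_types[OF co] top[OF co W] u W
 have [simp]: "mtrg (tdom u) = X" "msrc (tdom u) = W"
  using cel_mor(3,4)[OF u(1), symmetric] top[OF co W] unfolding u(2) by simp_all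
 have e: "tsu X k<|topo X k W = cid (topo X k W)"
  using arg_cong[OF cart_triangles(4)[OF co], of "%x. x<|tbang W"] by (simp add: topo_def)
 show ?thesis using whisker_exchange[of "tsu X k" u] by (simp add: e bng_def)
qed

lemma bng_eq:
 assumes co: "cartesian_object K X k" and u: "cel u" "tcod u = topo X k W" and v: "cel v" "tcod v = topo X k W" "tdom u = tdom v" and W: "W \<in> obj K"
 shows "u = v"
 using bng_unique[OF co u W] bng_unique[OF co v(1,2) W] v(3) by simp

lemma bng_comp:
 assumes co: "cartesian_object K X k" and w: "mor w" "mtrg w = X" and t: "cel t" "tcod t = w"
 shows "bng k w**t = bng k (tdom t)"
proof -
 have m: "mtrg (tdom t) = X" "msrc (tdom t) = msrc w" using cel_mor(3,4)[OF t(1)] t(2) w by simp_all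
 show ?thesis
  by (rule bng_eq[OF co _ _ _ _ _ mor_obj(1)[OF w(1)]]) (use bng[OF co w] bng[OF co cel_mor(1)[OF t(1)] m(1)] t m w in simp_all)
qed

text \<open>A product diagram \<open>a\<close>, \<open>b\<close> in the hom-category to which the two cells belong.\<close>

definition tprod :: "(('o, 'm) tmor, 'c) tarr => (('o, 'm) tmor, 'c) tarr => bool" where
 "tprod a b \<longleftrightarrow> cel a & cel b & tdom a = tdom b &
   (\<forall>x y. cel x & cel y & tdom x = tdom y & tcod x = tcod a & tcod y = tcod b -->
    (\<exists>!u. cel u & tdom u = tdom x & tcod u = tdom a & a**u = x & b**u = y))"

lemma tprodD: "tprod a b ==> cel a" "tprod a b ==> cel b" "tprod a b ==> tdom b = tdom a"
 by (simp_all add: tprod_def)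

lemma tprod_ex:
 assumes "tprod a b" "cel x" "cel y" "tdom y = tdom x" "tcod x = tcod a" "tcod y = tcod b"
 obtains u where "cel u" "tdom u = tdom x" "tcod u = tdom a" "a**u = x" "b**u = y"
proof -
 have "\<exists>!u. cel u & tdom u = tdom x & tcod u = tdom a & a**u = x & b**u = y"
  using assms unfolding tprod_def by (metis (no_types, lifting))
 then show thesis using that by blast
qed

lemma tprod_eqI:
 assumes "tprod a b" "cel u" "cel v" "tdom u = tdom v" "tcod u = tdom a" "tcod v = tdom a" "a**u = a**v" "b**u = b**v"
 shows "u = v"
proof -
 have "\<exists>!w. cel w & tdom w = tdom (a**v) & tcod w = tdom a & a**w = a**v & b**w = b**v"
  using assms(1)[unfolded tprod_def, THEN conjunct2, THEN conjunct2, THEN conjunct2, THEN spec, THEN spec, THEN mp, of "a**v" "b**v"]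
   tprodD[OF assms(1)] assms(2-6) by simp
 then show ?thesis using assms by (metis typed_sel(7))
qed

lemma tprodI:
 assumes "cel a" "cel b" "tdom b = tdom a"
  and ex: "!!x y. [|cel x; cel y; tdom y = tdom x; tcod x = tcod a; tcod y = tcod b|] ==>
    \<exists>u. cel u & tdom u = tdom x & tcod u = tdom a & a**u = x & b**u = y"
  and un: "!!u v. [|cel u; cel v; tdom u = tdom v; tcod u = tdom a; tcod v = tdom a; a**u = a**v; b**u = b**v|] ==> u = v"
 shows "tprod a b"
 unfolding tprod_def
proof (intro conjI allI impI; (elim conjE)?)
 fix x y assume h: "cel x" "cel y" "tdom x = tdom y" "tcod x = tcod a" "tcod y = tcod b"
 obtain u where u: "cel u" "tdom u = tdom x" "tcod u = tdom a" "a**u = x" "b**u = y" using ex[of x y] h by auto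
 show "\<exists>!u. cel u & tdom u = tdom x & tcod u = tdom a & a**u = x & b**u = y"
 proof (rule ex1I[of _ u])
  fix v assume "cel v & tdom v = tdom x & tcod v = tdom a & a**v = x & b**v = y"
  then have v: "cel v" "tdom v = tdom x" "tcod v = tdom a" "a**v = x" "b**v = y" by blast+
  show "v = u" by (rule un) (simp_all add: u v)
 qed (use u in simp)
qed (use assms in simp_all)

definition tinv :: "(('o, 'm) tmor, 'c) tarr => (('o, 'm) tmor, 'c) tarr => bool" where
 "tinv u v \<longleftrightarrow> cel u & cel v & tdom v = tcod u & tcod v = tdom u & u**v = cid (tcod u) & v**u = cid (tdom u)"

definition tiso :: "(('o, 'm) tmor, 'c) tarr => bool" where "tiso u \<longleftrightarrow> (\<exists>v. tinv u v)"

lemma tinvD: "tinv u v ==> cel u & cel v & tdom v = tcod u & tcod v = tdom u"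
 "tinv u v ==> u**v = cid (tcod u)" "tinv u v ==> v**u = cid (tdom u)"
 by (auto simp: tinv_def)

lemma tiso_lw: "[|tiso u; mor f; msrc f = mtrg (tdom u)|] ==> tiso (f|>u)"
 unfolding tiso_def tinv_def
proof (elim exE conjE)
 fix v assume h: "mor f" "msrc f = mtrg (tdom u)" "cel u" "cel v" "tdom v = tcod u" "tcod v = tdom u" "u**v = cid (tcod u)" "v**u = cid (tdom u)"
 show "\<exists>v. cel (f|>u) & cel v & tdom v = tcod (f|>u) & tcod v = tdom (f|>u) & (f|>u)**v = cid (tcod (f|>u)) & v**(f|>u) = cid (tdom (f|>u))"
  by (intro exI[of _ "f|>v"]) (use h(1-6) in \<open>simp add: vc_lw_eq[OF h(7)] vc_lw_eq[OF h(8)]\<close>)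
qed

lemma tiso_rw: "[|tiso u; mor f; mtrg f = msrc (tdom u)|] ==> tiso (u<|f)"
 unfolding tiso_def tinv_def
proof (elim exE conjE)
 fix v assume h: "mor f" "mtrg f = msrc (tdom u)" "cel u" "cel v" "tdom v = tcod u" "tcod v = tdom u" "u**v = cid (tcod u)" "v**u = cid (tdom u)"
 show "\<exists>v. cel (u<|f) & cel v & tdom v = tcod (u<|f) & tcod v = tdom (u<|f) & (u<|f)**v = cid (tcod (u<|f)) & v**(u<|f) = cid (tdom (u<|f))"
  by (intro exI[of _ "v<|f"]) (use h(1-6) in \<open>simp add: vc_rw_eq[OF h(7)] vc_rw_eq[OF h(8)]\<close>)
qed

lemma tiso_vc: "[|tiso u; tiso v; tdom u = tcod v|] ==> tiso (u**v)"
 unfolding tiso_def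
proof (elim exE)
 fix u' v' assume h: "tdom u = tcod v" and u: "tinv u u'" and v: "tinv v v'"
 note d = tinvD(1)[OF u] tinvD(1)[OF v]
 show "\<exists>w. tinv (u**v) w"
  by (intro exI[of _ "v'**u'"])
   (use d h in \<open>simp add: tinv_def tinvD(2,3)[OF u] tinvD(2,3)[OF v] vc_pre[OF tinvD(2)[OF v]] vc_pre[OF tinvD(3)[OF u]]\<close>)
qed

lemma tiso_cid: "mor f ==> tiso (cid f)"
 unfolding tiso_def tinv_def by (intro exI[of _ "cid f"]) simp

lemma tiso_epi:
 assumes u: "tiso u" and e: "a**u = b**u" and c: "cel a" "cel b" "tdom a = tcod u" "tdom b = tcod u"
 shows "a = b"
proof -
 obtain v where v: "tinv u v" using u unfolding tiso_def by blast
 note d = tinvD(1)[OF v]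
 show ?thesis using arg_cong[OF e, of "%x. x**v"] c d by (simp add: tinvD(2)[OF v])
qed

lemma tprod_iso:
 assumes ab: "tprod a b" and u: "tiso u" "tcod u = tdom a"
 shows "tprod (a**u) (b**u)"
proof -
 obtain v where v: "tinv u v" using u unfolding tiso_def by blast
 note d = tinvD(1)[OF v] and D = tprodD[OF ab]
 have d1: "cel u" "cel v" "tdom v = tdom a" "tcod v = tdom u" using d u by simp_all
 note [simp] = d1 D u(2)
 have uv: "u**v = cid (tdom a)" and vu: "v**u = cid (tdom u)" using tinvD(2,3)[OF v] by simp_all
 show ?thesis
 proof (rule tprodI)
  fix x y assume h: "cel x" "cel y" "tdom y = tdom x" "tcod x = tcod (a**u)" "tcod y = tcod (b**u)"
  obtain w where w: "cel w" "tdom w = tdom x" "tcod w = tdom a" "a**w = x" "b**w = y"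
   by (rule tprod_ex[OF ab h(1-3)]) (use h in simp_all)
  show "\<exists>w. cel w & tdom w = tdom x & tcod w = tdom (a**u) & (a**u)**w = x & (b**u)**w = y"
   by (intro exI[of _ "v**w"]) (simp add: w vc_pre[OF uv])
 next
  fix w w' assume h: "cel w" "cel w'" "tdom w = tdom w'" "tcod w = tdom (a**u)" "tcod w' = tdom (a**u)"
   "(a**u)**w = (a**u)**w'" "(b**u)**w = (b**u)**w'"
  have "u**w = u**w'" by (rule tprod_eqI[OF ab]) (use h in simp_all)
  then have "v**u**w = v**u**w'" by simp
  then show "w = w'" using h by (simp add: vc_pre[OF vu])
 qed simp_all
qed

text \<open>Two products of the same factors are isomorphic, by the arrow that respects the projections.\<close>

lemma tprod_comparison:
 assumes ab: "tprod a b" and cd: "tprod c d" and t: "tcod c = tcod a" "tcod d = tcod b"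
  and u: "cel u" "tdom u = tdom a" "tcod u = tdom c" "c**u = a" "d**u = b"
 shows "tiso u"
proof -
 note D = tprodD[OF ab] tprodD[OF cd]
 obtain v where v: "cel v" "tdom v = tdom c" "tcod v = tdom a" "a**v = c" "b**v = d"
  by (rule tprod_ex[OF ab, of c d]) (use D t in simp_all)
 have "u**v = cid (tdom c)"
  by (rule tprod_eqI[OF cd]) (use D u(1-3) v(1-3) in \<open>simp_all add: vc_pre[OF u(4)] vc_pre[OF u(5)] v(4,5)\<close>)
 moreover have "v**u = cid (tdom a)"
  by (rule tprod_eqI[OF ab]) (use D u(1-3) v(1-3) in \<open>simp_all add: vc_pre[OF v(4)] vc_pre[OF v(5)] u(4,5)\<close>)
 ultimately show ?thesis unfolding tiso_def tinv_def using u v by metis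
qed

lemma tprod_bx:
 assumes co: "cartesian_object K X k" and A: "mor A" "mtrg A = X" and B: "mor B" "mtrg B = X" "msrc B = msrc A"
 shows "tprod (tbx1 k A B) (tbx2 k A B)"
proof (rule tprodI)
 note b = box[OF co A B]
 show "cel (tbx1 k A B)" "cel (tbx2 k A B)" "tdom (tbx2 k A B) = tdom (tbx1 k A B)" using b by simp_all
 show "\<exists>u. cel u & tdom u = tdom x & tcod u = tdom (tbx1 k A B) & tbx1 k A B**u = x & tbx2 k A B**u = y"
  if h: "cel x" "cel y" "tdom y = tdom x" "tcod x = tcod (tbx1 k A B)" "tcod y = tcod (tbx2 k A B)" for x y
 proof -
  have "mtrg (tdom x) = X" using cel_mor(4)[OF h(1)] h(4) A b by simp
  from bpr[OF co h(1) this h(2,3)] show ?thesis using h b by (intro exI[of _ "bpr k x y"]) simp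
 qed
 show "u = v" if "cel u" "cel v" "tdom u = tdom v" "tcod u = tdom (tbx1 k A B)" "tcod v = tdom (tbx1 k A B)"
   "tbx1 k A B**u = tbx1 k A B**v" "tbx2 k A B**u = tbx2 k A B**v" for u v
  by (rule bpr_eqI[OF co A B]) (use that b in simp_all)
qed

text \<open>Preservation of the finite products of all hom-categories at once. It amounts to the invertibility of the two comparison
 2-cells (\<open>preserves_products_iff_fpres\<close>).\<close>

definition fpres :: "('o, 'm) tmor => ('m, 'c) cart => ('m, 'c) cart => bool" where
 "fpres f k k' \<longleftrightarrow> (\<forall>A B. mor A & mor B & mtrg A = msrc f & mtrg B = msrc f & msrc B = msrc A -->
    tprod (f|>tbx1 k A B) (f|>tbx2 k A B)) &
   (\<forall>W\<in>obj K. tiso (bng k' (f oo topo (msrc f) k W)))"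

lemma fpres_tprod:
 assumes fp: "fpres f k k'" and f: "mor f" and co: "cartesian_object K (msrc f) k" and ab: "tprod a b" and t: "mtrg (tdom a) = msrc f"
 shows "tprod (f|>a) (f|>b)"
proof -
 note D = tprodD[OF ab]
 have m: "mtrg (tcod a) = msrc f" "mtrg (tcod b) = msrc f" "msrc (tcod b) = msrc (tcod a)"
  using cel_mor(3,4)[OF D(1)] cel_mor(3,4)[OF D(2)] D t by simp_all
 let ?u = "bpr k a b"
 note u = bpr[OF co D(1) t D(2,3)] and b = box[OF co cel_mor(2)[OF D(1)] m(1) cel_mor(2)[OF D(2)] m(2,3)]
 have "tiso ?u"
  by (rule tprod_comparison[OF ab tprod_bx[OF co cel_mor(2)[OF D(1)] m(1) cel_mor(2)[OF D(2)] m(2,3)]]) (use u b in simp_all)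
 then have "tiso (f|>?u)" by (rule tiso_lw) (use f u t in simp_all)
 then have "tprod ((f|>tbx1 k (tcod a) (tcod b))**(f|>?u)) ((f|>tbx2 k (tcod a) (tcod b))**(f|>?u))"
  using fp[unfolded fpres_def] m D b u by (intro tprod_iso) simp_all
 moreover have "mtrg (tbx k (tcod a) (tcod b)) = msrc f" using b by simp
 ultimately show ?thesis using vc_lw_eq[OF u(4), of f] vc_lw_eq[OF u(5), of f] b u f t by simp
qed

end

section \<open>2-categories with an abstract tangent bundle\<close>

locale tangent_2_category = cartesian_2_category K
 for K :: "('o, 'm, 'c, 'z) cat2p_scheme" (structure) +
 fixes T T2 :: "'o => 'm" and q1 q2 p z s l :: "'o => 'c" and al :: "'m => 'c"
 assumes T_hom: "X \<in> obj K ==> T X \<in> hom1 K X X"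
  and T2_hom: "X \<in> obj K ==> T2 X \<in> hom1 K X X"
  and q1_hom: "X \<in> obj K ==> q1 X \<in> hom2 K X X (T2 X) (T X)"
  and q2_hom: "X \<in> obj K ==> q2 X \<in> hom2 K X X (T2 X) (T X)"
  and p_hom: "X \<in> obj K ==> p X \<in> hom2 K X X (T X) (id1 K X)"
  and z_hom: "X \<in> obj K ==> z X \<in> hom2 K X X (id1 K X) (T X)"
  and s_hom: "X \<in> obj K ==> s X \<in> hom2 K X X (T2 X) (T X)"
  and l_hom: "X \<in> obj K ==> l X \<in> hom2 K X X (T X) (T X \<odot> T X)"
  and T2_pb: "[|X \<in> obj K; W \<in> obj K; A \<in> hom1 K W X|] ==>
   is_pullback (homcat K W X) (T2 X \<odot> A) (q1 X \<lhd> A) (q2 X \<lhd> A) (T X \<odot> A) (T X \<odot> A) (id1 K X \<odot> A) (p X \<lhd> A) (p X \<lhd> A)"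
  and al_hom: "[|X \<in> obj K; Y \<in> obj K; F \<in> hom1 K X Y|] ==> al F \<in> hom2 K X Y (F \<odot> T X) (T Y \<odot> F)"
  and al_id1: "X \<in> obj K ==> al (id1 K X) = id2 K (T X)"
  and al_comp1: "[|X \<in> obj K; Y \<in> obj K; Z \<in> obj K; F \<in> hom1 K X Y; G \<in> hom1 K Y Z|] ==>
   al (G \<odot> F) = (al G \<lhd> F) \<bullet> (G \<rhd> al F)"
  and al_nat: "[|X \<in> obj K; Y \<in> obj K; F \<in> hom1 K X Y; G \<in> hom1 K X Y; \<phi> \<in> hom2 K X Y F G|] ==>
   (T Y \<rhd> \<phi>) \<bullet> al F = al G \<bullet> (\<phi> \<lhd> T X)"
  and al_p: "[|X \<in> obj K; Y \<in> obj K; F \<in> hom1 K X Y|] ==> (p Y \<lhd> F) \<bullet> al F = F \<rhd> p X"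
  and al_z: "[|X \<in> obj K; Y \<in> obj K; F \<in> hom1 K X Y|] ==> al F \<bullet> (F \<rhd> z X) = z Y \<lhd> F"
  and al_s: "[|X \<in> obj K; Y \<in> obj K; F \<in> hom1 K X Y|] ==> \<exists>r \<in> hom2 K X Y (F \<odot> T2 X) (T2 Y \<odot> F).
   (q1 Y \<lhd> F) \<bullet> r = al F \<bullet> (F \<rhd> q1 X) & (q2 Y \<lhd> F) \<bullet> r = al F \<bullet> (F \<rhd> q2 X) & al F \<bullet> (F \<rhd> s X) = (s Y \<lhd> F) \<bullet> r"
  and al_l: "[|X \<in> obj K; Y \<in> obj K; F \<in> hom1 K X Y|] ==>
   (l Y \<lhd> F) \<bullet> al F = (T Y \<rhd> al F) \<bullet> (al F \<lhd> T X) \<bullet> (F \<rhd> l X)"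
  and T_pr: "[|X \<in> obj K; Y \<in> obj K|] ==> pfst K X Y \<odot> T (pobj K X Y) = T X \<odot> pfst K X Y"
   "[|X \<in> obj K; Y \<in> obj K|] ==> psnd K X Y \<odot> T (pobj K X Y) = T Y \<odot> psnd K X Y"
  and al_pr: "[|X \<in> obj K; Y \<in> obj K|] ==> al (pfst K X Y) = id2 K (T X \<odot> pfst K X Y)"
   "[|X \<in> obj K; Y \<in> obj K|] ==> al (psnd K X Y) = id2 K (T Y \<odot> psnd K X Y)"
begin

definition gT where "gT X = Tmor X X (T X)"
definition gT2 where "gT2 X = Tmor X X (T2 X)"
definition gq1 where "gq1 X = Tarr (gT2 X) (gT X) (q1 X)"
definition gq2 where "gq2 X = Tarr (gT2 X) (gT X) (q2 X)"
definition gp where "gp X = Tarr (gT X) (mid X) (p X)"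
definition gz where "gz X = Tarr (mid X) (gT X) (z X)"
definition gs where "gs X = Tarr (gT2 X) (gT X) (s X)"
definition gl where "gl X = Tarr (gT X) (gT X oo gT X) (l X)"
definition ga where "ga f = Tarr (f oo gT (msrc f)) (gT (mtrg f) oo f) (al (mval f))"

lemma g_sel [simp]:
 "msrc (gT X) = X" "mtrg (gT X) = X" "msrc (gT2 X) = X" "mtrg (gT2 X) = X"
 "tdom (gq1 X) = gT2 X" "tdom (gq2 X) = gT2 X" "tdom (gp X) = gT X" "tdom (gz X) = mid X" "tdom (gs X) = gT2 X" "tdom (gl X) = gT X"
 "tcod (gq1 X) = gT X" "tcod (gq2 X) = gT X" "tcod (gp X) = mid X" "tcod (gz X) = gT X" "tcod (gs X) = gT X" "tcod (gl X) = gT X oo gT X"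
 "tdom (ga f) = f oo gT (msrc f)" "tcod (ga f) = gT (mtrg f) oo f"
 by (simp_all add: gT_def gT2_def gq1_def gq2_def gp_def gz_def gs_def gl_def ga_def)

lemma g_val:
 "mval (gT X) = T X" "mval (gT2 X) = T2 X" "tval (gq1 X) = q1 X" "tval (gq2 X) = q2 X" "tval (gp X) = p X" "tval (gz X) = z X"
 "tval (gs X) = s X" "tval (gl X) = l X" "tval (ga f) = al (mval f)"
 by (simp_all add: gT_def gT2_def gq1_def gq2_def gp_def gz_def gs_def gl_def ga_def)

lemma mor_gT [simp]: "X \<in> obj K ==> mor (gT X)" "X \<in> obj K ==> mor (gT2 X)"
 by (simp_all add: mor_def g_val T_hom T2_hom del: mor_obj)

lemma cel_g [simp]:
 assumes "X \<in> obj K"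
 shows "cel (gq1 X)" "cel (gq2 X)" "cel (gp X)" "cel (gz X)" "cel (gs X)" "cel (gl X)"
 unfolding gq1_def gq2_def gp_def gz_def gs_def gl_def
 using assms by (auto intro!: celI simp: typed_val g_val q1_hom q2_hom p_hom z_hom s_hom l_hom)

lemma cel_ga [simp]: "mor f ==> cel (ga f)"
 unfolding ga_def using al_hom[of "msrc f" "mtrg f" "mval f"]
 by (intro celI) (simp_all add: typed_val g_val, simp add: mor_def del: mor_obj)

lemma hom1_if_mor: "mor f ==> mval f \<in> hom1 K (msrc f) (mtrg f)"
 by (simp add: mor_def del: mor_obj)

lemma hom2_if_cel: "cel t ==> tval t \<in> hom2 K (msrc (tdom t)) (mtrg (tdom t)) (mval (tdom t)) (mval (tcod t))"
 by (simp add: cel_def del: cel_mor)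

lemma ga_mid: "X \<in> obj K ==> ga (mid X) = cid (gT X)"
 by (rule tarr_eqI) (simp_all add: g_val typed_val al_id1)

lemma ga_comp: "[|mor g; mor f; msrc g = mtrg f|] ==> ga (g oo f) = (ga g<|f)**(g|>ga f)"
 using al_comp1[of "msrc f" "mtrg f" "mtrg g" "mval f" "mval g"] hom1_if_mor[of f] hom1_if_mor[of g]
 by (intro tarr_eqI) (simp_all add: g_val typed_val)

lemma ga_nat:
 assumes "cel t" "X = mtrg (tdom t)" "Y = msrc (tdom t)"
 shows "(gT X|>t)**ga (tdom t) = ga (tcod t)**(t<|gT Y)"
 using assms al_nat[of "msrc (tdom t)" "mtrg (tdom t)" "mval (tdom t)" "mval (tcod t)" "tval t"]
  hom1_if_mor[OF cel_mor(1)[OF assms(1)]] hom1_if_mor[OF cel_mor(2)[OF assms(1)]] hom2_if_cel[OF assms(1)]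
 by (intro tarr_eqI) (simp_all add: g_val typed_val)

lemma ga_p: "[|mor f; X = mtrg f; Y = msrc f|] ==> (gp X<|f)**ga f = f|>gp Y"
 using al_p[of "msrc f" "mtrg f" "mval f"] hom1_if_mor[of f] by (intro tarr_eqI) (simp_all add: g_val typed_val)

lemma ga_z: "[|mor f; X = mtrg f; Y = msrc f|] ==> ga f**(f|>gz Y) = gz X<|f"
 using al_z[of "msrc f" "mtrg f" "mval f"] hom1_if_mor[of f] by (intro tarr_eqI) (simp_all add: g_val typed_val)

lemma ga_l: "[|mor f; X = mtrg f; Y = msrc f|] ==> (gl X<|f)**ga f = (gT X|>ga f)**(ga f<|gT Y)**(f|>gl Y)"
 using al_l[of "msrc f" "mtrg f" "mval f"] hom1_if_mor[of f] by (intro tarr_eqI) (simp_all add: g_val typed_val)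

lemma ga_s:
 assumes f: "mor f" "X = mtrg f" "Y = msrc f"
 obtains r where "cel r" "tdom r = f oo gT2 Y" "tcod r = gT2 X oo f"
  "(gq1 X<|f)**r = ga f**(f|>gq1 Y)" "(gq2 X<|f)**r = ga f**(f|>gq2 Y)"
  "ga f**(f|>gs Y) = (gs X<|f)**r"
proof -
 obtain r where r: "r \<in> hom2 K Y X (mval f \<odot> T2 Y) (T2 X \<odot> mval f)" and
  e: "(q1 X \<lhd> mval f) \<bullet> r = al (mval f) \<bullet> (mval f \<rhd> q1 Y)" "(q2 X \<lhd> mval f) \<bullet> r = al (mval f) \<bullet> (mval f \<rhd> q2 Y)"
   "al (mval f) \<bullet> (mval f \<rhd> s Y) = (s X \<lhd> mval f) \<bullet> r"
  using al_s[of Y X "mval f"] hom1_if_mor[of f] f mor_obj[of f] by auto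
 let ?r = "Tarr (f oo gT2 Y) (gT2 X oo f) r"
 show thesis
 proof (rule that[of ?r])
  show "cel ?r" by (rule celI) (use r f in \<open>simp_all add: typed_val g_val\<close>)
 qed (use f e in \<open>auto intro!: tarr_eqI simp: typed_val g_val\<close>)
qed

lemma gT2_tpb: "[|mor h; mtrg h = X|] ==> tpb (gq1 X<|h) (gq2 X<|h) (gp X<|h) (gp X<|h)"
 by (rule is_pullback_tpb[OF T2_pb[of X "msrc h" "mval h"]])
  (use hom1_if_mor[of h] mor_obj[of h] in \<open>auto simp: typed_val g_val intro!: tmor.expand simp del: mcomp_mid\<close>)

lemma gT_pr [simp]: "[|A \<in> obj K; B \<in> obj K|] ==> pr1 A B oo gT (pobj K A B) = gT A oo pr1 A B"
 "[|A \<in> obj K; B \<in> obj K|] ==> pr2 A B oo gT (pobj K A B) = gT B oo pr2 A B"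
 by (auto intro!: tmor.expand simp: typed_val g_val pr_val T_pr)

lemma ga_pr [simp]: "[|A \<in> obj K; B \<in> obj K|] ==> ga (pr1 A B) = cid (gT A oo pr1 A B)"
 "[|A \<in> obj K; B \<in> obj K|] ==> ga (pr2 A B) = cid (gT B oo pr2 A B)"
 by (auto intro!: tarr_eqI simp: typed_val g_val pr_val al_pr)

lemma gT_pr_pre [simp]:
 assumes "A \<in> obj K" "B \<in> obj K" "mor f" "mtrg f = pobj K A B"
 shows "pr1 A B oo gT (pobj K A B) oo f = gT A oo pr1 A B oo f" "pr2 A B oo gT (pobj K A B) oo f = gT B oo pr2 A B oo f"
 using arg_cong[OF gT_pr(1)[OF assms(1,2)], of "%x. x oo f"] arg_cong[OF gT_pr(2)[OF assms(1,2)], of "%x. x oo f"] assms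
 by (simp_all add: pobj_closed del: gT_pr)

lemma gT_pr_cell [simp]:
 assumes "A \<in> obj K" "B \<in> obj K" "cel t" "mtrg (tdom t) = pobj K A B"
 shows "pr1 A B|>gT (pobj K A B)|>t = gT A|>pr1 A B|>t" "pr2 A B|>gT (pobj K A B)|>t = gT B|>pr2 A B|>t"
 using arg_cong[OF gT_pr(1)[OF assms(1,2)], of "%x. x|>t"] arg_cong[OF gT_pr(2)[OF assms(1,2)], of "%x. x|>t"] assms
 by (simp_all add: pobj_closed del: gT_pr)

lemma gT_tpair:
 assumes "mor A" "mor B" "msrc B = msrc A" "X = mtrg A" "Y = mtrg B"
 shows "gT (pobj K X Y) oo tpair A B = tpair (gT X oo A) (gT Y oo B)"
 by (rule mor_prod_eqI[of _ _ X Y]) (use assms in \<open>simp_all add: pobj_closed\<close>)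

lemma gT_cpair:
 assumes "cel t" "cel u" "msrc (tdom u) = msrc (tdom t)" "X = mtrg (tdom t)" "Y = mtrg (tdom u)"
 shows "gT (pobj K X Y)|>cpair t u = cpair (gT X|>t) (gT Y|>u)"
 by (rule cel_prod_eqI[of _ _ X Y]) (use assms in \<open>simp_all add: pobj_closed gT_tpair\<close>)

text \<open>The tangent bundle preserves the products of a Cartesian object, since the latter are given by a right adjoint
 among tangentads.\<close>

lemma T_bx_inverse:
 assumes co: "cartesian_object K X k" and A: "mor A" "mtrg A = X" and B: "mor B" "mtrg B = X" "msrc B = msrc A"
 shows "tinv (ga (tms X k)<|tpair A B) (bpr k (gT X|>tbx1 k A B) (gT X|>tbx2 k A B))"
  "(gT X|>tbx1 k A B)**(ga (tms X k)<|tpair A B) = tbx1 k (gT X oo A) (gT X oo B)"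
  "(gT X|>tbx2 k A B)**(ga (tms X k)<|tpair A B) = tbx2 k (gT X oo A) (gT X oo B)"
proof -
 note c [simp] = cart_types[OF co] and ab [simp] = A B
 note b [simp] = box[OF co A B]
 have TA: "mor (gT X oo A)" "mtrg (gT X oo A) = X" "mor (gT X oo B)" "mtrg (gT X oo B) = X" "msrc (gT X oo B) = msrc (gT X oo A)" by simp_all
 note Tb [simp] = box[OF co TA]
 let ?XX = "pobj K X X" and ?th = "ga (tms X k)<|tpair A B" and ?d = "tpair (mid X) (mid X)"
 have gt [simp]: "gT ?XX oo tpair A B = tpair (gT X oo A) (gT X oo B)" by (rule gT_tpair) simp_all
 have w: "e<|gT ?XX<|tpair A B = e<|tpair (gT X oo A) (gT X oo B)" if "cel e" "msrc (tdom e) = ?XX" for e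
  using rw_mcomp[of "gT ?XX" "tpair A B" e] that by simp
 have th [simp]: "cel ?th" "tdom ?th = tbx k (gT X oo A) (gT X oo B)" "tcod ?th = gT X oo tbx k A B"
  by (simp_all add: tbx_def)
 have fold: "tms X k oo tpair (gT X oo A) (gT X oo B) = tbx k (gT X oo A) (gT X oo B)"
  "tms X k oo tpair A B = tbx k A B" by (simp_all add: tbx_def)
 have n: "(gT X|>ep1 X k)**ga (tms X k) = ep1 X k<|gT ?XX" "(gT X|>ep2 X k)**ga (tms X k) = ep2 X k<|gT ?XX"
  using ga_nat[of "ep1 X k" X ?XX] ga_nat[of "ep2 X k" X ?XX] by simp_all
 show pth: "(gT X|>tbx1 k A B)**?th = tbx1 k (gT X oo A) (gT X oo B)"
  "(gT X|>tbx2 k A B)**?th = tbx2 k (gT X oo A) (gT X oo B)"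
  using arg_cong[OF n(1), of "%x. x<|tpair A B"] arg_cong[OF n(2), of "%x. x<|tpair A B"] by (simp_all add: w tbx1_def tbx2_def)
 let ?f = "gT X|>tbx1 k A B" and ?g = "gT X|>tbx2 k A B"
 have fg: "cel ?f" "mtrg (tdom ?f) = X" "cel ?g" "tdom ?g = tdom ?f" by simp_all
 note kk [simp] = bpr(1-3)[OF co fg] and ke = bx_bpr_pre[OF co fg] bx_bpr[OF co fg]
 let ?k = "bpr k ?f ?g"
 have "?k**?th = cid (tbx k (gT X oo A) (gT X oo B))"
  by (rule bpr_eqI[OF co TA]) (simp_all add: fold ke pth)
 moreover have "?th**?k = cid (gT X oo tbx k A B)"
 proof -
  let ?c = "cpair (tbx1 k A B) (tbx2 k A B)"
  have gd: "ga ?d = cid (gT ?XX oo ?d)"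
  proof (rule cel_prod_eqI[of _ _ X X])
   have "ga (pr1 X X oo ?d) = pr1 X X|>ga ?d" by (subst ga_comp) (simp_all add: gT_tpair)
   moreover have "ga (pr2 X X oo ?d) = pr2 X X|>ga ?d" by (subst ga_comp) (simp_all add: gT_tpair)
   ultimately have q: "pr1 X X|>ga ?d = cid (gT X)" "pr2 X X|>ga ?d = cid (gT X)"
    by (simp_all add: ga_mid)
   show "pr1 X X|>ga ?d = pr1 X X|>cid (gT ?XX oo ?d)" "pr2 X X|>ga ?d = pr2 X X|>cid (gT ?XX oo ?d)" unfolding q by simp_all
  qed (simp_all add: gT_tpair)
  have et: "gT X|>teta X k = (ga (tms X k)<|?d)**(teta X k<|gT X)"
   using ga_nat[of "teta X k" X X] ga_comp[of "tms X k" ?d] by (simp add: ga_mid gd gT_tpair)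
  have wd: "e<|?d<|h = e<|tpair h h" if "cel e" "msrc (tdom e) = ?XX" "mor h" "mtrg h = X" for e h
   using rw_mcomp[of ?d h e] that by simp
  have etb: "gT X|>teta X k<|tbx k A B = (ga (tms X k)<|tpair (tbx k A B) (tbx k A B))**(teta X k<|gT X<|tbx k A B)"
   using arg_cong[OF et, of "%x. x<|tbx k A B"] by (simp add: wd gT_tpair)
  have x: "?th**(tms X k|>gT ?XX|>?c) = (gT X|>tms X k|>?c)**(ga (tms X k)<|tpair (tbx k A B) (tbx k A B))"
   using whisker_exchange[of "ga (tms X k)" ?c] by simp
  have gc: "cpair ?f ?g = gT ?XX|>?c" by (rule gT_cpair[symmetric]) simp_all
  have gt2: "gT ?XX oo tpair (tbx k A B) (tbx k A B) = tpair (gT X oo tbx k A B) (gT X oo tbx k A B)" by (rule gT_tpair) simp_all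
  have "?th**?k = ?th**(tms X k|>gT ?XX|>?c)**(teta X k<|gT X<|tbx k A B)"
   by (simp add: bpr_def gc)
  also have "\<dots> = (gT X|>tms X k|>?c)**(ga (tms X k)<|tpair (tbx k A B) (tbx k A B))**(teta X k<|gT X<|tbx k A B)"
   by (simp add: vc_pre[OF x] gt2)
  also have "\<dots> = (gT X|>tms X k|>?c)**(gT X|>teta X k<|tbx k A B)" unfolding etb ..
  also have "\<dots> = gT X|>bpr k (tbx1 k A B) (tbx2 k A B)" by (simp add: bpr_def)
  also have "bpr k (tbx1 k A B) (tbx2 k A B) = cid (tbx k A B)" using bpr_expand[OF co A B, of "cid (tbx k A B)"] by simp
  finally show ?thesis by simp
 qed
 ultimately show "tinv ?th ?k" unfolding tinv_def by (simp add: fold)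
qed

lemma T_bx_prod:
 assumes co: "cartesian_object K X k" and A: "mor A" "mtrg A = X" and B: "mor B" "mtrg B = X" "msrc B = msrc A"
 shows "tprod (gT X|>tbx1 k A B) (gT X|>tbx2 k A B)"
proof -
 note c [simp] = cart_types[OF co] and ab [simp] = A B
 note b [simp] = box[OF co A B]
 have TA: "mor (gT X oo A)" "mtrg (gT X oo A) = X" "mor (gT X oo B)" "mtrg (gT X oo B) = X" "msrc (gT X oo B) = msrc (gT X oo A)" by simp_all
 note Tb [simp] = box[OF co TA]
 note inv = T_bx_inverse[OF co A B]
 let ?f = "gT X|>tbx1 k A B" and ?g = "gT X|>tbx2 k A B"
 have fg: "cel ?f" "mtrg (tdom ?f) = X" "cel ?g" "tdom ?g = tdom ?f" by simp_all
 have "tiso (bpr k ?f ?g)" using inv(1) unfolding tiso_def tinv_def by metis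
 then have "tprod (tbx1 k (gT X oo A) (gT X oo B)**bpr k ?f ?g) (tbx2 k (gT X oo A) (gT X oo B)**bpr k ?f ?g)"
  using bpr(3)[OF co fg] by (intro tprod_iso[OF tprod_bx[OF co TA]]) simp_all
 then show ?thesis using bx_bpr[OF co fg] by simp
qed

lemma T_top_iso:
 assumes co: "cartesian_object K X k" and W: "W \<in> obj K"
 shows "tiso (bng k (gT X oo topo X k W))"
proof -
 note c [simp] = cart_types[OF co] and t [simp] = top[OF co W] and [simp] = W
 have Tt: "mor (gT X oo topo X k W)" "mtrg (gT X oo topo X k W) = X" by simp_all
 note bT [simp] = bng[OF co Tt]
 have g1: "gT (tobj K) = mid (tobj K)" by (rule mor_tobj_eq) simp_all
 let ?u = "ga (tst X k)<|tbang W"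
 have u [simp]: "cel ?u" "tdom ?u = topo X k W" "tcod ?u = gT X oo topo X k W" by (simp_all add: topo_def g1)
 have "bng k (gT X oo topo X k W)**?u = cid (topo X k W)"
  by (rule bng_eq[OF co _ _ _ _ _ W]) (simp_all add: g1 topo_def[symmetric])
 moreover have "?u**bng k (gT X oo topo X k W) = cid (gT X oo topo X k W)"
 proof -
  have gb: "ga (tbang X) = cid (tbang X)" by (rule cel_tobj_eq) (simp_all add: g1)
  have et: "gT X|>tsu X k = (ga (tst X k)<|tbang X)**(tsu X k<|gT X)"
   using ga_nat[of "tsu X k" X X] ga_comp[of "tst X k" "tbang X"] by (simp add: ga_mid gb g1)
  have wb: "e<|tbang X<|h = e<|tbang (msrc h)" if "cel e" "msrc (tdom e) = tobj K" "mor h" "mtrg h = X" for e h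
   using rw_mcomp[of "tbang X" h e] that by simp
  have e: "tsu X k<|topo X k W = cid (topo X k W)"
   using arg_cong[OF cart_triangles(4)[OF co], of "%x. x<|tbang W"] by (simp add: topo_def)
  have "gT X|>tsu X k<|topo X k W = (ga (tst X k)<|tbang W)**(tsu X k<|gT X<|topo X k W)"
   using arg_cong[OF et, of "%x. x<|topo X k W"] by (simp add: wb g1)
  then show ?thesis by (simp add: e bng_def)
 qed
 ultimately show ?thesis unfolding tiso_def tinv_def by (intro exI[of _ ?u]) (simp add: g1 topo_def[symmetric])
qed

section \<open>Differential objects\<close>

text \<open>A differential object on the 1-cell \<open>A\<close>, with zero \<open>e\<close>, addition \<open>m\<close> and projection \<open>h\<close>. The right-hand side of the
 axiom for \<open>h\<close> and \<open>T m\<close> is simplified: \<open>(h \<times> h)\<close> after the comparison \<open>T (A \<times> A) \<rightarrow> T A \<times> T A\<close> is the pairing of the two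
 cells \<open>h (T \<pi>)\<close>.\<close>

definition dob where
 "dob k A e m h \<longleftrightarrow> mor A & cel e & tdom e = topo (mtrg A) k (msrc A) & tcod e = A &
   cel m & tdom m = tbx k A A & tcod m = A & cel h & tdom h = gT (mtrg A) oo A & tcod h = A &
   (\<forall>a b d. cel a & cel b & cel d & tdom b = tdom a & tdom d = tdom a & tcod a = A & tcod b = A & tcod d = A -->
    m**bpr k (m**bpr k a b) d = m**bpr k a (m**bpr k b d)) &
   m**bpr k (e**bng k A) (cid A) = cid A & m**bpr k (cid A) (e**bng k A) = cid A &
   m**bpr k (tbx2 k A A) (tbx1 k A A) = m &
   h**(gT (mtrg A)|>e) = e**bng k (gT (mtrg A) oo topo (mtrg A) k (msrc A)) &
   h**(gT (mtrg A)|>m) = m**bpr k (h**(gT (mtrg A)|>tbx1 k A A)) (h**(gT (mtrg A)|>tbx2 k A A)) &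
   h**(gz (mtrg A)<|A) = e**bng k A &
   h**(gs (mtrg A)<|A) = m**bpr k (h**(gq1 (mtrg A)<|A)) (h**(gq2 (mtrg A)<|A)) &
   h**(gT (mtrg A)|>h)**(gl (mtrg A)<|A) = h &
   tprod (gp (mtrg A)<|A) h"

lemma dobD:
 assumes "dob k A e m h" "mtrg A = X" "msrc A = W"
 shows "mor A" "cel e" "tdom e = topo X k W" "tcod e = A" "cel m" "tdom m = tbx k A A" "tcod m = A"
  "cel h" "tdom h = gT X oo A" "tcod h = A"
  "!!a b d. [|cel a; cel b; cel d; tdom b = tdom a; tdom d = tdom a; tcod a = A; tcod b = A; tcod d = A|] ==>
    m**bpr k (m**bpr k a b) d = m**bpr k a (m**bpr k b d)"
  "m**bpr k (e**bng k A) (cid A) = cid A" "m**bpr k (cid A) (e**bng k A) = cid A"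
  "m**bpr k (tbx2 k A A) (tbx1 k A A) = m"
  "h**(gT X|>e) = e**bng k (gT X oo topo X k W)"
  "h**(gT X|>m) = m**bpr k (h**(gT X|>tbx1 k A A)) (h**(gT X|>tbx2 k A A))"
  "h**(gz X<|A) = e**bng k A"
  "h**(gs X<|A) = m**bpr k (h**(gq1 X<|A)) (h**(gq2 X<|A))"
  "h**(gT X|>h)**(gl X<|A) = h" "tprod (gp X<|A) h"
 using assms unfolding dob_def by blast+

section \<open>Pushing differential objects forward\<close>

text \<open>The cells \<open>e\<close>, \<open>m\<close>, \<open>h\<close> on \<open>A\<close> are transported to \<open>e'\<close>, \<open>m'\<close>, \<open>h'\<close> on \<open>f A\<close> along the comparisons of \<open>f\<close> and its
 distributive law. A relation avoids naming the inverses of these comparisons.\<close>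

definition dpush where
 "dpush f k k' A e m h e' m' h' \<longleftrightarrow>
   cel e' & tdom e' = topo (mtrg f) k' (msrc A) & tcod e' = f oo A & e'**bng k' (f oo topo (msrc f) k (msrc A)) = f|>e &
   cel m' & tdom m' = tbx k' (f oo A) (f oo A) & tcod m' = f oo A &
    m'**bpr k' (f|>tbx1 k A A) (f|>tbx2 k A A) = f|>m &
   cel h' & tdom h' = gT (mtrg f) oo f oo A & tcod h' = f oo A & h'**(ga f<|A) = f|>h"

lemma dpushD:
 assumes "dpush f k k' A e m h e' m' h'" "mtrg f = Y" "msrc f = X" "msrc A = W"
 shows "cel e'" "tdom e' = topo Y k' W" "tcod e' = f oo A" "e'**bng k' (f oo topo X k W) = f|>e"
  "cel m'" "tdom m' = tbx k' (f oo A) (f oo A)" "tcod m' = f oo A"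
    "m'**bpr k' (f|>tbx1 k A A) (f|>tbx2 k A A) = f|>m"
   "cel h'" "tdom h' = gT Y oo f oo A" "tcod h' = f oo A" "h'**(ga f<|A) = f|>h"
 using assms unfolding dpush_def by auto

lemma comparison_iso:
 assumes co: "cartesian_object K X k" and co': "cartesian_object K Y k'" and f: "mor f" "msrc f = X" "mtrg f = Y" and fp: "fpres f k k'"
  and A: "mor A" "mtrg A = X" and B: "mor B" "mtrg B = X" "msrc B = msrc A"
 shows "tiso (bpr k' (f|>tbx1 k A B) (f|>tbx2 k A B))"
proof -
 note b [simp] = box[OF co A B] and [simp] = f A B
 have pr: "tprod (f|>tbx1 k A B) (f|>tbx2 k A B)" using fp A B f unfolding fpres_def by simp
 have fA: "mor (f oo A)" "mtrg (f oo A) = Y" "mor (f oo B)" "mtrg (f oo B) = Y" "msrc (f oo B) = msrc (f oo A)" by simp_all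
 note b' [simp] = box[OF co' fA]
 have t: "cel (f|>tbx1 k A B)" "mtrg (tdom (f|>tbx1 k A B)) = Y" "cel (f|>tbx2 k A B)" "tdom (f|>tbx2 k A B) = tdom (f|>tbx1 k A B)"
  by simp_all
 show ?thesis
  by (rule tprod_comparison[OF pr tprod_bx[OF co' fA]]) (use bpr[OF co' t] in simp_all)
qed

lemma dpush_ex:
 assumes co: "cartesian_object K X k" and co': "cartesian_object K Y k'" and f: "mor f" "msrc f = X" "mtrg f = Y" and fp: "fpres f k k'"
  and iso: "tiso (ga f)" and d: "dob k A e m h" and A: "mtrg A = X" "msrc A = W"
 shows "\<exists>e' m' h'. dpush f k k' A e m h e' m' h'"
proof -
 note D [simp] = dobD(1-10)[OF d A] and [simp] = f A cart_types(1)[OF co] cart_types(1)[OF co']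
 have W [simp]: "W \<in> obj K" using mor_obj(1)[OF D(1)] A by simp
 note t [simp] = top[OF co W]
 note b [simp] = box[OF co D(1) A(1) D(1) A(1) refl]
 have fA: "mor (f oo A)" "mtrg (f oo A) = Y" by simp_all
 note b' [simp] = box[OF co' fA fA refl]
 have ex: "\<exists>x'. cel x' & tdom x' = tcod u & tcod x' = tcod x & x'**u = x" if u: "tiso u" "cel x" "tdom x = tdom u" for x u
 proof -
  obtain v where v: "tinv u v" using u unfolding tiso_def by blast
  show ?thesis using tinvD(1)[OF v] u tinvD(3)[OF v] by (intro exI[of _ "x**v"]) simp
 qed
 let ?u = "bng k' (f oo topo X k W)" and ?v = "bpr k' (f|>tbx1 k A A) (f|>tbx2 k A A)" and ?w = "ga f<|A"
 have u: "tiso ?u" using fp W unfolding fpres_def by simp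
 have v: "tiso ?v" by (rule comparison_iso[OF co co' f fp D(1) A(1) D(1) A(1) refl])
 have w: "tiso ?w" by (rule tiso_rw[OF iso]) simp_all
 have ft: "mor (f oo topo X k W)" "mtrg (f oo topo X k W) = Y" by simp_all
 have t1: "cel (f|>tbx1 k A A)" "mtrg (tdom (f|>tbx1 k A A)) = Y" "cel (f|>tbx2 k A A)" "tdom (f|>tbx2 k A A) = tdom (f|>tbx1 k A A)"
  by simp_all
 note bn [simp] = bng[OF co' ft] and bp [simp] = bpr(1-3)[OF co' t1]
 obtain e' m' h' where "cel e' & tdom e' = tcod ?u & tcod e' = tcod (f|>e) & e'**?u = f|>e"
  "cel m' & tdom m' = tcod ?v & tcod m' = tcod (f|>m) & m'**?v = f|>m"
  "cel h' & tdom h' = tcod ?w & tcod h' = tcod (f|>h) & h'**?w = f|>h"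
  using ex[OF u, of "f|>e"] ex[OF v, of "f|>m"] ex[OF w, of "f|>h"] by auto
 then have "dpush f k k' A e m h e' m' h'" unfolding dpush_def by simp
 then show ?thesis by blast
qed

lemma dpush_unique:
 assumes co: "cartesian_object K X k" and co': "cartesian_object K Y k'" and f: "mor f" "msrc f = X" "mtrg f = Y" and fp: "fpres f k k'"
  and iso: "tiso (ga f)" and A: "mor A" "mtrg A = X"
  and 1: "dpush f k k' A e m h e1 m1 h1" and 2: "dpush f k k' A e m h e2 m2 h2"
 shows "e1 = e2" "m1 = m2" "h1 = h2"
proof -
 have W: "msrc A \<in> obj K" using mor_obj(1)[OF A(1)] .
 note [simp] = cart_types(1)[OF co] cart_types(1)[OF co']
 note d1 = dpushD[OF 1 f(3,2) refl] and d2 = dpushD[OF 2 f(3,2) refl]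
 have ft: "mor (f oo topo X k (msrc A))" "mtrg (f oo topo X k (msrc A)) = Y" using top[OF co W] f by simp_all
 note b [simp] = box[OF co A A refl]
 have t1: "cel (f|>tbx1 k A A)" "mtrg (tdom (f|>tbx1 k A A)) = Y" "cel (f|>tbx2 k A A)" "tdom (f|>tbx2 k A A) = tdom (f|>tbx1 k A A)"
  using f A by simp_all
 have u: "tiso (bng k' (f oo topo X k (msrc A)))" using fp W f unfolding fpres_def by simp
 show "e1 = e2" by (rule tiso_epi[OF u]) (use d1 d2 bng[OF co' ft] top[OF co W] f in simp_all)
 show "m1 = m2" by (rule tiso_epi[OF comparison_iso[OF co co' f fp A A refl]]) (use d1 d2 bpr(3)[OF co' t1] f A in simp_all)
 show "h1 = h2" by (rule tiso_epi[OF tiso_rw[OF iso A(1)]]) (use d1 d2 f A in simp_all)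
qed

text \<open>Precomposition with an invertible cell reflects product diagrams.\<close>

lemma tprod_iso_conv:
 assumes "tprod (a**u) (b**u)" "tiso u" "cel a" "cel b" "tdom a = tcod u" "tdom b = tcod u"
 shows "tprod a b"
proof -
 obtain v where v: "tinv u v" using assms(2) unfolding tiso_def by blast
 note d = tinvD(1)[OF v]
 have "tiso v" using v unfolding tiso_def tinv_def by (intro exI[of _ u]) simp
 then have "tprod ((a**u)**v) ((b**u)**v)" by (rule tprod_iso[OF assms(1)]) (use d in simp)
 then show ?thesis using assms(3-6) d by (simp add: tinvD(2)[OF v])
qed

text \<open>A strong tangent morphism that preserves finite products preserves differential objects. It need not preserve the
 pullbacks \<open>T2\<close>; but the comparison at \<open>T2 A\<close> has a section when \<open>A\<close> is a differential object, because then \<open>T2 A\<close> is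
 a retract of a product of copies of \<open>A\<close>, and this suffices for the additivity axiom.\<close>

lemma dob_push:
 assumes co: "cartesian_object K X k" and co': "cartesian_object K Y k'" and f: "mor f" "msrc f = X" "mtrg f = Y" and fp: "fpres f k k'"
  and iso: "tiso (ga f)" and d: "dob k A e m h" and A: "mtrg A = X" "msrc A = W" and ps: "dpush f k k' A e m h e' m' h'"
 shows "dob k' (f oo A) e' m' h'"
proof -
 note D [simp] = dobD(1-10)[OF d A] and ax = dobD(11-20)[OF d A] and [simp] = f A
 have W [simp]: "W \<in> obj K" "X \<in> obj K" "Y \<in> obj K" using mor_obj[OF D(1)] mor_obj[OF f(1)] by simp_all
 note P [simp] = dpushD(1-3,5-7,9-11)[OF ps f(3,2) A(2)] and pe = dpushD(4,8,12)[OF ps f(3,2) A(2)]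
 note c [simp] = cart_types[OF co] cart_types[OF co']
 note t [simp] = top[OF co W(1)] top[OF co' W(1)]
 let ?AA = "tbx k A A" and ?a1 = "tbx1 k A A" and ?a2 = "tbx2 k A A" and ?fA = "f oo A"
 note b [simp] = box[OF co D(1) A(1) D(1) A(1) refl]
 have fA: "mor ?fA" "mtrg ?fA = Y" by simp_all
 note b' [simp] = box[OF co' fA fA refl]
 have [simp]: "msrc A = W" by simp
 note cart [simp] = bpr(1-3)[OF co'] bpr(1-3)[OF co] bng[OF co'] bng[OF co]
 note calc [simp] = bx_bpr[OF co'] bx_bpr[OF co] bx_bpr_pre[OF co'] bx_bpr_pre[OF co] bpr_comp[OF co'] bpr_comp[OF co]
 note bc [simp] = bng_comp[OF co'] bng_comp[OF co]
 let ?k = "bpr k' (f|>?a1) (f|>?a2)"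
 have kiso: "tiso ?k" by (rule comparison_iso[OF co co' f fp D(1) A(1) D(1) A(1) refl])
 have add: "m'**bpr k' (f|>x) (f|>y) = f|>(m**bpr k x y)"
  if xy: "cel x" "cel y" "tdom y = tdom x" "tcod x = A" "tcod y = A" for x y
 proof -
  have xm: "mtrg (tdom x) = X" "msrc (tdom x) = W" using cel_mor(3,4)[OF xy(1)] xy by simp_all
  have eq: "bpr k' (f|>x) (f|>y) = ?k**(f|>bpr k x y)"
   using vc_lw_eq[OF bx_bpr(1)[OF co xy(1) xm(1) xy(2,3) refl refl], of f] vc_lw_eq[OF bx_bpr(2)[OF co xy(1) xm(1) xy(2,3) refl refl], of f] xy xm
   by simp
  show ?thesis unfolding eq using xy xm by (simp add: vc_pre[OF pe(2)] del: calc)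
 qed
 have zero: "e'**bng k' (f oo B) = f|>(e**bng k B)" if B: "mor B" "mtrg B = X" "msrc B = W" for B
 proof -
  have eq: "bng k' (f oo B) = bng k' (f oo topo X k W)**(f|>bng k B)" using B by simp
  show ?thesis unfolding eq using B by (simp add: vc_pre[OF pe(1)] del: bc)
 qed
 have prodf: "tprod (f|>a) (f|>b)" if "tprod a b" "mtrg (tdom a) = X" for a b
  by (rule fpres_tprod[OF fp f(1)]) (use that co in simp_all)
 let ?Q = "tbx k A ?AA"
 have AA: "mor ?AA" "mtrg ?AA = X" "msrc ?AA = msrc A" by simp_all
 note bq [simp] = box[OF co D(1) A(1) AA]
 let ?x = "tbx1 k A ?AA" and ?y = "?a1**tbx2 k A ?AA" and ?w = "?a2**tbx2 k A ?AA"
 have triple: "\<exists>u. cel u & tdom u = tdom a & tcod u = f oo ?Q & (f|>?x)**u = a & (f|>?y)**u = b' & (f|>?w)**u = d'"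
  if h: "cel a" "cel b'" "cel d'" "tdom b' = tdom a" "tdom d' = tdom a" "tcod a = ?fA" "tcod b' = ?fA" "tcod d' = ?fA" for a b' d'
 proof -
  obtain v where v [simp]: "cel v" "tdom v = tdom b'" "tcod v = tdom (f|>?a1)" and ve: "(f|>?a1)**v = b'" "(f|>?a2)**v = d'"
   by (rule tprod_ex[OF prodf[OF tprod_bx[OF co D(1) A(1) D(1) A(1) refl]], of b' d']) (use h in simp_all)
  obtain u where u [simp]: "cel u" "tdom u = tdom a" "tcod u = tdom (f|>?x)" and ue: "(f|>?x)**u = a" "(f|>tbx2 k A ?AA)**u = v"
   by (rule tprod_ex[OF prodf[OF tprod_bx[OF co D(1) A(1) AA]], of a v]) (use h in simp_all)
  show ?thesis by (intro exI[of _ u]) (use h in \<open>simp add: ue ve\<close>)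
 qed
 have assoc: "m'**bpr k' (m'**bpr k' a b') d' = m'**bpr k' a (m'**bpr k' b' d')"
  if h: "cel a" "cel b'" "cel d'" "tdom b' = tdom a" "tdom d' = tdom a" "tcod a = ?fA" "tcod b' = ?fA" "tcod d' = ?fA" for a b' d'
 proof -
  obtain u where u [simp]: "cel u" "tdom u = tdom a" "tcod u = f oo ?Q" and ue: "a = (f|>?x)**u" "b' = (f|>?y)**u" "d' = (f|>?w)**u"
   using triple[OF h] by auto
  have dm: "mtrg (tdom a) = Y" using cel_mor(4)[OF h(1)] h by simp
  have "m'**bpr k' (m'**bpr k' (f|>?x) (f|>?y)) (f|>?w) = m'**bpr k' (f|>?x) (m'**bpr k' (f|>?y) (f|>?w))"
   using ax(1)[of ?x ?y ?w] by (simp add: add del: lw_vc)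
  from arg_cong[OF this, of "%x. x**u"]
  have "m'**bpr k' (m'**bpr k' ((f|>?x)**u) ((f|>?y)**u)) ((f|>?w)**u) =
    m'**bpr k' ((f|>?x)**u) (m'**bpr k' ((f|>?y)**u) ((f|>?w)**u))" by simp
  then show ?thesis unfolding ue[symmetric] .
 qed
 have unit: "m'**bpr k' (e'**bng k' ?fA) (cid ?fA) = cid ?fA" "m'**bpr k' (cid ?fA) (e'**bng k' ?fA) = cid ?fA"
  using add[of "e**bng k A" "cid A"] add[of "cid A" "e**bng k A"] ax(2,3) by (simp_all add: zero del: lw_vc)
 have comm: "m'**bpr k' (tbx2 k' ?fA ?fA) (tbx1 k' ?fA ?fA) = m'"
  by (rule tiso_epi[OF kiso]) (simp_all add: pe add ax(4))
 have xe: "gT Y|>f|>x**ga f<|tdom x = ga f<|tcod x**f|>gT X|>x" if "cel x" "mtrg (tdom x) = X" for x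
  using whisker_exchange[of "ga f" x] that by simp
 have hx: "h'**gT Y|>f|>x**ga f<|tdom x = f|>(h**gT X|>x)" if "cel x" "tcod x = A" for x
  using xe[of x] cel_mor(3,4)[OF that(1)] that by (simp add: vc_pre[OF pe(3)])
 have Tzero: "h'**(gT Y|>e') = e'**bng k' (gT Y oo topo Y k' W)"
 proof -
  let ?u = "(gT Y|>bng k' (f oo topo X k W))**(ga f<|topo X k W)"
  have u: "tiso ?u"
  proof (rule tiso_vc)
   show "tiso (gT Y|>bng k' (f oo topo X k W))" by (rule tiso_lw) (use fp[unfolded fpres_def] in simp_all)
   show "tiso (ga f<|topo X k W)" by (rule tiso_rw[OF iso]) simp_all
  qed simp
  have "(h'**(gT Y|>e'))**?u = f|>(h**(gT X|>e))"
   using hx[of e] by (simp add: vc_pre[OF vc_lw_eq[OF pe(1), of "gT Y"]])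
  also have "\<dots> = e'**bng k' (f oo gT X oo topo X k W)"
   unfolding ax(5) by (rule zero[symmetric]) simp_all
  also have "\<dots> = (e'**bng k' (gT Y oo topo Y k' W))**?u" by simp
  finally show ?thesis by (rule tiso_epi[OF u]) simp_all
 qed
 have Tadd: "h'**(gT Y|>m') = m'**bpr k' (h'**(gT Y|>tbx1 k' ?fA ?fA)) (h'**(gT Y|>tbx2 k' ?fA ?fA))"
 proof -
  let ?u = "(gT Y|>?k)**(ga f<|?AA)"
  have u: "tiso ?u"
  proof (rule tiso_vc)
   show "tiso (gT Y|>?k)" by (rule tiso_lw[OF kiso]) simp_all
   show "tiso (ga f<|?AA)" by (rule tiso_rw[OF iso]) simp_all
  qed simp
  have p1: "(gT Y|>tbx1 k' ?fA ?fA)**(gT Y|>?k) = gT Y|>f|>?a1"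
   "(gT Y|>tbx2 k' ?fA ?fA)**(gT Y|>?k) = gT Y|>f|>?a2"
   by (subst vc_lw_eq[OF bx_bpr(1)[OF co' _ _ _ _ refl refl], of "f|>?a1" "f|>?a2", simplified]
     vc_lw_eq[OF bx_bpr(2)[OF co' _ _ _ _ refl refl], of "f|>?a1" "f|>?a2", simplified]; simp)+
  have "(h'**(gT Y|>m'))**?u = f|>(h**(gT X|>m))"
   using hx[of m] by (simp add: vc_pre[OF vc_lw_eq[OF pe(2), of "gT Y"]] del: calc)
  also have "\<dots> = m'**bpr k' (f|>(h**(gT X|>?a1))) (f|>(h**(gT X|>?a2)))"
   unfolding ax(6) by (rule add[symmetric]) simp_all
  also have "\<dots> = (m'**bpr k' (h'**(gT Y|>tbx1 k' ?fA ?fA)) (h'**(gT Y|>tbx2 k' ?fA ?fA)))**?u"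
   using hx[of ?a1] hx[of ?a2] by (simp add: vc_pre[OF p1(1)] vc_pre[OF p1(2)])
  finally show ?thesis by (rule tiso_epi[OF u]) simp_all
 qed
 have gzA: "gz Y<|f<|A = ga f<|A**f|>gz X<|A"
  using arg_cong[OF ga_z[of f Y X], of "%x. x<|A"] by simp
 have z: "h'**(gz Y<|?fA) = e'**bng k' ?fA"
  using arg_cong[OF ax(7), of "%x. f|>x"] by (simp add: gzA vc_pre[OF pe(3)] zero)
 have glA: "gl Y<|f<|A**ga f<|A = gT Y|>ga f<|A**ga f<|gT X<|A**f|>gl X<|A"
  using arg_cong[OF ga_l[of f Y X], of "%x. x<|A"] by simp
 have gaA: "tiso (ga f<|A)" by (rule tiso_rw[OF iso]) simp_all
 have l: "h'**(gT Y|>h')**(gl Y<|?fA) = h'"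
 proof (rule tiso_epi[OF gaA])
  have x: "gT Y|>f|>h**ga f<|gT X<|A = ga f<|A**f|>gT X|>h"
   using xe[of h] by simp
  show "(h'**(gT Y|>h')**(gl Y<|?fA))**(ga f<|A) = h'**(ga f<|A)"
   using arg_cong[OF ax(9), of "%x. f|>x"]
   by (simp add: glA vc_pre[OF vc_lw_eq[OF pe(3), of "gT Y"]] vc_pre[OF x] vc_pre[OF pe(3)] pe(3))
 qed simp_all
 have gpA: "gp Y<|f<|A**ga f<|A = f|>gp X<|A"
  using arg_cong[OF ga_p[of f Y X], of "%x. x<|A"] by simp
 have prod: "tprod (gp Y<|?fA) h'"
  by (rule tprod_iso_conv[OF _ gaA]) (use prodf[OF ax(10)] in \<open>simp_all add: gpA pe(3)\<close>)
 have sum: "h'**(gs Y<|?fA) = m'**bpr k' (h'**(gq1 Y<|?fA)) (h'**(gq2 Y<|?fA))"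
 proof -
  note pbA = gT2_tpb[of A X, OF D(1) A(1)] and pbf = gT2_tpb[of ?fA Y, OF fA]
  obtain r where r [simp]: "cel r" "tdom r = f oo gT2 X" "tcod r = gT2 Y oo f"
   and re: "(gq1 Y<|f)**r = ga f**(f|>gq1 X)" "(gq2 Y<|f)**r = ga f**(f|>gq2 X)"
   "ga f**(f|>gs X) = (gs Y<|f)**r"
   by (rule ga_s[of f Y X]) simp_all
  have rA: "(gq1 Y<|f<|A)**(r<|A) = (ga f<|A)**(f|>gq1 X<|A)" "(gq2 Y<|f<|A)**(r<|A) = (ga f<|A)**(f|>gq2 X<|A)"
   "(gs Y<|f<|A)**(r<|A) = (ga f<|A)**(f|>gs X<|A)"
   using re[THEN arg_cong[of _ _ "%x. x<|A"]] by simp_all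
  obtain v1 where v1 [simp]: "cel v1" "tdom v1 = ?Q" "tcod v1 = gT X oo A" and v1e: "(gp X<|A)**v1 = ?x" "h**v1 = ?y"
   by (rule tprod_ex[OF ax(10), of ?x ?y]) simp_all
  obtain v2 where v2 [simp]: "cel v2" "tdom v2 = ?Q" "tcod v2 = gT X oo A" and v2e: "(gp X<|A)**v2 = ?x" "h**v2 = ?w"
   by (rule tprod_ex[OF ax(10), of ?x ?w]) simp_all
  obtain g where g [simp]: "cel g" "tdom g = ?Q" "tcod g = gT2 X oo A" and ge: "(gq1 X<|A)**g = v1" "(gq2 X<|A)**g = v2"
   by (rule tpb_ex[OF pbA, of v1 v2]) (simp_all add: v1e v2e)
  obtain u where u [simp]: "cel u" "tdom u = gT2 Y oo ?fA" "tcod u = f oo ?Q"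
   and ue: "(f|>?x)**u = (gp Y<|?fA)**(gq1 Y<|?fA)" "(f|>?y)**u = h'**(gq1 Y<|?fA)" "(f|>?w)**u = h'**(gq2 Y<|?fA)"
   using triple[of "(gp Y<|?fA)**(gq1 Y<|?fA)" "h'**(gq1 Y<|?fA)" "h'**(gq2 Y<|?fA)"] by auto
  let ?t = "(f|>g)**u"
  have q1: "(ga f<|A)**(f|>v1)**u = gq1 Y<|?fA"
   by (rule tprod_eqI[OF prod]) (use ue in \<open>simp_all add: vc_pre[OF gpA] vc_pre[OF pe(3)] vc_pre[OF vc_lw_eq[OF v1e(1)]] vc_pre[OF vc_lw_eq[OF v1e(2), of f, simplified]]\<close>)
  have pq: "gp Y<|f<|A**gq1 Y<|f<|A = gp Y<|f<|A**gq2 Y<|f<|A"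
   using tpbD(9)[OF pbf] by simp
  have q2: "(ga f<|A)**(f|>v2)**u = gq2 Y<|?fA"
   by (rule tprod_eqI[OF prod]) (use ue pq in \<open>simp_all add: vc_pre[OF gpA] vc_pre[OF pe(3)] vc_pre[OF vc_lw_eq[OF v2e(1)]] vc_pre[OF vc_lw_eq[OF v2e(2), of f, simplified]]\<close>)
  have rt: "(r<|A)**?t = cid (gT2 Y oo ?fA)"
   by (rule tpb_eqI[OF pbf]) (use q1 q2 in \<open>simp_all add: vc_pre[OF rA(1)] vc_pre[OF rA(2)] vc_pre[OF vc_lw_eq[OF ge(1)]] vc_pre[OF vc_lw_eq[OF ge(2)]]\<close>)
  have "h'**(gs Y<|?fA) = (h'**(gs Y<|?fA))**(r<|A)**?t" unfolding rt by simp
  also have "\<dots> = (f|>(h**(gs X<|A)))**?t" by (simp add: vc_pre[OF rA(3)] vc_pre[OF pe(3)])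
  also have "\<dots> = (m'**bpr k' (f|>(h**(gq1 X<|A))) (f|>(h**(gq2 X<|A))))**?t"
   unfolding ax(8) by (subst add) simp_all
  also have "\<dots> = m'**bpr k' (h'**(gq1 Y<|?fA)**(r<|A)**?t) (h'**(gq2 Y<|?fA)**(r<|A)**?t)"
   by (simp add: vc_pre[OF rA(1)] vc_pre[OF rA(2)] vc_pre[OF pe(3)])
  also have "\<dots> = m'**bpr k' (h'**(gq1 Y<|?fA)) (h'**(gq2 Y<|?fA))" unfolding rt by simp
  finally show ?thesis .
 qed
 show ?thesis unfolding dob_def
  using assoc unit comm Tzero Tadd z l prod sum by simp
qed

end

context cartesian_2_category
begin

lemma bpr_whisker:
 assumes co: "cartesian_object K X k" and f: "cel f" "mtrg (tdom f) = X" and g: "cel g" "tdom g = tdom f"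
  and h: "mor h" "mtrg h = msrc (tdom f)"
 shows "bpr k f g<|h = bpr k (f<|h) (g<|h)"
 using assms cart_types[OF co] by (simp add: bpr_def)

lemma bng_whisker:
 assumes co: "cartesian_object K X k" and w: "mor w" "mtrg w = X" and h: "mor h" "mtrg h = msrc w"
 shows "bng k w<|h = bng k (w oo h)"
 using assms cart_types[OF co] by (simp add: bng_def)

lemma topo_whisker:
 assumes co: "cartesian_object K X k" and h: "mor h" "mtrg h = W"
 shows "topo X k W oo h = topo X k (msrc h)"
proof -
 have "W \<in> obj K" using mor_obj(2)[OF h(1)] h by simp
 then show ?thesis using assms cart_types[OF co] by (simp add: topo_def)
qed

lemma tiso_mono:
 assumes u: "tiso u" and e: "u**a = u**b" and c: "cel a" "cel b" "tcod a = tdom u" "tcod b = tdom u"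
 shows "a = b"
proof -
 obtain v where v: "tinv u v" using u unfolding tiso_def by blast
 note d = tinvD(1)[OF v]
 have "v**u**a = v**u**b" using e by simp
 then show ?thesis using c d by (simp add: vc_pre[OF tinvD(3)[OF v]])
qed

lemma tiso_sym: "tinv u v ==> tiso v"
 unfolding tiso_def tinv_def by (intro exI[of _ u]) simp

text \<open>Two of three, for the factor that is applied first.\<close>

lemma tiso_cancel_left:
 assumes "tiso (u**v)" "tiso u" "cel v" "tcod v = tdom u"
 shows "tiso v"
proof -
 obtain u' where u': "tinv u u'" using assms(2) unfolding tiso_def by blast
 note d = tinvD(1)[OF u']
 have "tiso (u'**(u**v))" by (rule tiso_vc[OF tiso_sym[OF u'] assms(1)]) (use d assms in simp)
 then show ?thesis using d assms by (simp add: vc_pre[OF tinvD(3)[OF u']])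
qed

end

context tangent_2_category
begin

section \<open>Products of differential objects\<close>

text \<open>A cell \<open>b\<close> that commutes with zero, addition and projection carries every axiom of the target to the same axiom of the
 source, up to composition with \<open>b\<close>. Applied to the two jointly monic projections of a product, this yields the axioms of
 the product.\<close>

lemma dob_homomorphism:
 assumes co: "cartesian_object K X k" and d: "dob k A e m h" and A: "mtrg A = X" "msrc A = W"
  and P: "mor P" "mtrg P = X" "msrc P = W" and b: "cel b" "tdom b = P" "tcod b = A"
  and E: "cel E" "tdom E = topo X k W" "tcod E = P" "b**E = e"
  and M: "cel M" "tdom M = tbx k P P" "tcod M = P" "b**M = m**bpr k (b**tbx1 k P P) (b**tbx2 k P P)"
  and H: "cel H" "tdom H = gT X oo P" "tcod H = P" "b**H = h**(gT X|>b)"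
 shows "!!x y t. [|cel x; cel y; cel t; tdom y = tdom x; tdom t = tdom x; tcod x = P; tcod y = P; tcod t = P|] ==>
   b**M**bpr k (M**bpr k x y) t = b**M**bpr k x (M**bpr k y t)"
  "b**M**bpr k (E**bng k P) (cid P) = b" "b**M**bpr k (cid P) (E**bng k P) = b"
  "b**M**bpr k (tbx2 k P P) (tbx1 k P P) = b**M"
  "b**H**(gT X|>E) = b**E**bng k (gT X oo topo X k W)"
  "b**H**(gT X|>M) = b**M**bpr k (H**(gT X|>tbx1 k P P)) (H**(gT X|>tbx2 k P P))"
  "b**H**(gz X<|P) = b**E**bng k P"
  "b**H**(gs X<|P) = b**M**bpr k (H**(gq1 X<|P)) (H**(gq2 X<|P))"
  "b**H**(gT X|>H)**(gl X<|P) = b**H"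
proof -
 note D [simp] = dobD(1-10)[OF d A] and ax = dobD(11-20)[OF d A] and [simp] = P A b E(1-3) M(1-3) H(1-3)
 have W [simp]: "W \<in> obj K" "X \<in> obj K" using mor_obj[OF P(1)] P by simp_all
 note c [simp] = cart_types[OF co] and t [simp] = top[OF co W(1)]
 note box [simp] = box[OF co P(1,2) P(1,2) refl] box[OF co D(1) A(1) D(1) A(1) refl]
 note cart [simp] = bpr(1-3)[OF co] bng[OF co]
 note calc [simp] = bx_bpr[OF co] bx_bpr_pre[OF co] bpr_comp[OF co] bng_comp[OF co]
 have bm: "mtrg (tdom x) = X" if "cel x" "tcod x = P" for x
  using cel_mor(4)[OF that(1)] that by simp
 have add: "b**M**bpr k x y = m**bpr k (b**x) (b**y)" if "cel x" "cel y" "tdom y = tdom x" "tcod x = P" "tcod y = P" for x y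
  using that bm[of x] by (simp add: vc_pre[OF M(4)])
 show "b**M**bpr k (M**bpr k x y) t = b**M**bpr k x (M**bpr k y t)"
  if h: "cel x" "cel y" "cel t" "tdom y = tdom x" "tdom t = tdom x" "tcod x = P" "tcod y = P" "tcod t = P" for x y t
  using h bm[of x] ax(1)[of "b**x" "b**y" "b**t"] by (simp add: add)
 have unit: "m**bpr k (e**bng k P) b = b" "m**bpr k b (e**bng k P) = b"
  using arg_cong[OF ax(2), of "%x. x**b"] arg_cong[OF ax(3), of "%x. x**b"] by simp_all
 show "b**M**bpr k (E**bng k P) (cid P) = b" "b**M**bpr k (cid P) (E**bng k P) = b"
  by (simp_all add: add vc_pre[OF E(4)] unit)
 show "b**M**bpr k (tbx2 k P P) (tbx1 k P P) = b**M"
  using arg_cong[OF ax(4), of "%x. x**bpr k (b**tbx1 k P P) (b**tbx2 k P P)"] by (simp add: add M(4))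
 have Tx: "b**H**x = h**(gT X|>b)**x" if "cel x" "tcod x = gT X oo P" for x
  using that by (simp add: vc_pre[OF H(4)])
 have ex: "(tcod s|>b)**(s<|P) = (s<|A)**(tdom s|>b)" if "cel s" "msrc (tdom s) = X" for s
  using whisker_exchange[of s b] that by simp
 have exs: "(gT X|>b)**(gq1 X<|P) = (gq1 X<|A)**(gT2 X|>b)" "(gT X|>b)**(gq2 X<|P) = (gq2 X<|A)**(gT2 X|>b)"
  "(gT X|>b)**(gs X<|P) = (gs X<|A)**(gT2 X|>b)" "(gT X|>b)**(gz X<|P) = (gz X<|A)**b"
  "(gT X|>gT X|>b)**(gl X<|P) = (gl X<|A)**(gT X|>b)"
  using ex[of "gq1 X"] ex[of "gq2 X"] ex[of "gs X"] ex[of "gz X"] ex[of "gl X"] by simp_all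
 show "b**H**(gT X|>E) = b**E**bng k (gT X oo topo X k W)"
  by (simp add: Tx vc_lw_eq[OF E(4)] vc_pre[OF E(4)] ax(5))
 have TM: "(gT X|>b)**(gT X|>M) = (gT X|>m)**(gT X|>bpr k (b**tbx1 k P P) (b**tbx2 k P P))"
  by (simp add: vc_lw_eq[OF M(4)])
 have TP: "(gT X|>tbx1 k A A)**(gT X|>bpr k (b**tbx1 k P P) (b**tbx2 k P P)) = (gT X|>b)**(gT X|>tbx1 k P P)"
  "(gT X|>tbx2 k A A)**(gT X|>bpr k (b**tbx1 k P P) (b**tbx2 k P P)) = (gT X|>b)**(gT X|>tbx2 k P P)"
  using vc_lw_eq[OF bx_bpr(1)[OF co _ _ _ _ refl refl], of "b**tbx1 k P P" "b**tbx2 k P P" "gT X"]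
   vc_lw_eq[OF bx_bpr(2)[OF co _ _ _ _ refl refl], of "b**tbx1 k P P" "b**tbx2 k P P" "gT X"] by simp_all
 show "b**H**(gT X|>M) = b**M**bpr k (H**(gT X|>tbx1 k P P)) (H**(gT X|>tbx2 k P P))"
  by (simp add: Tx TM vc_pre[OF ax(6)] TP add)
 show "b**H**(gz X<|P) = b**E**bng k P"
  by (simp add: Tx exs vc_pre[OF ax(7)] vc_pre[OF E(4)])
 show "b**H**(gs X<|P) = b**M**bpr k (H**(gq1 X<|P)) (H**(gq2 X<|P))"
  by (simp add: Tx exs vc_pre[OF ax(8)] add)
 have l: "h**gT X|>h**gl X<|A**gT X|>b = h**gT X|>b"
  using arg_cong[OF ax(9), of "%x. x**gT X|>b"] by simp
 show "b**H**(gT X|>H)**(gl X<|P) = b**H"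
  by (simp add: Tx vc_pre[OF vc_lw_eq[OF H(4), of "gT X", simplified]] exs l H(4))
qed

text \<open>Products commute with products: \<open>T (A \<times> B)\<close> is \<open>T A \<times> T B\<close>, which is \<open>(A \<times> A) \<times> (B \<times> B)\<close> and hence
 \<open>(A \<times> B) \<times> (A \<times> B)\<close>.\<close>

lemma tprod_box:
 assumes co: "cartesian_object K X k" and A: "mor A" "mtrg A = X" and B: "mor B" "mtrg B = X" "msrc B = msrc A"
  and a: "tprod (gp X<|A) a" "tcod a = A" and b: "tprod (gp X<|B) b" "tcod b = B"
 shows "tprod (gp X<|tbx k A B) (bpr k (a**(gT X|>tbx1 k A B)) (b**(gT X|>tbx2 k A B)))"
proof -
 note [simp] = A B a(2) b(2) cart_types[OF co]
 note D [simp] = tprodD[OF a(1)] tprodD[OF b(1)]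
 note bx [simp] = box[OF co A B]
 let ?P = "tbx k A B" and ?b1 = "tbx1 k A B" and ?b2 = "tbx2 k A B"
 let ?f = "a**(gT X|>?b1)" and ?g = "b**(gT X|>?b2)"
 have [simp]: "tdom a = gT X oo A" "tdom b = gT X oo B" by simp_all
 have fg: "cel ?f" "mtrg (tdom ?f) = X" "cel ?g" "tdom ?g = tdom ?f" by simp_all
 note h [simp] = bpr(1-3)[OF co fg]
 have hb: "?b1**bpr k ?f ?g = ?f" "?b2**bpr k ?f ?g = ?g" using bx_bpr[OF co fg] by simp_all
 have pb: "?b1**(gp X<|?P) = (gp X<|A)**(gT X|>?b1)" "?b2**(gp X<|?P) = (gp X<|B)**(gT X|>?b2)"
  using whisker_exchange[of "gp X" ?b1] whisker_exchange[of "gp X" ?b2] by simp_all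
 note Tp = T_bx_prod[OF co A B]
 show ?thesis
 proof (rule tprodI)
  fix x y assume "cel x" "cel y" "tdom y = tdom x" "tcod x = tcod (gp X<|?P)" "tcod y = tcod (bpr k ?f ?g)"
  then have xy [simp]: "cel x" "cel y" "tdom y = tdom x" "tcod x = ?P" "tcod y = ?P" by simp_all
  obtain u1 where u1 [simp]: "cel u1" "tdom u1 = tdom x" "tcod u1 = gT X oo A" and u1e: "(gp X<|A)**u1 = ?b1**x" "a**u1 = ?b1**y"
   by (rule tprod_ex[OF a(1), of "?b1**x" "?b1**y"]) simp_all
  obtain u2 where u2 [simp]: "cel u2" "tdom u2 = tdom x" "tcod u2 = gT X oo B" and u2e: "(gp X<|B)**u2 = ?b2**x" "b**u2 = ?b2**y"
   by (rule tprod_ex[OF b(1), of "?b2**x" "?b2**y"]) simp_all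
  obtain u where u [simp]: "cel u" "tdom u = tdom x" "tcod u = gT X oo ?P" and ue: "(gT X|>?b1)**u = u1" "(gT X|>?b2)**u = u2"
   by (rule tprod_ex[OF Tp, of u1 u2]) simp_all
  have "(gp X<|?P)**u = x" by (rule bpr_eqI[OF co A B]) (simp_all add: vc_pre[OF pb(1)] vc_pre[OF pb(2)] ue u1e u2e)
  moreover have "bpr k ?f ?g**u = y" by (rule bpr_eqI[OF co A B]) (simp_all add: vc_pre[OF hb(1)] vc_pre[OF hb(2)] ue u1e u2e)
  ultimately show "\<exists>u. cel u & tdom u = tdom x & tcod u = tdom (gp X<|?P) & (gp X<|?P)**u = x & bpr k ?f ?g**u = y"
   by (intro exI[of _ u]) simp
 next
  fix u v assume "cel u" "cel v" "tdom u = tdom v" "tcod u = tdom (gp X<|?P)" "tcod v = tdom (gp X<|?P)"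
   and e: "(gp X<|?P)**u = (gp X<|?P)**v" "bpr k ?f ?g**u = bpr k ?f ?g**v"
  then have uv [simp]: "cel u" "cel v" "tdom u = tdom v" "tcod u = gT X oo ?P" "tcod v = gT X oo ?P" by simp_all
  have i: "?b1**(gp X<|?P)**u = ?b1**(gp X<|?P)**v" "?b2**(gp X<|?P)**u = ?b2**(gp X<|?P)**v"
   "?b1**bpr k ?f ?g**u = ?b1**bpr k ?f ?g**v" "?b2**bpr k ?f ?g**u = ?b2**bpr k ?f ?g**v" unfolding e by simp_all
  have 1: "(gT X|>?b1)**u = (gT X|>?b1)**v"
   by (rule tprod_eqI[OF a(1)]) (use i in \<open>simp_all add: vc_pre[OF pb(1)] vc_pre[OF hb(1)]\<close>)
  have 2: "(gT X|>?b2)**u = (gT X|>?b2)**v"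
   by (rule tprod_eqI[OF b(1)]) (use i in \<open>simp_all add: vc_pre[OF pb(2)] vc_pre[OF hb(2)]\<close>)
  show "u = v" by (rule tprod_eqI[OF Tp]) (use 1 2 in simp_all)
 qed simp_all
qed

lemma dob_box:
 assumes co: "cartesian_object K X k" and dA: "dob k A eA mA hA" and A: "mtrg A = X" "msrc A = W"
  and dB: "dob k B eB mB hB" and B: "mtrg B = X" "msrc B = W" and P: "P = tbx k A B"
  and E: "E = bpr k eA eB"
  and M: "M = bpr k (mA**bpr k (tbx1 k A B**tbx1 k P P) (tbx1 k A B**tbx2 k P P)) (mB**bpr k (tbx2 k A B**tbx1 k P P) (tbx2 k A B**tbx2 k P P))"
  and H: "H = bpr k (hA**(gT X|>tbx1 k A B)) (hB**(gT X|>tbx2 k A B))"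
 shows "dob k P E M H"
proof -
 note DA [simp] = dobD(1-10)[OF dA A] and DB [simp] = dobD(1-10)[OF dB B] and [simp] = A B
 have AB: "msrc B = msrc A" by simp
 have W [simp]: "W \<in> obj K" using mor_obj(1)[OF DA(1)] A by simp
 note c [simp] = cart_types[OF co] and t [simp] = top[OF co W(1)]
 note bx = box[OF co DA(1) A(1) DB(1) B(1) AB]
 have Pm [simp]: "mor P" "mtrg P = X" "msrc P = W" unfolding P using bx by simp_all
 let ?b1 = "tbx1 k A B" and ?b2 = "tbx2 k A B"
 have b [simp]: "cel ?b1" "tdom ?b1 = P" "tcod ?b1 = A" "cel ?b2" "tdom ?b2 = P" "tcod ?b2 = B" unfolding P using bx by simp_all
 note box [simp] = box[OF co Pm(1,2) Pm(1,2) refl] box[OF co DA(1) A(1) DA(1) A(1) refl] box[OF co DB(1) B(1) DB(1) B(1) refl]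
 note cart [simp] = bpr(1-3)[OF co] bng[OF co]
 note calc = bx_bpr[OF co] bx_bpr_pre[OF co] bpr_comp[OF co] bng_comp[OF co]
 have E' [simp]: "cel E" "tdom E = topo X k W" "tcod E = P" and bE: "?b1**E = eA" "?b2**E = eB"
  unfolding E by (simp_all add: P calc)
 have M' [simp]: "cel M" "tdom M = tbx k P P" "tcod M = P"
  and bM: "?b1**M = mA**bpr k (?b1**tbx1 k P P) (?b1**tbx2 k P P)" "?b2**M = mB**bpr k (?b2**tbx1 k P P) (?b2**tbx2 k P P)"
  unfolding M using P[symmetric] by (simp_all add: calc)
 have H' [simp]: "cel H" "tdom H = gT X oo P" "tcod H = P"
  and bH: "?b1**H = hA**(gT X|>?b1)" "?b2**H = hB**(gT X|>?b2)"
  unfolding H using P[symmetric] by (simp_all add: calc)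
 note X1 = dob_homomorphism[OF co dA A Pm b(1-3) E' bE(1) M' bM(1) H' bH(1)]
 note X2 = dob_homomorphism[OF co dB B Pm b(4-6) E' bE(2) M' bM(2) H' bH(2)]
 have PP: "tcod u = P ==> tcod u = tbx k A B" for u using P by simp
 have eqI: "u = v" if "?b1**u = ?b1**v" "?b2**u = ?b2**v" "cel u" "tcod u = P" "cel v" "tcod v = P" "tdom u = tdom v" for u v
  by (rule bpr_eqI[OF co DA(1) A(1) DB(1) B(1) AB that(3) PP[OF that(4)] that(5) PP[OF that(6)] that(7) that(1,2)])
 have xm: "mtrg (tdom x) = X" if "cel x" "tcod x = P" for x
  using cel_mor(4)[OF that(1)] that by simp
 have pr: "tprod (gp X<|P) H"
  unfolding H P by (rule tprod_box[OF co]) (use dobD(20)[OF dA A] dobD(20)[OF dB B] in simp_all)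
 show ?thesis unfolding dob_def
 proof (intro conjI)
  show "\<forall>a b d. cel a & cel b & cel d & tdom b = tdom a & tdom d = tdom a & tcod a = P & tcod b = P & tcod d = P -->
   M**bpr k (M**bpr k a b) d = M**bpr k a (M**bpr k b d)"
  proof (intro allI impI; elim conjE)
   fix x y d assume h: "cel x" "cel y" "cel d" "tdom y = tdom x" "tdom d = tdom x" "tcod x = P" "tcod y = P" "tcod d = P"
   show "M**bpr k (M**bpr k x y) d = M**bpr k x (M**bpr k y d)"
    by (rule eqI[OF X1(1)[OF h] X2(1)[OF h]]) (use h xm[OF h(1,6)] in simp_all)
  qed
  show "M**bpr k (E**bng k P) (cid P) = cid P" by (rule eqI) (simp_all add: X1(2) X2(2))
  show "M**bpr k (cid P) (E**bng k P) = cid P" by (rule eqI) (simp_all add: X1(3) X2(3))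
  show "M**bpr k (tbx2 k P P) (tbx1 k P P) = M" by (rule eqI[OF X1(4) X2(4)]) simp_all
  show "H**(gT (mtrg P)|>E) = E**bng k (gT (mtrg P) oo topo (mtrg P) k (msrc P))"
   unfolding Pm by (rule eqI[OF X1(5) X2(5)]) simp_all
  show "H**(gT (mtrg P)|>M) = M**bpr k (H**(gT (mtrg P)|>tbx1 k P P)) (H**(gT (mtrg P)|>tbx2 k P P))"
   unfolding Pm by (rule eqI[OF X1(6) X2(6)]) simp_all
  show "H**(gz (mtrg P)<|P) = E**bng k P" unfolding Pm by (rule eqI[OF X1(7) X2(7)]) simp_all
  show "H**(gs (mtrg P)<|P) = M**bpr k (H**(gq1 (mtrg P)<|P)) (H**(gq2 (mtrg P)<|P))"
   unfolding Pm by (rule eqI[OF X1(8) X2(8)]) simp_all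
  show "H**(gT (mtrg P)|>H)**(gl (mtrg P)<|P) = H" unfolding Pm by (rule eqI[OF X1(9) X2(9)]) simp_all
 qed (use pr in simp_all)
qed

text \<open>All equations hold between cells into a terminal object, and \<open>T\<close> of the terminal object is terminal.\<close>

lemma dob_top:
 assumes co: "cartesian_object K X k" and W: "W \<in> obj K" and A: "A = topo X k W"
 shows "dob k A (cid A) (bng k (tbx k A A)) (bng k (gT X oo A))"
proof -
 note c [simp] = cart_types[OF co] and t = top[OF co W]
 have Am [simp]: "mor A" "mtrg A = X" "msrc A = W" unfolding A using t by simp_all
 note At = A[symmetric, simp]
 note box [simp] = box[OF co Am(1,2) Am(1,2) refl]
 note cart [simp] = bpr(1-3)[OF co] bng[OF co]
 have un: "u = v" if "cel u" "tcod u = A" "cel v" "tcod v = A" "tdom u = tdom v" for u v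
  by (rule bng_eq[OF co that(1) _ that(3) _ that(5) W]) (use that in simp_all)
 let ?h = "bng k (gT X oo A)"
 have h [simp]: "cel ?h" "tdom ?h = gT X oo A" "tcod ?h = A" by simp_all
 have hi: "tiso ?h" using T_top_iso[OF co W] by simp
 obtain v where v: "tinv ?h v" using hi unfolding tiso_def by blast
 have v' [simp]: "cel v" "tdom v = A" "tcod v = gT X oo A" using tinvD(1)[OF v] by simp_all
 have pr: "tprod (gp X<|A) ?h"
 proof (rule tprodI)
  fix x y assume s: "cel x" "cel y" "tdom y = tdom x" "tcod x = tcod (gp X<|A)" "tcod y = tcod ?h"
  show "\<exists>u. cel u & tdom u = tdom x & tcod u = tdom (gp X<|A) & (gp X<|A)**u = x & ?h**u = y"
  proof (intro exI conjI)
   show "(gp X<|A)**v**x = x" by (rule un) (use s in simp_all)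
   show "?h**v**x = y" by (rule un) (use s in simp_all)
  qed (use s in simp_all)
 next
  fix u w assume s: "cel u" "cel w" "tdom u = tdom w" "tcod u = tdom (gp X<|A)" "tcod w = tdom (gp X<|A)"
  have "?h**u = ?h**w" by (rule un) (use s in simp_all)
  then show "u = w" by (rule tiso_mono[OF hi]) (use s in simp_all)
 qed simp_all
 have xm: "mtrg (tdom x) = X" if "cel x" "tcod x = A" for x
  using cel_mor(4)[OF that(1)] that by simp
 show ?thesis unfolding dob_def
 proof (intro conjI)
  show "\<forall>a b d. cel a & cel b & cel d & tdom b = tdom a & tdom d = tdom a & tcod a = A & tcod b = A & tcod d = A -->
   bng k (tbx k A A)**bpr k (bng k (tbx k A A)**bpr k a b) d = bng k (tbx k A A)**bpr k a (bng k (tbx k A A)**bpr k b d)"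
   by (intro allI impI; elim conjE; rule un) (simp_all add: xm)
  show "tprod (gp (mtrg A)<|A) (bng k (gT X oo A))" using pr by simp
 qed ((rule un)?, simp_all)+
qed

section \<open>The universal differential object\<close>

definition pdob where
 "pdob k V \<longleftrightarrow> dob k (d_ob V) (d_zero V) (d_add V) (d_proj V) &
  (\<forall>w. mor w & mtrg w = msrc (d_ob V) --> tprod (gp (mtrg (d_ob V))<|d_ob V<|w) (d_proj V<|w))"

definition twh where
 "twh V a = \<lparr>d_ob = d_ob V oo a, d_zero = d_zero V<|a, d_add = d_add V<|a, d_proj = d_proj V<|a\<rparr>"

lemma twh_sel [simp]: "d_ob (twh V a) = d_ob V oo a" "d_zero (twh V a) = d_zero V<|a"
 "d_add (twh V a) = d_add V<|a" "d_proj (twh V a) = d_proj V<|a"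
 by (simp_all add: twh_def)

text \<open>The universal property of \<open>U : DO(X) \<rightarrow> X\<close> with its differential structure \<open>V\<close>.\<close>

definition udob where
 "udob k kY V \<longleftrightarrow> cartesian_object K (mtrg (d_ob V)) k & cartesian_object K (msrc (d_ob V)) kY & tiso (ga (d_ob V)) & pdob k V &
  (\<forall>a. mor a & mtrg a = msrc (d_ob V) --> pdob k (twh V a)) &
  (\<forall>D. pdob k D & mtrg (d_ob D) = mtrg (d_ob V) -->
    (\<exists>!a. mor a & msrc a = msrc (d_ob D) & mtrg a = msrc (d_ob V) & twh V a = D)) &
  (\<forall>a b f. mor a & mor b & mtrg a = msrc (d_ob V) & mtrg b = msrc (d_ob V) & msrc b = msrc a &
    cel f & tdom f = d_ob V oo a & tcod f = d_ob V oo b & f**(d_proj V<|a) = (d_proj V<|b)**(gT (mtrg (d_ob V))|>f) -->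
    (\<exists>!t. cel t & tdom t = a & tcod t = b & d_ob V|>t = f))"

lemma udobD:
 assumes "udob k kY V" "d_ob V = U" "mtrg U = X" "msrc U = Y" "d_proj V = h"
 shows "cartesian_object K X k" "cartesian_object K Y kY" "tiso (ga U)" "pdob k V"
  "mor U" "cel h" "tdom h = gT X oo U" "tcod h = U" "X \<in> obj K" "Y \<in> obj K"
  "!!a. [|mor a; mtrg a = Y|] ==> pdob k (twh V a)"
  "!!D. [|pdob k D; mtrg (d_ob D) = X|] ==> \<exists>!a. mor a & msrc a = msrc (d_ob D) & mtrg a = Y & twh V a = D"
proof -
 show c: "cartesian_object K X k" "cartesian_object K Y kY" and "tiso (ga U)" and p: "pdob k V" and
  "!!a. [|mor a; mtrg a = Y|] ==> pdob k (twh V a)"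
  "!!D. [|pdob k D; mtrg (d_ob D) = X|] ==> \<exists>!a. mor a & msrc a = msrc (d_ob D) & mtrg a = Y & twh V a = D"
  using assms(1)[unfolded udob_def assms(2-5)] by blast+
 have d: "dob k U (d_zero V) (d_add V) h" using p assms unfolding pdob_def by simp
 show "mor U" "cel h" "tdom h = gT X oo U" "tcod h = U" using dobD[OF d assms(3,4)] by simp_all
 show "X \<in> obj K" "Y \<in> obj K" using c unfolding cartesian_object_def by simp_all
qed

lemma udob_lift:
 assumes u: "udob k kY V" "d_ob V = U" "mtrg U = X" "msrc U = Y" "d_proj V = h"
  and a: "mor a" "mtrg a = Y" and b: "mor b" "mtrg b = Y" "msrc b = msrc a"
  and f: "cel f" "tdom f = U oo a" "tcod f = U oo b" "f**(h<|a) = (h<|b)**(gT X|>f)"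
 shows "\<exists>!t. cel t & tdom t = a & tcod t = b & U|>t = f"
 using assms(1)[unfolded udob_def assms(2-5)] a b f by blast

text \<open>Cells of the form \<open>U \<rhd> t\<close> are linear, by interchange with \<open>d_proj V\<close>. Hence \<open>U\<close> is locally faithful.\<close>

lemma udob_linear:
 assumes u: "udob k kY V" "d_ob V = U" "mtrg U = X" "msrc U = Y" "d_proj V = h" and t: "cel t" "mtrg (tdom t) = Y"
 shows "(U|>t)**(h<|tdom t) = (h<|tcod t)**(gT X|>U|>t)"
 using whisker_exchange[of h t] udobD(5-10)[OF u] u t by simp

lemma udob_faithful:
 assumes u: "udob k kY V" "d_ob V = U" "mtrg U = X" "msrc U = Y" "d_proj V = h"
  and t: "cel t" "mtrg (tdom t) = Y" and t': "cel t'" "tdom t' = tdom t" "tcod t' = tcod t" and e: "U|>t = U|>t'"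
 shows "t = t'"
proof -
 note m = cel_mor[OF t(1)]
 have "\<exists>!r. cel r & tdom r = tdom t & tcod r = tcod t & U|>r = U|>t"
  by (rule udob_lift[OF u]) (use udob_linear[OF u t] udobD(5-10)[OF u] u m t in simp_all)
 then show ?thesis using t' t(1) e by metis
qed

text \<open>The inverse of a linear cell is linear, so \<open>U\<close> reflects isomorphisms.\<close>

lemma udob_conservative:
 assumes u: "udob k kY V" "d_ob V = U" "mtrg U = X" "msrc U = Y" "d_proj V = h"
  and t: "cel t" "mtrg (tdom t) = Y" and i: "tiso (U|>t)"
 shows "tiso t"
proof -
 note [simp] = udobD(5-10)[OF u] u(2-5) t cel_mor[OF t(1)]
 obtain g where g: "tinv (U|>t) g" using i unfolding tiso_def by blast
 have g' [simp]: "cel g" "tdom g = U oo tcod t" "tcod g = U oo tdom t" using tinvD(1)[OF g] by simp_all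
 have gg: "(U|>t)**g = cid (U oo tcod t)" "g**(U|>t) = cid (U oo tdom t)" using tinvD(2,3)[OF g] by simp_all
 have lin: "g**(h<|tcod t) = (h<|tdom t)**(gT X|>g)"
 proof (rule tiso_mono[OF i])
  have "(U|>t)**(h<|tdom t)**(gT X|>g) = (h<|tcod t)**(gT X|>U|>t)**(gT X|>g)"
   by (simp add: vc_pre[OF udob_linear[OF u t]])
  then show "(U|>t)**g**(h<|tcod t) = (U|>t)**(h<|tdom t)**(gT X|>g)"
   by (simp add: vc_lw_eq[OF gg(1)] vc_pre[OF gg(1)])
 qed simp_all
 obtain s where s: "cel s" "tdom s = tcod t" "tcod s = tdom t" "U|>s = g"
  using udob_lift[OF u, of "tcod t" "tdom t" g] lin by auto
 have "t**s = cid (tcod t)" by (rule udob_faithful[OF u]) (use s gg in simp_all)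
 moreover have "s**t = cid (tdom t)" by (rule udob_faithful[OF u]) (use s gg in simp_all)
 ultimately show ?thesis unfolding tiso_def tinv_def using s t by (intro exI[of _ s]) simp
qed

lemma pdob_dob: "pdob k (twh V a) ==> d_ob V = U ==> d_proj V = h ==> dob k (U oo a) (d_zero V<|a) (d_add V<|a) (h<|a)"
 unfolding pdob_def by simp

text \<open>The product of two differential objects, with linear projections, lifts along \<open>U\<close> to a product, and so does the
 terminal object. As \<open>U\<close> reflects isomorphisms, the given products of its source are the lifted ones.\<close>

lemma udob_lift_box:
 assumes u: "udob k kY V" "d_ob V = U" "mtrg U = X" "msrc U = Y" "d_proj V = h"
  and a: "mor a" "mtrg a = Y" and b: "mor b" "mtrg b = Y" "msrc b = msrc a"
 obtains x y where "tprod x y" "tcod x = a" "tcod y = b" "U|>x = tbx1 k (U oo a) (U oo b)" "U|>y = tbx2 k (U oo a) (U oo b)"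
proof -
 note [simp] = udobD(5-10)[OF u] u(2-5) a b and co = udobD(1)[OF u]
 let ?A = "U oo a" and ?B = "U oo b"
 have A: "mor ?A" "mtrg ?A = X" "msrc ?A = msrc a" and B: "mor ?B" "mtrg ?B = X" "msrc ?B = msrc a" by simp_all
 have AB: "msrc ?B = msrc ?A" by simp
 note pa = udobD(11)[OF u a(1,2)] and pb = udobD(11)[OF u b(1,2)]
 note dA = pdob_dob[OF pa u(2,5)] and dB = pdob_dob[OF pb u(2,5)]
 note [simp] = dobD(2-10)[OF dA A(2,3)] dobD(2-10)[OF dB B(2,3)]
 note bx [simp] = box[OF co A(1,2) B(1,2) AB]
 define P where "P = tbx k ?A ?B"
 define H where "H = bpr k ((h<|a)**(gT X|>tbx1 k ?A ?B)) ((h<|b)**(gT X|>tbx2 k ?A ?B))"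
 obtain E M where D: "dob k P E M H" using dob_box[OF co dA A(2,3) dB B(2,3) P_def refl refl H_def] by blast
 have P [simp]: "mor P" "mtrg P = X" "msrc P = msrc a" by (simp_all add: P_def)
 have fg: "cel ((h<|a)**(gT X|>tbx1 k ?A ?B))" "mtrg (tdom ((h<|a)**(gT X|>tbx1 k ?A ?B))) = X"
  "cel ((h<|b)**(gT X|>tbx2 k ?A ?B))" "tdom ((h<|b)**(gT X|>tbx2 k ?A ?B)) = tdom ((h<|a)**(gT X|>tbx1 k ?A ?B))"
  by simp_all
 have pd: "pdob k \<lparr>d_ob = P, d_zero = E, d_add = M, d_proj = H\<rparr>"
  unfolding pdob_def
 proof (intro conjI allI impI; (elim conjE)?)
  fix w assume "mor w" "mtrg w = msrc (d_ob \<lparr>d_ob = P, d_zero = E, d_add = M, d_proj = H\<rparr>)"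
  then have w [simp]: "mor w" "mtrg w = msrc a" by simp_all
  have bw: "tbx k ?A ?B oo w = tbx k (U oo a oo w) (U oo b oo w)" "tbx1 k ?A ?B<|w = tbx1 k (U oo a oo w) (U oo b oo w)" "tbx2 k ?A ?B<|w = tbx2 k (U oo a oo w) (U oo b oo w)"
   using box_whisker[OF co A(1,2) B(1,2) AB, of w] by simp_all
  have Hw: "H<|w = bpr k ((h<|a<|w)**(gT X|>tbx1 k (U oo a oo w) (U oo b oo w))) ((h<|b<|w)**(gT X|>tbx2 k (U oo a oo w) (U oo b oo w)))"
   unfolding H_def by (subst bpr_whisker[OF co fg]) (simp_all add: bw)
  have wa: "mor (a oo w)" "mtrg (a oo w) = Y" "mor (b oo w)" "mtrg (b oo w) = Y" by simp_all
  have ta: "tprod (gp X<|(U oo a oo w)) (h<|a<|w)" "tprod (gp X<|(U oo b oo w)) (h<|b<|w)"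
   using pa[unfolded pdob_def, THEN conjunct2, THEN spec, of w] pb[unfolded pdob_def, THEN conjunct2, THEN spec, of w] by simp_all
  have "tprod (gp X<|tbx k (U oo a oo w) (U oo b oo w)) (H<|w)"
   unfolding Hw by (rule tprod_box[OF co]) (use ta in simp_all)
  moreover have "gp X<|tbx k (U oo a oo w) (U oo b oo w) = gp X<|P<|w" unfolding bw(1)[symmetric] P_def by simp
  ultimately show "tprod (gp (mtrg (d_ob \<lparr>d_ob = P, d_zero = E, d_add = M, d_proj = H\<rparr>))<|d_ob \<lparr>d_ob = P, d_zero = E, d_add = M, d_proj = H\<rparr><|w)
    (d_proj \<lparr>d_ob = P, d_zero = E, d_add = M, d_proj = H\<rparr><|w)" by simp
 qed (use D in simp)
 obtain c where c [simp]: "mor c" "msrc c = msrc a" "mtrg c = Y" and cw: "twh V c = \<lparr>d_ob = P, d_zero = E, d_add = M, d_proj = H\<rparr>"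
  using udobD(12)[OF u pd] by auto
 have cP: "U oo c = P" "h<|c = H" using arg_cong[OF cw, of d_ob] arg_cong[OF cw, of d_proj] by simp_all
 have hb: "tbx1 k ?A ?B**H = (h<|a)**(gT X|>tbx1 k ?A ?B)" "tbx2 k ?A ?B**H = (h<|b)**(gT X|>tbx2 k ?A ?B)"
  unfolding H_def using bx_bpr[OF co fg] by simp_all
 obtain x where x [simp]: "cel x" "tdom x = c" "tcod x = a" and xe: "U|>x = tbx1 k ?A ?B"
  using udob_lift[OF u c(1,3) a(1,2), of "tbx1 k ?A ?B"] hb(1) by (auto simp: cP P_def)
 obtain y where y [simp]: "cel y" "tdom y = c" "tcod y = b" and ye: "U|>y = tbx2 k ?A ?B"
  using udob_lift[OF u c(1,3) b(1,2), of "tbx2 k ?A ?B"] hb(2) by (auto simp: cP P_def)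
 have "tprod x y"
 proof (rule tprodI)
  fix r s assume "cel r" "cel s" "tdom s = tdom r" "tcod r = tcod x" "tcod s = tcod y"
  then have rs [simp]: "cel r" "cel s" "tdom s = tdom r" "tcod r = a" "tcod s = b" by simp_all
  have dr [simp]: "mor (tdom r)" "mtrg (tdom r) = Y" "msrc (tdom r) = msrc a" using cel_mor[OF rs(1)] by simp_all
  let ?f = "U|>r" and ?g = "U|>s"
  have rg: "cel ?f" "mtrg (tdom ?f) = X" "cel ?g" "tdom ?g = tdom ?f" by simp_all
  note bp [simp] = bpr(1-3)[OF co rg] and be = bx_bpr[OF co rg]
  have be' : "tbx1 k ?A ?B**bpr k ?f ?g = ?f" "tbx2 k ?A ?B**bpr k ?f ?g = ?g" by (rule be; simp)+
  have lr: "(h<|a)**(gT X|>U|>r) = (U|>r)**(h<|tdom r)" "(h<|b)**(gT X|>U|>s) = (U|>s)**(h<|tdom r)"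
   using udob_linear[OF u, of r] udob_linear[OF u, of s] by simp_all
  have tc: "tcod (bpr k ?f ?g) = P" by (simp add: P_def)
  have lin: "bpr k ?f ?g**(h<|tdom r) = H**(gT X|>bpr k ?f ?g)"
   by (rule bpr_eqI[OF co A(1,2) B(1,2) AB])
    (simp_all add: tc P_def[symmetric] vc_pre[OF hb(1)] vc_pre[OF hb(2)] vc_pre[OF be'(1)] vc_pre[OF be'(2)] vc_lw_eq[OF be'(1)] vc_lw_eq[OF be'(2)] lr dobD(8-10)[OF D P(2,3)] del: bp(3))
  obtain t where t: "cel t" "tdom t = tdom r" "tcod t = c" "U|>t = bpr k ?f ?g"
   using udob_lift[OF u dr(1,2) c(1,3), of "bpr k ?f ?g"] lin tc by (auto simp: cP)
  have "x**t = r" by (rule udob_faithful[OF u]) (use t in \<open>simp_all add: xe be'\<close>)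
  moreover have "y**t = s" by (rule udob_faithful[OF u]) (use t in \<open>simp_all add: ye be'\<close>)
  ultimately show "\<exists>u. cel u & tdom u = tdom r & tcod u = tdom x & x**u = r & y**u = s" using t by (intro exI[of _ t]) simp
 next
  fix s t assume st: "cel s" "cel t" "tdom s = tdom t" "tcod s = tdom x" "tcod t = tdom x" "x**s = x**t" "y**s = y**t"
  have sm: "mtrg (tdom t) = Y" using cel_mor(4)[OF st(2)] st by simp
  have e: "U|>s = U|>t"
   by (rule bpr_eqI[OF co A(1,2) B(1,2) AB])
    (use st(1-5) sm arg_cong[OF st(6), of "%x. U|>x"] arg_cong[OF st(7), of "%x. U|>x"] in \<open>simp_all add: xe ye cP P_def\<close>)
  show "s = t" by (rule udob_faithful[OF u _ _ _ _ _ e]) (use st sm in simp_all)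
 qed simp_all
 then show thesis by (rule that) (use xe ye in \<open>simp_all add:\<close>)
qed

lemma udob_fpres:
 assumes u: "udob k kY V" "d_ob V = U" "mtrg U = X" "msrc U = Y" "d_proj V = h"
 shows "fpres U kY k"
 unfolding fpres_def u(4)
proof (intro conjI allI impI ballI; (elim conjE)?)
 note [simp] = udobD(5-10)[OF u] u(2-5) and co = udobD(1)[OF u] and coY = udobD(2)[OF u]
 fix a b assume a: "mor a" "mtrg a = Y" and b: "mor b" "mtrg b = Y" "msrc b = msrc a"
 note [simp] = a b
 note bx [simp] = box[OF coY a b]
 have U: "mor (U oo a)" "mtrg (U oo a) = X" "mor (U oo b)" "mtrg (U oo b) = X" "msrc (U oo b) = msrc (U oo a)" by simp_all
 obtain x y where xy: "tprod x y" "tcod x = a" "tcod y = b" and xe: "U|>x = tbx1 k (U oo a) (U oo b)" "U|>y = tbx2 k (U oo a) (U oo b)"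
  using udob_lift_box[OF u a b] by metis
 note D [simp] = tprodD[OF xy(1)] xy(2,3)
 obtain t where t [simp]: "cel t" "tdom t = tbx kY a b" "tcod t = tdom x" and te: "x**t = tbx1 kY a b" "y**t = tbx2 kY a b"
  by (rule tprod_ex[OF xy(1), of "tbx1 kY a b" "tbx2 kY a b"]) simp_all
 have dx [simp]: "mtrg (tdom x) = Y" using cel_mor(4)[OF D(1)] by simp
 have "tiso t" by (rule tprod_comparison[OF tprod_bx[OF coY a b] xy(1)]) (simp_all add: te)
 then have ti: "tiso (U|>t)" by (rule tiso_lw) simp_all
 have xy': "tprod (U|>x) (U|>y)" unfolding xe by (rule tprod_bx[OF co U])
 have "tprod ((U|>x)**(U|>t)) ((U|>y)**(U|>t))"
  by (rule tprod_iso[OF _ ti]) (simp_all add: xy')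
 then show "tprod (U|>tbx1 kY a b) (U|>tbx2 kY a b)" by (simp add: vc_lw_eq[OF te(1)] vc_lw_eq[OF te(2)])
next
 note [simp] = udobD(5-10)[OF u] u(2-5) and co = udobD(1)[OF u] and coY = udobD(2)[OF u]
 fix W assume W [simp]: "W \<in> obj K"
 note t [simp] = top[OF co W] top[OF coY W]
 let ?tX = "topo X k W" and ?tY = "topo Y kY W"
 let ?D = "\<lparr>d_ob = ?tX, d_zero = cid ?tX, d_add = bng k (tbx k ?tX ?tX), d_proj = bng k (gT X oo ?tX)\<rparr>"
 have dt: "dob k (topo X k W') (cid (topo X k W')) (bng k (tbx k (topo X k W') (topo X k W'))) (bng k (gT X oo topo X k W'))" if "W' \<in> obj K" for W'
  using dob_top[OF co that refl] .
 have pd: "pdob k ?D"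
  unfolding pdob_def
 proof (intro conjI allI impI; (elim conjE)?)
  fix w assume "mor w" "mtrg w = msrc (d_ob ?D)"
  then have w [simp]: "mor w" "mtrg w = W" "msrc w \<in> obj K" by (simp_all add: mor_obj(1))
  have e: "?tX oo w = topo X k (msrc w)" "bng k (gT X oo ?tX)<|w = bng k (gT X oo topo X k (msrc w))"
   using topo_whisker[OF co w(1,2)] by (simp_all add: bng_whisker[OF co])
  have "gp X<|?tX<|w = gp X<|topo X k (msrc w)" using e(1) rw_mcomp[of ?tX w "gp X"] by simp
  then show "tprod (gp (mtrg (d_ob ?D))<|d_ob ?D<|w) (d_proj ?D<|w)"
   using dobD(20)[OF dt[OF w(3)]] top[OF co w(3)] e by simp
 qed (use dt[OF W] in simp)
 obtain c where c [simp]: "mor c" "msrc c = W" "mtrg c = Y" and cw: "twh V c = ?D" using udobD(12)[OF u pd] by auto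
 have cP: "U oo c = ?tX" "h<|c = bng k (gT X oo ?tX)" using arg_cong[OF cw, of d_ob] arg_cong[OF cw, of d_proj] by simp_all
 have un: "u = v" if "cel u" "tcod u = ?tX" "cel v" "tcod v = ?tX" "tdom u = tdom v" for u v
  by (rule bng_eq[OF co that(1,2,3,4,5) W])
 have Ut: "mor (U oo ?tY)" "mtrg (U oo ?tY) = X" "mor (gT X oo ?tX)" "mtrg (gT X oo ?tX) = X" by simp_all
 note b [simp] = bng[OF co Ut(1,2)] bng[OF co Ut(3,4)] bng[OF coY c(1,3)]
 have lin: "bng k (U oo ?tY)**(h<|?tY) = (h<|c)**(gT X|>bng k (U oo ?tY))"
  by (rule un) (simp_all add: cP)
 obtain v where v [simp]: "cel v" "tdom v = ?tY" "tcod v = c" and ve: "U|>v = bng k (U oo ?tY)"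
  using udob_lift[OF u, of ?tY c "bng k (U oo ?tY)"] lin by (auto simp: cP)
 have "bng kY c**v = cid ?tY" by (rule bng_eq[OF coY _ _ _ _ _ W]) simp_all
 moreover have "v**bng kY c = cid c"
 proof (rule udob_faithful[OF u])
  show "U|>(v**bng kY c) = U|>cid c" by (rule un) (simp_all add: cP)
 qed simp_all
 ultimately have "tiso v" unfolding tiso_def tinv_def by (intro exI[of _ "bng kY c"]) simp
 then have "tiso (U|>v)" by (rule tiso_lw) simp_all
 then show "tiso (bng k (U oo ?tY))" unfolding ve .
qed

text \<open>The comparison from the candidate to the given product becomes invertible under \<open>U\<close>, and \<open>U\<close> reflects this.\<close>

lemma udob_reflect_tprod:
 assumes u: "udob k kY V" "d_ob V = U" "mtrg U = X" "msrc U = Y" "d_proj V = h"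
  and ab: "cel a" "cel b" "tdom b = tdom a" "mtrg (tdom a) = Y" and p: "tprod (U|>a) (U|>b)"
 shows "tprod a b"
proof -
 note [simp] = udobD(5-10)[OF u] u(2-5) ab and co = udobD(1)[OF u] and coY = udobD(2)[OF u]
 have m [simp]: "mor (tcod a)" "mtrg (tcod a) = Y" "mor (tcod b)" "mtrg (tcod b) = Y" "msrc (tcod b) = msrc (tcod a)"
  using cel_mor[OF ab(1)] cel_mor[OF ab(2)] by simp_all
 note bx [simp] = box[OF coY m] and bp [simp] = bpr(1-3)[OF coY ab(1,4,2,3)] and be = bpr(4,5)[OF coY ab(1,4,2,3)]
 let ?t = "bpr kY a b"
 have "tprod (U|>tbx1 kY (tcod a) (tcod b)) (U|>tbx2 kY (tcod a) (tcod b))"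
  using udob_fpres[OF u] unfolding fpres_def by simp
 from tprod_comparison[OF p this, of "U|>?t"] have "tiso (U|>?t)" by (simp add: vc_lw_eq[OF be(1)] vc_lw_eq[OF be(2)])
 then have "tiso ?t" by (rule udob_conservative[OF u, rotated 2]) simp_all
 then have "tprod (tbx1 kY (tcod a) (tcod b)**?t) (tbx2 kY (tcod a) (tcod b)**?t)" by (rule tprod_iso[OF tprod_bx[OF coY m]]) simp
 then show ?thesis by (simp add: be)
qed

section \<open>Functoriality of the universal differential object\<close>

definition dpushV where
 "dpushV f k k' V V' \<longleftrightarrow> d_ob V' = f oo d_ob V &
   dpush f k k' (d_ob V) (d_zero V) (d_add V) (d_proj V) (d_zero V') (d_add V') (d_proj V')"

lemma dpush_whisker:
 assumes co: "cartesian_object K X k" and co': "cartesian_object K X' k'" and f: "mor f" "msrc f = X" "mtrg f = X'"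
  and d: "dob k A e m h" and A: "mtrg A = X" "msrc A = W" and ps: "dpush f k k' A e m h e' m' h'" and w: "mor w" "mtrg w = W"
 shows "dpush f k k' (A oo w) (e<|w) (m<|w) (h<|w) (e'<|w) (m'<|w) (h'<|w)"
proof -
 note D [simp] = dobD(1-10)[OF d A] and [simp] = f A w
 have W [simp]: "W \<in> obj K" "X \<in> obj K" "X' \<in> obj K" "msrc w \<in> obj K" using mor_obj[OF D(1)] mor_obj[OF f(1)] mor_obj[OF w(1)] by simp_all
 note P [simp] = dpushD(1-3,5-7,9-11)[OF ps f(3,2) A(2)] and pe = dpushD(4,8,12)[OF ps f(3,2) A(2)]
 note c [simp] = cart_types[OF co] cart_types[OF co']
 note t [simp] = top[OF co W(1)] top[OF co' W(1)] top[OF co W(4)] top[OF co' W(4)]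
 have fA: "mor (f oo A)" "mtrg (f oo A) = X'" by simp_all
 note b [simp] = box[OF co D(1) A(1) D(1) A(1) refl] box[OF co' fA fA refl]
 note tw [simp] = topo_whisker[OF co w] topo_whisker[OF co' w]
 have bw [simp]: "tbx k A A oo w = tbx k (A oo w) (A oo w)" "tbx1 k A A<|w = tbx1 k (A oo w) (A oo w)" "tbx2 k A A<|w = tbx2 k (A oo w) (A oo w)"
  "tbx k' (f oo A) (f oo A) oo w = tbx k' (f oo A oo w) (f oo A oo w)"
  using box_whisker[OF co D(1) A(1) D(1) A(1) refl, of w] box_whisker[OF co' fA fA refl, of w] by simp_all
 have p1: "cel (f|>tbx1 k A A)" "mtrg (tdom (f|>tbx1 k A A)) = X'" "cel (f|>tbx2 k A A)" "tdom (f|>tbx2 k A A) = tdom (f|>tbx1 k A A)" by simp_all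
 have z1: "mor (f oo topo X k W)" "mtrg (f oo topo X k W) = X'" by simp_all
 note bp [simp] = bpr(1-3)[OF co' p1] bng[OF co' z1]
 have [simp]: "bpr k' (f|>tbx1 k A A) (f|>tbx2 k A A)<|w = bpr k' (f|>tbx1 k (A oo w) (A oo w)) (f|>tbx2 k (A oo w) (A oo w))"
  using bpr_whisker[OF co' p1 w(1)] by simp
 have [simp]: "bng k' (f oo topo X k W)<|w = bng k' (f oo topo X k (msrc w))"
  using bng_whisker[OF co' z1 w(1)] by simp
 show ?thesis unfolding dpush_def
  using vc_rw_eq[OF pe(1), of w] vc_rw_eq[OF pe(2), of w] vc_rw_eq[OF pe(3), of w] by simp
qed

text \<open>The transported structure on \<open>f U\<close> is pointwise, because transport commutes with whiskering and every whiskering of the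
 universal differential object is a differential object. So it factors uniquely through the universal one.\<close>

lemma udob_mor:
 assumes u: "udob k kY V" "d_ob V = U" "mtrg U = X" "msrc U = Y" "d_proj V = h"
  and u': "udob k' kY' V'" "d_ob V' = U'" "mtrg U' = X'" "msrc U' = Y'" "d_proj V' = h'"
  and f: "mor f" "msrc f = X" "mtrg f = X'" and fp: "fpres f k k'" and iso: "tiso (ga f)"
 shows "\<exists>!H. mor H & msrc H = Y & mtrg H = Y' & dpushV f k k' V (twh V' H)"
proof -
 note [simp] = udobD(5-10)[OF u] u(2-5) udobD(5-10)[OF u'] u'(2-5) f
 note co = udobD(1)[OF u] and co' = udobD(1)[OF u']
 have d: "dob k U (d_zero V) (d_add V) h" using udobD(4)[OF u] unfolding pdob_def by simp
 obtain e' m' h1 where ps: "dpush f k k' U (d_zero V) (d_add V) h e' m' h1"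
  using dpush_ex[OF co co' f fp iso d u(3,4)] by blast
 let ?D = "\<lparr>d_ob = f oo U, d_zero = e', d_add = m', d_proj = h1\<rparr>"
 have pd: "pdob k' ?D"
  unfolding pdob_def
 proof (intro conjI allI impI; (elim conjE)?)
  show "dob k' (d_ob ?D) (d_zero ?D) (d_add ?D) (d_proj ?D)" using dob_push[OF co co' f fp iso d u(3,4) ps] by simp
  fix w assume "mor w" "mtrg w = msrc (d_ob ?D)"
  then have w [simp]: "mor w" "mtrg w = Y" by simp_all
  have Uw: "mtrg (U oo w) = X" "msrc (U oo w) = msrc w" "mtrg (f oo U oo w) = X'" "msrc (f oo U oo w) = msrc w" by simp_all
  have "dob k' (f oo U oo w) (e'<|w) (m'<|w) (h1<|w)"
   by (rule dob_push[OF co co' f fp iso pdob_dob[OF udobD(11)[OF u w] u(2,5)] Uw(1,2) dpush_whisker[OF co co' f d u(3,4) ps w]])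
  from dobD(20)[OF this Uw(3,4)] show "tprod (gp (mtrg (d_ob ?D))<|d_ob ?D<|w) (d_proj ?D<|w)" by simp
 qed
 have iff: "dpushV f k k' V (twh V' H) \<longleftrightarrow> twh V' H = ?D" for H
 proof
  assume "dpushV f k k' V (twh V' H)"
  then have 1: "U' oo H = f oo U" "dpush f k k' U (d_zero V) (d_add V) h (d_zero V'<|H) (d_add V'<|H) (h'<|H)"
   unfolding dpushV_def by simp_all
  note un = dpush_unique[OF co co' f fp iso udobD(5)[OF u] u(3) 1(2) ps]
  show "twh V' H = ?D" unfolding twh_def by (simp add: 1(1) un)
 next
  assume e: "twh V' H = ?D"
  show "dpushV f k k' V (twh V' H)" unfolding e dpushV_def using ps by simp
 qed
 show ?thesis unfolding iff using udobD(12)[OF u' pd] by simp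
qed

definition lifts where
 "lifts f k k' V V' H \<longleftrightarrow> mor H & msrc H = msrc (d_ob V) & mtrg H = msrc (d_ob V') & dpushV f k k' V (twh V' H)"

lemma liftsD:
 assumes "lifts f k k' V V' H" "d_ob V = U" "d_ob V' = U'" "msrc U = Y" "msrc U' = Y'" "mtrg U' = X'" "mtrg f = X'" "d_proj V = h" "d_proj V' = h'"
 shows "mor H" "msrc H = Y" "mtrg H = Y'" "U' oo H = f oo U" "(h'<|H)**(ga f<|U) = f|>h"
 using assms by (auto simp: lifts_def dpushV_def dpush_def)

text \<open>The tangent structure of the lift \<open>H\<close> lies over \<open>ga f \<lhd> U\<close>, up to the strictness of \<open>U\<close> and \<open>U'\<close>, and \<open>U'\<close>
 reflects invertibility.\<close>

lemma lift_strong: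
 assumes u: "udob k kY V" "d_ob V = U" "mtrg U = X" "msrc U = Y" "d_proj V = h"
  and u': "udob k' kY' V'" "d_ob V' = U'" "mtrg U' = X'" "msrc U' = Y'" "d_proj V' = h'"
  and f: "mor f" "msrc f = X" "mtrg f = X'" and iso: "tiso (ga f)" and H: "lifts f k k' V V' H"
 shows "tiso (ga H)"
proof -
 note [simp] = udobD(5-10)[OF u] u(2-5) udobD(5-10)[OF u'] u'(2-5) f
 note L [simp] = liftsD(1-4)[OF H u(2) u'(2) u(4) u'(4) u'(3) f(3) u(5) u'(5)]
 have g [simp]: "cel (ga H)" "tdom (ga H) = H oo gT Y" "tcod (ga H) = gT Y' oo H" by simp_all
 have e: "(ga U'<|H)**(U'|>ga H) = (ga f<|U)**(f|>ga U)"
  using ga_comp[of U' H] ga_comp[of f U] by simp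
 have "tiso ((ga f<|U)**(f|>ga U))"
  by (rule tiso_vc[OF tiso_rw[OF iso] tiso_lw[OF udobD(3)[OF u]]]) simp_all
 then have "tiso ((ga U'<|H)**(U'|>ga H))" unfolding e .
 then have "tiso (U'|>ga H)"
  by (rule tiso_cancel_left[OF _ tiso_rw[OF udobD(3)[OF u']]]) simp_all
 then show ?thesis by (rule udob_conservative[OF u', rotated 2]) simp_all
qed

text \<open>Both \<open>U\<close> and \<open>f\<close> preserve products, hence so does \<open>U' H = f U\<close>, and \<open>U'\<close> reflects products.\<close>

lemma lift_fpres:
 assumes u: "udob k kY V" "d_ob V = U" "mtrg U = X" "msrc U = Y" "d_proj V = h"
  and u': "udob k' kY' V'" "d_ob V' = U'" "mtrg U' = X'" "msrc U' = Y'" "d_proj V' = h'"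
  and f: "mor f" "msrc f = X" "mtrg f = X'" and fp: "fpres f k k'" and H: "lifts f k k' V V' H"
 shows "fpres H kY kY'"
proof -
 note [simp] = udobD(5-10)[OF u] u(2-5) udobD(5-10)[OF u'] u'(2-5) f
 note co = udobD(1,2)[OF u] and co' = udobD(1,2)[OF u']
 note L = liftsD(1-4)[OF H u(2) u'(2) u(4) u'(4) u'(3) f(3) u(5) u'(5)]
 note [simp] = L
 have wh: "U'|>H|>t = f|>U|>t" if "cel t" "mtrg (tdom t) = Y" for t
  using lw_mcomp[of U' H t] lw_mcomp[of f U t] that by simp
 have wc: "U' oo H oo a = f oo U oo a" if "mor a" "mtrg a = Y" for a
  using arg_cong[OF L(4), of "%x. x oo a"] that by (simp del: L(4))
 note fU = udob_fpres[OF u, unfolded fpres_def u(4)] and fU' = udob_fpres[OF u', unfolded fpres_def u'(4)] and ff = fp[unfolded fpres_def f(2)]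
 show ?thesis unfolding fpres_def L(2)
 proof (intro conjI allI impI ballI; (elim conjE)?)
  fix a b assume a: "mor a" "mtrg a = Y" and b: "mor b" "mtrg b = Y" "msrc b = msrc a"
  note [simp] = a b and bx [simp] = box[OF co(2) a b]
  have t: "tprod (U|>tbx1 kY a b) (U|>tbx2 kY a b)" using fU by simp
  have "tprod (f|>U|>tbx1 kY a b) (f|>U|>tbx2 kY a b)"
   by (rule fpres_tprod[OF fp f(1) _ t]) (use co in simp_all)
  then show "tprod (H|>tbx1 kY a b) (H|>tbx2 kY a b)"
   using wh by - (rule udob_reflect_tprod[OF u'], simp_all)
 next
  fix W assume W [simp]: "W \<in> obj K"
  note t [simp] = top[OF co(1) W] top[OF co(2) W] top[OF co'(1) W] top[OF co'(2) W]
  let ?t = "topo Y kY W"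
  have m: "mor (H oo ?t)" "mtrg (H oo ?t) = Y'" "mor (U oo ?t)" "mtrg (U oo ?t) = X" "mor (f oo topo X k W)" "mtrg (f oo topo X k W) = X'"
   "mor (U' oo topo Y' kY' W)" "mtrg (U' oo topo Y' kY' W) = X'" "mor (f oo U oo ?t)" "mtrg (f oo U oo ?t) = X'" by simp_all
  note b [simp] = bng[OF co'(2) m(1,2)] bng[OF co(1) m(3,4)] bng[OF co'(1) m(5,6)] bng[OF co'(1) m(7,8)] bng[OF co'(1) m(9,10)]
  have w [simp]: "U' oo H oo ?t = f oo U oo ?t" by (rule wc) simp_all
  have 1: "tiso (bng k' (f oo topo X k W)**(f|>bng k (U oo ?t)))"
  proof (rule tiso_vc)
   show "tiso (bng k' (f oo topo X k W))" using ff by simp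
   show "tiso (f|>bng k (U oo ?t))" by (rule tiso_lw) (use fU in simp_all)
  qed simp
  have "bng k' (f oo topo X k W)**(f|>bng k (U oo ?t)) = bng k' (U' oo topo Y' kY' W)**(U'|>bng kY' (H oo ?t))"
   by (rule bng_eq[OF co'(1) _ _ _ _ _ W]) simp_all
  with 1 have "tiso (bng k' (U' oo topo Y' kY' W)**(U'|>bng kY' (H oo ?t)))" by simp
  then have "tiso (U'|>bng kY' (H oo ?t))" by (rule tiso_cancel_left) (use fU' in simp_all)
  then show "tiso (bng kY' (H oo ?t))" by (rule udob_conservative[OF u', rotated 2]) simp_all
 qed
qed

text \<open>Whiskered with \<open>U\<close>, a 2-cell \<open>t : f \<Rightarrow> g\<close> is linear for the transported structures, by naturality of the distributive
 laws in \<open>t\<close>.\<close>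

lemma lift_cell:
 assumes u: "udob k kY V" "d_ob V = U" "mtrg U = X" "msrc U = Y" "d_proj V = h"
  and u': "udob k' kY' V'" "d_ob V' = U'" "mtrg U' = X'" "msrc U' = Y'" "d_proj V' = h'"
  and f: "mor f" "msrc f = X" "mtrg f = X'" and iso: "tiso (ga f)" and H: "lifts f k k' V V' H"
  and g: "mor g" "msrc g = X" "mtrg g = X'" and G: "lifts g k k' V V' G"
  and t: "cel t" "tdom t = f" "tcod t = g"
 shows "\<exists>!w. cel w & tdom w = H & tcod w = G & U'|>w = t<|U"
proof -
 note [simp] = udobD(5-10)[OF u] u(2-5) udobD(5-10)[OF u'] u'(2-5) f g t
 note L = liftsD[OF H u(2) u'(2) u(4) u'(4) u'(3) f(3) u(5) u'(5)] and M = liftsD[OF G u(2) u'(2) u(4) u'(4) u'(3) g(3) u(5) u'(5)]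
 note [simp] = L(1-4) M(1-4)
 have i: "tiso (ga f<|U)" by (rule tiso_rw[OF iso]) simp_all
 have n: "gT X'|>t<|U**ga f<|U = ga g<|U**t<|gT X<|U"
  using arg_cong[OF ga_nat[of t X' X], of "%x. x<|U"] by simp
 have ex: "t<|U**f|>h = g|>h**t<|gT X<|U" using whisker_exchange[of t h] by simp
 have th [simp]: "tdom (h'<|H) = gT X' oo f oo U" "tdom (h'<|G) = gT X' oo g oo U" by simp_all
 have "(t<|U)**(h'<|H) = (h'<|G)**(gT X'|>t<|U)"
  by (rule tiso_epi[OF i]) (simp_all add: L(5) n ex vc_pre[OF M(5)])
 then show ?thesis by (intro udob_lift[OF u']) simp_all
qed

lemma lift_mid:
 assumes u: "udob k kY V" "d_ob V = U" "mtrg U = X" "msrc U = Y" "d_proj V = h"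
 shows "lifts (mid X) k k V V (mid Y)"
proof -
 note [simp] = udobD(5-10)[OF u] u(2-5) and co = udobD(1)[OF u]
 have d: "dob k U (d_zero V) (d_add V) h" using udobD(4)[OF u] unfolding pdob_def by simp
 note [simp] = dobD(1-10)[OF d u(3,4)] top[OF co udobD(10)[OF u]] cart_types[OF co]
 note bx [simp] = box[OF co udobD(5)[OF u] u(3) udobD(5)[OF u] u(3) refl]
 have e: "bng k (topo X k Y) = cid (topo X k Y)"
  by (rule bng_eq[OF co _ _ _ _ _ udobD(10)[OF u]]) (simp_all add: bng[OF co])
 have m: "bpr k (tbx1 k U U) (tbx2 k U U) = cid (tbx k U U)"
  using bpr_expand[OF co udobD(5)[OF u] u(3) udobD(5)[OF u] u(3) refl, of "cid (tbx k U U)"] by simp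
 show ?thesis unfolding lifts_def dpushV_def dpush_def by (simp add: e m ga_mid)
qed

lemma lift_comp:
 assumes u: "udob k kY V" "d_ob V = U" "mtrg U = X" "msrc U = Y" "d_proj V = h"
  and u': "udob k' kY' V'" "d_ob V' = U'" "mtrg U' = X'" "msrc U' = Y'" "d_proj V' = h'"
  and u'': "udob k'' kY'' V''" "d_ob V'' = U''" "mtrg U'' = X''" "msrc U'' = Y''" "d_proj V'' = h''"
  and f: "mor f" "msrc f = X" "mtrg f = X'" and H: "lifts f k k' V V' H"
  and g: "mor g" "msrc g = X'" "mtrg g = X''" and G: "lifts g k' k'' V' V'' G"
 shows "lifts (g oo f) k k'' V V'' (G oo H)"
proof -
 note [simp] = udobD(5-10)[OF u] u(2-5) udobD(5-10)[OF u'] u'(2-5) udobD(5-10)[OF u''] u''(2-5) f g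
 note co = udobD(1)[OF u] and co' = udobD(1)[OF u'] and co'' = udobD(1)[OF u'']
 note L = liftsD(1-4)[OF H u(2) u'(2) u(4) u'(4) u'(3) f(3) u(5) u'(5)] and M = liftsD(1-4)[OF G u'(2) u''(2) u'(4) u''(4) u''(3) g(3) u'(5) u''(5)]
 note [simp] = L M
 have d: "dob k U (d_zero V) (d_add V) h" and d': "dob k' U' (d_zero V') (d_add V') h'" and d'': "dob k'' U'' (d_zero V'') (d_add V'') h''"
  using udobD(4)[OF u] udobD(4)[OF u'] udobD(4)[OF u''] unfolding pdob_def by simp_all
 note [simp] = dobD(1-10)[OF d u(3,4)] dobD(1-10)[OF d' u'(3,4)] dobD(1-10)[OF d'' u''(3,4)]
 have pf: "dpush f k k' U (d_zero V) (d_add V) h (d_zero V'<|H) (d_add V'<|H) (h'<|H)"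
  using H unfolding lifts_def dpushV_def by simp
 have pg0: "dpush g k' k'' U' (d_zero V') (d_add V') h' (d_zero V''<|G) (d_add V''<|G) (h''<|G)"
  using G unfolding lifts_def dpushV_def by simp
 have pg: "dpush g k' k'' (f oo U) (d_zero V'<|H) (d_add V'<|H) (h'<|H) (d_zero V''<|G<|H) (d_add V''<|G<|H) (h''<|G<|H)"
  using dpush_whisker[OF co' co'' g d' u'(3,4) pg0 L(1,3)] by simp
 have c: "U'' oo G oo H = g oo f oo U"
  using arg_cong[OF M(4), of "%x. x oo H"] by (simp del: M(4))
 have fU: "mor (f oo U)" "mtrg (f oo U) = X'" "msrc (f oo U) = Y" "mor (g oo f oo U)" "mtrg (g oo f oo U) = X''" by simp_all
 have Us: "msrc (f oo U) = Y" by simp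
 note F = dpushD[OF pf f(3,2) u(4)] and Gd = dpushD[OF pg g(3,2) Us]
 note Y = udobD(10)[OF u]
 note [simp] = F(1-3,5-7,9-11) Gd(1-3,5-7,9-11)
 note [simp] = top[OF co Y] top[OF co' Y] top[OF co'' Y] top[OF co'' udobD(10)[OF u'']]
  box[OF co'' udobD(5)[OF u''] u''(3) udobD(5)[OF u''] u''(3) refl]
 note bx [simp] = box[OF co udobD(5)[OF u] u(3) udobD(5)[OF u] u(3) refl] box[OF co' fU(1,2) fU(1,2) refl] box[OF co'' fU(4,5) fU(4,5) refl]
 note cart [simp] = bpr(1-3)[OF co'] bpr(1-3)[OF co''] bng[OF co'] bng[OF co'']
 note calc = bx_bpr[OF co'] bpr_comp[OF co''] bng_comp[OF co'']
 note [simp] = c topo_whisker[OF co'] topo_whisker[OF co''] box_whisker(1)[OF co'] box_whisker(1)[OF co'']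
 have zz: "bng k'' (g oo f oo topo X k Y) = bng k'' (g oo topo X' k' Y)**(g|>bng k' (f oo topo X k Y))"
  by (simp add: calc)
 have z: "(d_zero V''<|G<|H)**bng k'' (g oo f oo topo X k Y) = g|>f|>d_zero V"
  unfolding zz by (simp add: vc_pre[OF Gd(4)] vc_lw_eq[OF F(4)])
 let ?b1 = "f|>tbx1 k U U" and ?b2 = "f|>tbx2 k U U"
 let ?fU = "f oo U"
 have t: "cel ?b1" "mtrg (tdom ?b1) = X'" "cel ?b2" "tdom ?b2 = tdom ?b1" by simp_all
 have be: "tbx1 k' ?fU ?fU**bpr k' ?b1 ?b2 = ?b1" "tbx2 k' ?fU ?fU**bpr k' ?b1 ?b2 = ?b2" by (rule bx_bpr[OF co' t]; simp)+
 have mm: "bpr k'' (g|>?b1) (g|>?b2) = bpr k'' (g|>tbx1 k' ?fU ?fU) (g|>tbx2 k' ?fU ?fU)**(g|>bpr k' ?b1 ?b2)"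
  by (simp add: calc vc_lw_eq[OF be(1)] vc_lw_eq[OF be(2)])
 have m: "(d_add V''<|G<|H)**bpr k'' (g|>?b1) (g|>?b2) = g|>f|>d_add V"
  unfolding mm by (simp add: vc_pre[OF Gd(8)] vc_lw_eq[OF F(8)])
 have hg: "(h''<|G<|H)**(ga g<|f<|U) = g|>h'<|H" using Gd(12) by simp
 have h: "(h''<|G<|H)**(ga (g oo f)<|U) = g|>f|>h"
  by (simp add: ga_comp vc_pre[OF hg] vc_lw_eq[OF F(12)])
 show ?thesis unfolding lifts_def dpushV_def dpush_def by (use z m h in \<open>simp add: c\<close>)
qed

end

context two_category
begin

lemma teq: "[|tdom u = tdom v; tcod u = tcod v|] ==> u = v \<longleftrightarrow> tval u = tval v"
 by (auto intro: tarr_eqI)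

lemma hom2_iff_cel:
 "[|mor F; mor G; msrc F = X; mtrg F = Y; msrc G = X; mtrg G = Y; mval F = f; mval G = g|] ==> v \<in> hom2 K X Y f g \<longleftrightarrow> cel (Tarr F G v)"
 by (auto simp: cel_def simp del: cel_mor)

lemma hom1_iff_mor: "[|X \<in> obj K; Y \<in> obj K|] ==> F \<in> hom1 K X Y \<longleftrightarrow> mor (Tmor X Y F)"
 by (simp add: mor_def del: mor_obj)

end

context cartesian_2_category
begin

section \<open>Products and comparisons in hom-categories\<close>

lemma invertible_cell_iff:
 assumes t: "cel t" "tdom t = F" "tcod t = G" "msrc F = X" "mtrg F = Y" "mval F = f" "mval G = g" "tval t = v"
 shows "invertible_cell K X Y f g v \<longleftrightarrow> tiso t"
proof -
 have m: "mor F" "mor G" "msrc G = X" "mtrg G = Y" using cel_mor[OF t(1)] t by simp_all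
 have te: "t = Tarr F G v" using t by (cases t) simp
 have 1: "w \<in> hom2 K X Y g f \<longleftrightarrow> cel (Tarr G F w)" for w using hom2_iff_cel[OF m(2,1,3,4) t(4,5,7,6)] .
 have 2: "v \<in> hom2 K X Y f g" using hom2_iff_cel[OF m(1,2) t(4,5) m(3,4) t(6,7), of v] t(1) te by simp
 have eq: "(w \<bullet> v = id2 K f \<longleftrightarrow> Tarr G F w**t = cid F) & (v \<bullet> w = id2 K g \<longleftrightarrow> t**Tarr G F w = cid G)" if "cel (Tarr G F w)" for w
  using that t by (simp add: teq typed_val)
 have "(\<exists>w. cel (Tarr G F w) & Tarr G F w**t = cid F & t**Tarr G F w = cid G) \<longleftrightarrow> tiso t"
  unfolding tiso_def tinv_def
 proof
  assume "\<exists>w. cel (Tarr G F w) & Tarr G F w**t = cid F & t**Tarr G F w = cid G"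
  then show "\<exists>w. cel t & cel w & tdom w = tcod t & tcod w = tdom t & t**w = cid (tcod t) & w**t = cid (tdom t)"
   using t(1-3) by (metis tarr.sel(1,2))
 next
  assume "\<exists>w. cel t & cel w & tdom w = tcod t & tcod w = tdom t & t**w = cid (tcod t) & w**t = cid (tdom t)"
  then show "\<exists>w. cel (Tarr G F w) & Tarr G F w**t = cid F & t**Tarr G F w = cid G"
   using t(1-3) by (metis tarr.collapse)
 qed
 then show ?thesis unfolding invertible_cell_def is_inverse_def using 1 2 eq by (auto simp: homcat_def)
qed

lemma is_product_iff_tprod:
 assumes "X \<in> obj K" "Y \<in> obj K" "P \<in> hom1 K X Y" "A \<in> hom1 K X Y" "B \<in> hom1 K X Y"
 shows "is_product (homcat K X Y) P p1 p2 A B \<longleftrightarrow>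
  tprod (Tarr (Tmor X Y P) (Tmor X Y A) p1) (Tarr (Tmor X Y P) (Tmor X Y B) p2)" (is "_ \<longleftrightarrow> tprod ?q1 ?q2")
proof -
 let ?U = "%x y. (\<exists>!u. cel u & tdom u = tdom x & tcod u = Tmor X Y P & ?q1**u = x & ?q2**u = y)"
 have U: "?U (Tarr (Tmor X Y W) (Tmor X Y A) a) (Tarr (Tmor X Y W) (Tmor X Y B) b) \<longleftrightarrow>
   (\<exists>!u. u \<in> hom2 K X Y W P & p1 \<bullet> u = a & p2 \<bullet> u = b)"
  if "W \<in> hom1 K X Y" "a \<in> hom2 K X Y W A" "b \<in> hom2 K X Y W B" for W a b
  by (simp, rule ex1_tarr) (use assms that in \<open>auto simp: vc_def\<close>)
 have main: "(\<forall>x y. cel x & cel y & tdom x = tdom y & tcod x = Tmor X Y A & tcod y = Tmor X Y B --> ?U x y)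
  \<longleftrightarrow> (\<forall>W\<in>hom1 K X Y. \<forall>a\<in>hom2 K X Y W A. \<forall>b\<in>hom2 K X Y W B.
    (\<exists>!u. u \<in> hom2 K X Y W P & p1 \<bullet> u = a & p2 \<bullet> u = b))" (is "?L \<longleftrightarrow> ?R")
 proof
  assume L: ?L
  show ?R
  proof (intro ballI impI)
   fix W a b assume h: "W \<in> hom1 K X Y" "a \<in> hom2 K X Y W A" "b \<in> hom2 K X Y W B"
   have "?U (Tarr (Tmor X Y W) (Tmor X Y A) a) (Tarr (Tmor X Y W) (Tmor X Y B) b)"
    using L[rule_format, of "Tarr (Tmor X Y W) (Tmor X Y A) a" "Tarr (Tmor X Y W) (Tmor X Y B) b"] h assms
    by (simp add: cel_def mor_def vc_def del: cel_mor mor_obj)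
   then show "\<exists>!u. u \<in> hom2 K X Y W P & p1 \<bullet> u = a & p2 \<bullet> u = b" by (rule U[OF h(1-3), THEN iffD1])
  qed
 next
  assume R: ?R
  show ?L
  proof (intro allI impI)
   fix x y assume h: "cel x & cel y & tdom x = tdom y & tcod x = Tmor X Y A & tcod y = Tmor X Y B"
   have "msrc (tdom x) = X" "mtrg (tdom x) = Y" using h cel_mor(3,4)[of x] by auto
   then obtain W where W: "tdom x = Tmor X Y W" by (cases "tdom x") auto
   obtain a where a: "x = Tarr (Tmor X Y W) (Tmor X Y A) a" using h W by (cases x) auto
   obtain b where b: "y = Tarr (Tmor X Y W) (Tmor X Y B) b" using h W by (cases y) auto
   have ab: "W \<in> hom1 K X Y" "a \<in> hom2 K X Y W A" "b \<in> hom2 K X Y W B"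
    using h unfolding a b by (auto simp: cel_def mor_def vc_def simp del: cel_mor mor_obj)
   show "?U x y" unfolding a b by (rule U[OF ab(1-3), THEN iffD2]) (use R ab in blast)
  qed
 qed
 show ?thesis
  unfolding is_product_def tprod_def
  using main assms by (auto simp: homcat_def cel_def mor_def vc_def simp del: cel_mor mor_obj)
qed

lemma is_product_tprod:
 assumes "mor (tdom a)" "msrc (tdom a) = X" "mtrg (tdom a) = Y" "mor (tcod a)" "msrc (tcod a) = X" "mtrg (tcod a) = Y"
  "mor (tcod b)" "msrc (tcod b) = X" "mtrg (tcod b) = Y" "tdom b = tdom a"
  "P = mval (tdom a)" "p1 = tval a" "p2 = tval b" "A = mval (tcod a)" "B = mval (tcod b)"
 shows "is_product (homcat K X Y) P p1 p2 A B \<longleftrightarrow> tprod a b"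
proof -
 have ty: "X \<in> obj K" "Y \<in> obj K" "P \<in> hom1 K X Y" "A \<in> hom1 K X Y" "B \<in> hom1 K X Y"
  using assms mor_obj[OF assms(1)] by (auto simp: mor_def simp del: mor_obj)
 have "Tmor X Y P = tdom a" "Tmor X Y A = tcod a" "Tmor X Y B = tcod b" "Tmor X Y P = tdom b"
  using assms by (auto intro: tmor.expand)
 then have "Tarr (Tmor X Y P) (Tmor X Y A) p1 = a" "Tarr (Tmor X Y P) (Tmor X Y B) p2 = b"
  using assms(12,13) by (auto intro: tarr.expand)
 then show ?thesis using is_product_iff_tprod[OF ty, of p1 p2] by simp
qed

lemma pairing_tprod:
 assumes pr: "tprod a b" and u: "cel u" "tcod u = tdom a" and t: "msrc (tdom u) = X" "mtrg (tdom u) = Y"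
 shows "pairing (homcat K X Y) (mval (tdom a)) (tval a) (tval b) (mval (tdom u)) (tval (a**u)) (tval (b**u)) = tval u"
proof -
 note D = tprodD[OF pr]
 have m: "mor (tdom u)" "mor (tdom a)" "msrc (tdom a) = X" "mtrg (tdom a) = Y" using cel_mor[OF u(1)] u t by simp_all
 have iff: "v \<in> hom2 K X Y (mval (tdom u)) (mval (tdom a)) \<longleftrightarrow> cel (Tarr (tdom u) (tdom a) v)" for v
  by (rule hom2_iff_cel[OF m(1,2) t m(3,4)]) simp_all
 have ue: "Tarr (tdom u) (tdom a) (tval u) = u" using u by (cases u) simp
 have "(THE v. v \<in> hom2 K X Y (mval (tdom u)) (mval (tdom a)) & tval a \<bullet> v = tval (a**u) & tval b \<bullet> v = tval (b**u)) = tval u"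
 proof (rule the_equality)
  show "tval u \<in> hom2 K X Y (mval (tdom u)) (mval (tdom a)) & tval a \<bullet> tval u = tval (a**u) & tval b \<bullet> tval u = tval (b**u)"
   unfolding iff ue using u by (simp add: typed_val)
  fix v assume v: "v \<in> hom2 K X Y (mval (tdom u)) (mval (tdom a)) & tval a \<bullet> v = tval (a**u) & tval b \<bullet> v = tval (b**u)"
  let ?v = "Tarr (tdom u) (tdom a) v"
  have "?v = u"
  proof (rule tprod_eqI[OF pr])
   show "cel ?v" using v iff by simp
   show "a**?v = a**u" "b**?v = b**u" using v by (auto intro!: tarr_eqI simp: typed_val)
  qed (use u in simp_all)
  then show "v = tval u" by (metis tarr.sel(3))
 qed
 then show ?thesis unfolding pairing_def by (simp add: homcat_def)
qed

end

context tangent_2_category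
begin

text \<open>The comparison 2-cells of \<open>f\<close> are the comparison arrows at the universal objects \<open>*\<close> and \<open>(pr1, pr2)\<close>; all other
 comparison arrows are obtained from these by whiskering.\<close>

lemma comparison_val:
 assumes co: "cartesian_object K X k" and co': "cartesian_object K Y k'" and f: "mor f" "msrc f = X" "mtrg f = Y"
  and \<kappa>: "\<kappa> = bpr k' (f|>ep1 X k) (f|>ep2 X k)" and st: "st = bng k' (f oo tst X k)"
 shows "star_comparison K k k' (mval f) = tval st" "times_comparison K X k Y k' (mval f) = tval \<kappa>"
  "cel st" "tdom st = f oo tst X k" "tcod st = tst Y k'"
  "cel \<kappa>" "tdom \<kappa> = f oo tms X k" "tcod \<kappa> = tms Y k' oo tpair (f oo pr1 X X) (f oo pr2 X X)"
proof -
 note [simp] = cart_types[OF co] cart_types[OF co'] f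
 show "cel st" "tdom st = f oo tst X k" "tcod st = tst Y k'" unfolding st by (simp_all add: bng_def tbang_tobj)
 show "cel \<kappa>" "tdom \<kappa> = f oo tms X k" "tcod \<kappa> = tms Y k' oo tpair (f oo pr1 X X) (f oo pr2 X X)"
  unfolding \<kappa> by (simp_all add: bpr_def)
 show "star_comparison K k k' (mval f) = tval st" unfolding st by (simp only: star_comparison_def bng_def typed_val cart_val)
 have e: "cpair (f|>ep1 X k) (f|>ep2 X k) = tpair (f oo pr1 X X) (f oo pr2 X X)|>teps X k"
  by (simp add: ep1_def ep2_def)
 have "\<kappa> = ((tms Y k' oo tpair (f oo pr1 X X) (f oo pr2 X X))|>teps X k)**(teta Y k'<|(f oo tms X k))"
  unfolding \<kappa> bpr_def e by simp
 then show "times_comparison K X k Y k' (mval f) = tval \<kappa>"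
  by (simp only: times_comparison_def typed_val cart_val prod1_tpair[OF f(3,3,2,2)])
qed

lemma preserves_products_iff_fpres:
 assumes co: "cartesian_object K X k" and co': "cartesian_object K Y k'" and f: "mor f" "msrc f = X" "mtrg f = Y"
 shows "preserves_products K X k Y k' (mval f) \<longleftrightarrow> fpres f k k'"
proof -
 note [simp] = cart_types[OF co] cart_types[OF co'] f
 define \<kappa> where "\<kappa> = bpr k' (f|>ep1 X k) (f|>ep2 X k)"
 define st where "st = bng k' (f oo tst X k)"
 note c = comparison_val[OF co co' f \<kappa>_def st_def]
 let ?XX = "pobj K X X"
 have p: "mor (pr1 X X)" "mtrg (pr1 X X) = X" "mor (pr2 X X)" "mtrg (pr2 X X) = X" "msrc (pr2 X X) = msrc (pr1 X X)" by simp_all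
 have pp: "tpair (pr1 X X) (pr2 X X) = mid ?XX" by (rule mor_prod_eqI[of _ _ X X]) simp_all
 have b: "tbx1 k (pr1 X X) (pr2 X X) = ep1 X k" "tbx2 k (pr1 X X) (pr2 X X) = ep2 X k" "tbx k (pr1 X X) (pr2 X X) = tms X k"
  by (simp_all add: tbx1_def tbx2_def tbx_def pp)
 have tt: "topo X k (tobj K) = tst X k" by (simp add: topo_def tbang_tobj)
 have "invertible_cell K ?XX Y (mval f \<odot> times1 k) (times1 k' \<odot> prod1 K X X Y Y (mval f) (mval f)) (times_comparison K X k Y k' (mval f)) \<longleftrightarrow> tiso \<kappa>"
  by (rule invertible_cell_iff[OF c(6-8)]) (use prod1_tpair[OF f(3,3,2,2)] in \<open>simp_all add: c(2) typed_val cart_val\<close>)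
 moreover have "invertible_cell K (tobj K) Y (mval f \<odot> star k) (star k') (star_comparison K k k' (mval f)) \<longleftrightarrow> tiso st"
  by (rule invertible_cell_iff[OF c(3-5)]) (simp_all add: c(1) typed_val cart_val)
 moreover have "tiso \<kappa>" "tiso st" if fp: "fpres f k k'"
 proof -
  show "tiso \<kappa>" using comparison_iso[OF co co' f fp p] unfolding b \<kappa>_def .
  show "tiso st" using fp[unfolded fpres_def, THEN conjunct2, THEN bspec, of "tobj K"] by (simp add: tt st_def)
 qed
 moreover have "fpres f k k'" if \<kappa>: "tiso \<kappa>" and st: "tiso st"
  unfolding fpres_def
 proof (intro conjI allI impI ballI; (elim conjE)?)
  fix A B assume A: "mor A" "mtrg A = msrc f" and B: "mor B" "mtrg B = msrc f" "msrc B = msrc A"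
  have A' [simp]: "mor A" "mtrg A = X" and B' [simp]: "mor B" "mtrg B = X" "msrc B = msrc A" using A B by simp_all
  note bx [simp] = box[OF co A' B']
  have w: "ep1 X k<|tpair A B = tbx1 k A B" "ep2 X k<|tpair A B = tbx2 k A B" by (simp_all add: tbx1_def tbx2_def)
  have t: "cel (f|>ep1 X k)" "mtrg (tdom (f|>ep1 X k)) = Y" "cel (f|>ep2 X k)" "tdom (f|>ep2 X k) = tdom (f|>ep1 X k)" by simp_all
  have t2: "cel (f|>tbx1 k A B)" "mtrg (tdom (f|>tbx1 k A B)) = Y" "cel (f|>tbx2 k A B)" "tdom (f|>tbx2 k A B) = tdom (f|>tbx1 k A B)" by simp_all
  have "\<kappa><|tpair A B = bpr k' (f|>tbx1 k A B) (f|>tbx2 k A B)"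
   unfolding \<kappa>_def by (subst bpr_whisker[OF co' t]) (simp_all add: w)
  moreover have "tiso (\<kappa><|tpair A B)" by (rule tiso_rw[OF \<kappa>]) (simp_all add: c)
  ultimately have i: "tiso (bpr k' (f|>tbx1 k A B) (f|>tbx2 k A B))" by simp
  have "mor (f oo A)" "mtrg (f oo A) = Y" "mor (f oo B)" "mtrg (f oo B) = Y" "msrc (f oo B) = msrc (f oo A)" by simp_all
  note fb = tprod_bx[OF co' this] box[OF co' this]
  show "tprod (f|>tbx1 k A B) (f|>tbx2 k A B)"
   using tprod_iso[OF fb(1) i] bpr(3)[OF co' t2] bx_bpr[OF co' t2] fb by simp
 next
  fix W assume W [simp]: "W \<in> obj K"
  have "bng k' (f oo topo X k W) = st<|tbang W" unfolding st_def by (subst bng_whisker[OF co']) (simp_all add: topo_def)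
  moreover have "tiso (st<|tbang W)" by (rule tiso_rw[OF st]) (simp_all add: c)
  ultimately show "tiso (bng k' (f oo topo (msrc f) k W))" by simp
 qed
 ultimately show ?thesis unfolding preserves_products_def by blast
qed

text \<open>Compatibility with the comparisons is automatic, by naturality of the units.\<close>

lemma compatible_cell_always:
 assumes co: "cartesian_object K X k" and co': "cartesian_object K Y k'" and f: "mor f" "msrc f = X" "mtrg f = Y"
  and g: "mor g" "msrc g = X" "mtrg g = Y" and t: "cel t" "tdom t = f" "tcod t = g"
 shows "compatible_cell K X k Y k' (mval f) (mval g) (tval t)"
proof -
 note [simp] = cart_types[OF co] cart_types[OF co'] f g t
 let ?kf = "bpr k' (f|>ep1 X k) (f|>ep2 X k)" and ?kg = "bpr k' (g|>ep1 X k) (g|>ep2 X k)"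
 let ?sf = "bng k' (f oo tst X k)" and ?sg = "bng k' (g oo tst X k)"
 note c = comparison_val[OF co co' f refl refl] and d = comparison_val[OF co co' g refl refl]
 let ?c = "cpair (t<|pr1 X X) (t<|pr2 X X)"
 have e: "t<|pr1 X X**f|>ep1 X k = g|>ep1 X k**t<|tms X k" "t<|pr2 X X**f|>ep2 X k = g|>ep2 X k**t<|tms X k"
  using whisker_exchange[of t "ep1 X k"] whisker_exchange[of t "ep2 X k"] by simp_all
 have gg: "cel (g|>ep1 X k)" "mtrg (tdom (g|>ep1 X k)) = Y" "cel (g|>ep2 X k)" "tdom (g|>ep2 X k) = tdom (g|>ep1 X k)" by simp_all
 have r: "(tms Y k'|>?c)**?kf = bpr k' (t<|pr1 X X**f|>ep1 X k) (t<|pr2 X X**f|>ep2 X k)"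
 proof -
  have "?c**cpair (f|>ep1 X k) (f|>ep2 X k) = cpair (t<|pr1 X X**f|>ep1 X k) (t<|pr2 X X**f|>ep2 X k)" by simp
  from vc_lw_eq[OF this, of "tms Y k'"] have "(tms Y k'|>?c)**(tms Y k'|>cpair (f|>ep1 X k) (f|>ep2 X k)) =
    tms Y k'|>cpair (t<|pr1 X X**f|>ep1 X k) (t<|pr2 X X**f|>ep2 X k)" by simp
  from vc_pre[OF this] show ?thesis by (simp add: bpr_def)
 qed
 have 1: "?kg**(t<|tms X k) = (tms Y k'|>?c)**?kf"
  unfolding r e by (subst bpr_comp[OF co' gg]) simp_all
 have 2: "?sg**(t<|tst X k) = ?sf"
  by (subst bng_comp[OF co']) simp_all
 have p2: "prod2 K X X Y Y (mval f) (mval f) (mval g) (mval g) (tval t) (tval t) = tval ?c"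
  by (rule prod2_cpair) simp_all
 show ?thesis
  unfolding compatible_cell_def c(1,2) d(1,2)
  using arg_cong[OF 1, of tval] arg_cong[OF 2, of tval] p2
  by (simp only: typed_val cart_val t f g)
qed

section \<open>Differential objects in a hom tangent category\<close>

text \<open>The part of the Cartesian tangent category of 1-cells \<open>W \<rightarrow> X\<close> that differential objects refer to, with the structure
 given by whiskering. The flip is absent because it enters only the tangent bundle of a differential object.\<close>

definition hct :: "('m, 'c) cart_tangent_cat => 'o => 'o => ('m, 'c) cart => bool" where
 "hct C W X k \<longleftrightarrow> Ob C = hom1 K W X & Arr C = hom2 K W X & idn C = id2 K & cmp C = vcomp K & (\<forall>\<phi>. cTa C \<phi> = T X \<rhd> \<phi>) &
  (\<forall>F. cT C F = T X \<odot> F & cT2 C F = T2 X \<odot> F & cq1 C F = q1 X \<lhd> F & cq2 C F = q2 X \<lhd> F &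
    cp C F = p X \<lhd> F & cz C F = z X \<lhd> F & cs C F = s X \<lhd> F & cl C F = l X \<lhd> F) &
  ctop C = star k \<odot> bang1 K W & bx C = (%A B. times1 k \<odot> pair1 K W X X A B) &
  bx1 C = (%A B. pfst K X X \<rhd> (times_counit k \<lhd> pair1 K W X X A B)) &
  bx2 C = (%A B. psnd K X X \<rhd> (times_counit k \<lhd> pair1 K W X X A B))"

lemma hctD:
 assumes "hct C W X k"
 shows "Ob C = hom1 K W X" "Arr C = hom2 K W X" "idn C = id2 K" "cmp C = vcomp K" "!!\<phi>. cTa C \<phi> = T X \<rhd> \<phi>"
  "!!F. cT C F = T X \<odot> F" "!!F. cT2 C F = T2 X \<odot> F" "!!F. cq1 C F = q1 X \<lhd> F" "!!F. cq2 C F = q2 X \<lhd> F"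
  "!!F. cp C F = p X \<lhd> F" "!!F. cz C F = z X \<lhd> F" "!!F. cs C F = s X \<lhd> F" "!!F. cl C F = l X \<lhd> F"
 using assms unfolding hct_def by blast+

lemma hct_homcat:
 assumes h: "hct C W X k"
 shows "is_product C P p1 p2 A B = is_product (homcat K W X) P p1 p2 A B" "pairing C P p1 p2 A a b = pairing (homcat K W X) P p1 p2 A a b"
 unfolding is_product_def pairing_def by (simp_all add: homcat_def hctD[OF h])

lemma hct_val:
 assumes h: "hct C W X k" and co: "cartesian_object K X k" and W: "W \<in> obj K"
 shows "mval (topo X k W) = ctop C"
  "[|mor A; msrc A = W; mtrg A = X; mor B; msrc B = W; mtrg B = X|] ==> mval (tbx k A B) = bx C (mval A) (mval B)"
  "[|mor A; msrc A = W; mtrg A = X; mor B; msrc B = W; mtrg B = X|] ==> tval (tbx1 k A B) = bx1 C (mval A) (mval B)"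
  "[|mor A; msrc A = W; mtrg A = X; mor B; msrc B = W; mtrg B = X|] ==> tval (tbx2 k A B) = bx2 C (mval A) (mval B)"
proof -
 note [simp] = cart_types[OF co] W
 show "mval (topo X k W) = ctop C"
  using h unfolding hct_def topo_def by (simp add: typed_val cart_val)
 assume A: "mor A" "msrc A = W" "mtrg A = X" and B: "mor B" "msrc B = W" "mtrg B = X"
 note [simp] = A B
 have e: "tbx1 k A B = pr1 X X|>(teps X k<|tpair A B)" "tbx2 k A B = pr2 X X|>(teps X k<|tpair A B)"
  by (simp_all add: tbx1_def tbx2_def ep1_def ep2_def)
 show "mval (tbx k A B) = bx C (mval A) (mval B)"
  using h unfolding hct_def by (simp add: tbx_def typed_val cart_val) (simp add: tpair_def)
 show "tval (tbx1 k A B) = bx1 C (mval A) (mval B)" "tval (tbx2 k A B) = bx2 C (mval A) (mval B)"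
  unfolding e using h unfolding hct_def by (simp_all only: typed_val cart_val pr_val) (simp_all add: tpair_def)
qed

lemma hct_pairing:
 assumes h: "hct C W X k" and co: "cartesian_object K X k"
  and x: "cel x" "msrc (tdom x) = W" "mtrg (tdom x) = X" and y: "cel y" "tdom y = tdom x"
 shows "tval (bpr k x y) = pairing C (bx C (mval (tcod x)) (mval (tcod y))) (bx1 C (mval (tcod x)) (mval (tcod y)))
   (bx2 C (mval (tcod x)) (mval (tcod y))) (mval (tdom x)) (tval x) (tval y)"
proof -
 have W: "W \<in> obj K" using mor_obj(1)[OF cel_mor(1)[OF x(1)]] x by simp
 have m [simp]: "mor (tcod x)" "msrc (tcod x) = W" "mtrg (tcod x) = X" "mor (tcod y)" "msrc (tcod y) = W" "mtrg (tcod y) = X"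
  using cel_mor[OF x(1)] cel_mor[OF y(1)] x y by simp_all
 have eq: "msrc (tcod y) = msrc (tcod x)" by simp
 note v = hct_val(2-4)[OF h co W m(1-3) m(4-6)] and pr = tprod_bx[OF co m(1,3,4,6) eq] and bx = box[OF co m(1,3,4,6) eq]
 note b = bpr[OF co x(1,3) y]
 show ?thesis unfolding hct_homcat[OF h] v[symmetric]
  using pairing_tprod[OF pr, of "bpr k x y" W X] b bx x by simp
qed

lemma hct_terminal:
 assumes h: "hct C W X k" and co: "cartesian_object K X k" and W: "W \<in> obj K"
 shows "is_terminal C (ctop C)" "[|mor w; msrc w = W; mtrg w = X|] ==> tval (bng k w) = to_terminal C (ctop C) (mval w)"
proof -
 note t = top[OF co W] and v = hct_val(1)[OF h co W]
 have 1: "tval (bng k w) \<in> Arr C (mval w) (ctop C) & (\<forall>f \<in> Arr C (mval w) (ctop C). f = tval (bng k w))"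
  if w: "mor w" "msrc w = W" "mtrg w = X" for w
 proof -
  note b = bng[OF co w(1,3), unfolded w(2)]
  have iff: "f \<in> Arr C (mval w) (ctop C) \<longleftrightarrow> cel (Tarr w (topo X k W) f)" for f
   unfolding hctD[OF h] by (rule hom2_iff_cel[OF w(1) t(1) w(2,3) t(2,3) refl v])
  have "Tarr w (topo X k W) f = bng k w" if "cel (Tarr w (topo X k W) f)" for f
   by (rule bng_eq[OF co that _ b(1,3) _ W]) (simp_all add: b)
  moreover have "Tarr w (topo X k W) (tval (bng k w)) = bng k w" using b by (cases "bng k w") simp
  ultimately show ?thesis using b(1) iff by (intro conjI ballI) (simp, metis tarr.sel(3))
 qed
 have X: "X \<in> obj K" using cart_types[OF co] by simp
 show "is_terminal C (ctop C)" unfolding is_terminal_def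
 proof (intro conjI ballI)
  show "ctop C \<in> Ob C" using t v[symmetric] unfolding hctD[OF h] by (simp add: mor_def del: mor_obj)
  fix F assume "F \<in> Ob C"
  then have F: "mor (Tmor W X F)" using hom1_iff_mor[OF W X, of F] by (simp add: hctD[OF h])
  from 1[OF this] show "\<exists>!f. f \<in> Arr C F (ctop C)" by simp metis
 qed
 show "tval (bng k w) = to_terminal C (ctop C) (mval w)" if w: "mor w" "msrc w = W" "mtrg w = X"
  unfolding to_terminal_def using 1[OF w] by (intro the_equality[symmetric]) auto
qed

text \<open>A differential object whose components are equipped with the endpoints they have in the hom-category from \<open>W\<close> to \<open>X\<close>.\<close>

definition tdo :: "'o => 'o => ('m, 'c) cart => ('m, 'c) dobj => (('o, 'm) tmor, (('o, 'm) tmor, 'c) tarr) dobj" where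
 "tdo W X k D = (let A = Tmor W X (d_ob D) in \<lparr>d_ob = A, d_zero = Tarr (topo X k W) A (d_zero D),
   d_add = Tarr (tbx k A A) A (d_add D), d_proj = Tarr (gT X oo A) A (d_proj D)\<rparr>)"

lemma tdo_sel:
 "d_ob (tdo W X k D) = Tmor W X (d_ob D)" "d_zero (tdo W X k D) = Tarr (topo X k W) (Tmor W X (d_ob D)) (d_zero D)"
 "d_add (tdo W X k D) = Tarr (tbx k (Tmor W X (d_ob D)) (Tmor W X (d_ob D))) (Tmor W X (d_ob D)) (d_add D)"
 "d_proj (tdo W X k D) = Tarr (gT X oo Tmor W X (d_ob D)) (Tmor W X (d_ob D)) (d_proj D)"
 by (simp_all add: tdo_def Let_def)

text \<open>Each axiom is translated separately, once the types of the three structure cells are known; if one of them is ill-typed,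
 both sides are false.\<close>

lemma differential_object_iff_dob:
 assumes h: "hct C W X k" and co: "cartesian_object K X k" and W: "W \<in> obj K"
  and A: "A = Tmor W X (d_ob D)" and e: "e = Tarr (topo X k W) A (d_zero D)" and m: "m = Tarr (tbx k A A) A (d_add D)"
  and ph: "ph = Tarr (gT X oo A) A (d_proj D)"
 shows "differential_object C D \<longleftrightarrow> dob k A e m ph"
proof -
 note ct [simp] = cart_types[OF co] and t [simp] = top[OF co W] W
 note hd = hctD[OF h] and hv = hct_val[OF h co W]
 have sel [simp]: "msrc A = W" "mtrg A = X" "mval A = d_ob D" "tdom e = topo X k W" "tcod e = A" "tval e = d_zero D"
  "tdom m = tbx k A A" "tcod m = A" "tval m = d_add D" "tdom ph = gT X oo A" "tcod ph = A" "tval ph = d_proj D"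
  using A e m ph by simp_all
 have Aiff: "d_ob D \<in> Ob C \<longleftrightarrow> mor A" unfolding A hd by (rule hom1_iff_mor) simp_all
 show ?thesis
 proof (cases "mor A")
  case False then show ?thesis unfolding differential_object_def Let_def dob_def using Aiff by simp
 next
  case Am [simp]: True
  note bx [simp] = box[OF co Am sel(2) Am sel(2) refl]
  let ?TA = "gT X oo A"
  have TA: "mor ?TA" "mtrg ?TA = X" by simp_all
  note Tb [simp] = box[OF co TA TA refl]
  have TAv: "cT C (d_ob D) = mval ?TA" by (simp add: hd typed_val g_val)
  have topv: "mval (topo X k W) = ctop C" and bxv: "mval (tbx k A A) = bx C (d_ob D) (d_ob D)" using hv(1) hv(2)[OF Am sel(1,2) Am sel(1,2)] by simp_all
  have e1: "d_zero D \<in> Arr C (ctop C) (d_ob D) \<longleftrightarrow> cel e"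
   unfolding e hd by (rule hom2_iff_cel) (simp_all add: topv)
  have m1: "d_add D \<in> Arr C (bx C (d_ob D) (d_ob D)) (d_ob D) \<longleftrightarrow> cel m"
   unfolding m hd by (rule hom2_iff_cel) (simp_all add: bxv)
  have h1: "d_proj D \<in> Arr C (cT C (d_ob D)) (d_ob D) \<longleftrightarrow> cel ph"
   unfolding ph hd(2) by (rule hom2_iff_cel) (simp_all add: TAv)
  show ?thesis
  proof (cases "cel e & cel m & cel ph")
   case False then show ?thesis unfolding differential_object_def Let_def dob_def commutative_monoid_def using e1 m1 h1 by blast
  next
   case True
   then have cels [simp]: "cel e" "cel m" "cel ph" by simp_all
   note cart [simp] = bpr(1-3)[OF co] bng[OF co]
   note pp = hct_pairing[OF h co] and tt = hct_terminal(2)[OF h co W]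
   let ?A = "d_ob D"
   let ?pair = "pairing C (bx C ?A ?A) (bx1 C ?A ?A) (bx2 C ?A ?A)"
   have pr: "is_product C (bx C ?A ?A) (bx1 C ?A ?A) (bx2 C ?A ?A) ?A ?A"
    unfolding hct_homcat[OF h] by (subst is_product_tprod[where a = "tbx1 k A A" and b = "tbx2 k A A"]) (use hv(2-4)[OF Am sel(1,2) Am sel(1,2)] tprod_bx[OF co Am sel(2) Am sel(2) refl] in simp_all)
   have as0: "m**bpr k (m**bpr k a b) d = m**bpr k a (m**bpr k b d) \<longleftrightarrow>
     d_add D \<bullet> ?pair (mval (tdom a)) (d_add D \<bullet> ?pair (mval (tdom a)) (tval a) (tval b)) (tval d)
     = d_add D \<bullet> ?pair (mval (tdom a)) (tval a) (d_add D \<bullet> ?pair (mval (tdom a)) (tval b) (tval d))"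
    if x: "cel a" "cel b" "cel d" "tdom b = tdom a" "tdom d = tdom a" "tcod a = A" "tcod b = A" "tcod d = A" for a b d
   proof -
    have [simp]: "msrc (tdom a) = W" "mtrg (tdom a) = X" using cel_mor[OF x(1)] x by simp_all
    show ?thesis using x by (subst teq) (simp_all add: typed_val pp)
   qed
   have as: "(\<forall>w\<in>Ob C. \<forall>a\<in>Arr C w ?A. \<forall>b\<in>Arr C w ?A. \<forall>d\<in>Arr C w ?A.
     d_add D \<bullet> ?pair w (d_add D \<bullet> ?pair w a b) d = d_add D \<bullet> ?pair w a (d_add D \<bullet> ?pair w b d)) \<longleftrightarrow>
    (\<forall>a b d. cel a & cel b & cel d & tdom b = tdom a & tdom d = tdom a & tcod a = A & tcod b = A & tcod d = A -->
     m**bpr k (m**bpr k a b) d = m**bpr k a (m**bpr k b d))" (is "?L \<longleftrightarrow> ?R")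
   proof
    assume L: ?L
    show ?R
    proof (intro allI impI; elim conjE)
     fix a b d assume x: "cel a" "cel b" "cel d" "tdom b = tdom a" "tdom d = tdom a" "tcod a = A" "tcod b = A" "tcod d = A"
     have w: "mor (tdom a)" "msrc (tdom a) = W" "mtrg (tdom a) = X" using cel_mor[OF x(1)] x by simp_all
     have "mval (tdom a) \<in> Ob C" using w by (simp add: hd mor_def del: mor_obj)
     moreover have "tval y \<in> Arr C (mval (tdom a)) ?A" if "cel y" "tdom y = tdom a" "tcod y = A" for y
      using that w unfolding hd by (auto simp: cel_def simp del: cel_mor)
     ultimately show "m**bpr k (m**bpr k a b) d = m**bpr k a (m**bpr k b d)"
      unfolding as0[OF x] using L x by blast
    qed
   next
    assume R: ?R
    show ?L
    proof (intro ballI)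
     fix w a b d assume "w \<in> Ob C" and x: "a \<in> Arr C w ?A" "b \<in> Arr C w ?A" "d \<in> Arr C w ?A"
     then have w: "mor (Tmor W X w)" using hom1_iff_mor[of W X w] by (simp add: hd)
     have iff: "y \<in> Arr C w ?A \<longleftrightarrow> cel (Tarr (Tmor W X w) A y)" for y
      unfolding hd by (rule hom2_iff_cel) (simp_all add: w)
     let ?a = "%y. Tarr (Tmor W X w) A y"
     have c: "cel (?a a)" "cel (?a b)" "cel (?a d)" using x by (simp_all only: iff)
     have "m**bpr k (m**bpr k (?a a) (?a b)) (?a d) = m**bpr k (?a a) (m**bpr k (?a b) (?a d))"
      by (rule R[rule_format]) (simp add: c)
     then show "d_add D \<bullet> ?pair w (d_add D \<bullet> ?pair w a b) d = d_add D \<bullet> ?pair w a (d_add D \<bullet> ?pair w b d)"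
      using as0[OF c] by simp
    qed
   qed
   have ax2: "d_add D \<bullet> ?pair ?A (d_zero D \<bullet> to_terminal C (ctop C) ?A) (id2 K ?A) = id2 K ?A \<longleftrightarrow> m**bpr k (e**bng k A) (cid A) = cid A"
    "d_add D \<bullet> ?pair ?A (id2 K ?A) (d_zero D \<bullet> to_terminal C (ctop C) ?A) = id2 K ?A \<longleftrightarrow> m**bpr k (cid A) (e**bng k A) = cid A"
    by (subst teq; simp add: typed_val pp tt)+
   have ax4: "d_add D \<bullet> ?pair (bx C ?A ?A) (bx2 C ?A ?A) (bx1 C ?A ?A) = d_add D \<longleftrightarrow> m**bpr k (tbx2 k A A) (tbx1 k A A) = m"
    by (subst teq; simp add: typed_val pp hv bxv)
   have ax5: "d_proj D \<bullet> cTa C (d_zero D) = d_zero D \<bullet> to_terminal C (ctop C) (cT C (ctop C)) \<longleftrightarrow>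
     ph**(gT X|>e) = e**bng k (gT X oo topo X k W)"
    using tt[of "gT X oo topo X k W"] by (subst teq) (simp_all add: typed_val hd g_val topv)
   let ?c1 = "ph**tbx1 k ?TA ?TA" and ?c2 = "ph**tbx2 k ?TA ?TA" and ?t1 = "gT X|>tbx1 k A A" and ?t2 = "gT X|>tbx2 k A A"
   have be: "bpr k (ph**?t1) (ph**?t2) = bpr k ?c1 ?c2**bpr k ?t1 ?t2"
    by (simp add: bpr_comp[OF co] bx_bpr[OF co])
   have tav: "mval (tbx k ?TA ?TA) = bx C (cT C ?A) (cT C ?A)" "tval (tbx1 k ?TA ?TA) = bx1 C (cT C ?A) (cT C ?A)" "tval (tbx2 k ?TA ?TA) = bx2 C (cT C ?A) (cT C ?A)"
    unfolding TAv by (rule hv; simp)+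
   have c1v: "tval (bpr k ?c1 ?c2) = bx_pair C ?A ?A (bx C (cT C ?A) (cT C ?A)) (d_proj D \<bullet> bx1 C (cT C ?A) (cT C ?A)) (d_proj D \<bullet> bx2 C (cT C ?A) (cT C ?A))"
    unfolding bx_pair_def by (subst pp) (simp_all add: typed_val tav)
   have c2v: "tval (bpr k ?t1 ?t2) = T_bx_comparison C ?A"
    unfolding T_bx_comparison_def bx_pair_def by (subst pp) (simp_all add: typed_val TAv hd g_val hv bxv)
   have ax6: "d_proj D \<bullet> cTa C (d_add D) = d_add D \<bullet> bx_pair C ?A ?A (bx C (cT C ?A) (cT C ?A)) (d_proj D \<bullet> bx1 C (cT C ?A) (cT C ?A)) (d_proj D \<bullet> bx2 C (cT C ?A) (cT C ?A)) \<bullet> T_bx_comparison C ?A \<longleftrightarrow>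
     ph**(gT X|>m) = m**bpr k (ph**?t1) (ph**?t2)"
    unfolding be c1v[symmetric] c2v[symmetric] by (subst teq) (simp_all add: hd(5), simp add: typed_val g_val)
   have ax7: "d_proj D \<bullet> cz C ?A = d_zero D \<bullet> to_terminal C (ctop C) ?A \<longleftrightarrow> ph**(gz X<|A) = e**bng k A"
    by (subst teq) (simp_all add: typed_val hd g_val tt)
   have ax8: "d_proj D \<bullet> cs C ?A = d_add D \<bullet> bx_pair C ?A ?A (cT2 C ?A) (d_proj D \<bullet> cq1 C ?A) (d_proj D \<bullet> cq2 C ?A) \<longleftrightarrow>
     ph**(gs X<|A) = m**bpr k (ph**(gq1 X<|A)) (ph**(gq2 X<|A))"
    by (subst teq) (simp_all add: typed_val hd g_val pp bx_pair_def)
   have ax9: "d_proj D \<bullet> cTa C (d_proj D) \<bullet> cl C ?A = d_proj D \<longleftrightarrow> ph**(gT X|>ph)**(gl X<|A) = ph"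
    by (subst teq) (simp_all add: typed_val hd g_val)
   have ax10: "is_product C (cT C ?A) (cp C ?A) (d_proj D) ?A ?A \<longleftrightarrow> tprod (gp X<|A) ph"
    unfolding hct_homcat[OF h] by (rule is_product_tprod) (simp_all add: TAv, simp_all add: hd typed_val g_val)
   show ?thesis
    unfolding differential_object_def Let_def commutative_monoid_def dob_def
    unfolding as[unfolded hd(4)[symmetric]] ax2[unfolded hd(3,4)[symmetric]] ax4[unfolded hd(4)[symmetric]] ax5[unfolded hd(4)[symmetric]]
     ax6[unfolded hd(4)[symmetric]] ax7[unfolded hd(4)[symmetric]] ax8[unfolded hd(4)[symmetric]] ax9[unfolded hd(4)[symmetric]] ax10 Aiff e1 m1 h1 sel(1,2)
    using cels pr hct_terminal(1)[OF h co W] by simp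
  qed
 qed
qed

lemma linear_arrow_iff:
 assumes h: "hct C W X k" and A: "A = Tmor W X (d_ob D)" "mor A" and B: "B = Tmor W X (d_ob E)" "mor B"
  and hD: "cel hD" "tdom hD = gT X oo A" "tcod hD = A" "tval hD = d_proj D"
  and hE: "cel hE" "tdom hE = gT X oo B" "tcod hE = B" "tval hE = d_proj E"
 shows "linear_arrow C D E v \<longleftrightarrow> cel (Tarr A B v) & Tarr A B v**hD = hE**(gT X|>Tarr A B v)"
proof -
 note hd = hctD[OF h]
 have s [simp]: "msrc A = W" "mtrg A = X" "mval A = d_ob D" "msrc B = W" "mtrg B = X" "mval B = d_ob E" using A B by simp_all
 have X [simp]: "X \<in> obj K" using mor_obj(2)[OF A(2)] by simp
 have iff: "v \<in> hom2 K W X (d_ob D) (d_ob E) \<longleftrightarrow> cel (Tarr A B v)" by (rule hom2_iff_cel) (use A(2) B(2) in simp_all)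
 have "v \<bullet> d_proj D = d_proj E \<bullet> (T X \<rhd> v) \<longleftrightarrow> Tarr A B v**hD = hE**(gT X|>Tarr A B v)" if "cel (Tarr A B v)"
  using that hD hE A(2) B(2) by (subst teq) (simp_all, simp add: typed_val g_val)
 then show ?thesis unfolding linear_arrow_def hd(2,4,5) iff by blast
qed

lemma tdo_whisker:
 assumes co: "cartesian_object K X k" and d: "dob k (Tmor Y X (d_ob V)) e m h" and a: "mor a" "msrc a = W" "mtrg a = Y"
 shows "tdo W X k (whisker_dobj K V (mval a)) = twh (tdo Y X k V) a"
proof -
 let ?A = "Tmor Y X (d_ob V)"
 have A [simp]: "mor ?A" using dobD(1)[OF d refl refl] .
 have [simp]: "X \<in> obj K" using mor_obj(2)[OF A] by simp
 have 1: "Tmor W X (d_ob V \<odot> mval a) = ?A oo a" using a by (intro tmor.expand) (simp add: typed_val)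
 have 2: "topo X k Y oo a = topo X k W" using topo_whisker[OF co a(1,3)] a by simp
 have 3: "tbx k ?A ?A oo a = tbx k (?A oo a) (?A oo a)" using box_whisker(1)[OF co A _ A _ refl a(1)] a by simp
 have 4: "(gT X oo ?A) oo a = gT X oo ?A oo a" using a by simp
 have "tdo W X k (whisker_dobj K V (mval a)) = \<lparr>d_ob = ?A oo a, d_zero = Tarr (topo X k W) (?A oo a) (d_zero V \<lhd> mval a),
   d_add = Tarr (tbx k (?A oo a) (?A oo a)) (?A oo a) (d_add V \<lhd> mval a), d_proj = Tarr (gT X oo ?A oo a) (?A oo a) (d_proj V \<lhd> mval a)\<rparr>"
  by (simp add: tdo_def Let_def whisker_dobj_def 1)
 also have "\<dots> = twh (tdo Y X k V) a"
  unfolding twh_def tdo_sel by (simp add: rw_def 2 3 4)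
 finally show ?thesis .
qed

definition dob_ob where
 "dob_ob C W X = {D. pointwise_product K W X (cT C (d_ob D)) (cp C (d_ob D)) (d_proj D) (d_ob D) (d_ob D) & differential_object C D}"

lemma dob_ob_iff_pdob:
 assumes h: "hct C W X k" and co: "cartesian_object K X k" and W: "W \<in> obj K"
 shows "D \<in> dob_ob C W X \<longleftrightarrow> pdob k (tdo W X k D)"
proof -
 let ?D = "tdo W X k D" and ?A = "Tmor W X (d_ob D)"
 let ?h = "d_proj ?D"
 note hd = hctD[OF h]
 have di: "differential_object C D \<longleftrightarrow> dob k ?A (d_zero ?D) (d_add ?D) ?h"
  unfolding tdo_sel by (rule differential_object_iff_dob[OF h co W refl refl refl refl])
 have X [simp]: "X \<in> obj K" using cart_types[OF co] by simp
 have "pointwise_product K W X (cT C (d_ob D)) (cp C (d_ob D)) (d_proj D) (d_ob D) (d_ob D) \<longleftrightarrow>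
   (\<forall>w. mor w & mtrg w = W --> tprod (gp X<|?A<|w) (?h<|w))" if d: "dob k (d_ob ?D) (d_zero ?D) (d_add ?D) (d_proj ?D)"
 proof -
  note D = dobD(1-10)[OF d, unfolded tdo_sel(1), of X W, simplified]
  have Am [simp]: "mor ?A" and hm [simp]: "cel ?h" "tdom ?h = gT X oo ?A" "tcod ?h = ?A" using D by (simp_all add: tdo_sel)
  have hv: "tval ?h = d_proj D" by (simp add: tdo_sel)
  have 1: "is_product (homcat K W X) (cT C (d_ob D)) (cp C (d_ob D)) (d_proj D) (d_ob D) (d_ob D)"
   using dobD(20)[OF d, of X W] by (subst is_product_tprod[where a = "gp X<|?A" and b = ?h]) (simp_all add: hd typed_val g_val hv, simp_all add: tdo_sel)
  have 2: "is_product (homcat K U X) (cT C (d_ob D) \<odot> F) (cp C (d_ob D) \<lhd> F) (d_proj D \<lhd> F) (d_ob D \<odot> F) (d_ob D \<odot> F) \<longleftrightarrow>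
    tprod (gp X<|?A<|w) (?h<|w)" if w: "w = Tmor U W F" "mor w" for U F w
  proof -
   have v: "mval ((gT X oo ?A) oo w) = cT C (d_ob D) \<odot> F" "tval ((gp X<|?A)<|w) = cp C (d_ob D) \<lhd> F"
    by (simp_all only: typed_val hd g_val w tmor.sel)
   show ?thesis
    using w(2) v by (intro is_product_tprod) (simp_all add: w(1) typed_val hv)
  qed
  show ?thesis unfolding pointwise_product_def
  proof (intro iffI conjI 1 ballI allI impI; (elim conjE)?)
   fix w assume a: "\<forall>U\<in>obj K. \<forall>F\<in>hom1 K U W. is_product (homcat K U X) (cT C (d_ob D) \<odot> F) (cp C (d_ob D) \<lhd> F) (d_proj D \<lhd> F) (d_ob D \<odot> F) (d_ob D \<odot> F)"
    and w: "mor w" "mtrg w = W"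
   have "w = Tmor (msrc w) W (mval w)" using w by (intro tmor_eta) simp_all
   moreover have "msrc w \<in> obj K" "mval w \<in> hom1 K (msrc w) W" using w mor_obj[OF w(1)] by (auto simp: mor_def simp del: mor_obj)
   ultimately show "tprod (gp X<|?A<|w) (?h<|w)" using a 2[of w "msrc w" "mval w"] w by blast
  next
   fix U F assume a: "\<forall>w. mor w & mtrg w = W --> tprod (gp X<|?A<|w) (?h<|w)" and U: "U \<in> obj K" "F \<in> hom1 K U W"
   have "mor (Tmor U W F)" using U W by (simp add: mor_def)
   then show "is_product (homcat K U X) (cT C (d_ob D) \<odot> F) (cp C (d_ob D) \<lhd> F) (d_proj D \<lhd> F) (d_ob D \<odot> F) (d_ob D \<odot> F)"
    using a 2[OF refl] by simp
  qed
 qed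
 then show ?thesis unfolding dob_ob_def pdob_def using di by (auto simp: tdo_sel(1))
qed

definition untdo :: "(('o, 'm) tmor, (('o, 'm) tmor, 'c) tarr) dobj => ('m, 'c) dobj" where
 "untdo D = \<lparr>d_ob = mval (d_ob D), d_zero = tval (d_zero D), d_add = tval (d_add D), d_proj = tval (d_proj D)\<rparr>"

lemma untdo_tdo: "untdo (tdo W X k D) = D"
 by (simp add: untdo_def tdo_sel)

lemma tdo_untdo:
 assumes "pdob k D" "msrc (d_ob D) = W" "mtrg (d_ob D) = X"
 shows "tdo W X k (untdo D) = D"
proof -
 note d = dobD(1-10)[OF assms(1)[unfolded pdob_def, THEN conjunct1] assms(3,2)]
 have "Tmor W X (mval (d_ob D)) = d_ob D" using assms(2,3) by (intro tmor.expand) simp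
 then show ?thesis using d by (intro dobj.equality) (auto simp: tdo_sel untdo_def intro: tarr.expand)
qed

text \<open>Objects and arrows of \<open>DO[W | X]\<close> are the pointwise differential objects and the linear cells, so bijectivity on objects and on hom-sets gives existence and uniqueness of the lifts.\<close>

lemma udobI:
 assumes co: "cartesian_object K X k" and coY: "cartesian_object K Y kY"
  and h: "!!W. W \<in> obj K ==> hct (C W) W X k" and iso: "tiso (ga (Tmor Y X (d_ob V)))" and V: "V \<in> dob_ob (C Y) Y X"
  and ob: "!!W. W \<in> obj K ==> bij_betw (whisker_dobj K V) (hom1 K W Y) (dob_ob (C W) W X)"
  and ar: "!!W A B. [|W \<in> obj K; A \<in> hom1 K W Y; B \<in> hom1 K W Y|] ==>
   bij_betw (%\<phi>. d_ob V \<rhd> \<phi>) (hom2 K W Y A B) {f. linear_arrow (C W) (whisker_dobj K V A) (whisker_dobj K V B) f}"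
 shows "udob k kY (tdo Y X k V)"
proof -
 let ?V = "tdo Y X k V" and ?U = "Tmor Y X (d_ob V)"
 have Y [simp]: "Y \<in> obj K" and X [simp]: "X \<in> obj K" using cart_types[OF coY] cart_types[OF co] by simp_all
 have pV: "pdob k ?V" using V dob_ob_iff_pdob[OF h[OF Y] co Y] by simp
 note dV = pV[unfolded pdob_def, THEN conjunct1, unfolded tdo_sel(1)]
 note DV = dobD(1-10)[OF dV, of X Y, simplified]
 note wh = tdo_whisker[OF co dV]
 have p: "pdob k (twh ?V a)" if a: "mor a" "mtrg a = Y" for a
 proof -
  have W: "msrc a \<in> obj K" using mor_obj[OF a(1)] by simp
  have "mval a \<in> hom1 K (msrc a) Y" using a by (auto simp: mor_def simp del: mor_obj)
  then have "whisker_dobj K V (mval a) \<in> dob_ob (C (msrc a)) (msrc a) X" using bij_betwE[OF ob[OF W]] by blast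
  then show ?thesis unfolding dob_ob_iff_pdob[OF h[OF W] co W] wh[OF a(1) refl a(2)] .
 qed
 have u: "\<exists>!a. mor a & msrc a = msrc (d_ob D) & mtrg a = Y & twh ?V a = D" if D: "pdob k D" "mtrg (d_ob D) = X" for D
 proof -
  let ?W = "msrc (d_ob D)"
  have W: "?W \<in> obj K" using mor_obj(1)[OF dobD(1)[OF D(1)[unfolded pdob_def, THEN conjunct1] refl refl]] .
  have "untdo D \<in> dob_ob (C ?W) ?W X" unfolding dob_ob_iff_pdob[OF h[OF W] co W] tdo_untdo[OF D(1) refl D(2)] by (rule D(1))
  then obtain F where F: "F \<in> hom1 K ?W Y" "whisker_dobj K V F = untdo D"
   and un: "!!G. G \<in> hom1 K ?W Y ==> whisker_dobj K V G = untdo D ==> G = F"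
   using ob[OF W] unfolding bij_betw_def inj_on_def by (metis (no_types, lifting) imageE)
  have m: "mor (Tmor ?W Y F)" using hom1_iff_mor[OF W Y] F by simp
  show ?thesis
  proof (rule ex1I[of _ "Tmor ?W Y F"])
   show "mor (Tmor ?W Y F) & msrc (Tmor ?W Y F) = ?W & mtrg (Tmor ?W Y F) = Y & twh ?V (Tmor ?W Y F) = D"
    using m wh[OF m] F(2) tdo_untdo[OF D(1) refl D(2)] by simp
   fix a assume a: "mor a & msrc a = ?W & mtrg a = Y & twh ?V a = D"
   note a1 = a[THEN conjunct1] and a2 = a[THEN conjunct2, THEN conjunct1] and a3 = a[THEN conjunct2, THEN conjunct2]
   have "untdo (tdo ?W X k (whisker_dobj K V (mval a))) = untdo D" unfolding wh[OF a1 a2 a3[THEN conjunct1]] a3[THEN conjunct2] ..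
   then have "whisker_dobj K V (mval a) = untdo D" unfolding untdo_tdo .
   moreover have "mval a \<in> hom1 K ?W Y" using a1 a2 a3[THEN conjunct1] by (auto simp: mor_def simp del: mor_obj)
   ultimately have "mval a = F" by (intro un)
   then show "a = Tmor ?W Y F" using a2 a3[THEN conjunct1] by (intro tmor.expand) simp
  qed
 qed
 have l: "\<exists>!t. cel t & tdom t = a & tcod t = b & ?U|>t = f"
  if a: "mor a" "mtrg a = Y" and b: "mor b" "mtrg b = Y" "msrc b = msrc a"
   and f: "cel f" "tdom f = ?U oo a" "tcod f = ?U oo b" and lin: "f**(d_proj ?V<|a) = (d_proj ?V<|b)**(gT X|>f)" for a b f
 proof -
  let ?W = "msrc a"
  have W: "?W \<in> obj K" using mor_obj[OF a(1)] by simp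
  have ab: "mval a \<in> hom1 K ?W Y" "mval b \<in> hom1 K ?W Y" using a b by (auto simp: mor_def simp del: mor_obj)
  have UA: "?U oo a = Tmor ?W X (d_ob (whisker_dobj K V (mval a)))" "?U oo b = Tmor ?W X (d_ob (whisker_dobj K V (mval b)))"
   using b by (auto intro!: tmor.expand simp: whisker_dobj_def typed_val)
  have fe: "f = Tarr (?U oo a) (?U oo b) (tval f)" using f by (cases f) simp
  have "linear_arrow (C ?W) (whisker_dobj K V (mval a)) (whisker_dobj K V (mval b)) (tval f) \<longleftrightarrow>
    cel (Tarr (?U oo a) (?U oo b) (tval f)) & Tarr (?U oo a) (?U oo b) (tval f)**(d_proj ?V<|a) = (d_proj ?V<|b)**(gT X|>Tarr (?U oo a) (?U oo b) (tval f))"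
   by (rule linear_arrow_iff[OF h[OF W] UA(1) _ UA(2)]) (use DV a b in simp_all, simp_all add: whisker_dobj_def typed_val tdo_sel(4))
  note la = this[folded fe]
  have "tval f \<in> {f. linear_arrow (C ?W) (whisker_dobj K V (mval a)) (whisker_dobj K V (mval b)) f}"
   unfolding mem_Collect_eq la by (intro conjI f(1) lin)
  note bj = ar[OF W ab]
  from this[THEN bij_betw_imp_surj_on] \<open>tval f \<in> _\<close>
  have "tval f \<in> (%\<phi>. d_ob V \<rhd> \<phi>) ` hom2 K ?W Y (mval a) (mval b)" by (simp only:)
  then obtain \<phi> where \<phi>: "\<phi> \<in> hom2 K ?W Y (mval a) (mval b)" "d_ob V \<rhd> \<phi> = tval f" by (elim imageE) simp
  have un: "\<psi> = \<phi>" if "\<psi> \<in> hom2 K ?W Y (mval a) (mval b)" "d_ob V \<rhd> \<psi> = tval f" for \<psi>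
   by (rule inj_onD[OF bij_betw_imp_inj_on[OF bj]]) (simp_all only: that \<phi>)
  have iff: "\<psi> \<in> hom2 K ?W Y (mval a) (mval b) \<longleftrightarrow> cel (Tarr a b \<psi>)" for \<psi>
   by (rule hom2_iff_cel) (use a b in simp_all)
  show ?thesis
  proof (rule ex1I[of _ "Tarr a b \<phi>"])
   have "cel (Tarr a b \<phi>)" using \<phi> iff by simp
   then show "cel (Tarr a b \<phi>) & tdom (Tarr a b \<phi>) = a & tcod (Tarr a b \<phi>) = b & ?U|>Tarr a b \<phi> = f"
    using \<phi> f DV(1) a by (auto intro!: tarr_eqI simp: typed_val)
   fix t assume t: "cel t & tdom t = a & tcod t = b & ?U|>t = f"
   then have te: "Tarr a b (tval t) = t" by (cases t) simp
   have "d_ob V \<rhd> tval t = tval (?U|>t)" by (simp add: typed_val)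
   also have "\<dots> = tval f" using t by simp
   finally have "tval t = \<phi>" using t by (intro un) (simp_all only: iff te)
   then show "t = Tarr a b \<phi>" using te by simp
  qed
 qed
 show ?thesis unfolding udob_def tdo_sel(1) tmor.sel
 proof (intro conjI allI impI co coY iso pV; elim conjE)
  fix a assume "mor a" "mtrg a = Y" then show "pdob k (twh ?V a)" by (rule p)
 next
  fix D :: "(('o, 'm) tmor, (('o, 'm) tmor, 'c) tarr) dobj" assume "pdob k D" "mtrg (d_ob D) = X"
  then show "\<exists>!a. mor a & msrc a = msrc (d_ob D) & mtrg a = Y & twh ?V a = D" by (rule u)
 next
  fix a b f assume "mor a" "mor b" "mtrg a = Y" "mtrg b = Y" "msrc b = msrc a" "cel f" "tdom f = ?U oo a" "tcod f = ?U oo b"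
   "f**(d_proj ?V<|a) = (d_proj ?V<|b)**(gT X|>f)"
  then show "\<exists>!t. cel t & tdom t = a & tcod t = b & ?U|>t = f" by (intro l)
 qed
qed

end

context cartesian_2_category
begin

section \<open>Tangentads as an instance of the abstract setting\<close>

text \<open>The axiom for \<open>c\<close> and \<open>T s\<close> involves the cell \<open>T T2 \<Rightarrow> T2 T\<close> induced by \<open>c\<close>, which is inverse to \<open>flip2\<close>. So it can be
 solved for \<open>s T\<close>.\<close>

lemma flip_sum:
 assumes X: "is_tangentad K X"
 shows "(tT X|>ts X)**tflip X = tc X**(ts X<|tT X)"
proof -
 note [simp] = tangentad_types[OF X] tflip_props(1)[OF X]
 note e = tangentad_eqs[OF X] and f = tflip_props(2,3)[OF X]
 note pb = T2_tpb(1)[OF X, of "tT X", simplified]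
 obtain r where r [simp]: "cel r" "tdom r = tT X oo tT2 X" "tcod r = tT2 X oo tT X"
    and re: "(tq1 X<|tT X)**r = tc X**(tT X|>tq1 X)" "(tq2 X<|tT X)**r = tc X**(tT X|>tq2 X)"
  by (rule tpb_ex[OF pb, of "tc X**(tT X|>tq1 X)" "tc X**(tT X|>tq2 X)"])
   (simp_all add: vc_pre[OF e(3)] vc_lw_eq[OF e(10)])
 have rf: "r**tflip X = cid (tT2 X oo tT X)"
  by (rule tpb_eqI[OF pb]) (simp_all add: vc_pre[OF re(1)] vc_pre[OF re(2)] f vc_pre[OF e(8)])
 have "(tc X**(tT X|>ts X))**tflip X = ts X<|tT X"
  unfolding tangentad_flip_add[OF X r re] by (simp add: rf)
 then have "tc X**tc X**(tT X|>ts X)**tflip X = tc X**(ts X<|tT X)" by simp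
 then show ?thesis by (simp add: vc_pre[OF e(8)])
qed

text \<open>The projections of \<open>T2\<close> are jointly monic after applying \<open>T\<close>, so they detect tangent 2-morphisms into \<open>T2 F\<close>.\<close>

lemma T2_tangent_cell:
 assumes X: "is_tangentad K X" and W: "is_tangentad K W" and f: "laxm W X f a" and u: "cel u" "tdom u = g" "tcod u = tT2 X oo f"
  and g: "cel b" "tdom b = g oo tT W" "tcod b = tT X oo g"
  and c: "(tT X|>((tq1 X<|f)**u))**b = ((tc X<|f)**(tT X|>a))**(((tq1 X<|f)**u)<|tT W)"
   "(tT X|>((tq2 X<|f)**u))**b = ((tc X<|f)**(tT X|>a))**(((tq2 X<|f)**u)<|tT W)"
 shows "(tT X|>u)**b = ((tflip X<|f)**(tT2 X|>a))**(u<|tT W)"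
proof -
 note [simp] = tangentad_types[OF X] tangentad_types[OF W] tflip_props(1)[OF X] laxmD(1-6)[OF f] u g
 note fl = tflip_props(2,3)[OF X]
 have g' [simp]: "msrc g = base W" "mtrg g = base X" using cel_mor(3,4)[OF u(1)] u by simp_all
 note pb = T2_tpb(2)[OF X laxmD(1,3)[OF f]]
 have q: "(tT X|>tq1 X<|f)**(tflip X<|f) = (tc X<|f)**(tq1 X<|tT X<|f)"
  "(tT X|>tq2 X<|f)**(tflip X<|f) = (tc X<|f)**(tq2 X<|tT X<|f)"
  using vc_rw_eq[OF fl(1), of f, simplified] vc_rw_eq[OF fl(2), of f, simplified] by simp_all
 have x: "(tq1 X<|tT X<|f)**(tT2 X|>a) = (tT X|>a)**(tq1 X<|f<|tT W)"
  "(tq2 X<|tT X<|f)**(tT2 X|>a) = (tT X|>a)**(tq2 X<|f<|tT W)"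
  using whisker_exchange[of "tq1 X" a] whisker_exchange[of "tq2 X" a] by simp_all
 show ?thesis
  by (rule tpb_eqI[OF pb]) (use c in \<open>simp_all add: vc_pre[OF q(1)] vc_pre[OF q(2)] vc_pre[OF x(1)] vc_pre[OF x(2)]\<close>)
qed

text \<open>The pullback \<open>T2 F\<close> of \<open>K\<close> is also a pullback among tangent 2-morphisms: the induced 2-cell satisfies the tangent
 condition because its two components do.\<close>

lemma tangent_2_category_Tng:
 "tangent_2_category (Tng K) (%X. (tanT X, tan_c X)) (%X. (tanT2 X, flip2 K X)) tan_q1 tan_q2 tan_p tan_z tan_s tan_l snd"
proof (rule tangent_2_category.intro[OF cartesian_2_category_Tng], rule tangent_2_category_axioms.intro)
 have flv: "tval (tflip X) = flip2 K X" for X by (simp add: tflip_def)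
 fix X assume "X \<in> obj (Tng K)"
 then have X: "is_tangentad K X" by simp
 note [simp] = tangentad_types[OF X] tflip_props(1)[OF X]
 note e = tangentad_eqs[OF X] and f = tflip_props(2,3)[OF X]
 have pc: "(tT X|>tp X)**tc X = tp X<|tT X" using arg_cong[OF e(3), of "%x. x**tc X"] by (simp add: e(8))
 have cz: "tT X|>tz X = tc X**(tz X<|tT X)" using arg_cong[OF e(4), of "%x. tc X**x"] by (simp add: vc_pre[OF e(8)])
 show T: "(tanT X, tan_c X) \<in> hom1 (Tng K) X X" by (rule hom1_Tng_I[OF X X laxm_T[OF X]]) (simp_all add: tan_val)
 show T2: "(tanT2 X, flip2 K X) \<in> hom1 (Tng K) X X" by (rule hom1_Tng_I[OF X X laxm_T2[OF X]]) (simp_all add: tan_val flv)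
 show "tan_q1 X \<in> hom2 (Tng K) X X (tanT2 X, flip2 K X) (tanT X, tan_c X)"
  by (rule hom2_Tng_I[of "tq1 X" _ _ "tflip X" _ "tc X"]) (use f(1) in \<open>simp_all add: tan_val flv\<close>)
 show "tan_q2 X \<in> hom2 (Tng K) X X (tanT2 X, flip2 K X) (tanT X, tan_c X)"
  by (rule hom2_Tng_I[of "tq2 X" _ _ "tflip X" _ "tc X"]) (use f(2) in \<open>simp_all add: tan_val flv\<close>)
 show "tan_p X \<in> hom2 (Tng K) X X (tanT X, tan_c X) (id1 (Tng K) X)"
  by (rule hom2_Tng_I[of "tp X" _ _ "tc X" _ "cid (tT X)"]) (use pc in \<open>simp_all add: tan_val typed_val\<close>)
 show "tan_z X \<in> hom2 (Tng K) X X (id1 (Tng K) X) (tanT X, tan_c X)"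
  by (rule hom2_Tng_I[of "tz X" _ _ "cid (tT X)" _ "tc X"]) (use cz in \<open>simp_all add: tan_val typed_val\<close>)
 show "tan_s X \<in> hom2 (Tng K) X X (tanT2 X, flip2 K X) (tanT X, tan_c X)"
  by (rule hom2_Tng_I[of "ts X" _ _ "tflip X" _ "tc X"]) (use flip_sum[OF X] in \<open>simp_all add: tan_val flv\<close>)
 show "tan_l X \<in> hom2 (Tng K) X X (tanT X, tan_c X) ((tanT X, tan_c X) \<odot>\<^bsub>Tng K\<^esub> (tanT X, tan_c X))"
  by (rule hom2_Tng_I[of "tl X" _ _ "tc X" _ "(tc X<|tT X)**(tT X|>tc X)"]) (use e(7) in \<open>simp_all add: tan_val typed_val\<close>)
 show "snd (id1 (Tng K) X) = id2 (Tng K) (tanT X, tan_c X)" by simp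
next
 have flv: "tval (tflip X) = flip2 K X" for X by (simp add: tflip_def)
 fix X W A assume "X \<in> obj (Tng K)" "W \<in> obj (Tng K)" and A: "A \<in> hom1 (Tng K) W X"
 then have X: "is_tangentad K X" and W: "is_tangentad K W" by simp_all
 interpret M: cartesian_2_category "Tng K" by (rule cartesian_2_category_Tng)
 note lA = lax_cases[OF W X A]
 let ?f = "mkf W X (fst A)" and ?a = "mka W X (fst A) (snd A)"
 note [simp] = tangentad_types[OF X] tangentad_types[OF W] tflip_props(1)[OF X] laxmD(1-6)[OF lA]
 note e = tangentad_eqs[OF X] and f = tflip_props(2,3)[OF X]
 have pc: "(tT X|>tp X)**tc X = tp X<|tT X" using arg_cong[OF e(3), of "%x. x**tc X"] by (simp add: e(8))
 define TA T2A IA where "TA = (tanT X, tan_c X) \<odot>\<^bsub>Tng K\<^esub> A" and "T2A = (tanT2 X, flip2 K X) \<odot>\<^bsub>Tng K\<^esub> A" and "IA = id1 (Tng K) X \<odot>\<^bsub>Tng K\<^esub> A"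
 have T: "(tanT X, tan_c X) \<in> hom1 (Tng K) X X" by (rule hom1_Tng_I[OF X X laxm_T[OF X]]) (simp_all add: tan_val)
 have T2: "(tanT2 X, flip2 K X) \<in> hom1 (Tng K) X X" by (rule hom1_Tng_I[OF X X laxm_T2[OF X]]) (simp_all add: tan_val flv)
 note hs = Tng_comp1_closed[OF W X X A T] Tng_comp1_closed[OF W X X A T2] Tng_comp1_closed[OF W X X A Tng_id1_closed[OF X]]
 note hs = hs[folded TA_def T2A_def IA_def]
 let ?Ta = "(tc X<|?f)**(tT X|>?a)" and ?T2a = "(tflip X<|?f)**(tT2 X|>?a)"
 have whk: "\<phi> \<lhd>\<^bsub>Tng K\<^esub> A \<in> hom2 (Tng K) W X (F \<odot>\<^bsub>Tng K\<^esub> A) (G \<odot>\<^bsub>Tng K\<^esub> A)"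
  if "\<phi> \<in> hom2 (Tng K) X X F G" "F \<in> hom1 (Tng K) X X" "G \<in> hom1 (Tng K) X X" for \<phi> F G
 proof -
  have "id2 (Tng K) A \<in> hom2 (Tng K) W X A A" using category.idn_closed[OF M.category_homcat[of W X], of A] A X W by (simp add: homcat_def)
  then show ?thesis unfolding rwhisker_def using M.hcomp_closed[of W X X A A F G "id2 (Tng K) A" \<phi>] that A X W by simp
 qed
 have q: "tan_q1 X \<lhd>\<^bsub>Tng K\<^esub> A \<in> hom2 (Tng K) W X T2A TA" "tan_q2 X \<lhd>\<^bsub>Tng K\<^esub> A \<in> hom2 (Tng K) W X T2A TA" "tan_p X \<lhd>\<^bsub>Tng K\<^esub> A \<in> hom2 (Tng K) W X TA IA"
 proof -
  show "tan_q1 X \<lhd>\<^bsub>Tng K\<^esub> A \<in> hom2 (Tng K) W X T2A TA"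
   unfolding TA_def T2A_def IA_def by (rule whk[OF hom2_Tng_I[of "tq1 X" _ _ "tflip X" _ "tc X"] T2 T]) (use f(1) in \<open>simp_all add: tan_val flv\<close>)
  show "tan_q2 X \<lhd>\<^bsub>Tng K\<^esub> A \<in> hom2 (Tng K) W X T2A TA"
   unfolding TA_def T2A_def IA_def by (rule whk[OF hom2_Tng_I[of "tq2 X" _ _ "tflip X" _ "tc X"] T2 T]) (use f(2) in \<open>simp_all add: tan_val flv\<close>)
  show "tan_p X \<lhd>\<^bsub>Tng K\<^esub> A \<in> hom2 (Tng K) W X TA IA"
   unfolding TA_def T2A_def IA_def by (rule whk[OF hom2_Tng_I[of "tp X" _ _ "tc X" _ "cid (tT X)"] T Tng_id1_closed[OF X]]) (use pc in \<open>simp_all add: tan_val typed_val\<close>)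
 qed
 have pb: "tpb (tq1 X<|?f) (tq2 X<|?f) (tp X<|?f) (tp X<|?f)" by (rule T2_tpb(1)[OF X]) simp_all
 note pbD = tpbD[OF pb]
 have mf: "mkf W X (fst TA) = tT X oo ?f" "mkf W X (fst T2A) = tT2 X oo ?f"
  by (auto intro!: tmor.expand simp: typed_val tan_val mk_val TA_def T2A_def)
 note [simp] = mf
 have TAv: "snd TA = tval ?Ta" "snd T2A = tval ?T2a" by (simp_all add: typed_val tan_val mk_val flv TA_def T2A_def)
 have ma: "mka W X (fst TA) (snd TA) = ?Ta" "mka W X (fst T2A) (snd T2A) = ?T2a"
  unfolding mka_def mf TAv by (rule tarr_eqI; simp)+
 have "is_pullback (homcat (Tng K) W X) T2A (tan_q1 X \<lhd>\<^bsub>Tng K\<^esub> A) (tan_q2 X \<lhd>\<^bsub>Tng K\<^esub> A) TA TA IA (tan_p X \<lhd>\<^bsub>Tng K\<^esub> A) (tan_p X \<lhd>\<^bsub>Tng K\<^esub> A)"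
  unfolding is_pullback_def
 proof (intro conjI ballI impI)
  show "cmp (homcat (Tng K) W X) (tan_p X \<lhd>\<^bsub>Tng K\<^esub> A) (tan_q1 X \<lhd>\<^bsub>Tng K\<^esub> A) = cmp (homcat (Tng K) W X) (tan_p X \<lhd>\<^bsub>Tng K\<^esub> A) (tan_q2 X \<lhd>\<^bsub>Tng K\<^esub> A)"
   using arg_cong[OF pbD(9), of tval] by (simp add: homcat_def typed_val tan_val mk_val)
  fix G x y assume "G \<in> Ob (homcat (Tng K) W X)" "x \<in> Arr (homcat (Tng K) W X) G TA" "y \<in> Arr (homcat (Tng K) W X) G TA"
   and eq0: "cmp (homcat (Tng K) W X) (tan_p X \<lhd>\<^bsub>Tng K\<^esub> A) x = cmp (homcat (Tng K) W X) (tan_p X \<lhd>\<^bsub>Tng K\<^esub> A) y"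
  then have G: "G \<in> hom1 (Tng K) W X" and x: "x \<in> hom2 (Tng K) W X G TA" and y: "y \<in> hom2 (Tng K) W X G TA" by (simp_all add: homcat_def)
  have eq: "(tan_p X \<lhd> fst A) \<bullet> x = (tan_p X \<lhd> fst A) \<bullet> y" using eq0 by (simp add: homcat_def)
  note lG = lax_cases[OF W X G]
  let ?g = "mkf W X (fst G)" and ?b = "mka W X (fst G) (snd G)" and ?x = "mkt W X G TA x" and ?y = "mkt W X G TA y"
  note cx = cell_cases[OF W X G hs(1) x, unfolded ma] and cy = cell_cases[OF W X G hs(1) y, unfolded ma]
  note [simp] = laxmD(1-6)[OF lG] cx(1) cy(1)
  have [simp]: "tdom ?x = ?g" "tcod ?x = tT X oo ?f" "tdom ?y = ?g" "tcod ?y = tT X oo ?f" by (simp_all only: mkt_sel mf)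
  have "(tp X<|?f)**?x = (tp X<|?f)**?y"
   by (rule tarr_eqI) (simp_all, simp add: typed_val tan_val mk_val mkt_val eq)
  then obtain u where u [simp]: "cel u" "tdom u = ?g" "tcod u = tT2 X oo ?f" and ue: "(tq1 X<|?f)**u = ?x" "(tq2 X<|?f)**u = ?y"
   by - (rule tpb_ex[OF pb, of ?x ?y], simp_all)
  show "\<exists>!u. u \<in> Arr (homcat (Tng K) W X) G T2A & cmp (homcat (Tng K) W X) (tan_q1 X \<lhd>\<^bsub>Tng K\<^esub> A) u = x & cmp (homcat (Tng K) W X) (tan_q2 X \<lhd>\<^bsub>Tng K\<^esub> A) u = y"
  proof (rule ex1I[of _ "tval u"])
   have "(tT X|>u)**?b = ?T2a**(u<|tT W)"
    by (rule T2_tangent_cell[OF X W lA u]) (use cx(2) cy(2) in \<open>simp_all add: ue\<close>)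
   then have "tval u \<in> hom2 (Tng K) W X G T2A" by (intro mkt_hom2[OF W X G hs(2)]) (simp_all only: u ma mf)
   moreover have "(tan_q1 X \<lhd> fst A) \<bullet> tval u = x" "(tan_q2 X \<lhd> fst A) \<bullet> tval u = y"
    using ue[THEN arg_cong[of _ _ tval]] by (simp_all only: typed_val tan_val mk_val mkt_val)
   ultimately show "tval u \<in> Arr (homcat (Tng K) W X) G T2A & cmp (homcat (Tng K) W X) (tan_q1 X \<lhd>\<^bsub>Tng K\<^esub> A) (tval u) = x & cmp (homcat (Tng K) W X) (tan_q2 X \<lhd>\<^bsub>Tng K\<^esub> A) (tval u) = y"
    by (simp add: homcat_def)
   fix v assume "v \<in> Arr (homcat (Tng K) W X) G T2A & cmp (homcat (Tng K) W X) (tan_q1 X \<lhd>\<^bsub>Tng K\<^esub> A) v = x & cmp (homcat (Tng K) W X) (tan_q2 X \<lhd>\<^bsub>Tng K\<^esub> A) v = y"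
   then have v: "v \<in> hom2 (Tng K) W X G T2A" and ve: "(tan_q1 X \<lhd> fst A) \<bullet> v = x" "(tan_q2 X \<lhd> fst A) \<bullet> v = y" by (simp_all add: homcat_def)
   let ?v = "mkt W X G T2A v"
   have cv [simp]: "cel ?v" "tdom ?v = ?g" "tcod ?v = tT2 X oo ?f" using cell_cases(1)[OF W X G hs(2) v] by (simp_all only: mkt_sel mf)
   have "(tq1 X<|?f)**?v = ?x" "(tq2 X<|?f)**?v = ?y"
    by (rule tarr_eqI; use cv in \<open>simp_all add: typed_val tan_val mk_val mkt_val ve del: mf\<close>; simp)+
   then have "?v = u" by - (rule tpb_eqI[OF pb], simp_all add: ue)
   then show "v = tval u" by (metis mkt_val)
  qed
 qed (use hs q in \<open>simp_all add: homcat_def\<close>)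
 then show "is_pullback (homcat (Tng K) W X) ((tanT2 X, flip2 K X) \<odot>\<^bsub>Tng K\<^esub> A) (tan_q1 X \<lhd>\<^bsub>Tng K\<^esub> A) (tan_q2 X \<lhd>\<^bsub>Tng K\<^esub> A)
   ((tanT X, tan_c X) \<odot>\<^bsub>Tng K\<^esub> A) ((tanT X, tan_c X) \<odot>\<^bsub>Tng K\<^esub> A) (id1 (Tng K) X \<odot>\<^bsub>Tng K\<^esub> A) (tan_p X \<lhd>\<^bsub>Tng K\<^esub> A) (tan_p X \<lhd>\<^bsub>Tng K\<^esub> A)"
  unfolding TA_def T2A_def IA_def .
next
 fix X Y F assume "X \<in> obj (Tng K)" "Y \<in> obj (Tng K)" and F: "F \<in> hom1 (Tng K) X Y"
 then have X: "is_tangentad K X" and Y: "is_tangentad K Y" by simp_all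
 note lF = lax_cases[OF X Y F]
 let ?f = "mkf X Y (fst F)" and ?a = "mka X Y (fst F) (snd F)"
 note [simp] = tangentad_types[OF X] tangentad_types[OF Y] tflip_props(1)[OF X] tflip_props(1)[OF Y] laxmD(1-6)[OF lF]
 note L = laxmD(7-10)[OF lF]
 have flv: "tval (tflip X) = flip2 K X" for X by (simp add: tflip_def)
 show "snd F \<in> hom2 (Tng K) X Y (F \<odot>\<^bsub>Tng K\<^esub> (tanT X, tan_c X)) ((tanT Y, tan_c Y) \<odot>\<^bsub>Tng K\<^esub> F)"
  by (rule hom2_Tng_I[of ?a _ _ "(?a<|tT X)**(?f|>tc X)" _ "(tc Y<|?f)**(tT Y|>?a)"])
   (use L(4) in \<open>simp_all add: typed_val tan_val mk_val\<close>)
 show "(tan_p Y \<lhd>\<^bsub>Tng K\<^esub> F) \<bullet>\<^bsub>Tng K\<^esub> snd F = F \<rhd>\<^bsub>Tng K\<^esub> tan_p X" "snd F \<bullet>\<^bsub>Tng K\<^esub> (F \<rhd>\<^bsub>Tng K\<^esub> tan_z X) = tan_z Y \<lhd>\<^bsub>Tng K\<^esub> F"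
  "(tan_l Y \<lhd>\<^bsub>Tng K\<^esub> F) \<bullet>\<^bsub>Tng K\<^esub> snd F = ((tanT Y, tan_c Y) \<rhd>\<^bsub>Tng K\<^esub> snd F) \<bullet>\<^bsub>Tng K\<^esub> (snd F \<lhd>\<^bsub>Tng K\<^esub> (tanT X, tan_c X)) \<bullet>\<^bsub>Tng K\<^esub> (F \<rhd>\<^bsub>Tng K\<^esub> tan_l X)"
  using L(1-3)[THEN arg_cong[of _ _ tval]] by (simp_all add: typed_val tan_val mk_val)
 obtain r where r [simp]: "cel r" "tdom r = ?f oo tT2 X" "tcod r = tT2 Y oo ?f"
  and re: "(tq1 Y<|?f)**r = ?a**(?f|>tq1 X)" "(tq2 Y<|?f)**r = ?a**(?f|>tq2 X)" "?a**(?f|>ts X) = (ts Y<|?f)**r"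
  by (rule laxm_s[OF lF])
 have x: "(tT Y|>?f|>t)**(?a<|tdom t) = (?a<|tcod t)**(?f|>tT X|>t)" if "cel t" "mtrg (tdom t) = base X" for t
  using whisker_exchange[of ?a t] that by simp
 have xq: "(tT Y|>?f|>tq1 X)**(?a<|tT2 X) = (?a<|tT X)**(?f|>tT X|>tq1 X)" "(tT Y|>?f|>tq2 X)**(?a<|tT2 X) = (?a<|tT X)**(?f|>tT X|>tq2 X)"
  using x[of "tq1 X"] x[of "tq2 X"] by simp_all
 note fl = tflip_props(2,3)[OF X]
 have cc: "(tT Y|>?a)**(?a<|tT X)**(?f|>tc X)**t = (tc Y<|?f)**(tT Y|>?a)**(?a<|tT X)**t"
  if "cel t" "tcod t = ?f oo tT X oo tT X" for t
  using arg_cong[OF L(4), of "%x. x**t"] that by simp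
 have "(tT Y|>r)**((?a<|tT2 X)**(?f|>tflip X)) = ((tflip Y<|?f)**(tT2 Y|>?a))**(r<|tT X)"
  by (rule T2_tangent_cell[OF Y X lF r])
   (simp_all add: re vc_pre[OF xq(1)] vc_pre[OF xq(2)] vc_lw_eq[OF fl(1)] vc_lw_eq[OF fl(2)] cc)
 then have rh: "tval r \<in> hom2 (Tng K) X Y (F \<odot>\<^bsub>Tng K\<^esub> (tanT2 X, flip2 K X)) ((tanT2 Y, flip2 K Y) \<odot>\<^bsub>Tng K\<^esub> F)"
  by (intro hom2_Tng_I[of r _ _ "(?a<|tT2 X)**(?f|>tflip X)" _ "(tflip Y<|?f)**(tT2 Y|>?a)"])
   (simp_all add: typed_val tan_val mk_val flv)
 show "\<exists>r\<in>hom2 (Tng K) X Y (F \<odot>\<^bsub>Tng K\<^esub> (tanT2 X, flip2 K X)) ((tanT2 Y, flip2 K Y) \<odot>\<^bsub>Tng K\<^esub> F).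
   (tan_q1 Y \<lhd>\<^bsub>Tng K\<^esub> F) \<bullet>\<^bsub>Tng K\<^esub> r = snd F \<bullet>\<^bsub>Tng K\<^esub> (F \<rhd>\<^bsub>Tng K\<^esub> tan_q1 X) & (tan_q2 Y \<lhd>\<^bsub>Tng K\<^esub> F) \<bullet>\<^bsub>Tng K\<^esub> r = snd F \<bullet>\<^bsub>Tng K\<^esub> (F \<rhd>\<^bsub>Tng K\<^esub> tan_q2 X) &
   snd F \<bullet>\<^bsub>Tng K\<^esub> (F \<rhd>\<^bsub>Tng K\<^esub> tan_s X) = (tan_s Y \<lhd>\<^bsub>Tng K\<^esub> F) \<bullet>\<^bsub>Tng K\<^esub> r"
  by (rule bexI[OF _ rh]) (use re[THEN arg_cong[of _ _ tval]] in \<open>simp add: typed_val tan_val mk_val\<close>)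
next
 fix X Y F G \<phi> assume "\<phi> \<in> hom2 (Tng K) X Y F G"
 then show "((tanT Y, tan_c Y) \<rhd>\<^bsub>Tng K\<^esub> \<phi>) \<bullet>\<^bsub>Tng K\<^esub> snd F = snd G \<bullet>\<^bsub>Tng K\<^esub> (\<phi> \<lhd>\<^bsub>Tng K\<^esub> (tanT X, tan_c X))" by (simp add: hom2_Tng_iff)
next
 fix X Y assume "X \<in> obj (Tng K)" "Y \<in> obj (Tng K)"
 then have X: "is_tangentad K X" and Y: "is_tangentad K Y" by simp_all
 note P = is_tangentad_product[OF X Y] and s = product_tangentad_strict[OF X Y]
 let ?P = "product_tangentad K X Y" and ?p = "pr1 (base X) (base Y)" and ?q = "pr2 (base X) (base Y)"
 note [simp] = tangentad_types[OF X] tangentad_types[OF Y] tangentad_types[OF P] s(2)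
 note s1 = strictly_simps[OF s(3,1) pretan_if_tangentad[OF X]] and s2 = strictly_simps[OF s(4,1) pretan_if_tangentad[OF Y]]
 have 1: "((cid (tT X oo ?p))<|tT ?P)**(?p|>tc ?P) = (tc X<|?p)**(tT X|>cid (tT X oo ?p))"
  "((cid (tT Y oo ?q))<|tT ?P)**(?q|>tc ?P) = (tc Y<|?q)**(tT Y|>cid (tT Y oo ?q))"
  using s1 s2 by simp_all
 show "pfst (Tng K) X Y \<odot>\<^bsub>Tng K\<^esub> (tanT (pobj (Tng K) X Y), tan_c (pobj (Tng K) X Y)) = (tanT X, tan_c X) \<odot>\<^bsub>Tng K\<^esub> pfst (Tng K) X Y"
  using arg_cong[OF 1(1), of tval] arg_cong[OF s1(4), of mval]
  by (simp only: typed_val tan_val pr_val Tng_sel Tng_psel fst_conv snd_conv prod.inject simp_thms)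
 show "psnd (Tng K) X Y \<odot>\<^bsub>Tng K\<^esub> (tanT (pobj (Tng K) X Y), tan_c (pobj (Tng K) X Y)) = (tanT Y, tan_c Y) \<odot>\<^bsub>Tng K\<^esub> psnd (Tng K) X Y"
  using arg_cong[OF 1(2), of tval] arg_cong[OF s2(4), of mval]
  by (simp only: typed_val tan_val pr_val Tng_sel Tng_psel fst_conv snd_conv prod.inject simp_thms)
qed simp_all

end

context tangent_2_category
begin

lemma fpres_mid:
 assumes co: "cartesian_object K X k" shows "fpres (mid X) k k"
 unfolding fpres_def typed_sel
proof (intro conjI allI impI ballI; (elim conjE)?)
 note [simp] = cart_types[OF co]
 fix A B assume A: "mor A" "mtrg A = X" and B: "mor B" "mtrg B = X" "msrc B = msrc A"
 then show "tprod (mid X|>tbx1 k A B) (mid X|>tbx2 k A B)" using tprod_bx[OF co A B] box[OF co A B] by simp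
next
 note [simp] = cart_types[OF co]
 fix W assume W: "W \<in> obj K"
 note t [simp] = top[OF co W]
 have "bng k (topo X k W) = cid (topo X k W)" by (rule bng_eq[OF co _ _ _ _ _ W]) (simp_all add: bng[OF co])
 then show "tiso (bng k (mid X oo topo X k W))" using tiso_cid[OF t(1)] by simp
qed

lemma fpres_comp:
 assumes co: "cartesian_object K X k" "cartesian_object K Y k'" "cartesian_object K Z k''"
  and f: "mor f" "msrc f = X" "mtrg f = Y" "fpres f k k'" and g: "mor g" "msrc g = Y" "mtrg g = Z" "fpres g k' k''"
 shows "fpres (g oo f) k k''"
 unfolding fpres_def
proof (intro conjI allI impI ballI; (elim conjE)?)
 note [simp] = cart_types(1)[OF co(1)] cart_types(1)[OF co(2)] cart_types(1)[OF co(3)] f(1-3) g(1-3)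
 fix A B assume "mor A" "mor B" "mtrg A = msrc (g oo f)" "mtrg B = msrc (g oo f)" "msrc B = msrc A"
 then have A: "mor A" "mtrg A = X" and B: "mor B" "mtrg B = X" "msrc B = msrc A" by simp_all
 note [simp] = A B box[OF co(1) A B]
 have "tprod (f|>tbx1 k A B) (f|>tbx2 k A B)" using f(4) unfolding fpres_def by simp
 from fpres_tprod[OF g(4,1) _ this] show "tprod ((g oo f)|>tbx1 k A B) ((g oo f)|>tbx2 k A B)"
  using co(2) by simp
next
 note [simp] = cart_types(1)[OF co(1)] cart_types(1)[OF co(2)] cart_types(1)[OF co(3)] f(1-3) g(1-3)
 fix W assume W: "W \<in> obj K"
 note [simp] = top[OF co(1) W] top[OF co(2) W] top[OF co(3) W]
 have 1: "tiso (bng k' (f oo topo X k W))" "tiso (bng k'' (g oo topo Y k' W))" using f(4) g(4) W unfolding fpres_def by simp_all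
 note b = bng[OF co(2), of "f oo topo X k W"] bng[OF co(3), of "g oo topo Y k' W"]
 have "tiso (bng k'' (g oo topo Y k' W)**(g|>bng k' (f oo topo X k W)))"
  by (rule tiso_vc[OF 1(2) tiso_lw[OF 1(1)]]) (use b in simp_all)
 then show "tiso (bng k'' ((g oo f) oo topo (msrc (g oo f)) k W))"
  using b by (simp add: bng_comp[OF co(3)])
qed

lemma lift_hcomp:
 assumes m: "mor U" "mor U'" "mor U''" "msrc U = A" "msrc U' = A'" "msrc U'' = A''" "mtrg U = B" "mtrg U' = B'" "mtrg U'' = B''"
  and t: "cel t" "msrc (tdom t) = B" "mtrg (tdom t) = B'" and r: "cel r" "msrc (tdom r) = B'" "mtrg (tdom r) = B''"
  and v: "cel v" "msrc (tdom v) = A" "mtrg (tdom v) = A'" and w: "cel w" "msrc (tdom w) = A'" "mtrg (tdom w) = A''"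
  and e: "U' oo tcod v = tcod t oo U" "U'' oo tdom w = tdom r oo U'" and vt: "U'|>v = t<|U" and wr: "U''|>w = r<|U'"
 shows "U''|>hc w v = hc r t<|U"
proof -
 note [simp] = m t r v w cel_mor[OF t(1)] cel_mor[OF r(1)] cel_mor[OF v(1)] cel_mor[OF w(1)]
 have "U''|>hc w v = ((U''|>w)<|tcod v)**((U'' oo tdom w)|>v)" unfolding hc_def by simp
 also have "\<dots> = (r<|(U' oo tcod v))**(tdom r|>(U'|>v))" unfolding wr e(2) by simp
 also have "\<dots> = hc r t<|U" unfolding e(1) vt hc_def by simp
 finally show ?thesis .
qed

end

context cartesian_2_category
begin

section \<open>The construction of differential objects as a 2-functor\<close>

interpretation M: tangent_2_category "Tng K" "%X. (tanT X, tan_c X)" "%X. (tanT2 X, flip2 K X)" tan_q1 tan_q2 tan_p tan_z tan_s tan_l snd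
 by (rule tangent_2_category_Tng)

lemma hct_Tng: "M.hct (hom_cart_tangent_cat K W (X, k)) W X k"
 unfolding M.hct_def hom_cart_tangent_cat_def
 by (simp add: hom_tangent_cat_def tangent_cat.extend_def split_beta Let_def)

text \<open>The inverse in \<open>K\<close> of a tangent 2-morphism is again a tangent 2-morphism.\<close>

lemma invertible_Tng:
 assumes X: "is_tangentad K X" and Y: "is_tangentad K Y" and A: "A \<in> hom1 (Tng K) X Y" and B: "B \<in> hom1 (Tng K) X Y"
  and t: "\<theta> \<in> hom2 (Tng K) X Y A B"
 shows "invertible_cell (Tng K) X Y A B \<theta> \<longleftrightarrow> invertible_cell K (base X) (base Y) (fst A) (fst B) \<theta>"
proof
 assume "invertible_cell (Tng K) X Y A B \<theta>"
 then show "invertible_cell K (base X) (base Y) (fst A) (fst B) \<theta>"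
  unfolding invertible_cell_def is_inverse_def by (simp add: homcat_def) (meson Tng_base_hom2)
next
 assume i: "invertible_cell K (base X) (base Y) (fst A) (fst B) \<theta>"
 note lA = lax_cases[OF X Y A] and lB = lax_cases[OF X Y B] and c = cell_cases[OF X Y A B t]
 note [simp] = tangentad_types[OF X] tangentad_types[OF Y] laxmD(1-6)[OF lA] laxmD(1-6)[OF lB] c(1)
 let ?t = "mkt X Y A B \<theta>" and ?a = "mka X Y (fst A) (snd A)" and ?b = "mka X Y (fst B) (snd B)"
 have "tiso ?t" using i invertible_cell_iff[OF c(1) refl refl, of "base X" "base Y" "fst A" "fst B" \<theta>] by (simp add: mk_val mkt_val)
 then obtain u where u: "tinv ?t u" unfolding tiso_def by blast
 have ty [simp]: "cel u" "tdom u = mkf X Y (fst B)" "tcod u = mkf X Y (fst A)" using tinvD(1)[OF u] by simp_all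
 have e: "?t**u = cid (mkf X Y (fst B))" "u**?t = cid (mkf X Y (fst A))" using tinvD(2,3)[OF u] by simp_all
 have 1: "(tT Y|>u)**(tT Y|>?t) = cid (tT Y oo mkf X Y (fst A))" using vc_lw_eq[OF e(2), of "tT Y"] by simp
 have 2: "(?t<|tT X)**(u<|tT X) = cid (mkf X Y (fst B) oo tT X)" using vc_rw_eq[OF e(1), of "tT X"] by simp
 have "(tT Y|>u)**?b = (tT Y|>u)**(?b**(?t<|tT X))**(u<|tT X)" by (simp add: 2)
 also have "\<dots> = ?a**(u<|tT X)" unfolding c(2)[symmetric] by (simp add: vc_pre[OF 1])
 finally have m: "tval u \<in> hom2 (Tng K) X Y B A" by (intro mkt_hom2[OF X Y B A]) simp_all
 have "tval u \<bullet> \<theta> = id2 K (fst A)" "\<theta> \<bullet> tval u = id2 K (fst B)"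
  using e[THEN arg_cong[of _ _ tval]] by (simp_all add: typed_val mk_val mkt_val)
 then show "invertible_cell (Tng K) X Y A B \<theta>"
  unfolding invertible_cell_def is_inverse_def using t m by (auto simp: homcat_def)
qed

lemma strong_iff:
 assumes X: "is_tangentad K X" and Y: "is_tangentad K Y" and F: "F \<in> hom1 (Tng K) X Y"
 shows "strong_tangent_morphism K X Y F \<longleftrightarrow> M.tiso (M.ga (Tmor X Y F))"
proof -
 have f: "M.mor (Tmor X Y F)" using M.hom1_iff_mor[of X Y F] X Y F by simp
 have g: "M.cel (M.ga (Tmor X Y F))" using f by simp
 have lx: "lax_tangent_morphism K X Y (fst F) (snd F)" using F by (auto simp: Tng_def)
 have TX: "(tanT X, tan_c X) \<in> hom1 (Tng K) X X" "(tanT Y, tan_c Y) \<in> hom1 (Tng K) Y Y" using M.T_hom X Y by simp_all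
 note h = Tng_comp1_closed[OF X X Y TX(1) F] Tng_comp1_closed[OF X Y Y F TX(2)]
 have al: "snd F \<in> hom2 (Tng K) X Y (F \<odot>\<^bsub>Tng K\<^esub> (tanT X, tan_c X)) ((tanT Y, tan_c Y) \<odot>\<^bsub>Tng K\<^esub> F)" using M.al_hom X Y F by simp
 have "invertible_cell (Tng K) X Y (F \<odot>\<^bsub>Tng K\<^esub> (tanT X, tan_c X)) ((tanT Y, tan_c Y) \<odot>\<^bsub>Tng K\<^esub> F) (snd F) \<longleftrightarrow> M.tiso (M.ga (Tmor X Y F))"
  by (rule M.invertible_cell_iff[OF g refl refl]) (use f X Y in \<open>simp_all add: M.typed_val M.g_val del: Tng_sel\<close>)
 moreover have "strong_tangent_morphism K X Y F \<longleftrightarrow> invertible_cell K (base X) (base Y) (fst F \<odot> tanT X) (tanT Y \<odot> fst F) (snd F)"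
  using lx by (cases F) (simp add: strong_tangent_morphism_def)
 ultimately show ?thesis using invertible_Tng[OF X Y h al] by simp
qed

lemma strict_is_strong:
 assumes X: "is_tangentad K X" and Y: "is_tangentad K Y" and F: "strict_tangent_morphism K X Y F"
 shows "F \<in> hom1 (Tng K) X Y" "strong_tangent_morphism K X Y F"
proof -
 obtain A a where Fe: "F = (A, a)" by (cases F)
 have s: "lax_tangent_morphism K X Y A a" "A \<odot> tanT X = tanT Y \<odot> A" "a = id2 K (A \<odot> tanT X)"
  using F unfolding Fe strict_tangent_morphism_def prod.case by blast+
 show h: "F \<in> hom1 (Tng K) X Y" using s(1) by (simp add: Tng_def Fe)
 note [simp] = tangentad_types[OF X] tangentad_types[OF Y] laxmD(1-6)[OF lax_cases[OF X Y h]]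
 let ?f = "mkf X Y A oo tT X"
 have f: "mor ?f" using laxmD(1)[OF lax_cases[OF X Y h]] by (simp add: Fe)
 have "invertible_cell K (base X) (base Y) (A \<odot> tanT X) (A \<odot> tanT X) (id2 K (A \<odot> tanT X)) \<longleftrightarrow> tiso (cid ?f)"
  by (rule invertible_cell_iff[of "cid ?f", OF _ refl refl]) (use f in \<open>simp_all add: typed_val tan_val mk_val\<close>)
 then have "invertible_cell K (base X) (base Y) (A \<odot> tanT X) (tanT Y \<odot> A) a"
  using tiso_cid[OF f] unfolding s(2)[symmetric] s(3) by blast
 then show "strong_tangent_morphism K X Y F" unfolding Fe strong_tangent_morphism_def prod.case using s(1) by blast
qed

lemma udob_construction:
 assumes co: "cartesian_object (Tng K) X k" and d: "differential_objects_construction K (X, k) (Y, kY) V"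
 shows "M.udob k kY (M.tdo Y X k V)"
proof -
 note D = d[unfolded differential_objects_construction_def fst_conv snd_conv]
 have coY: "cartesian_object (Tng K) Y kY" using D by blast
 have X: "is_tangentad K X" and Y: "is_tangentad K Y" using co coY unfolding cartesian_object_def by simp_all
 note st = strict_is_strong[OF Y X, of "d_ob V"]
 have iso: "M.tiso (M.ga (Tmor Y X (d_ob V)))" using D st strong_iff[OF Y X] by blast
 let ?C = "%W. hom_cart_tangent_cat K W (X, k)"
 have ob: "Ob (pointwise_DO K W (X, k)) = M.dob_ob (?C W) W X" for W
  unfolding pointwise_DO_def DO_cat_def M.dob_ob_def by (simp add: Let_def)
 have ar: "Arr (pointwise_DO K W (X, k)) A B = {f. linear_arrow (?C W) A B f}" for W A B
  unfolding pointwise_DO_def DO_cat_def by (simp add: Let_def)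
 have hm: "Ob (hom_tangent_cat K W Y) = hom1 (Tng K) W Y" "Arr (hom_tangent_cat K W Y) = hom2 (Tng K) W Y" for W
  by (simp_all add: hom_tangent_cat_def)
 have iso2: "tangent_cat_iso (hom_tangent_cat K W Y) (pointwise_DO K W (X, k)) (whisker_dobj (Tng K) V) (%\<phi>. d_ob V \<rhd>\<^bsub>Tng K\<^esub> \<phi>)" if "W \<in> obj (Tng K)" for W
  using D that by blast
 show ?thesis
 proof (rule M.udobI[OF co coY hct_Tng iso])
  show "V \<in> M.dob_ob (?C Y) Y X" using D unfolding ob by blast
  fix W assume W: "W \<in> obj (Tng K)"
  show "bij_betw (whisker_dobj (Tng K) V) (hom1 (Tng K) W Y) (M.dob_ob (?C W) W X)"
   using tangent_cat_iso.bij_ob[OF iso2[OF W]] unfolding ob hm .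
  fix A B assume "A \<in> hom1 (Tng K) W Y" "B \<in> hom1 (Tng K) W Y"
  then show "bij_betw (%\<phi>. d_ob V \<rhd>\<^bsub>Tng K\<^esub> \<phi>) (hom2 (Tng K) W Y A B) {f. linear_arrow (?C W) (whisker_dobj (Tng K) V A) (whisker_dobj (Tng K) V B) f}"
   using tangent_cat_iso.bij_arr[OF iso2[OF W], of A B] unfolding ar hm by blast
 qed
qed

text \<open>A universal differential object is chosen for every \<open>X\<close>; \<open>H X Y F\<close> and \<open>w X Y F G \<theta>\<close> are then the unique lifts of \<open>F\<close> and
 of \<open>\<theta>\<close>, and each law of a 2-functor is an instance of their uniqueness.\<close>

lemma DO_two_functor:
 assumes DO: "!!X. X \<in> obj (cTng_strong K) ==> is_tangentad_of_differential_objects K X (DO X)"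
 shows "\<exists>\<Phi>. two_functor (cTng_strong K) (cTng_strong K) \<Phi> &
  (\<forall>X\<in>obj (cTng_strong K). fobj \<Phi> X = DO X) &
  (\<forall>X\<in>obj (cTng_strong K). \<forall>X'\<in>obj (cTng_strong K). \<forall>F\<in>hom1 (cTng_strong K) X X'.
    strong_tangent_morphism K (fst (DO X)) (fst (DO X')) (fmor \<Phi> X X' F))"
proof -
 let ?N = "cTng_strong K"
 have N [simp]: "obj ?N = {X. cartesian_object (Tng K) (fst X) (snd X)}" "id1 ?N X = id1 (Tng K) (fst X)" "comp1 ?N = comp1 (Tng K)"
  "id2 ?N = id2 (Tng K)" "vcomp ?N = vcomp (Tng K)" "hcomp ?N = hcomp (Tng K)" for X
  by (auto simp: cTng_strong_def split_beta simp del: Tng_sel)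
 define f where "f X Y F = Tmor (fst X) (fst Y) F" for X Y :: "('o, 'm, 'c) cart_tangentad" and F :: "'m \<times> 'c"
 have cob: "fst X \<in> obj (Tng K)" "is_tangentad K (fst X)" if "X \<in> obj ?N" for X
  using that by (auto simp: cartesian_object_def)
 have h1: "F \<in> hom1 ?N X Y \<longleftrightarrow> M.mor (f X Y F) & M.tiso (M.ga (f X Y F)) & M.fpres (f X Y F) (snd X) (snd Y)"
  if X: "X \<in> obj ?N" and Y: "Y \<in> obj ?N" for X Y F
 proof -
  have co: "cartesian_object (Tng K) (fst X) (snd X)" "cartesian_object (Tng K) (fst Y) (snd Y)" using X Y by simp_all
  have m: "F \<in> hom1 (Tng K) (fst X) (fst Y) \<longleftrightarrow> M.mor (f X Y F)" unfolding f_def by (rule M.hom1_iff_mor[OF cob(1)[OF X] cob(1)[OF Y]])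
  have lax: "strong_tangent_morphism K (fst X) (fst Y) F ==> F \<in> hom1 (Tng K) (fst X) (fst Y)"
   by (cases F) (simp add: strong_tangent_morphism_def Tng_def)
  have s: "strong_tangent_morphism K (fst X) (fst Y) F \<longleftrightarrow> M.tiso (M.ga (f X Y F))" if "M.mor (f X Y F)"
   unfolding f_def by (rule strong_iff[OF cob(2)[OF X] cob(2)[OF Y]]) (use m that in simp)
  have p: "preserves_products (Tng K) (fst X) (snd X) (fst Y) (snd Y) F \<longleftrightarrow> M.fpres (f X Y F) (snd X) (snd Y)" if "M.mor (f X Y F)"
   using M.preserves_products_iff_fpres[OF co that] by (simp add: f_def)
  have "F \<in> hom1 ?N X Y \<longleftrightarrow> strong_tangent_morphism K (fst X) (fst Y) F & preserves_products (Tng K) (fst X) (snd X) (fst Y) (snd Y) F"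
   by (simp add: cTng_strong_def split_beta)
  then show ?thesis using lax m s p by blast
 qed
 have h2: "\<phi> \<in> hom2 ?N X Y F G \<longleftrightarrow> M.cel (Tarr (f X Y F) (f X Y G) \<phi>)"
  if X: "X \<in> obj ?N" and Y: "Y \<in> obj ?N" and F: "F \<in> hom1 ?N X Y" and G: "G \<in> hom1 ?N X Y" for X Y F G \<phi>
 proof -
  have co: "cartesian_object (Tng K) (fst X) (snd X)" "cartesian_object (Tng K) (fst Y) (snd Y)" using X Y by simp_all
  have fg: "M.mor (f X Y F)" "M.mor (f X Y G)" using h1[OF X Y] F G by blast+
  have m: "\<phi> \<in> hom2 (Tng K) (fst X) (fst Y) F G \<longleftrightarrow> M.cel (Tarr (f X Y F) (f X Y G) \<phi>)"
   by (rule M.hom2_iff_cel[OF fg]) (simp_all add: f_def)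
  have c: "compatible_cell (Tng K) (fst X) (snd X) (fst Y) (snd Y) F G \<phi>" if "M.cel (Tarr (f X Y F) (f X Y G) \<phi>)"
   using M.compatible_cell_always[OF co fg(1) _ _ fg(2) _ _ that] by (simp add: f_def)
  have "\<phi> \<in> hom2 ?N X Y F G \<longleftrightarrow> \<phi> \<in> hom2 (Tng K) (fst X) (fst Y) F G & compatible_cell (Tng K) (fst X) (snd X) (fst Y) (snd Y) F G \<phi>"
   by (simp add: cTng_strong_def split_beta Tng_def)
  then show ?thesis using m c by blast
 qed
 have "\<exists>V. differential_objects_construction K X (DO X) V" if "X \<in> obj ?N" for X
  using DO[OF that] unfolding is_tangentad_of_differential_objects_def .
 then obtain V0 where V0: "!!X. X \<in> obj ?N ==> differential_objects_construction K X (DO X) (V0 X)" by metis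
 define V where "V X = M.tdo (fst (DO X)) (fst X) (snd X) (V0 X)" for X
 define U where "U X = d_ob (V X)" for X
 have u: "M.udob (snd X) (snd (DO X)) (V X)" "d_ob (V X) = U X" "mtrg (U X) = fst X" "msrc (U X) = fst (DO X)" if X: "X \<in> obj ?N" for X
  using udob_construction[of "fst X" "snd X" "fst (DO X)" "snd (DO X)" "V0 X"] V0[OF X] X unfolding V_def U_def by (simp_all add: M.tdo_sel)
 have ob: "DO X \<in> obj ?N" if X: "X \<in> obj ?N" for X
  using V0[OF X] by (simp add: differential_objects_construction_def)
 let ?L = "%X Y F. M.lifts (f X Y F) (snd X) (snd Y) (V X) (V Y)"
 define H where "H X Y F = (THE h. ?L X Y F h)" for X Y F
 have fm: "M.mor (f X Y F)" "msrc (f X Y F) = fst X" "mtrg (f X Y F) = fst Y" "M.tiso (M.ga (f X Y F))" "M.fpres (f X Y F) (snd X) (snd Y)"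
  if "X \<in> obj ?N" "Y \<in> obj ?N" "F \<in> hom1 ?N X Y" for X Y F using h1[OF that(1,2)] that(3) by (simp_all add: f_def)
 have L: "\<exists>!h. ?L X Y F h" if XY: "X \<in> obj ?N" "Y \<in> obj ?N" "F \<in> hom1 ?N X Y" for X Y F
  using M.udob_mor[OF u[OF XY(1)] refl u[OF XY(2)] refl fm(1-3)[OF XY] fm(5,4)[OF XY]] u(2,4)[OF XY(1)] u(2,4)[OF XY(2)]
  unfolding M.lifts_def by simp
 have HL: "?L X Y F (H X Y F)" if "X \<in> obj ?N" "Y \<in> obj ?N" "F \<in> hom1 ?N X Y" for X Y F
  unfolding H_def by (rule theI'[OF L[OF that]])
 have HU: "h = H X Y F" if "X \<in> obj ?N" "Y \<in> obj ?N" "F \<in> hom1 ?N X Y" "?L X Y F h" for X Y F h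
  using L[OF that(1-3)] HL[OF that(1-3)] that(4) by blast
 have Hm: "M.mor (H X Y F)" "msrc (H X Y F) = fst (DO X)" "mtrg (H X Y F) = fst (DO Y)" "M.mcomp (U Y) (H X Y F) = M.mcomp (f X Y F) (U X)"
  if XY: "X \<in> obj ?N" "Y \<in> obj ?N" "F \<in> hom1 ?N X Y" for X Y F
  using M.liftsD(1-4)[OF HL[OF XY] u(2)[OF XY(1)] u(2)[OF XY(2)] u(4)[OF XY(1)] u(4)[OF XY(2)] u(3)[OF XY(2)] fm(3)[OF XY] refl refl] by simp_all
 have Hf: "f (DO X) (DO Y) (mval (H X Y F)) = H X Y F" if XY: "X \<in> obj ?N" "Y \<in> obj ?N" "F \<in> hom1 ?N X Y" for X Y F
  using Hm[OF XY] unfolding f_def by (intro tmor.expand) simp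
 have Hc: "mval (H X Y F) \<in> hom1 ?N (DO X) (DO Y)" if XY: "X \<in> obj ?N" "Y \<in> obj ?N" "F \<in> hom1 ?N X Y" for X Y F
  unfolding h1[OF ob[OF XY(1)] ob[OF XY(2)]] Hf[OF XY]
  using Hm(1)[OF XY] M.lift_strong[OF u[OF XY(1)] refl u[OF XY(2)] refl fm(1-4)[OF XY] HL[OF XY]]
   M.lift_fpres[OF u[OF XY(1)] refl u[OF XY(2)] refl fm(1-3,5)[OF XY] HL[OF XY]] by blast
 let ?P = "%X Y F G t w. M.cel w & tdom w = H X Y F & tcod w = H X Y G & M.lw (U Y) w = M.rw t (U X)"
 define c where "c X Y F G \<theta> = Tarr (f X Y F) (f X Y G) \<theta>" for X Y F G and \<theta> :: 'c
 define w where "w X Y F G \<theta> = (THE w. ?P X Y F G (c X Y F G \<theta>) w)" for X Y F G \<theta>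
 have cc: "M.cel (c X Y F G \<theta>)" "tdom (c X Y F G \<theta>) = f X Y F" "tcod (c X Y F G \<theta>) = f X Y G" "tval (c X Y F G \<theta>) = \<theta>"
  if "X \<in> obj ?N" "Y \<in> obj ?N" "F \<in> hom1 ?N X Y" "G \<in> hom1 ?N X Y" "\<theta> \<in> hom2 ?N X Y F G" for X Y F G \<theta>
  using h2[OF that(1-4)] that(5) unfolding c_def by simp_all
 have W: "\<exists>!w. ?P X Y F G (c X Y F G \<theta>) w"
  if XY: "X \<in> obj ?N" "Y \<in> obj ?N" and F: "F \<in> hom1 ?N X Y" and G: "G \<in> hom1 ?N X Y" and t: "\<theta> \<in> hom2 ?N X Y F G" for X Y F G \<theta>
  by (rule M.lift_cell[OF u[OF XY(1)] refl u[OF XY(2)] refl fm(1-4)[OF XY F] HL[OF XY F] fm(1-3)[OF XY G] HL[OF XY G] cc(1-3)[OF XY F G t]])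
 have wP: "?P X Y F G (c X Y F G \<theta>) (w X Y F G \<theta>)"
  if XY: "X \<in> obj ?N" "Y \<in> obj ?N" and F: "F \<in> hom1 ?N X Y" and G: "G \<in> hom1 ?N X Y" and t: "\<theta> \<in> hom2 ?N X Y F G" for X Y F G \<theta>
  unfolding w_def by (rule theI'[OF W[OF XY F G t]])
 have wU: "v = w X Y F G \<theta>"
  if XY: "X \<in> obj ?N" "Y \<in> obj ?N" and F: "F \<in> hom1 ?N X Y" and G: "G \<in> hom1 ?N X Y" and t: "\<theta> \<in> hom2 ?N X Y F G"
   and v: "?P X Y F G (c X Y F G \<theta>) v" for X Y F G \<theta> v
  using W[OF XY F G t] wP[OF XY F G t] v by blast
 have Um: "M.mor (U X)" "mtrg (U X) = fst X" "msrc (U X) = fst (DO X)" if X: "X \<in> obj ?N" for X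
  using M.udobD(5)[OF u[OF X] refl] u(3,4)[OF X] by simp_all
 define \<Phi> where "\<Phi> = \<lparr>fobj = DO, fmor = (%X Y F. mval (H X Y F)), fcell = (%X Y F G \<theta>. tval (w X Y F G \<theta>))\<rparr>"
 have \<Phi> [simp]: "fobj \<Phi> = DO" "fmor \<Phi> X Y F = mval (H X Y F)" "fcell \<Phi> X Y F G \<theta> = tval (w X Y F G \<theta>)" for X Y F G \<theta>
  by (simp_all add: \<Phi>_def)
 have cid: "f X X (id1 ?N X) = M.mid (fst X)" if "X \<in> obj ?N" for X
  by (intro tmor.expand) (simp add: f_def M.typed_val del: Tng_sel)
 have ccm: "f X Z (G \<odot>\<^bsub>?N\<^esub> F) = M.mcomp (f Y Z G) (f X Y F)" for X Y Z F G
  by (intro tmor.expand) (simp add: f_def M.typed_val del: Tng_sel)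
 have id1c: "id1 ?N X \<in> hom1 ?N X X" if X: "X \<in> obj ?N" for X
  unfolding h1[OF X X] cid[OF X] using M.fpres_mid[of "fst X" "snd X"] M.tiso_cid[of "M.gT (fst X)"] cob(1)[OF X] X by (simp add: M.ga_mid)
 have comp1c: "G \<odot>\<^bsub>?N\<^esub> F \<in> hom1 ?N X Z"
  if XYZ: "X \<in> obj ?N" "Y \<in> obj ?N" "Z \<in> obj ?N" and F: "F \<in> hom1 ?N X Y" and G: "G \<in> hom1 ?N Y Z" for X Y Z F G
 proof -
  note a = fm[OF XYZ(1,2) F] and b = fm[OF XYZ(2,3) G]
  have "M.tiso (M.ga (M.mcomp (f Y Z G) (f X Y F)))"
   by (subst M.ga_comp) (use a b cob[OF XYZ(1)] cob[OF XYZ(2)] cob[OF XYZ(3)] in \<open>auto intro!: M.tiso_vc M.tiso_lw M.tiso_rw\<close>)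
  moreover have "M.fpres (M.mcomp (f Y Z G) (f X Y F)) (snd X) (snd Z)"
   by (rule M.fpres_comp[OF _ _ _ a(1-3,5) b(1-3,5)]) (use XYZ in simp_all)
  ultimately show ?thesis unfolding h1[OF XYZ(1,3)] ccm[of _ _ _ _ Y] using a b by simp
 qed
 have Hid: "H X X (id1 ?N X) = M.mid (fst (DO X))" if X: "X \<in> obj ?N" for X
  by (rule HU[OF X X id1c[OF X], symmetric]) (unfold cid[OF X], rule M.lift_mid[OF u[OF X] refl])
 have Hcomp: "H X Z (G \<odot>\<^bsub>?N\<^esub> F) = M.mcomp (H Y Z G) (H X Y F)"
  if XYZ: "X \<in> obj ?N" "Y \<in> obj ?N" "Z \<in> obj ?N" and F: "F \<in> hom1 ?N X Y" and G: "G \<in> hom1 ?N Y Z" for X Y Z F G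
  by (rule HU[OF XYZ(1,3) comp1c[OF XYZ F G], symmetric]) (unfold ccm[of _ _ _ _ Y], rule M.lift_comp[OF u[OF XYZ(1)] refl u[OF XYZ(2)] refl u[OF XYZ(3)] refl
    fm(1-3)[OF XYZ(1,2) F] HL[OF XYZ(1,2) F] fm(1-3)[OF XYZ(2,3) G] HL[OF XYZ(2,3) G]])
 show ?thesis
 proof (intro exI[of _ \<Phi>] conjI ballI)
  show "fobj \<Phi> X = DO X" for X by simp
  fix X X' F assume XX: "X \<in> obj ?N" "X' \<in> obj ?N" "F \<in> hom1 ?N X X'"
  show "strong_tangent_morphism K (fst (DO X)) (fst (DO X')) (fmor \<Phi> X X' F)"
   using Hc[OF XX] by (simp add: cTng_strong_def split_beta)
 next
  show "two_functor ?N ?N \<Phi>"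
  proof (rule two_functor.intro)
   fix X assume X: "X \<in> obj ?N"
   show "fobj \<Phi> X \<in> obj ?N" using ob[OF X] by simp
   show "fmor \<Phi> X X (id1 ?N X) = id1 ?N (fobj \<Phi> X)" using arg_cong[OF Hid[OF X], of mval] by (simp only: \<Phi> N(2) M.typed_val)
  next
   fix X Y F assume XY: "X \<in> obj ?N" "Y \<in> obj ?N" "F \<in> hom1 ?N X Y"
   show "fmor \<Phi> X Y F \<in> hom1 ?N (fobj \<Phi> X) (fobj \<Phi> Y)" using Hc[OF XY] by simp
   have t: "id2 ?N F \<in> hom2 ?N X Y F F" and ce: "c X Y F F (id2 ?N F) = M.cid (f X Y F)"
   proof -
    show ce: "c X Y F F (id2 ?N F) = M.cid (f X Y F)" unfolding c_def N by (intro tarr_eqI) (simp_all add: M.typed_val f_def del: Tng_sel)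
    show "id2 ?N F \<in> hom2 ?N X Y F F" unfolding h2[OF XY XY(3)] ce[unfolded c_def] using fm(1)[OF XY] by simp
   qed
   have "M.cid (H X Y F) = w X Y F F (id2 ?N F)"
    by (rule wU[OF XY XY(3) t]) (unfold ce, use Hm[OF XY] Um[OF XY(1)] Um[OF XY(2)] fm[OF XY] in simp)
   from arg_cong[OF this, of tval] show "fcell \<Phi> X Y F F (id2 ?N F) = id2 ?N (fmor \<Phi> X Y F)" by (simp only: \<Phi> N M.typed_val)
  next
   fix X Y F G \<theta> assume XY: "X \<in> obj ?N" "Y \<in> obj ?N" and F: "F \<in> hom1 ?N X Y" and G: "G \<in> hom1 ?N X Y" and t: "\<theta> \<in> hom2 ?N X Y F G"
   have "Tarr (H X Y F) (H X Y G) (tval (w X Y F G \<theta>)) = w X Y F G \<theta>" using wP[OF XY F G t] by (cases "w X Y F G \<theta>") simp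
   then show "fcell \<Phi> X Y F G \<theta> \<in> hom2 ?N (fobj \<Phi> X) (fobj \<Phi> Y) (fmor \<Phi> X Y F) (fmor \<Phi> X Y G)"
    unfolding \<Phi> h2[OF ob[OF XY(1)] ob[OF XY(2)] Hc[OF XY F] Hc[OF XY G]] Hf[OF XY F] Hf[OF XY G] using wP[OF XY F G t] by simp
  next
   fix X Y Z F G assume "X \<in> obj ?N" "Y \<in> obj ?N" "Z \<in> obj ?N" "F \<in> hom1 ?N X Y" "G \<in> hom1 ?N Y Z"
   then have "H X Z (G \<odot>\<^bsub>?N\<^esub> F) = M.mcomp (H Y Z G) (H X Y F)" by (rule Hcomp)
   then show "fmor \<Phi> X Z (G \<odot>\<^bsub>?N\<^esub> F) = fmor \<Phi> Y Z G \<odot>\<^bsub>?N\<^esub> fmor \<Phi> X Y F" by (simp only: \<Phi> N M.typed_val)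
  next
   fix X Y F G E \<theta> \<theta>' assume XY: "X \<in> obj ?N" "Y \<in> obj ?N" and F: "F \<in> hom1 ?N X Y" and G: "G \<in> hom1 ?N X Y" and E: "E \<in> hom1 ?N X Y"
    and t: "\<theta> \<in> hom2 ?N X Y F G" and t': "\<theta>' \<in> hom2 ?N X Y G E"
   note a = cc[OF XY F G t] and b = cc[OF XY G E t'] and p = wP[OF XY F G t] and q = wP[OF XY G E t']
   have ce: "c X Y F E (\<theta>' \<bullet>\<^bsub>?N\<^esub> \<theta>) = M.vc (c X Y G E \<theta>') (c X Y F G \<theta>)"
    unfolding c_def N by (intro tarr_eqI) (simp_all add: M.typed_val del: Tng_sel)
   have tt: "\<theta>' \<bullet>\<^bsub>?N\<^esub> \<theta> \<in> hom2 ?N X Y F E" unfolding h2[OF XY F E] ce[unfolded c_def] using a b by (simp add: c_def)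
   have "M.vc (w X Y G E \<theta>') (w X Y F G \<theta>) = w X Y F E (\<theta>' \<bullet>\<^bsub>?N\<^esub> \<theta>)"
    by (rule wU[OF XY F E tt]) (unfold ce, use a b p q Um[OF XY(1)] Um[OF XY(2)] Hm[OF XY F] Hm[OF XY G] fm[OF XY F] fm[OF XY G] in simp)
   from arg_cong[OF this, of tval] show "fcell \<Phi> X Y F E (\<theta>' \<bullet>\<^bsub>?N\<^esub> \<theta>) = fcell \<Phi> X Y G E \<theta>' \<bullet>\<^bsub>?N\<^esub> fcell \<Phi> X Y F G \<theta>" by (simp only: \<Phi> N M.typed_val)
  next
   fix X Y Z F F' G G' \<theta> \<psi> assume XYZ: "X \<in> obj ?N" "Y \<in> obj ?N" "Z \<in> obj ?N" and F: "F \<in> hom1 ?N X Y" and F': "F' \<in> hom1 ?N X Y"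
    and G: "G \<in> hom1 ?N Y Z" and G': "G' \<in> hom1 ?N Y Z" and t: "\<theta> \<in> hom2 ?N X Y F F'" and s: "\<psi> \<in> hom2 ?N Y Z G G'"
   note a = cc[OF XYZ(1,2) F F' t] and b = cc[OF XYZ(2,3) G G' s] and p = wP[OF XYZ(1,2) F F' t] and q = wP[OF XYZ(2,3) G G' s]
   note m = fm(1-3)[OF XYZ(1,2) F] fm(1-3)[OF XYZ(2,3) G] fm(1-3)[OF XYZ(1,2) F'] fm(1-3)[OF XYZ(2,3) G']
   note h = Hm[OF XYZ(1,2) F] Hm[OF XYZ(2,3) G] Hm[OF XYZ(1,2) F'] Hm[OF XYZ(2,3) G']
   have hv: "tval (M.hc (c Y Z G G' \<psi>) (c X Y F F' \<theta>)) = \<psi> \<star>\<^bsub>Tng K\<^esub> \<theta>" by (subst M.tval_hc) (use a b m in \<open>simp_all del: Tng_sel\<close>)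
   have hs: "M.cel (M.hc (c Y Z G G' \<psi>) (c X Y F F' \<theta>))" "tdom (M.hc (c Y Z G G' \<psi>) (c X Y F F' \<theta>)) = f X Z (G \<odot>\<^bsub>?N\<^esub> F)"
    "tcod (M.hc (c Y Z G G' \<psi>) (c X Y F F' \<theta>)) = f X Z (G' \<odot>\<^bsub>?N\<^esub> F')" unfolding ccm[of _ _ _ _ Y] M.hc_def using a b m by simp_all
   have ce: "c X Z (G \<odot>\<^bsub>?N\<^esub> F) (G' \<odot>\<^bsub>?N\<^esub> F') (\<psi> \<star>\<^bsub>?N\<^esub> \<theta>) = M.hc (c Y Z G G' \<psi>) (c X Y F F' \<theta>)"
    by (rule tarr_eqI) (unfold c_def[of X Z] tarr.sel, rule hs(2)[symmetric], rule hs(3)[symmetric], unfold hv N, rule refl)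
   note GF = comp1c[OF XYZ F G] and GF' = comp1c[OF XYZ F' G']
   have tt: "\<psi> \<star>\<^bsub>?N\<^esub> \<theta> \<in> hom2 ?N X Z (G \<odot>\<^bsub>?N\<^esub> F) (G' \<odot>\<^bsub>?N\<^esub> F')"
    unfolding h2[OF XYZ(1,3) GF GF'] ce[unfolded c_def] using hs(1) by (simp add: c_def)
   let ?w = "M.hc (w Y Z G G' \<psi>) (w X Y F F' \<theta>)"
   have e1: "?w = w X Z (G \<odot>\<^bsub>?N\<^esub> F) (G' \<odot>\<^bsub>?N\<^esub> F') (\<psi> \<star>\<^bsub>?N\<^esub> \<theta>)"
   proof (rule wU[OF XYZ(1,3) GF GF' tt], intro conjI)
    show "M.cel ?w" unfolding M.hc_def using p q h by simp
    show "tdom ?w = H X Z (G \<odot>\<^bsub>?N\<^esub> F)" unfolding Hcomp[OF XYZ F G] M.hc_def using p q h by simp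
    show "tcod ?w = H X Z (G' \<odot>\<^bsub>?N\<^esub> F')" unfolding Hcomp[OF XYZ F' G'] M.hc_def using p q h by simp
    show "M.lw (U Z) ?w = M.rw (c X Z (G \<odot>\<^bsub>?N\<^esub> F) (G' \<odot>\<^bsub>?N\<^esub> F') (\<psi> \<star>\<^bsub>?N\<^esub> \<theta>)) (U X)"
     unfolding ce by (rule M.lift_hcomp[OF Um(1)[OF XYZ(1)] Um(1)[OF XYZ(2)] Um(1)[OF XYZ(3)] Um(3)[OF XYZ(1)] Um(3)[OF XYZ(2)] Um(3)[OF XYZ(3)]
      Um(2)[OF XYZ(1)] Um(2)[OF XYZ(2)] Um(2)[OF XYZ(3)]]) (use a b p q m h in simp_all)
   qed
   have e2: "tval ?w = tval (w Y Z G G' \<psi>) \<star>\<^bsub>Tng K\<^esub> tval (w X Y F F' \<theta>)" by (rule M.tval_hc) (use p q h in simp_all)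
   from arg_cong[OF e1, of tval] e2 show "fcell \<Phi> X Z (G \<odot>\<^bsub>?N\<^esub> F) (G' \<odot>\<^bsub>?N\<^esub> F') (\<psi> \<star>\<^bsub>?N\<^esub> \<theta>) = fcell \<Phi> Y Z G G' \<psi> \<star>\<^bsub>?N\<^esub> fcell \<Phi> X Y F F' \<theta>"
    by (simp only: \<Phi> N)
  qed
 qed
qed

end

theorem proposition3p13:
  fixes K :: "('o, 'm, 'c) cat2p"
    and DO :: "('o, 'm, 'c) cart_tangentad \<Rightarrow> ('o, 'm, 'c) cart_tangentad"
  assumes "two_category K"
    and "finite_2_products K"
    and "admits_differential_objects K"
    and "\<And>X. X \<in> obj (cTng_strong K) \<Longrightarrow> is_tangentad_of_differential_objects K X (DO X)"
  shows "\<exists>\<Phi>. two_functor (cTng_strong K) (cTng_strong K) \<Phi> \<and>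
    (\<forall>X\<in>obj (cTng_strong K). fobj \<Phi> X = DO X) \<and>
    (\<forall>X\<in>obj (cTng_strong K). \<forall>X'\<in>obj (cTng_strong K). \<forall>F\<in>hom1 (cTng_strong K) X X'.
       strong_tangent_morphism K (fst (DO X)) (fst (DO X')) (fmor \<Phi> X X' F))"
proof -
  interpret cartesian_2_category K by (rule cartesian_2_category.intro[OF assms(1,2)])
  show ?thesis by (rule DO_two_functor[OF assms(4)])
qed

end
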